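(* Let $d\ge1$, let $\phi:\mathbb R^d\to\mathbb R$ be smooth, let $a$ be a smooth function on $\mathbb R^d$ supported in $B(0,1)$, and suppose that the Hessian matrix $H\phi$ of $\phi$ satisfies $\det H\phi\neq0$ on the support of $a$. Define $$Ef(x,t)=\int_{\mathbb R^d} e^{i(x\cdot\xi+t\phi(\xi))}a(\xi)f(\xi)\,d\xi,\qquad (x,t)\in\mathbb R^d\times\mathbb R .$$ Let $2\le q,r<\infty$ and set $s_c=\frac dr+\frac2q-\frac d2$. (i) If $\frac dr+\frac2q>\frac d2$ and $\frac dr+\frac1q<\frac d2$, then for every $s\ge s_c$ there is a constant $C$ such that $$\|Ef\|_{L^q_t(\mathbb R,\,L^r_x(\mathbb R^d))}\le C\|f\|_{H^s}\qquad\text{for all } f\in H^s(\mathbb R^d).$$ (ii) If $\frac dr+\frac1q=\frac d2$ and $q\ne2$, then there is a constant $C$ such that $$\|Ef\|_{L^{q,\infty}_t(\mathbb R,\,L^r_x(\mathbb R^d))}\le C\|f\|_{H^{s_c}}\qquad\text{for all } f\in H^{s_c}(\mathbb R^d).$$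
   Context: $B(z,r)$ is the ball of radius $r$ centered at $z$. $H^s=H^s(\mathbb R^d)$ is the usual inhomogeneous $L^2$-Sobolev space of order $s$. $\|F\|_{L^q_t(\mathbb R,L^r_x(\mathbb R^d))}$ is the $L^q$ norm in $t$ of $t\mapsto\|F(\cdot,t)\|_{L^r_x(\mathbb R^d)}$, and $\|F\|_{L^{q,\infty}_t(\mathbb R,L^r_x(\mathbb R^d))}$ is the weak-$L^q$ (quasi-)norm in $t$ of the same function. *)

theory Defs
  imports "HOL-Analysis.Analysis"
begin

definition partial_deriv :: "'n::finite \<Rightarrow> (real^'n \<Rightarrow> 'b::real_normed_vector) \<Rightarrow> real^'n \<Rightarrow> 'b"
  where "partial_deriv i f x = frechet_derivative f (at x) (axis i 1)"

fun iter_partial :: "'n::finite list \<Rightarrow> (real^'n \<Rightarrow> 'b::real_normed_vector) \<Rightarrow> real^'n \<Rightarrow> 'b"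
  where
    "iter_partial [] f = f"
  | "iter_partial (i # is) f = partial_deriv i (iter_partial is f)"

text \<open>
  \<open>C\<^sup>\<infinity>\<close>: every iterated partial derivative exists and is (Frechet) differentiable
  everywhere, hence also continuous.
\<close>
definition smooth :: "(real^'n::finite \<Rightarrow> 'b::real_normed_vector) \<Rightarrow> bool"
  where "smooth f \<longleftrightarrow> (\<forall>is x. iter_partial is f differentiable (at x))"

definition hessian :: "(real^'n::finite \<Rightarrow> real) \<Rightarrow> real^'n \<Rightarrow> real^'n^'n"
  where "hessian \<phi> x = (\<chi> i j. partial_deriv i (partial_deriv j \<phi>) x)"

definition closed_support :: "('a::topological_space \<Rightarrow> 'b::zero) \<Rightarrow> 'a set"
  where "closed_support f = closure {x. f x \<noteq> 0}"

text \<open>Only used with positive exponents, for which \<open>\<infinity>\<close> raised to \<open>p\<close> is \<open>\<infinity>\<close>.\<close>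
definition ennreal_powr :: "ennreal \<Rightarrow> real \<Rightarrow> ennreal"
  where "ennreal_powr x p = (if x = \<infinity> then \<infinity> else ennreal (enn2real x powr p))"

definition Lp_norm_ennreal :: "real \<Rightarrow> ('a::euclidean_space \<Rightarrow> ennreal) \<Rightarrow> ennreal"
  where "Lp_norm_ennreal p g = ennreal_powr (\<integral>\<^sup>+ x. ennreal_powr (g x) p \<partial>lebesgue) (1 / p)"

definition Lp_norm :: "real \<Rightarrow> ('a::euclidean_space \<Rightarrow> 'b::real_normed_vector) \<Rightarrow> ennreal"
  where "Lp_norm p F = Lp_norm_ennreal p (\<lambda>x. ennreal (norm (F x)))"

definition weak_Lp_norm_ennreal :: "real \<Rightarrow> ('a::euclidean_space \<Rightarrow> ennreal) \<Rightarrow> ennreal"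
  where "weak_Lp_norm_ennreal p g =
    (SUP l\<in>{0<..}. ennreal l * ennreal_powr (emeasure lebesgue {x. g x > ennreal l}) (1 / p))"

definition mixed_norm :: "real \<Rightarrow> real \<Rightarrow> (real^'n::finite \<Rightarrow> real \<Rightarrow> complex) \<Rightarrow> ennreal"
  where "mixed_norm q r F = Lp_norm_ennreal q (\<lambda>t. Lp_norm r (\<lambda>x. F x t))"

definition weak_mixed_norm :: "real \<Rightarrow> real \<Rightarrow> (real^'n::finite \<Rightarrow> real \<Rightarrow> complex) \<Rightarrow> ennreal"
  where "weak_mixed_norm q r F = weak_Lp_norm_ennreal q (\<lambda>t. Lp_norm r (\<lambda>x. F x t))"

definition L2_space :: "(real^'n::finite \<Rightarrow> complex) set"
  where "L2_space = {f \<in> borel_measurable lebesgue. Lp_norm 2 f < \<infinity>}"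

text \<open>The unitary normalisation, under which the \<open>H\<^sup>0\<close> norm below is the \<open>L\<^sup>2\<close> norm.\<close>
definition fourier_L1 :: "(real^'n::finite \<Rightarrow> complex) \<Rightarrow> real^'n \<Rightarrow> complex"
  where "fourier_L1 f y =
    of_real ((2 * pi) powr (- real CARD('n) / 2)) *
    (LINT x|lebesgue. exp (- \<i> * of_real (x \<bullet> y)) * f x)"

text \<open>
  The Fourier transform on \<open>L\<^sup>2\<close>: \<open>g\<close> is the limit in \<open>L\<^sup>2\<close> of the Fourier integrals of the
  truncations of \<open>f\<close> to balls, which are integrable.  By Plancherel's theorem such a \<open>g\<close>
  exists for each \<open>f\<close> in \<open>L\<^sup>2\<close> and is unique up to null sets, so norms of
  \<open>fourier_L2 f\<close> do not depend on the choice.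
\<close>
definition is_fourier_L2 :: "(real^'n::finite \<Rightarrow> complex) \<Rightarrow> (real^'n \<Rightarrow> complex) \<Rightarrow> bool"
  where "is_fourier_L2 f g \<longleftrightarrow>
    g \<in> L2_space \<and>
    (\<lambda>n::nat. Lp_norm 2
       (\<lambda>y. fourier_L1 (\<lambda>x. if x \<in> ball 0 (real n) then f x else 0) y - g y))
      \<longlonglongrightarrow> 0"

definition fourier_L2 :: "(real^'n::finite \<Rightarrow> complex) \<Rightarrow> real^'n \<Rightarrow> complex"
  where "fourier_L2 f = (SOME g. is_fourier_L2 f g)"

text \<open>
  \<open>H\<^sup>s\<close> for \<open>s \<ge> 0\<close>, where it is a subspace of \<open>L\<^sup>2\<close>; elements are represented by Lebesgue
  measurable functions.  (For \<open>s < 0\<close> this would miss the distributions that are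
  not in \<open>L\<^sup>2\<close>.)
\<close>
definition sobolev_norm :: "real \<Rightarrow> (real^'n::finite \<Rightarrow> complex) \<Rightarrow> ennreal"
  where "sobolev_norm s f =
    Lp_norm 2 (\<lambda>y. of_real ((1 + (norm y)\<^sup>2) powr (s / 2)) * fourier_L2 f y)"

definition sobolev_space :: "real \<Rightarrow> (real^'n::finite \<Rightarrow> complex) set"
  where "sobolev_space s = {f \<in> L2_space. sobolev_norm s f < \<infinity>}"

definition extension_op ::
    "(real^'n::finite \<Rightarrow> real) \<Rightarrow> (real^'n \<Rightarrow> complex) \<Rightarrow> (real^'n \<Rightarrow> complex) \<Rightarrow>
      real^'n \<Rightarrow> real \<Rightarrow> complex"
  where "extension_op \<phi> a f x t =
    (LINT \<xi>|lebesgue. exp (\<i> * of_real (x \<bullet> \<xi> + t * \<phi> \<xi>)) * a \<xi> * f \<xi>)"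

end

theory Submission
  imports Defs "HOL-Probability.Characteristic_Functions"
begin

text \<open>
  Write \<open>\<delta> = d (1/2 - 1/r)\<close>.  Since \<open>det H\<phi> \<noteq> 0\<close>, gradients of \<open>\<phi>\<close> at nearby points differ by at least a multiple
  of their distance, so van der Corput differencing together with nonstationary phase yields the decay
  \<open>|t|\<^bsup>-d/2\<^esup>\<close> of the kernels with amplitudes \<open>a\<close> and \<open>a a\<^sup>*\<close>.  Decomposing into level sets instead of
  interpolating, this gives the fixed time bound
  \<open>\<parallel>Ef(t)\<parallel>\<^sub>r \<le> C |t|\<^bsup>-\<delta>\<^esup> \<parallel> |y|\<^bsup>\<delta>\<^esup> g \<parallel>\<^sub>2\<close>, where \<open>g\<close> is the Fourier transform of \<open>f\<close>, and, by duality
  (\<open>TT\<^sup>*\<close>), the weak type bound of \<open>t \<mapsto> \<parallel>Ef(t)\<parallel>\<^sub>r\<close> in \<open>L\<^bsup>2/\<delta>,\<infinity>\<^esup>\<close> by \<open>\<parallel>f\<parallel>\<^sub>2\<close>.  Part (ii), where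
  \<open>\<delta> = 1/q = s\<^sub>c\<close>, is immediate from the former.  For part (i) the times \<open>4\<^sup>j < |t| \<le> 4\<^bsup>j+1\<^esup>\<close> are
  treated separately: the part of \<open>f\<close> with \<open>|y| \<le> 2\<^sup>j\<close> by the former bound, the rest by the latter.
  As \<open>1/q < \<delta> < 2/q\<close>, each \<open>y\<close> contributes a geometric series in \<open>j\<close>, with sum \<open>O((1 + |y|\<^sup>2)\<^bsup>s\<^esup>)\<close> for \<open>s = s\<^sub>c\<close>.
\<close>

section \<open>Level sets and radial integrals\<close>

text \<open>Here f lives on the frequency side of a propagator: the initial datum is essentially the
  Fourier transform g of f, and the H^s norm puts a power weight on that datum. Pointwise decay in
  time is bought with the weight |y|^\<delta>; the weak type bound has no weight but sees only an
  averaged decay. The radius R = |t|^(1/2) is where the two agree: over |t| ~ R^2 they contribute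
  R^(4/q - 4\<delta>) |y|^(2\<delta>) and R^(4/q - 2\<delta>) per unit of |g(y)|^2, and at |y| = R
  both are R^(2 s_c). The two strict inequalities of part (i) say that the first power of R decays
  and the second grows, so that either dyadic sum is dominated by its end near |y|. At the endpoint
  \<delta> = 1/q the first sum no longer decays, which leaves a weak type bound. The dyadic times
  are disjoint, so q-th powers of norms add up, and q >= 2 lets the sum of (q/2)-th powers of
  squares be bounded through the sum of the squares. The weak exponent 2/\<delta> exceeds q exactly
  when \<delta> < 2/q, which gives L^q bounds on bounded time sets for the high part.\<close>

lemma nn_integral_powr_initial:
  fixes p w :: real
  assumes "0 < p" "0 \<le> w"
  shows "(\<integral>\<^sup>+x. ennreal (p * x powr (p - 1)) * indicator {0<..w} x \<partial>lborel) = ennreal (w powr p)"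
proof -
  have "((\<lambda>x. p * x powr (p - 1)) has_integral p * (w powr ((p - 1) + 1) / ((p - 1) + 1))) {0..w}"
    using assms by (intro has_integral_mult_right has_integral_powr_from_0) auto
  then have "integral\<^sup>N lborel (\<lambda>x. indicator {0..w} x * (p * x powr (p - 1))) = p * (w powr ((p - 1) + 1) / ((p - 1) + 1))"
    using assms by (intro nn_integral_has_integral_lebesgue) auto
  moreover have "(\<integral>\<^sup>+x. ennreal (p * x powr (p - 1)) * indicator {0<..w} x \<partial>lborel)
     = integral\<^sup>N lborel (\<lambda>x. indicator {0..w} x * (p * x powr (p - 1)))"
    by (intro nn_integral_cong) (auto simp: indicator_def)
  ultimately show ?thesis using assms by simp
qed

lemma nn_integral_powr_tail:
  fixes p w :: real
  assumes "0 < p" "0 < w"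
  shows "(\<integral>\<^sup>+x. ennreal (p * x powr (- p - 1)) * indicator {w..} x \<partial>lborel) = ennreal (w powr (- p))"
proof -
  have "((\<lambda>x. p * x powr (- p - 1)) has_integral p * (- (w powr ((- p - 1) + 1)) / ((- p - 1) + 1))) {w..}"
    using assms by (intro has_integral_mult_right has_integral_powr_to_inf) auto
  then have "integral\<^sup>N lborel (\<lambda>x. indicator {w..} x * (p * x powr (- p - 1))) = p * (- (w powr ((- p - 1) + 1)) / ((- p - 1) + 1))"
    using assms by (intro nn_integral_has_integral_lebesgue) auto
  moreover have "(\<integral>\<^sup>+x. ennreal (p * x powr (- p - 1)) * indicator {w..} x \<partial>lborel)
     = integral\<^sup>N lborel (\<lambda>x. indicator {w..} x * (p * x powr (- p - 1)))"
    by (intro nn_integral_cong) (auto simp: indicator_def)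
  ultimately show ?thesis using assms by simp
qed

lemma layer_cake_powr:
  fixes F :: "'a \<Rightarrow> real" and p :: real
  assumes "sigma_finite_measure M" and [measurable]: "F \<in> borel_measurable M"
    and F0: "\<And>x. 0 \<le> F x" and p: "0 < p"
  shows "(\<integral>\<^sup>+x. ennreal (F x powr p) \<partial>M)
    = (\<integral>\<^sup>+l. ennreal (p * l powr (p - 1)) * indicator {0<..} l * emeasure M {x\<in>space M. l \<le> F x} \<partial>lborel)"
proof -
  interpret M: sigma_finite_measure M by fact
  interpret P: pair_sigma_finite lborel M ..
  have "(\<integral>\<^sup>+x. ennreal (F x powr p) \<partial>M)
     = (\<integral>\<^sup>+x. (\<integral>\<^sup>+l. ennreal (p * l powr (p - 1)) * indicator {0<..F x} l \<partial>lborel) \<partial>M)"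
    by (intro nn_integral_cong nn_integral_powr_initial[symmetric] p F0)
  also have "\<dots> = (\<integral>\<^sup>+x. (\<integral>\<^sup>+l. ennreal (p * l powr (p - 1)) * indicator {0<..} l * indicator {x\<in>space M. l \<le> F x} x \<partial>lborel) \<partial>M)"
    by (intro nn_integral_cong) (auto simp: indicator_def)
  also have "\<dots> = (\<integral>\<^sup>+l. (\<integral>\<^sup>+x. ennreal (p * l powr (p - 1)) * indicator {0<..} l * indicator {x\<in>space M. l \<le> F x} x \<partial>M) \<partial>lborel)"
    by (rule P.Fubini') measurable
  also have "\<dots> = (\<integral>\<^sup>+l. ennreal (p * l powr (p - 1)) * indicator {0<..} l * emeasure M {x\<in>space M. l \<le> F x} \<partial>lborel)"
    by (intro nn_integral_cong) (subst nn_integral_cmult_indicator, auto)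
  finally show ?thesis .
qed

text \<open>This replaces interpolation theorems below: a weak \<open>L\<^sup>2\<close> bound at each height, whose right-hand
  side only sees the part of the data that could not be bounded uniformly, gives a strong bound.\<close>

lemma strong_type_of_level_sets:
  fixes F :: "'a \<Rightarrow> real" and w :: "'b \<Rightarrow> real" and k :: "'b \<Rightarrow> ennreal" and r :: real
  assumes "sigma_finite_measure M" "sigma_finite_measure N" and [measurable]: "F \<in> borel_measurable M"
      "w \<in> borel_measurable N" "k \<in> borel_measurable N"
    and F0: "\<And>x. 0 \<le> F x" and w0: "\<And>y. 0 \<le> w y" and r: "2 < r"
    and lev: "\<And>l. 0 < l \<Longrightarrow> emeasure M {x\<in>space M. l \<le> F x}
       \<le> ennreal (l powr (-2)) * (\<integral>\<^sup>+y. k y * indicator {y. l \<le> w y} y \<partial>N)"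
  shows "(\<integral>\<^sup>+x. ennreal (F x powr r) \<partial>M)
    \<le> ennreal (r / (r - 2)) * (\<integral>\<^sup>+y. k y * ennreal (w y powr (r - 2)) \<partial>N)"
proof -
  interpret M: sigma_finite_measure M by fact
  interpret N: sigma_finite_measure N by fact
  interpret P: pair_sigma_finite lborel N ..
  have "(\<integral>\<^sup>+x. ennreal (F x powr r) \<partial>M)
    = (\<integral>\<^sup>+l. ennreal (r * l powr (r - 1)) * indicator {0<..} l * emeasure M {x\<in>space M. l \<le> F x} \<partial>lborel)"
    using r by (intro layer_cake_powr assms) auto
  also have "\<dots> \<le> (\<integral>\<^sup>+l. ennreal (r * l powr (r - 1)) * indicator {0<..} l *
        (ennreal (l powr (-2)) * (\<integral>\<^sup>+y. k y * indicator {y. l \<le> w y} y \<partial>N)) \<partial>lborel)"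
    using lev by (intro nn_integral_mono) (auto simp: indicator_def intro!: mult_left_mono)
  also have "\<dots> = (\<integral>\<^sup>+l. (\<integral>\<^sup>+y. ennreal (r * l powr (r - 3)) * indicator {0<..} l * (k y * indicator {y. l \<le> w y} y) \<partial>N) \<partial>lborel)"
  proof (intro nn_integral_cong)
    fix l :: real
    have "(\<integral>\<^sup>+y. ennreal (r * l powr (r - 3)) * indicator {0<..} l * (k y * indicator {y. l \<le> w y} y) \<partial>N)
       = ennreal (r * l powr (r - 3)) * indicator {0<..} l * (\<integral>\<^sup>+y. (k y * indicator {y. l \<le> w y} y) \<partial>N)"
      by (rule nn_integral_cmult) measurable
    moreover have "0 < l \<Longrightarrow> ennreal (r * l powr (r - 1)) * ennreal (l powr (-2)) = ennreal (r * l powr (r - 3))"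
      using r by (subst ennreal_mult[symmetric]) (auto simp: powr_add[symmetric] simp flip: mult.assoc)
    ultimately show "ennreal (r * l powr (r - 1)) * indicator {0<..} l *
        (ennreal (l powr (-2)) * (\<integral>\<^sup>+y. k y * indicator {y. l \<le> w y} y \<partial>N)) =
       (\<integral>\<^sup>+y. ennreal (r * l powr (r - 3)) * indicator {0<..} l * (k y * indicator {y. l \<le> w y} y) \<partial>N)"
      by (cases "0 < l") (auto simp: indicator_def mult.assoc[symmetric])
  qed
  also have "\<dots> = (\<integral>\<^sup>+y. (\<integral>\<^sup>+l. ennreal (r * l powr (r - 3)) * indicator {0<..} l * (k y * indicator {y. l \<le> w y} y) \<partial>lborel) \<partial>N)"
    by (rule P.Fubini'[symmetric]) measurable
  \<comment> \<open>For fixed y the height runs over (0, \<open>w y\<close>], and r > 2 makes l^(r -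
    3) integrable at 0; this integral, with its factor r, produces r / (r - 2) and the power r - 2
    of \<open>w y\<close>.\<close>
  also have "\<dots> = (\<integral>\<^sup>+y. ennreal (r / (r - 2)) * (k y * ennreal (w y powr (r - 2))) \<partial>N)"
  proof (intro nn_integral_cong)
    fix y
    have "(\<integral>\<^sup>+l. ennreal (r * l powr (r - 3)) * indicator {0<..} l * (k y * indicator {y. l \<le> w y} y) \<partial>lborel)
       = (\<integral>\<^sup>+l. (ennreal (r / (r - 2)) * k y) * (ennreal ((r - 2) * l powr ((r - 2) - 1)) * indicator {0<..w y} l) \<partial>lborel)"
    proof (intro nn_integral_cong)
      fix l :: real
      have "ennreal (r * l powr (r - 3)) = ennreal (r / (r - 2)) * ennreal ((r - 2) * l powr ((r - 2) - 1))"
        using r by (subst ennreal_mult[symmetric]) auto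
      then show "ennreal (r * l powr (r - 3)) * indicator {0<..} l * (k y * indicator {y. l \<le> w y} y)
         = (ennreal (r / (r - 2)) * k y) * (ennreal ((r - 2) * l powr ((r - 2) - 1)) * indicator {0<..w y} l)"
        by (auto simp: indicator_def ac_simps)
    qed
    also have "\<dots> = (ennreal (r / (r - 2)) * k y) * ennreal (w y powr (r - 2))"
      using r w0 by (subst nn_integral_cmult, measurable) (subst nn_integral_powr_initial, auto)
    finally show "(\<integral>\<^sup>+l. ennreal (r * l powr (r - 3)) * indicator {0<..} l * (k y * indicator {y. l \<le> w y} y) \<partial>lborel)
      = ennreal (r / (r - 2)) * (k y * ennreal (w y powr (r - 2)))" by (simp add: mult.assoc)
  qed
  also have "\<dots> = ennreal (r / (r - 2)) * (\<integral>\<^sup>+y. k y * ennreal (w y powr (r - 2)) \<partial>N)"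
    by (rule nn_integral_cmult) measurable
  finally show ?thesis .
qed

lemma emeasure_cball_0:
  assumes "0 \<le> R"
  shows "emeasure lborel {y::'a::euclidean_space. norm y \<le> R} = ennreal (unit_ball_vol (real DIM('a)) * R powr real DIM('a))"
proof -
  have "{y::'a. norm y \<le> R} = cball 0 R" by auto
  moreover have "R powr real DIM('a) = R ^ DIM('a)" using assms by (cases "R = 0") (auto simp: powr_realpow)
  ultimately show ?thesis using emeasure_cball[OF assms, of "0::'a"] by simp
qed

text \<open>Polar coordinates without a surface measure: |y|^(-p) is the integral of p l^(-p - 1)
  over l >= |y|, so Tonelli leaves only the measures of the parts of S in the balls of radius l,
  which are easily bounded when S is a ball or the complement of one.\<close>

lemma nn_integral_radial_swap:
  fixes p :: real and S :: "'a::euclidean_space set"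
  assumes p: "0 < p" and [measurable]: "S \<in> sets borel"
  shows "(\<integral>\<^sup>+y. ennreal (norm y powr (- p)) * indicator S y \<partial>lborel)
    = (\<integral>\<^sup>+l. ennreal (p * l powr (- p - 1)) * indicator {0<..} l * emeasure lborel {y. norm y \<le> l \<and> y \<in> S} \<partial>lborel)"
proof -
  \<comment> \<open>The origin is set aside: there \<open>powr\<close> gives 0, but the tail
    integral from 0 diverges.\<close>
  have "AE y::'a in lborel. y \<noteq> 0" by (rule AE_lborel_singleton)
  then have "(\<integral>\<^sup>+y. ennreal (norm y powr (- p)) * indicator S y \<partial>lborel)
      = (\<integral>\<^sup>+y. (\<integral>\<^sup>+l. ennreal (p * l powr (- p - 1)) * indicator {norm y..} l \<partial>lborel) * indicator S y \<partial>lborel)"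
    by (intro nn_integral_cong_AE) (auto simp: nn_integral_powr_tail p elim!: AE_mp)
  also have "\<dots> = (\<integral>\<^sup>+y. (\<integral>\<^sup>+l. ennreal (p * l powr (- p - 1)) * indicator {0<..} l * indicator {y. norm y \<le> l \<and> y \<in> S} y \<partial>lborel) \<partial>lborel)"
  proof (intro nn_integral_cong_AE, use AE_lborel_singleton[of 0] in eventually_elim)
    fix y :: 'a assume "y \<noteq> 0"
    have "(\<integral>\<^sup>+l. ennreal (p * l powr (- p - 1)) * indicator {norm y..} l \<partial>lborel) * indicator S y
      = (\<integral>\<^sup>+l. ennreal (p * l powr (- p - 1)) * indicator {norm y..} l * indicator S y \<partial>lborel)"
      by (subst nn_integral_multc) auto
    also have "\<dots> = (\<integral>\<^sup>+l. ennreal (p * l powr (- p - 1)) * indicator {0<..} l * indicator {y. norm y \<le> l \<and> y \<in> S} y \<partial>lborel)"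
      using \<open>y \<noteq> 0\<close>
      by (intro nn_integral_cong) (auto simp: indicator_def simp flip: zero_less_norm_iff simp del: zero_less_norm_iff)
    finally show "(\<integral>\<^sup>+l. ennreal (p * l powr (- p - 1)) * indicator {norm y..} l \<partial>lborel) * indicator S y = \<dots>" .
  qed
  also have "\<dots> = (\<integral>\<^sup>+l. (\<integral>\<^sup>+y. ennreal (p * l powr (- p - 1)) * indicator {0<..} l * indicator {y. norm y \<le> l \<and> y \<in> S} y \<partial>lborel) \<partial>lborel)"
    by (rule lborel_pair.Fubini') measurable
  also have "\<dots> = (\<integral>\<^sup>+l. ennreal (p * l powr (- p - 1)) * indicator {0<..} l * emeasure lborel {y. norm y \<le> l \<and> y \<in> S} \<partial>lborel)"
    by (intro nn_integral_cong) (subst nn_integral_cmult_indicator, auto)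
  finally show ?thesis .
qed

text \<open>The sublevel sets have measure v l^d up to l = R and v R^d from there on. The two ranges
  contribute p / (d - p) and 1 times v R^(d - p), which add up to d / (d - p). For p = 0, where
  |y|^(-p) is not a tail integral, the bound is the volume of the ball.\<close>

lemma nn_integral_norm_powr_cball:
  fixes p R :: real
  assumes p: "0 \<le> p" "p < real DIM('a::euclidean_space)" and R: "0 < R"
  defines "v \<equiv> unit_ball_vol (real DIM('a))" and "d \<equiv> real DIM('a)"
  shows "(\<integral>\<^sup>+(y::'a). ennreal (norm y powr (- p)) * indicator {y. norm y \<le> R} y \<partial>lborel)
    \<le> ennreal (v * d / (d - p) * R powr (d - p))"
proof (cases "p = 0")
  case True
  have "(\<integral>\<^sup>+(y::'a). ennreal (norm y powr (- p)) * indicator {y. norm y \<le> R} y \<partial>lborel)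
    \<le> (\<integral>\<^sup>+(y::'a). indicator {y. norm y \<le> R} y \<partial>lborel)"
    by (intro nn_integral_mono) (auto simp: indicator_def True)
  also have "\<dots> = ennreal (v * R powr d)" unfolding v_def d_def
    using R by (subst emeasure_cball_0[symmetric]) auto
  finally show ?thesis using True p R by (auto simp: d_def)
next
  case False
  then have p0: "0 < p" using p by auto
  have v0: "0 \<le> v" by (auto simp: v_def)
  have pd: "0 < d - p" using p by (auto simp: d_def)
  have "(\<integral>\<^sup>+(y::'a). ennreal (norm y powr (- p)) * indicator {y. norm y \<le> R} y \<partial>lborel)
    = (\<integral>\<^sup>+l. ennreal (p * l powr (- p - 1)) * indicator {0<..} l * emeasure lborel {y::'a. norm y \<le> l \<and> y \<in> {y. norm y \<le> R}} \<partial>lborel)"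
    by (intro nn_integral_radial_swap p0) measurable
  also have "\<dots> \<le> (\<integral>\<^sup>+l. ennreal (v * p / (d - p)) * (ennreal ((d - p) * l powr ((d - p) - 1)) * indicator {0<..R} l)
       + ennreal (v * R powr d) * (ennreal (p * l powr (- p - 1)) * indicator {R..} l) \<partial>lborel)"
  proof (intro nn_integral_mono)
    fix l :: real
    show "ennreal (p * l powr (- p - 1)) * indicator {0<..} l * emeasure lborel {y::'a. norm y \<le> l \<and> y \<in> {y. norm y \<le> R}}
      \<le> ennreal (v * p / (d - p)) * (ennreal ((d - p) * l powr ((d - p) - 1)) * indicator {0<..R} l)
       + ennreal (v * R powr d) * (ennreal (p * l powr (- p - 1)) * indicator {R..} l)"
    proof (cases "0 < l \<and> l \<le> R")
      case True
      have "emeasure lborel {y::'a. norm y \<le> l \<and> y \<in> {y. norm y \<le> R}} \<le> emeasure lborel {y::'a. norm y \<le> l}"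
        by (intro emeasure_mono) auto
      also have "\<dots> = ennreal (v * l powr d)" using True by (subst emeasure_cball_0) (auto simp: v_def d_def)
      finally have "ennreal (p * l powr (- p - 1)) * emeasure lborel {y::'a. norm y \<le> l \<and> y \<in> {y. norm y \<le> R}}
          \<le> ennreal (p * l powr (- p - 1)) * ennreal (v * l powr d)" by (intro mult_left_mono) auto
      also have "\<dots> = ennreal (v * p / (d - p)) * ennreal ((d - p) * l powr ((d - p) - 1))"
      proof -
        have "l powr (- p - 1) * l powr d = l powr ((d - p) - 1)" by (simp add: powr_add[symmetric] algebra_simps)
        then have "p * l powr (- p - 1) * (v * l powr d) = v * p / (d - p) * ((d - p) * l powr ((d - p) - 1))"
          using pd by (simp add: field_simps)
        then show ?thesis using p0 v0 pd by (subst (1 2) ennreal_mult[symmetric]) auto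
      qed
      finally show ?thesis using True by (auto simp: indicator_def intro: add_increasing2)
    next
      case False
      have "emeasure lborel {y::'a. norm y \<le> l \<and> y \<in> {y. norm y \<le> R}} \<le> emeasure lborel {y::'a. norm y \<le> R}"
        by (intro emeasure_mono) auto
      also have "\<dots> = ennreal (v * R powr d)" using R by (subst emeasure_cball_0) (auto simp: v_def d_def)
      finally have "ennreal (p * l powr (- p - 1)) * emeasure lborel {y::'a. norm y \<le> l \<and> y \<in> {y. norm y \<le> R}}
          \<le> ennreal (p * l powr (- p - 1)) * ennreal (v * R powr d)" by (intro mult_left_mono) auto
      then show ?thesis using False by (auto simp: indicator_def mult.commute)
    qed
  qed
  also have "\<dots> = ennreal (v * p / (d - p)) * ennreal (R powr (d - p)) + ennreal (v * R powr d) * ennreal (R powr (- p))"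
    using R p0 pd
    by (subst nn_integral_add, measurable, subst (1 2) nn_integral_cmult, measurable)
       (simp add: nn_integral_powr_tail nn_integral_powr_initial)
  also have "\<dots> = ennreal (v * p / (d - p) * R powr (d - p) + v * R powr (d - p))"
    using v0 p0 pd R by (subst (1 2) ennreal_mult[symmetric])
      (auto simp: mult.assoc powr_add[symmetric] simp flip: ennreal_plus)
  also have "v * p / (d - p) * R powr (d - p) + v * R powr (d - p) = v * d / (d - p) * R powr (d - p)"
    using pd by (simp add: field_simps)
  finally show ?thesis .
qed

text \<open>Only heights l >= R contribute. There the shell is enlarged to the full ball of radius
  l, and p > d makes l^(d - p - 1) integrable at infinity.\<close>

lemma nn_integral_norm_powr_outside:
  fixes p R :: real
  assumes p: "real DIM('a::euclidean_space) < p" and R: "0 < R"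
  defines "v \<equiv> unit_ball_vol (real DIM('a))" and "d \<equiv> real DIM('a)"
  shows "(\<integral>\<^sup>+(y::'a). ennreal (norm y powr (- p)) * indicator {y. R < norm y} y \<partial>lborel)
    \<le> ennreal (v * p / (p - d) * R powr (d - p))"
proof -
  have v0: "0 \<le> v" by (auto simp: v_def)
  have d0: "0 < d" by (auto simp: d_def)
  have p0: "0 < p" and pd: "0 < p - d" using p d0 by (auto simp: d_def)
  have "(\<integral>\<^sup>+(y::'a). ennreal (norm y powr (- p)) * indicator {y. R < norm y} y \<partial>lborel)
    = (\<integral>\<^sup>+l. ennreal (p * l powr (- p - 1)) * indicator {0<..} l * emeasure lborel {y::'a. norm y \<le> l \<and> y \<in> {y. R < norm y}} \<partial>lborel)"
    by (intro nn_integral_radial_swap p0) measurable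
  also have "\<dots> \<le> (\<integral>\<^sup>+l. ennreal (v * p / (p - d)) * (ennreal ((p - d) * l powr (- (p - d) - 1)) * indicator {R..} l) \<partial>lborel)"
  proof (intro nn_integral_mono)
    fix l :: real
    show "ennreal (p * l powr (- p - 1)) * indicator {0<..} l * emeasure lborel {y::'a. norm y \<le> l \<and> y \<in> {y. R < norm y}}
      \<le> ennreal (v * p / (p - d)) * (ennreal ((p - d) * l powr (- (p - d) - 1)) * indicator {R..} l)"
    proof (cases "R \<le> l")
      case True
      have "emeasure lborel {y::'a. norm y \<le> l \<and> y \<in> {y. R < norm y}} \<le> emeasure lborel {y::'a. norm y \<le> l}"
        by (intro emeasure_mono) auto
      also have "\<dots> = ennreal (v * l powr d)" using True R by (subst emeasure_cball_0) (auto simp: v_def d_def)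
      finally have "ennreal (p * l powr (- p - 1)) * emeasure lborel {y::'a. norm y \<le> l \<and> y \<in> {y. R < norm y}}
          \<le> ennreal (p * l powr (- p - 1)) * ennreal (v * l powr d)" by (intro mult_left_mono) auto
      also have "\<dots> = ennreal (v * p / (p - d)) * ennreal ((p - d) * l powr (- (p - d) - 1))"
      proof -
        have "l powr (- p - 1) * l powr d = l powr (- (p - d) - 1)" by (simp add: powr_add[symmetric] algebra_simps)
        then have "p * l powr (- p - 1) * (v * l powr d) = v * p / (p - d) * ((p - d) * l powr (- (p - d) - 1))"
          using pd by (simp add: field_simps)
        then show ?thesis using p0 v0 pd by (subst (1 2) ennreal_mult[symmetric]) auto
      qed
      finally show ?thesis using True R by (auto simp: indicator_def)
    next
      case False
      then have "{y::'a. norm y \<le> l \<and> y \<in> {y. R < norm y}} = {}" by auto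
      then show ?thesis by (simp only: emeasure_empty mult_zero_right zero_le)
    qed
  qed
  also have "\<dots> = ennreal (v * p / (p - d)) * ennreal (R powr (- (p - d)))"
    by (subst nn_integral_cmult, measurable) (simp only: nn_integral_powr_tail[OF pd R])
  also have "\<dots> = ennreal (v * p / (p - d) * R powr (d - p))"
    using v0 p0 pd R by (subst ennreal_mult[symmetric]) auto
  finally show ?thesis .
qed

section \<open>The Fourier transform on \<open>L\<^sup>2\<close>\<close>

lemma borel_measurable_cis [measurable (raw)]:
  assumes "f \<in> borel_measurable M" shows "(\<lambda>x. cis (f x)) \<in> borel_measurable M"
  using assms unfolding cis_conv_exp by measurable

lemma borel_measurable_cnj' [measurable (raw)]:
  assumes "f \<in> borel_measurable M" shows "(\<lambda>x. cnj (f x)) \<in> borel_measurable M"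
  by (rule borel_measurable_continuous_on[OF _ assms]) (intro continuous_intros)

lemma integrable_cis_mult:
  assumes f: "integrable M f" and [measurable]: "g \<in> borel_measurable M"
  shows "integrable M (\<lambda>x. cis (g x) * f x)"
proof -
  have [measurable]: "f \<in> borel_measurable M" using f by auto
  show ?thesis using f by (rule Bochner_Integration.integrable_bound) (auto simp: norm_mult)
qed

lemma nn_integral_affine_euclidean:
  fixes t :: "'a::euclidean_space"
  assumes [measurable]: "f \<in> borel_measurable borel" and c: "c \<noteq> 0"
  shows "(\<integral>\<^sup>+x. f x \<partial>lborel) = ennreal (\<bar>c\<bar> ^ DIM('a)) * (\<integral>\<^sup>+x. f (t + c *\<^sub>R x) \<partial>lborel)"
  by (subst lborel_affine[OF c, of t])
     (simp add: nn_integral_density nn_integral_distr nn_integral_cmult)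

lemma integral_affine_euclidean:
  fixes t :: "'a::euclidean_space" and f :: "'a \<Rightarrow> 'b :: {banach, second_countable_topology}"
  assumes [measurable]: "f \<in> borel_measurable borel" and c: "c \<noteq> 0"
  shows "(LINT x|lborel. f x) = \<bar>c\<bar> ^ DIM('a) *\<^sub>R (LINT x|lborel. f (t + c *\<^sub>R x))"
  by (subst lborel_affine[OF c, of t]) (simp add: integral_density integral_distr)

lemma integrable_affine_euclidean:
  fixes t :: "'a::euclidean_space" and f :: "'a \<Rightarrow> 'b :: {banach, second_countable_topology}"
  assumes f: "integrable lborel f" and c: "c \<noteq> 0"
  shows "integrable lborel (\<lambda>x. f (t + c *\<^sub>R x))"
proof -
  have [measurable]: "f \<in> borel_measurable borel" using f by auto
  have "(\<integral>\<^sup>+x. norm (f x) \<partial>lborel) = ennreal (\<bar>c\<bar> ^ DIM('a)) * (\<integral>\<^sup>+x. norm (f (t + c *\<^sub>R x)) \<partial>lborel)"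
    by (rule nn_integral_affine_euclidean[OF _ c]) measurable
  then show ?thesis using f c unfolding integrable_iff_bounded
    by (auto simp: ennreal_mult_less_top)
qed

lemma nn_integral_reflect:
  fixes x :: "'a::euclidean_space"
  assumes "f \<in> borel_measurable borel"
  shows "(\<integral>\<^sup>+y. f (x - y) \<partial>lborel) = (\<integral>\<^sup>+y. f y \<partial>lborel)"
  using nn_integral_affine_euclidean[OF assms, of "-1" x] by simp

lemma nn_integral_translate:
  fixes x :: "'a::euclidean_space"
  assumes "f \<in> borel_measurable borel"
  shows "(\<integral>\<^sup>+y. f (x + y) \<partial>lborel) = (\<integral>\<^sup>+y. f y \<partial>lborel)"
  using nn_integral_affine_euclidean[OF assms, of 1 x] by simp

lemma integrable_pair_mult:
  fixes f :: "'a \<Rightarrow> 'c::{real_normed_field,banach,second_countable_topology}" and g :: "'b \<Rightarrow> 'c"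
  assumes "sigma_finite_measure M" "sigma_finite_measure N" and f: "integrable M f" and g: "integrable N g"
  shows "integrable (M \<Otimes>\<^sub>M N) (\<lambda>p. f (fst p) * g (snd p))"
proof -
  interpret M: sigma_finite_measure M by fact
  interpret N: sigma_finite_measure N by fact
  interpret P: pair_sigma_finite M N ..
  have [measurable]: "f \<in> borel_measurable M" "g \<in> borel_measurable N" using f g by auto
  show ?thesis
    by (rule P.Fubini_integrable) (use f g in \<open>auto simp: norm_mult intro!: integrable_mult_left\<close>)
qed

lemma integral_pair_mult:
  fixes f :: "'a \<Rightarrow> 'c::{real_normed_field,banach,second_countable_topology}" and g :: "'b \<Rightarrow> 'c"
  assumes "sigma_finite_measure M" "sigma_finite_measure N" and f: "integrable M f" and g: "integrable N g"
  shows "(LINT p|(M \<Otimes>\<^sub>M N). f (fst p) * g (snd p)) = (LINT x|M. f x) * (LINT y|N. g y)"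
proof -
  interpret M: sigma_finite_measure M by fact
  interpret N: sigma_finite_measure N by fact
  interpret P: pair_sigma_finite M N ..
  show ?thesis using P.integral_fst'[OF integrable_pair_mult[OF assms]] by simp
qed

section \<open>Gaussians and their Fourier transforms\<close>

lemma lborel_prod_Basis:
  fixes h :: "'a::euclidean_space \<Rightarrow> real \<Rightarrow> complex"
  assumes h: "\<And>b. b \<in> Basis \<Longrightarrow> integrable lborel (h b)"
  shows "integrable lborel (\<lambda>y::'a. \<Prod>b\<in>Basis. h b (y \<bullet> b))"
    and "(LINT y|lborel. (\<Prod>b\<in>Basis. h b (y \<bullet> b))) = (\<Prod>b\<in>(Basis::'a set). LINT t|lborel. h b t)"
proof -
  interpret product_sigma_finite "\<lambda>_::'a. lborel :: real measure" ..
  have [measurable]: "\<And>b. b \<in> Basis \<Longrightarrow> h b \<in> borel_measurable borel" using h by auto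
  have eq: "(\<Prod>b\<in>Basis. h b ((\<Sum>b\<in>Basis. f b *\<^sub>R b) \<bullet> b)) = (\<Prod>b\<in>Basis. h b (f b))" for f :: "'a \<Rightarrow> real"
    by (intro prod.cong) auto
  show "integrable lborel (\<lambda>y::'a. \<Prod>b\<in>Basis. h b (y \<bullet> b))"
    by (subst lborel_eq, subst integrable_distr_eq, measurable, subst eq)
       (intro product_integrable_prod h, auto)
  show "(LINT y|lborel. (\<Prod>b\<in>Basis. h b (y \<bullet> b))) = (\<Prod>b\<in>(Basis::'a set). LINT t|lborel. h b t)"
    by (subst lborel_eq, subst integral_distr, measurable, subst eq)
       (intro product_integral_prod h, auto)
qed

text \<open>The parameter is a reciprocal width: as e tends to 0 this is a cutoff increasing to 1,
  while its transform, a multiple of \<open>gauss (1 / e)\<close>, concentrates at scale e.\<close>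

definition gauss :: "real \<Rightarrow> 'a::euclidean_space \<Rightarrow> real" where
  "gauss e y = exp (- (e\<^sup>2 * (norm y)\<^sup>2 / 2))"

lemma gauss_pos: "0 < gauss e y" and gauss_le_1: "gauss e y \<le> 1"
  by (auto simp: gauss_def)

lemma borel_measurable_gauss [measurable]: "gauss e \<in> borel_measurable borel"
  unfolding gauss_def[abs_def] by measurable

lemma integrable_gauss_real:
  assumes "0 < e" shows "integrable lborel (\<lambda>t::real. exp (- (e\<^sup>2 * t\<^sup>2 / 2)))"
proof -
  have "integrable lborel (\<lambda>t. sqrt (2 * pi) * std_normal_density t)" by (intro integrable_mult_right) simp
  then have "integrable lborel (\<lambda>t::real. exp (- (t\<^sup>2 / 2)))" by (simp add: std_normal_density_def)
  from lborel_integrable_real_affine[OF this, of e 0] assms show ?thesis by (simp add: power_mult_distrib)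
qed

lemma fourier_gauss_real:
  assumes e: "0 < e"
  shows "(LINT t|lborel. cis (- (z * t)) * of_real (exp (- (e\<^sup>2 * t\<^sup>2 / 2))))
    = of_real (sqrt (2 * pi) / e * exp (- (z\<^sup>2 / (2 * e\<^sup>2))))"
proof -
  have base: "(LINT t|lborel. cis (- (z * t)) * of_real (exp (- (t\<^sup>2 / 2)))) = of_real (sqrt (2 * pi) * exp (- (z\<^sup>2 / 2)))" for z
  proof -
    \<comment> \<open>The Gaussian integral is read off from the characteristic function of the
      standard normal law; general e follows by scaling.\<close>
    have "complex_of_real (exp (- (z\<^sup>2 / 2))) = char std_normal_distribution (- z)"
      by (simp add: char_std_normal_distribution)
    also have "\<dots> = (LINT t|lborel. std_normal_density t *\<^sub>R exp (\<i> * complex_of_real (- z * t)))"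
      unfolding char_def by (subst integral_density) auto
    also have "\<dots> = (LINT t|lborel. of_real (1 / sqrt (2 * pi)) * (cis (- (z * t)) * of_real (exp (- (t\<^sup>2 / 2)))))"
      by (intro Bochner_Integration.integral_cong) (auto simp: std_normal_density_def cis_conv_exp scaleR_conv_of_real)
    also have "\<dots> = of_real (1 / sqrt (2 * pi)) * (LINT t|lborel. cis (- (z * t)) * of_real (exp (- (t\<^sup>2 / 2))))"
      by (rule integral_mult_right_zero)
    finally show ?thesis by (simp add: field_simps)
  qed
  have "(LINT t|lborel. cis (- (z * t)) * of_real (exp (- (e\<^sup>2 * t\<^sup>2 / 2))))
     = \<bar>1 / e\<bar> *\<^sub>R (LINT t|lborel. cis (- (z * (0 + 1 / e * t))) * complex_of_real (exp (- (e\<^sup>2 * (0 + 1 / e * t)\<^sup>2 / 2))))"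
    using e by (intro lborel_integral_real_affine) auto
  also have "(LINT t|lborel. cis (- (z * (0 + 1 / e * t))) * complex_of_real (exp (- (e\<^sup>2 * (0 + 1 / e * t)\<^sup>2 / 2))))
     = (LINT t|lborel. cis (- ((z / e) * t)) * of_real (exp (- (t\<^sup>2 / 2))))"
    using e by (intro Bochner_Integration.integral_cong) (auto simp: power_mult_distrib power_divide)
  also have "\<dots> = of_real (sqrt (2 * pi) * exp (- ((z / e)\<^sup>2 / 2)))" by (rule base)
  finally show ?thesis using e by (simp add: power_divide scaleR_conv_of_real field_simps)
qed

lemma cis_sum: "finite A \<Longrightarrow> cis (\<Sum>i\<in>A. f i) = (\<Prod>i\<in>A. cis (f i))"
  by (induction A rule: finite_induct) (auto simp: cis_mult[symmetric])

lemma norm_sq_euclidean: "(norm (y::'a::euclidean_space))\<^sup>2 = (\<Sum>b\<in>Basis. (y \<bullet> b)\<^sup>2)"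
  by (subst euclidean_inner[of y y, folded power2_norm_eq_inner, THEN trans]) (auto simp: power2_norm_eq_inner euclidean_inner[of y y] power2_eq_square)

lemma fourier_gauss_aux:
  fixes z y :: "'a::euclidean_space"
  shows "cis (- (z \<bullet> y)) * of_real (gauss e y)
    = (\<Prod>b\<in>Basis. cis (- ((z \<bullet> b) * (y \<bullet> b))) * of_real (exp (- (e\<^sup>2 * (y \<bullet> b)\<^sup>2 / 2))))"
proof -
  have "cis (- (z \<bullet> y)) = (\<Prod>b\<in>Basis. cis (- ((z \<bullet> b) * (y \<bullet> b))))"
    by (subst cis_sum[symmetric]) (auto simp: sum_negf euclidean_inner[of z y])
  moreover have "gauss e y = (\<Prod>b\<in>Basis. exp (- (e\<^sup>2 * (y \<bullet> b)\<^sup>2 / 2)))"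
    unfolding gauss_def norm_sq_euclidean
    by (subst exp_sum[symmetric]) (auto simp: sum_negf sum_divide_distrib sum_distrib_left)
  ultimately show ?thesis by (simp add: prod.distrib)
qed

lemma integrable_fourier_gauss:
  fixes z :: "'a::euclidean_space"
  assumes e: "0 < e"
  shows "integrable lborel (\<lambda>y. cis (- (z \<bullet> y)) * complex_of_real (gauss e y))"
  unfolding fourier_gauss_aux
  by (rule lborel_prod_Basis) (auto intro!: integrable_cis_mult integrable_of_real integrable_gauss_real[OF e])

lemma fourier_gauss:
  fixes z :: "'a::euclidean_space"
  assumes e: "0 < e"
  shows "(LINT y|lborel. cis (- (z \<bullet> y)) * complex_of_real (gauss e y))
    = of_real ((sqrt (2 * pi) / e) ^ DIM('a) * gauss (1 / e) z)"
proof -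
  have "(LINT y|lborel. cis (- (z \<bullet> y)) * complex_of_real (gauss e y))
      = (\<Prod>b\<in>(Basis::'a set). LINT t|lborel. cis (- ((z \<bullet> b) * t)) * of_real (exp (- (e\<^sup>2 * t\<^sup>2 / 2))))"
    unfolding fourier_gauss_aux
    by (rule lborel_prod_Basis) (auto intro!: integrable_cis_mult integrable_of_real integrable_gauss_real[OF e])
  also have "\<dots> = (\<Prod>b\<in>(Basis::'a set). of_real (sqrt (2 * pi) / e * exp (- ((z \<bullet> b)\<^sup>2 / (2 * e\<^sup>2)))))"
    by (intro prod.cong fourier_gauss_real e refl)
  also have "\<dots> = of_real ((sqrt (2 * pi) / e) ^ DIM('a) * (\<Prod>b\<in>(Basis::'a set). exp (- ((z \<bullet> b)\<^sup>2 / (2 * e\<^sup>2)))))"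
    by (simp add: prod.distrib prod_dividef power_divide)
  also have "(\<Prod>b\<in>(Basis::'a set). exp (- ((z \<bullet> b)\<^sup>2 / (2 * e\<^sup>2)))) = gauss (1 / e) z"
    unfolding gauss_def norm_sq_euclidean
    by (subst exp_sum[symmetric]) (auto simp: sum_negf sum_divide_distrib sum_distrib_left power_divide mult.commute)
  finally show ?thesis .
qed

lemma integrable_gauss: "0 < e \<Longrightarrow> integrable lborel (gauss e :: 'a::euclidean_space \<Rightarrow> real)"
  using integrable_fourier_gauss[of e "0::'a"] by (simp add: complex_of_real_integrable_eq)

lemma integral_gauss:
  assumes "0 < e" shows "(LINT y|lborel. gauss e (y::'a::euclidean_space)) = (sqrt (2 * pi) / e) ^ DIM('a)"
proof -
  have "complex_of_real (LINT y|lborel. gauss e (y::'a)) = of_real ((sqrt (2 * pi) / e) ^ DIM('a))"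
    using fourier_gauss[OF assms, of "0::'a"] by (simp add: gauss_def)
  then show ?thesis by (simp only: of_real_eq_iff)
qed

section \<open>Plancherel's inequalities for integrable functions\<close>

definition FT :: "('a::euclidean_space \<Rightarrow> complex) \<Rightarrow> 'a \<Rightarrow> complex" where
  "FT f y = (LINT x|lborel. cis (- (x \<bullet> y)) * f x)"

text \<open>The square of the L^2 norm, as an extended real: roots are avoided and every function
  has a value, at the price of the factors 2 in \<open>sqnorm_add_le\<close> where the norm would
  have a triangle inequality.\<close>

definition sqnorm :: "('a::euclidean_space \<Rightarrow> complex) \<Rightarrow> ennreal" where
  "sqnorm f = (\<integral>\<^sup>+x. ennreal ((cmod (f x))\<^sup>2) \<partial>lborel)"

lemma borel_measurable_FT [measurable]:
  assumes [measurable]: "f \<in> borel_measurable borel" shows "FT f \<in> borel_measurable borel"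
  unfolding FT_def[abs_def] by measurable

lemma norm_FT_le: "cmod (FT f y) \<le> (LINT x|lborel. cmod (f x))"
  unfolding FT_def using integral_norm_bound[of lborel "\<lambda>x. cis (- (x \<bullet> y)) * f x"] by (simp add: norm_mult)

text \<open>Damping the squared Fourier transform by a Gaussian makes Fubini applicable; the dual kernel is
  an approximate identity.\<close>

lemma FT_gauss_identity:
  fixes f :: "'a::euclidean_space \<Rightarrow> complex"
  assumes f: "integrable lborel f" and e: "0 < e"
  shows "complex_of_real (LINT y|lborel. (cmod (FT f y))\<^sup>2 * gauss e y)
      = (LINT p|(lborel \<Otimes>\<^sub>M lborel). f (fst p) * cnj (f (snd p)) * of_real ((sqrt (2 * pi) / e) ^ DIM('a) * gauss (1 / e) (fst p - snd p)))"
proof -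
  let ?P = "lborel \<Otimes>\<^sub>M lborel :: ('a \<times> 'a) measure"
  have [measurable]: "f \<in> borel_measurable borel" using f by auto
  have cf: "integrable lborel (\<lambda>x. cnj (f x))" using f by simp
  interpret P: pair_sigma_finite "lborel::'a measure" ?P
    unfolding lborel_prod by standard
  have ff: "integrable ?P (\<lambda>p. f (fst p) * cnj (f (snd p)))"
    by (intro integrable_pair_mult f cf sigma_finite_lborel)
  have int: "integrable (lborel \<Otimes>\<^sub>M ?P) (\<lambda>(y, p). of_real (gauss e y) * (f (fst p) * cnj (f (snd p))) * cis (- ((fst p - snd p) \<bullet> y)))"
  proof -
    have "integrable (lborel \<Otimes>\<^sub>M ?P) (\<lambda>q. of_real (gauss e (fst q)) * (\<lambda>p. f (fst p) * cnj (f (snd p))) (snd q))"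
      by (rule integrable_pair_mult[OF _ _ integrable_of_real[OF integrable_gauss[OF e]] ff])
         (auto simp: lborel_prod intro: sigma_finite_lborel)
    then show ?thesis by (rule Bochner_Integration.integrable_bound) (measurable, auto simp: norm_mult split: prod.splits)
  qed
  have sq: "complex_of_real ((cmod (FT f y))\<^sup>2) = (LINT p|?P. f (fst p) * cnj (f (snd p)) * cis (- ((fst p - snd p) \<bullet> y)))" for y
  proof -
    have "complex_of_real ((cmod (FT f y))\<^sup>2) = FT f y * cnj (FT f y)" by (rule complex_norm_square)
    also have "\<dots> = (LINT x|lborel. cis (- (x \<bullet> y)) * f x) * (LINT x|lborel. cnj (cis (- (x \<bullet> y)) * f x))"
      by (simp only: FT_def Bochner_Integration.integral_cnj)
    also have "\<dots> = (LINT p|?P. (cis (- (fst p \<bullet> y)) * f (fst p)) * (cnj (cis (- (snd p \<bullet> y)) * f (snd p))))"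
      by (rule integral_pair_mult[symmetric])
         (auto intro!: integrable_cis_mult f cf simp: sigma_finite_lborel cis_cnj)
    also have "\<dots> = (LINT p|?P. f (fst p) * cnj (f (snd p)) * cis (- ((fst p - snd p) \<bullet> y)))"
      by (intro Bochner_Integration.integral_cong refl) (auto simp: cis_cnj inner_diff_left cis_mult)
    finally show ?thesis .
  qed
  have "complex_of_real (LINT y|lborel. (cmod (FT f y))\<^sup>2 * gauss e y) = (LINT y|lborel. complex_of_real ((cmod (FT f y))\<^sup>2) * of_real (gauss e y))"
    by (simp only: integral_complex_of_real[symmetric] of_real_mult)
  also have "\<dots> = (LINT y|lborel. (LINT p|?P. of_real (gauss e y) * (f (fst p) * cnj (f (snd p))) * cis (- ((fst p - snd p) \<bullet> y))))"
    by (simp only: sq mult.assoc integral_mult_right_zero mult.commute[of _ "complex_of_real (gauss e _)"])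
  also have "\<dots> = (LINT p|?P. (LINT y|lborel. of_real (gauss e y) * (f (fst p) * cnj (f (snd p))) * cis (- ((fst p - snd p) \<bullet> y))))"
    by (rule P.Fubini_integral[symmetric]) (rule int)
  also have "\<dots> = (LINT p|?P. (f (fst p) * cnj (f (snd p))) * (LINT y|lborel. cis (- ((fst p - snd p) \<bullet> y)) * of_real (gauss e y)))"
    by (simp only: mult.commute[of "complex_of_real (gauss e _)"] mult.assoc integral_mult_right_zero)
  also have "\<dots> = (LINT p|?P. f (fst p) * cnj (f (snd p)) * of_real ((sqrt (2 * pi) / e) ^ DIM('a) * gauss (1 / e) (fst p - snd p)))"
    by (simp only: fourier_gauss[OF e])
  finally show ?thesis .
qed

lemma norm_add_sq_le: "(cmod (a + b))\<^sup>2 \<le> 2 * (cmod a)\<^sup>2 + 2 * (cmod b)\<^sup>2"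
proof -
  have "(cmod (a + b))\<^sup>2 \<le> (cmod a + cmod b)\<^sup>2" by (intro power_mono norm_triangle_ineq) auto
  also have "\<dots> \<le> 2 * (cmod a)\<^sup>2 + 2 * (cmod b)\<^sup>2"
    using sum_squares_bound[of "cmod a" "cmod b"] by (simp add: power2_sum)
  finally show ?thesis .
qed

lemma sqnorm_add_le:
  assumes [measurable]: "f \<in> borel_measurable borel" "g \<in> borel_measurable borel"
  shows "sqnorm (\<lambda>x. f x + g x) \<le> 2 * sqnorm f + 2 * sqnorm g"
proof -
  have "sqnorm (\<lambda>x. f x + g x) \<le> (\<integral>\<^sup>+x. 2 * ennreal ((cmod (f x))\<^sup>2) + 2 * ennreal ((cmod (g x))\<^sup>2) \<partial>lborel)"
    unfolding sqnorm_def
  proof (rule nn_integral_mono)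
    fix x
    have "ennreal ((cmod (f x + g x))\<^sup>2) \<le> ennreal (2 * (cmod (f x))\<^sup>2 + 2 * (cmod (g x))\<^sup>2)"
      by (intro ennreal_leI norm_add_sq_le)
    then show "ennreal ((cmod (f x + g x))\<^sup>2) \<le> 2 * ennreal ((cmod (f x))\<^sup>2) + 2 * ennreal ((cmod (g x))\<^sup>2)"
      by (simp add: ennreal_mult ennreal_plus)
  qed
  also have "\<dots> = 2 * sqnorm f + 2 * sqnorm g"
    unfolding sqnorm_def by (subst nn_integral_add, measurable, subst (1 2) nn_integral_cmult, auto)
  finally show ?thesis .
qed

lemma sqnorm_minus_commute: "sqnorm (\<lambda>x. f x - g x) = sqnorm (\<lambda>x. g x - f x)"
  unfolding sqnorm_def by (simp add: norm_minus_commute)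

lemma sqnorm_diff_triangle:
  assumes [measurable]: "f \<in> borel_measurable borel" "g \<in> borel_measurable borel" "h \<in> borel_measurable borel"
  shows "sqnorm (\<lambda>x. f x - h x) \<le> 2 * sqnorm (\<lambda>x. f x - g x) + 2 * sqnorm (\<lambda>x. g x - h x)"
  using sqnorm_add_le[of "\<lambda>x. f x - g x" "\<lambda>x. g x - h x"] by simp

lemma sqnorm_cmult:
  assumes [measurable]: "f \<in> borel_measurable borel"
  shows "sqnorm (\<lambda>x. c * f x) = ennreal ((cmod c)\<^sup>2) * sqnorm f"
  unfolding sqnorm_def by (simp add: norm_mult power_mult_distrib ennreal_mult nn_integral_cmult)

lemma sqnorm_uminus_arg:
  assumes [measurable]: "f \<in> borel_measurable borel"
  shows "sqnorm (\<lambda>x. f (- x)) = sqnorm f"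
  using nn_integral_reflect[of "\<lambda>x. ennreal ((cmod (f x))\<^sup>2)" 0] unfolding sqnorm_def by simp

lemma ennreal_norm_integral_le:
  fixes f :: "'a \<Rightarrow> 'b::{banach, second_countable_topology}"
  shows "ennreal (norm (LINT x|M. f x)) \<le> (\<integral>\<^sup>+x. ennreal (norm (f x)) \<partial>M)"
  by (cases "integrable M f") (auto simp: integral_norm_bound_ennreal not_integrable_integral_eq)

text \<open>Schur's test on the dual side of the identity: |f(x) f(y)| <= (|f(x)|^2 + |f(y)|^2) / 2,
  and the kernel \<open>k\<close> is nonnegative with total mass (2 pi)^d, whatever e is.\<close>

lemma sqnorm_FT_gauss_le:
  fixes f :: "'a::euclidean_space \<Rightarrow> complex"
  assumes f: "integrable lborel f" and e: "0 < e"
  shows "(\<integral>\<^sup>+y. ennreal ((cmod (FT f y))\<^sup>2 * gauss e y) \<partial>lborel) \<le> ennreal ((2 * pi) ^ DIM('a)) * sqnorm f"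
proof -
  let ?P = "lborel \<Otimes>\<^sub>M lborel :: ('a \<times> 'a) measure"
  have [measurable]: "f \<in> borel_measurable borel" using f by auto
  define k where "k z = (sqrt (2 * pi) / e) ^ DIM('a) * gauss (1 / e) z" for z :: 'a
  have [measurable]: "k \<in> borel_measurable borel" unfolding k_def[abs_def] by measurable
  have mk1: "(\<lambda>p. ennreal ((cmod (f (fst p)))\<^sup>2 / 2) * ennreal (k (fst p - snd p))) \<in> borel_measurable ?P" by measurable
  have mk2: "(\<lambda>p. ennreal ((cmod (f (snd p)))\<^sup>2 / 2) * ennreal (k (fst p - snd p))) \<in> borel_measurable ?P" by measurable
  have k0: "0 \<le> k z" for z using e gauss_pos[of "1/e" z] by (auto simp: k_def)
  have ik: "integrable lborel k" unfolding k_def[abs_def] using e by (intro integrable_mult_right integrable_gauss) auto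
  have "(LINT z|lborel. k z) = (sqrt (2 * pi) / e) ^ DIM('a) * (sqrt (2 * pi) / (1 / e)) ^ DIM('a)"
    unfolding k_def using e by (subst integral_mult_right_zero, subst integral_gauss) auto
  \<comment> \<open>The prefactors belong to the widths 1 / e and e, so e cancels and each dimension
    contributes 2 pi.\<close>
  also have "\<dots> = ((sqrt (2 * pi) / e) * (sqrt (2 * pi) / (1 / e))) ^ DIM('a)" by (simp only: power_mult_distrib)
  also have "(sqrt (2 * pi) / e) * (sqrt (2 * pi) / (1 / e)) = 2 * pi" using e by simp
  finally have nk: "(\<integral>\<^sup>+z. ennreal (k z) \<partial>lborel) = ennreal ((2 * pi) ^ DIM('a))"
    by (subst nn_integral_eq_integral[OF ik]) (auto simp: k0)
  have bnd: "cmod (FT f y) \<le> (LINT x|lborel. cmod (f x))" for y by (rule norm_FT_le)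
  have int: "integrable lborel (\<lambda>y. (cmod (FT f y))\<^sup>2 * gauss e y)"
  proof (rule Bochner_Integration.integrable_bound)
    show "integrable lborel (\<lambda>y. (LINT x|lborel. cmod (f x))\<^sup>2 * gauss e (y::'a))" using e by (intro integrable_mult_right integrable_gauss)
    show "AE y in lborel. norm ((cmod (FT f y))\<^sup>2 * gauss e y) \<le> norm ((LINT x|lborel. cmod (f x))\<^sup>2 * gauss e y)"
      using bnd gauss_pos[of e] by (auto simp: abs_mult less_imp_le intro!: mult_right_mono power_mono)
  qed measurable
  have "(\<integral>\<^sup>+y. ennreal ((cmod (FT f y))\<^sup>2 * gauss e y) \<partial>lborel) = ennreal (LINT y|lborel. (cmod (FT f y))\<^sup>2 * gauss e y)"
    by (intro nn_integral_eq_integral int AE_I2 mult_nonneg_nonneg less_imp_le[OF gauss_pos]) auto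
  also have "\<dots> \<le> ennreal (cmod (LINT p|?P. f (fst p) * cnj (f (snd p)) * of_real (k (fst p - snd p))))"
    unfolding k_def FT_gauss_identity[OF f e, symmetric] by (intro ennreal_leI) simp
  also have "\<dots> \<le> (\<integral>\<^sup>+p. ennreal (cmod (f (fst p) * cnj (f (snd p)) * of_real (k (fst p - snd p)))) \<partial>?P)"
    by (rule ennreal_norm_integral_le)
  also have "\<dots> \<le> (\<integral>\<^sup>+p. ennreal ((cmod (f (fst p)))\<^sup>2 / 2) * ennreal (k (fst p - snd p)) + ennreal ((cmod (f (snd p)))\<^sup>2 / 2) * ennreal (k (fst p - snd p)) \<partial>?P)"
  proof (rule nn_integral_mono)
    fix p :: "'a \<times> 'a"
    have "cmod (f (fst p)) * cmod (f (snd p)) \<le> (cmod (f (fst p)))\<^sup>2 / 2 + (cmod (f (snd p)))\<^sup>2 / 2"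
      using sum_squares_bound[of "cmod (f (fst p))" "cmod (f (snd p))"] by simp
    then have "cmod (f (fst p)) * cmod (f (snd p)) * k (fst p - snd p) \<le> ((cmod (f (fst p)))\<^sup>2 / 2 + (cmod (f (snd p)))\<^sup>2 / 2) * k (fst p - snd p)"
      by (rule mult_right_mono) (rule k0)
    then show "ennreal (cmod (f (fst p) * cnj (f (snd p)) * of_real (k (fst p - snd p))))
       \<le> ennreal ((cmod (f (fst p)))\<^sup>2 / 2) * ennreal (k (fst p - snd p)) + ennreal ((cmod (f (snd p)))\<^sup>2 / 2) * ennreal (k (fst p - snd p))"
      using k0 by (simp add: norm_mult ennreal_mult[symmetric] ennreal_plus[symmetric] ring_distribs ennreal_leI del: ennreal_plus)
  qed
  also have "\<dots> = (\<integral>\<^sup>+p. ennreal ((cmod (f (fst p)))\<^sup>2 / 2) * ennreal (k (fst p - snd p)) \<partial>?P)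
      + (\<integral>\<^sup>+p. ennreal ((cmod (f (snd p)))\<^sup>2 / 2) * ennreal (k (fst p - snd p)) \<partial>?P)"
    by (rule nn_integral_add) measurable
  also have "(\<integral>\<^sup>+p. ennreal ((cmod (f (fst p)))\<^sup>2 / 2) * ennreal (k (fst p - snd p)) \<partial>?P)
     = (\<integral>\<^sup>+x. (\<integral>\<^sup>+y. ennreal ((cmod (f x))\<^sup>2 / 2) * ennreal (k (x - y)) \<partial>lborel) \<partial>lborel)"
    using lborel.nn_integral_fst[OF mk1] by simp
  also have "\<dots> = (\<integral>\<^sup>+x. ennreal ((cmod (f x))\<^sup>2 / 2) * ennreal ((2 * pi) ^ DIM('a)) \<partial>lborel)"
    by (intro nn_integral_cong, subst nn_integral_cmult, measurable)
       (subst nn_integral_reflect[of "\<lambda>z. ennreal (k z)"], measurable, simp add: nk)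
  also have "(\<integral>\<^sup>+p. ennreal ((cmod (f (snd p)))\<^sup>2 / 2) * ennreal (k (fst p - snd p)) \<partial>?P)
     = (\<integral>\<^sup>+y. (\<integral>\<^sup>+x. ennreal ((cmod (f y))\<^sup>2 / 2) * ennreal (k (x - y)) \<partial>lborel) \<partial>lborel)"
    using lborel_pair.nn_integral_snd[OF mk2] by simp
  also have "\<dots> = (\<integral>\<^sup>+y. ennreal ((cmod (f y))\<^sup>2 / 2) * ennreal ((2 * pi) ^ DIM('a)) \<partial>lborel)"
  proof (intro nn_integral_cong)
    fix y :: 'a
    have kk: "(\<integral>\<^sup>+x. ennreal (k (x - y)) \<partial>lborel) = ennreal ((2 * pi) ^ DIM('a))"
      using nn_integral_translate[of "\<lambda>z. ennreal (k z)" "- y"] by (simp add: nk)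
    show "(\<integral>\<^sup>+x. ennreal ((cmod (f y))\<^sup>2 / 2) * ennreal (k (x - y)) \<partial>lborel) = ennreal ((cmod (f y))\<^sup>2 / 2) * ennreal ((2 * pi) ^ DIM('a))"
      by (subst nn_integral_cmult) (measurable, simp add: kk)
  qed
  also have "(\<integral>\<^sup>+x. ennreal ((cmod (f x))\<^sup>2 / 2) * ennreal ((2 * pi) ^ DIM('a)) \<partial>lborel)
     = ennreal ((2 * pi) ^ DIM('a)) * (\<integral>\<^sup>+x. ennreal ((cmod (f x))\<^sup>2 / 2) \<partial>lborel)"
    by (subst nn_integral_multc) (auto simp: mult.commute)
  also have "(\<integral>\<^sup>+x. ennreal ((cmod (f x))\<^sup>2 / 2) \<partial>lborel) = sqnorm f / 2"
    unfolding sqnorm_def by (subst nn_integral_divide[symmetric]) (auto intro!: nn_integral_cong simp: divide_ennreal[symmetric])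
  also have "ennreal ((2 * pi) ^ DIM('a)) * (sqnorm f / 2) + ennreal ((2 * pi) ^ DIM('a)) * (sqnorm f / 2) = ennreal ((2 * pi) ^ DIM('a)) * sqnorm f"
    by (simp only: distrib_left[symmetric] add_divide_distrib_ennreal[symmetric])
       (simp add: mult_2[symmetric] ennreal_times_divide mult.commute[of 2] ennreal_mult_divide_eq)
  finally show ?thesis .
qed

text \<open>The undamped bound is uniform in e, so Fatou's lemma along e = 1 / (n + 1) removes the
  Gaussian; the right-hand side may be infinite.\<close>

lemma sqnorm_FT_le:
  fixes f :: "'a::euclidean_space \<Rightarrow> complex"
  assumes f: "integrable lborel f"
  shows "sqnorm (FT f) \<le> ennreal ((2 * pi) ^ DIM('a)) * sqnorm f"
proof -
  have [measurable]: "f \<in> borel_measurable borel" using f by auto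
  have lim: "(\<lambda>n. ennreal ((cmod (FT f y))\<^sup>2 * gauss (1 / real (Suc n)) y)) \<longlonglongrightarrow> ennreal ((cmod (FT f y))\<^sup>2)" for y
  proof -
    have "(\<lambda>n. (cmod (FT f y))\<^sup>2 * gauss (1 / real (Suc n)) y) \<longlonglongrightarrow> (cmod (FT f y))\<^sup>2 * exp (- (0\<^sup>2 * (norm y)\<^sup>2 / 2))"
      unfolding gauss_def by (intro tendsto_intros LIMSEQ_Suc[OF lim_const_over_n[of 1]]) simp
    then show ?thesis by (intro tendsto_ennrealI) simp
  qed
  have "sqnorm (FT f) = (\<integral>\<^sup>+y. liminf (\<lambda>n. ennreal ((cmod (FT f y))\<^sup>2 * gauss (1 / real (Suc n)) y)) \<partial>lborel)"
    unfolding sqnorm_def by (intro nn_integral_cong) (rule lim_imp_Liminf[OF _ lim, symmetric], simp)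
  also have "\<dots> \<le> liminf (\<lambda>n. \<integral>\<^sup>+y. ennreal ((cmod (FT f y))\<^sup>2 * gauss (1 / real (Suc n)) y) \<partial>lborel)"
    by (rule nn_integral_liminf) measurable
  also have "\<dots> \<le> liminf (\<lambda>n. ennreal ((2 * pi) ^ DIM('a)) * sqnorm f)"
    by (intro Liminf_mono always_eventually allI sqnorm_FT_gauss_le f) auto
  finally show ?thesis by (simp add: Liminf_const)
qed

text \<open>For the reverse inequality the approximate identity must converge to f pointwise, hence
  the continuity; the bound B gives the integrable majorant B |f(x)| k(z). The Gaussian factor is at
  most 1, so the limit of the damped integrals bounds \<open>sqnorm (FT f)\<close> from
  below.\<close>

lemma sqnorm_FT_ge:
  fixes f :: "'a::euclidean_space \<Rightarrow> complex"
  assumes f: "integrable lborel f" and cont: "continuous_on UNIV f" and bdd: "\<And>x. cmod (f x) \<le> B"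
  shows "ennreal ((2 * pi) ^ DIM('a)) * sqnorm f \<le> sqnorm (FT f)"
proof -
  let ?P = "lborel \<Otimes>\<^sub>M lborel :: ('a \<times> 'a) measure"
  have [measurable]: "f \<in> borel_measurable borel" using f by auto
  define k where "k = (\<lambda>z::'a. (sqrt (2 * pi)) ^ DIM('a) * gauss 1 z)"
  have k0: "0 \<le> k z" for z using gauss_pos[of 1 z] by (auto simp: k_def)
  have ik: "integrable lborel k" unfolding k_def by (intro integrable_mult_right integrable_gauss) auto
  have [measurable]: "k \<in> borel_measurable borel" using ik by auto
  have Ik: "(LINT z|lborel. k z) = (2 * pi) ^ DIM('a)"
  proof -
    have "(LINT z|lborel. k z) = sqrt (2 * pi) ^ DIM('a) * sqrt (2 * pi) ^ DIM('a)"
      unfolding k_def by (subst integral_mult_right_zero, subst integral_gauss) auto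
    also have "\<dots> = (sqrt (2 * pi) * sqrt (2 * pi)) ^ DIM('a)" by (simp only: power_mult_distrib)
    finally show ?thesis by simp
  qed
  define e where "e n = 1 / real (Suc n)" for n
  have e0: "0 < e n" for n by (simp add: e_def)
  have elim: "e \<longlonglongrightarrow> 0" unfolding e_def by (rule LIMSEQ_Suc[OF lim_const_over_n[of 1]])
  have iabs: "integrable ?P (\<lambda>p. cmod (f (fst p)) * k (snd p))"
    by (intro integrable_pair_mult sigma_finite_lborel ik integrable_norm f)
  have ibd: "integrable ?P (\<lambda>p. B * (cmod (f (fst p)) * k (snd p)))" by (intro integrable_mult_right iabs)
  have eq: "complex_of_real (LINT y|lborel. (cmod (FT f y))\<^sup>2 * gauss (e n) y)
     = (LINT p|?P. f (fst p) * cnj (f (fst p - e n *\<^sub>R snd p)) * of_real (k (snd p)))" for n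
  proof -
    define kn where "kn = (\<lambda>z::'a. (sqrt (2 * pi) / e n) ^ DIM('a) * gauss (1 / e n) z)"
    have [measurable]: "kn \<in> borel_measurable borel" unfolding kn_def by measurable
    \<comment> \<open>The normalisation of \<open>kn\<close> absorbs the Jacobian of y = x - e z:
      after the substitution the kernel is independent of n and e sits in the argument of f.\<close>
    have scale: "kn (e n *\<^sub>R z) * e n ^ DIM('a) = k z" for z
      using e0[of n] by (simp add: kn_def k_def gauss_def power_divide power_mult_distrib)
    have i1: "integrable lborel (\<lambda>z. kn z)" unfolding kn_def using e0[of n] by (intro integrable_mult_right integrable_gauss) auto
    have i2: "integrable lborel (\<lambda>y. kn (x - y))" for x
      using integrable_affine_euclidean[OF i1, of "-1" x] by simp
    have kpos: "0 \<le> kn z" for z using e0[of n] gauss_pos[of "1 / e n" z] by (auto simp: kn_def)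
    have "integrable ?P (\<lambda>p. f (fst p) * cnj (f (snd p)) * of_real (kn (fst p - snd p)))"
    proof (rule lborel_pair.Fubini_integrable)
      show "AE x in lborel. integrable lborel (\<lambda>y. f (fst (x, y)) * cnj (f (snd (x, y))) * complex_of_real (kn (fst (x, y) - snd (x, y))))"
      proof (rule AE_I2)
        fix x
        have "integrable lborel (\<lambda>y. cmod (f x) * B * kn (x - y))" by (intro integrable_mult_right i2)
        then show "integrable lborel (\<lambda>y. f (fst (x, y)) * cnj (f (snd (x, y))) * complex_of_real (kn (fst (x, y) - snd (x, y))))"
          by (rule Bochner_Integration.integrable_bound)
             (use kpos bdd order_trans[OF norm_ge_zero bdd] in \<open>auto simp: norm_mult abs_mult intro!: mult_mono\<close>)
      qed
      have "(LINT y|lborel. kn (x - y)) = (LINT y|lborel. kn y)" for x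
        using integral_affine_euclidean[of kn "-1" x] by simp
      moreover have "(LINT y|lborel. cmod (f (fst (x, y)) * cnj (f (snd (x, y))) * complex_of_real (kn (fst (x, y) - snd (x, y)))))
          \<le> (LINT y|lborel. cmod (f x) * B * kn (x - y))" for x
      proof (rule integral_mono')
        show "integrable lborel (\<lambda>y. cmod (f x) * B * kn (x - y))" by (intro integrable_mult_right i2)
      qed (use kpos bdd order_trans[OF norm_ge_zero bdd] in \<open>auto simp: norm_mult abs_mult intro!: mult_mono mult_nonneg_nonneg\<close>)
      ultimately have bb: "(LINT y|lborel. cmod (f (fst (x, y)) * cnj (f (snd (x, y))) * complex_of_real (kn (fst (x, y) - snd (x, y)))))
         \<le> cmod (f x) * B * (LINT y|lborel. kn y)" for x by simp
      show "integrable lborel (\<lambda>x. LINT y|lborel. cmod (f (fst (x, y)) * cnj (f (snd (x, y))) * complex_of_real (kn (fst (x, y) - snd (x, y)))))"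
      proof (rule Bochner_Integration.integrable_bound)
        show "integrable lborel (\<lambda>x. cmod (f x) * B * (LINT y|lborel. kn y))" using f by (intro integrable_mult_left integrable_norm)
        show "AE x in lborel. norm (LINT y|lborel. cmod (f (fst (x, y)) * cnj (f (snd (x, y))) * complex_of_real (kn (fst (x, y) - snd (x, y)))))
           \<le> norm (cmod (f x) * B * (LINT y|lborel. kn y))"
          using bb by (intro AE_I2) (smt (verit) real_norm_def integral_nonneg_AE AE_I2 norm_ge_zero)
      qed measurable
    qed measurable
    from lborel_pair.integral_fst'[OF this]
    have "complex_of_real (LINT y|lborel. (cmod (FT f y))\<^sup>2 * gauss (e n) y)
      = (LINT x|lborel. LINT y|lborel. f x * cnj (f y) * of_real (kn (x - y)))"
      unfolding FT_gauss_identity[OF f e0] by (simp add: kn_def)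
    also have "\<dots> = (LINT x|lborel. LINT z|lborel. f x * cnj (f (x - e n *\<^sub>R z)) * of_real (k z))"
    proof (rule Bochner_Integration.integral_cong[OF refl])
      fix x
      have "(LINT y|lborel. f x * cnj (f y) * of_real (kn (x - y)))
        = \<bar>- e n\<bar> ^ DIM('a) *\<^sub>R (LINT z|lborel. f x * cnj (f (x + (- e n) *\<^sub>R z)) * of_real (kn (x - (x + (- e n) *\<^sub>R z))))"
        by (rule integral_affine_euclidean) (measurable, use e0[of n] in auto)
      also have "\<dots> = (LINT z|lborel. \<bar>- e n\<bar> ^ DIM('a) *\<^sub>R (f x * cnj (f (x + (- e n) *\<^sub>R z)) * of_real (kn (x - (x + (- e n) *\<^sub>R z)))))"
        by simp
      also have "\<dots> = (LINT z|lborel. f x * cnj (f (x - e n *\<^sub>R z)) * of_real (k z))"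
        using e0[of n] by (intro Bochner_Integration.integral_cong refl) (simp add: scale[symmetric] scaleR_conv_of_real)
      finally show "(LINT y|lborel. f x * cnj (f y) * of_real (kn (x - y))) = (LINT z|lborel. f x * cnj (f (x - e n *\<^sub>R z)) * of_real (k z))" .
    qed
    also have "\<dots> = (LINT p|?P. f (fst p) * cnj (f (fst p - e n *\<^sub>R snd p)) * of_real (k (snd p)))"
    proof -
      have "integrable ?P (\<lambda>p. f (fst p) * cnj (f (fst p - e n *\<^sub>R snd p)) * of_real (k (snd p)))"
        by (rule Bochner_Integration.integrable_bound[OF ibd], measurable)
           (use k0 bdd order_trans[OF norm_ge_zero bdd] in \<open>auto simp: norm_mult abs_mult mult.assoc[symmetric] mult.commute[of B] intro!: mult_mono\<close>)
      from lborel_pair.integral_fst'[OF this] show ?thesis by simp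
    qed
    finally show ?thesis .
  qed
  have "(\<lambda>n. LINT p|?P. f (fst p) * cnj (f (fst p - e n *\<^sub>R snd p)) * of_real (k (snd p)))
      \<longlonglongrightarrow> (LINT p|?P. f (fst p) * cnj (f (fst p)) * of_real (k (snd p)))"
  proof (rule integral_dominated_convergence[OF _ _ ibd])
    show "AE p in ?P. (\<lambda>n. f (fst p) * cnj (f (fst p - e n *\<^sub>R snd p)) * complex_of_real (k (snd p))) \<longlonglongrightarrow> f (fst p) * cnj (f (fst p)) * complex_of_real (k (snd p))"
    proof (rule AE_I2)
      fix p :: "'a \<times> 'a"
      have "(\<lambda>n. fst p - e n *\<^sub>R snd p) \<longlonglongrightarrow> fst p - 0 *\<^sub>R snd p" by (intro tendsto_intros elim)
      then have "(\<lambda>n. f (fst p - e n *\<^sub>R snd p)) \<longlonglongrightarrow> f (fst p)"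
        using cont by (intro isCont_tendsto_compose[where g=f]) (auto simp: continuous_on_eq_continuous_at)
      then show "(\<lambda>n. f (fst p) * cnj (f (fst p - e n *\<^sub>R snd p)) * complex_of_real (k (snd p))) \<longlonglongrightarrow> f (fst p) * cnj (f (fst p)) * complex_of_real (k (snd p))"
        by (intro tendsto_intros)
    qed
    show "AE p in ?P. cmod (f (fst p) * cnj (f (fst p - e n *\<^sub>R snd p)) * complex_of_real (k (snd p))) \<le> B * (cmod (f (fst p)) * k (snd p))" for n
      using k0 bdd order_trans[OF norm_ge_zero bdd]
      by (intro AE_I2) (auto simp: norm_mult abs_mult mult.assoc[symmetric] mult.commute[of B] intro!: mult_mono)
  qed measurable
  then have lim: "(\<lambda>n. complex_of_real (LINT y|lborel. (cmod (FT f y))\<^sup>2 * gauss (e n) y)) \<longlonglongrightarrow> (LINT p|?P. f (fst p) * cnj (f (fst p)) * of_real (k (snd p)))"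
    unfolding eq .
  have if2: "integrable lborel (\<lambda>x. f x * cnj (f x))"
    by (rule Bochner_Integration.integrable_bound[OF integrable_mult_right[OF integrable_norm[OF f], of B]])
       (use bdd order_trans[OF norm_ge_zero bdd] in \<open>auto simp: norm_mult mult_right_mono\<close>)
  have if3: "integrable lborel (\<lambda>x. (cmod (f x))\<^sup>2)"
    using integrable_norm[OF if2] by (simp add: norm_mult power2_eq_square)
  have "(LINT p|?P. f (fst p) * cnj (f (fst p)) * of_real (k (snd p))) = (LINT x|lborel. f x * cnj (f x)) * (LINT z|lborel. complex_of_real (k z))"
    using integral_pair_mult[OF sigma_finite_lborel sigma_finite_lborel if2 integrable_of_real[OF ik]] by simp
  also have "(LINT x|lborel. f x * cnj (f x)) = of_real (LINT x|lborel. (cmod (f x))\<^sup>2)"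
    unfolding complex_norm_square[symmetric] by (rule integral_complex_of_real)
  also have "(LINT z|lborel. complex_of_real (k z)) = of_real ((2 * pi) ^ DIM('a))"
    by (simp only: integral_complex_of_real Ik)
  finally have "(\<lambda>n. complex_of_real (LINT y|lborel. (cmod (FT f y))\<^sup>2 * gauss (e n) y)) \<longlonglongrightarrow> of_real ((LINT x|lborel. (cmod (f x))\<^sup>2) * (2 * pi) ^ DIM('a))"
    using lim by simp
  then have "(\<lambda>n. (LINT y|lborel. (cmod (FT f y))\<^sup>2 * gauss (e n) y)) \<longlonglongrightarrow> (LINT x|lborel. (cmod (f x))\<^sup>2) * (2 * pi) ^ DIM('a)"
    by (simp only: tendsto_of_real_iff)
  then have "(\<lambda>n. ennreal (LINT y|lborel. (cmod (FT f y))\<^sup>2 * gauss (e n) y)) \<longlonglongrightarrow> ennreal ((LINT x|lborel. (cmod (f x))\<^sup>2) * (2 * pi) ^ DIM('a))"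
    by (rule tendsto_ennrealI)
  moreover have "ennreal (LINT y|lborel. (cmod (FT f y))\<^sup>2 * gauss (e n) y) \<le> sqnorm (FT f)" for n
  proof -
    have "integrable lborel (\<lambda>y. (cmod (FT f y))\<^sup>2 * gauss (e n) y)"
    proof (rule Bochner_Integration.integrable_bound)
      show "integrable lborel (\<lambda>y. (LINT x|lborel. cmod (f x))\<^sup>2 * gauss (e n) (y::'a))" using e0[of n] by (intro integrable_mult_right integrable_gauss)
      show "AE y in lborel. norm ((cmod (FT f y))\<^sup>2 * gauss (e n) y) \<le> norm ((LINT x|lborel. cmod (f x))\<^sup>2 * gauss (e n) y)"
        using norm_FT_le[of f] gauss_pos[of "e n"] by (auto simp: abs_mult less_imp_le intro!: mult_right_mono power_mono)
    qed measurable
    then have "ennreal (LINT y|lborel. (cmod (FT f y))\<^sup>2 * gauss (e n) y) = (\<integral>\<^sup>+y. ennreal ((cmod (FT f y))\<^sup>2 * gauss (e n) y) \<partial>lborel)"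
      by (intro nn_integral_eq_integral[symmetric] AE_I2 mult_nonneg_nonneg less_imp_le[OF gauss_pos]) auto
    also have "\<dots> \<le> sqnorm (FT f)" unfolding sqnorm_def
      by (intro nn_integral_mono ennreal_leI mult_left_le gauss_le_1) auto
    finally show ?thesis .
  qed
  ultimately have "ennreal ((LINT x|lborel. (cmod (f x))\<^sup>2) * (2 * pi) ^ DIM('a)) \<le> sqnorm (FT f)"
    by (intro LIMSEQ_le_const2[of "\<lambda>n. ennreal (LINT y|lborel. (cmod (FT f y))\<^sup>2 * gauss (e n) y)"]) auto
  moreover have "sqnorm f = ennreal (LINT x|lborel. (cmod (f x))\<^sup>2)"
    unfolding sqnorm_def by (intro nn_integral_eq_integral if3) auto
  ultimately show ?thesis by (simp add: ennreal_mult' mult.commute)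
qed

section \<open>Truncation, density and completeness in L^2\<close>

lemma integrable_L2_truncation:
  fixes f :: "'a::euclidean_space \<Rightarrow> complex"
  assumes [measurable]: "f \<in> borel_measurable borel" "S \<in> sets borel"
    and f: "sqnorm f < \<infinity>" and S: "emeasure lborel S < \<infinity>"
  shows "integrable lborel (\<lambda>x. if x \<in> S then f x else 0)"
proof (rule Bochner_Integration.integrable_bound)
  have "integrable lborel (\<lambda>x. (cmod (f x))\<^sup>2)"
    using f unfolding integrable_iff_bounded sqnorm_def by auto
  \<comment> \<open>A majorant on S because |f| <= 1 + |f|^2; the constant is integrable as S has
    finite measure.\<close>
  then show "integrable lborel (\<lambda>x. indicator S x + (cmod (f x))\<^sup>2)"
    using S by (intro Bochner_Integration.integrable_add) auto
  show "AE x in lborel. cmod (if x \<in> S then f x else 0) \<le> norm (indicator S x + (cmod (f x))\<^sup>2)"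
  proof (rule AE_I2)
    fix x
    have "2 * cmod (f x) \<le> 1 + (cmod (f x))\<^sup>2"
      using zero_le_power2[of "cmod (f x) - 1"] by (simp add: power2_diff)
    then have "cmod (f x) \<le> 1 + (cmod (f x))\<^sup>2"
      using norm_ge_zero[of "f x"] by linarith
    then show "cmod (if x \<in> S then f x else 0) \<le> norm (indicator S x + (cmod (f x))\<^sup>2)"
      by (auto simp: indicator_def)
  qed
qed measurable

text \<open>A measurable function is almost everywhere a limit of continuous \<open>g n\<close>.
  Composing with the retraction \<open>P\<close> onto the disc of radius M and multiplying by the
  cutoff \<open>X\<close> keeps continuity, fixes f (which obeys both bounds), and makes the
  approximants uniformly bounded with a common bounded support, so dominated convergence upgrades
  the limit to L^2.\<close>

lemma L2_approx_bounded:
  fixes f :: "'a::euclidean_space \<Rightarrow> complex"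
  assumes f[measurable]: "f \<in> borel_measurable borel" and M: "0 < M" and bd: "\<And>x. cmod (f x) \<le> M"
    and supp: "\<And>x. M < norm x \<Longrightarrow> f x = 0" and e: "0 < e"
  obtains h B where "continuous_on UNIV h" "integrable lborel h" "\<And>x. cmod (h x) \<le> B"
    "sqnorm (\<lambda>x. f x - h x) \<le> ennreal e"
proof -
  have "f \<in> borel_measurable lebesgue" by (rule measurable_completion) simp
  then have "f measurable_on UNIV" by (rule lebesgue_measurable_imp_measurable_on) simp
  then obtain N g where N: "negligible N" and gc: "\<And>n. continuous_on UNIV (g n)"
    and glim: "\<And>x. x \<notin> N \<Longrightarrow> (\<lambda>n. g n x) \<longlonglongrightarrow> f x"
    unfolding measurable_on_def by auto
  define P where "P z = of_real (M / max M (cmod z)) * z" for z :: complex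
  define X where "X x = max 0 (min 1 (M + 1 - norm x))" for x :: 'a
  define h where "h n x = of_real (X x) * P (g n x)" for n x
  have Pc: "continuous_on UNIV P" unfolding P_def[abs_def] using M by (intro continuous_intros) auto
  have Pb: "cmod (P z) \<le> M" for z
    using M by (auto simp: P_def norm_mult norm_divide field_simps max_def)
  have Pid: "P (f x) = f x" for x using bd[of x] M by (simp add: P_def max_absorb1)
  have Xc: "continuous_on UNIV X" unfolding X_def[abs_def] by (intro continuous_intros)
  have hc: "continuous_on UNIV (h n)" for n
    unfolding h_def[abs_def] by (intro continuous_intros Xc continuous_on_compose2[OF Pc gc]) auto
  have [measurable]: "h n \<in> borel_measurable borel" for n using hc by (rule borel_measurable_continuous_onI)
  have hb: "cmod (h n x) \<le> M" for n x
  proof -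
    have "\<bar>X x\<bar> \<le> 1" by (auto simp: X_def)
    then have "\<bar>X x\<bar> * cmod (P (g n x)) \<le> 1 * M" using Pb M by (intro mult_mono) auto
    then show ?thesis by (simp add: h_def norm_mult)
  qed
  have hs: "h n x = 0" if "M + 1 < norm x" for n x using that by (simp add: h_def X_def)
  have [measurable]: "cball (0::'a) (M + 1) \<in> sets borel" by simp
  have fin: "emeasure lborel (cball (0::'a) (M + 1)) < \<infinity>" by (use M in \<open>simp add: emeasure_cball\<close>)
  have hi: "integrable lborel (h n)" for n
  proof (rule Bochner_Integration.integrable_bound)
    show "integrable lborel (\<lambda>x. M * indicator (cball (0::'a) (M + 1)) x)" using fin by (intro integrable_mult_right) auto
    show "AE x in lborel. cmod (h n x) \<le> norm (M * indicator (cball 0 (M + 1)) x)"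
      using hb hs M by (intro AE_I2) (auto simp: indicator_def not_le)
  qed measurable
  have "(\<lambda>n. \<integral>\<^sup>+x. ennreal ((cmod (f x - h n x))\<^sup>2) \<partial>lborel) \<longlonglongrightarrow> (\<integral>\<^sup>+(x::'a). 0 \<partial>lborel)"
  proof (rule nn_integral_dominated_convergence)
    show "AE x in lborel. ennreal ((cmod (f x - h n x))\<^sup>2) \<le> ennreal ((2 * M)\<^sup>2) * indicator (cball 0 (M + 1)) x" for n
    proof (rule AE_I2)
      fix x
      have "cmod (f x - h n x) \<le> 2 * M" using norm_triangle_ineq4[of "f x" "h n x"] bd[of x] hb[of n x] by simp
      then have "(cmod (f x - h n x))\<^sup>2 \<le> (2 * M)\<^sup>2" by (intro power_mono) auto
      moreover have "f x - h n x = 0" if "x \<notin> cball 0 (M + 1)" using that supp[of x] hs[of x n] by (auto simp: not_le)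
      ultimately show "ennreal ((cmod (f x - h n x))\<^sup>2) \<le> ennreal ((2 * M)\<^sup>2) * indicator (cball 0 (M + 1)) x"
        by (auto simp: indicator_def intro: ennreal_leI)
    qed
    show "(\<integral>\<^sup>+(x::'a). ennreal ((2 * M)\<^sup>2) * indicator (cball 0 (M + 1)) x \<partial>lborel) < \<infinity>"
      using fin by (subst nn_integral_cmult_indicator) (auto simp: ennreal_mult_less_top)
    have "AE x in lebesgue. x \<notin> N" using N by (auto simp: negligible_iff_null_sets intro: AE_not_in)
    then have "AE x in lborel. x \<notin> N" by (simp add: AE_completion_iff)
    then show "AE x in lborel. (\<lambda>n. ennreal ((cmod (f x - h n x))\<^sup>2)) \<longlonglongrightarrow> 0"
    proof eventually_elim
      fix x assume "x \<notin> N"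
      have "(\<lambda>n. P (g n x)) \<longlonglongrightarrow> P (f x)"
        using Pc by (intro isCont_tendsto_compose[where g=P] glim \<open>x \<notin> N\<close>) (auto simp: continuous_on_eq_continuous_at)
      then have "(\<lambda>n. (cmod (f x - h n x))\<^sup>2) \<longlonglongrightarrow> (cmod (f x - of_real (X x) * f x))\<^sup>2"
        unfolding h_def Pid by (intro tendsto_intros)
      moreover have "f x - of_real (X x) * f x = 0" using supp[of x] by (cases "M < norm x") (auto simp: X_def)
      ultimately have "(\<lambda>n. (cmod (f x - h n x))\<^sup>2) \<longlonglongrightarrow> 0" by simp
      then show "(\<lambda>n. ennreal ((cmod (f x - h n x))\<^sup>2)) \<longlonglongrightarrow> 0" using tendsto_ennrealI by fastforce
    qed
  qed measurable
  then have "(\<lambda>n. sqnorm (\<lambda>x. f x - h n x)) \<longlonglongrightarrow> 0" by (simp add: sqnorm_def)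
  from order_tendstoD(2)[OF this, of "ennreal e"] e obtain n where "sqnorm (\<lambda>x. f x - h n x) < ennreal e"
    by (auto simp: eventually_sequentially)
  then show ?thesis using that[OF hc[of n] hi hb] by auto
qed

lemma L2_truncation_tendsto:
  fixes f :: "'a::euclidean_space \<Rightarrow> complex"
  assumes [measurable]: "f \<in> borel_measurable borel" "\<And>n. A n \<in> sets borel"
    and f: "sqnorm f < \<infinity>" and A: "\<And>x. eventually (\<lambda>n::nat. x \<in> A n) sequentially"
  shows "(\<lambda>n. sqnorm (\<lambda>x. f x - (if x \<in> A n then f x else 0))) \<longlonglongrightarrow> 0"
proof -
  have m: "(\<lambda>x. ennreal ((cmod (f x - (if x \<in> A n then f x else 0)))\<^sup>2)) \<in> borel_measurable lborel" for n by measurable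
  have "(\<lambda>n. \<integral>\<^sup>+x. ennreal ((cmod (f x - (if x \<in> A n then f x else 0)))\<^sup>2) \<partial>lborel) \<longlonglongrightarrow> (\<integral>\<^sup>+(x::'a). 0 \<partial>lborel)"
  proof (rule nn_integral_dominated_convergence)
    show "(\<integral>\<^sup>+x. ennreal ((cmod (f x))\<^sup>2) \<partial>lborel) < \<infinity>" using f by (simp add: sqnorm_def)
    show "AE x in lborel. (\<lambda>n. ennreal ((cmod (f x - (if x \<in> A n then f x else 0)))\<^sup>2)) \<longlonglongrightarrow> 0"
    proof (rule AE_I2)
      fix x
      have "eventually (\<lambda>n. ennreal ((cmod (f x - (if x \<in> A n then f x else 0)))\<^sup>2) = 0) sequentially"
        using A[of x] by eventually_elim simp
      then show "(\<lambda>n. ennreal ((cmod (f x - (if x \<in> A n then f x else 0)))\<^sup>2)) \<longlonglongrightarrow> 0" by (rule tendsto_eventually)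
    qed
  qed (use m in auto)
  then show ?thesis by (simp add: sqnorm_def)
qed

lemma L2_approx:
  fixes f :: "'a::euclidean_space \<Rightarrow> complex"
  assumes f[measurable]: "f \<in> borel_measurable borel" and fin: "sqnorm f < \<infinity>" and e: "0 < e"
  obtains h B where "continuous_on UNIV h" "integrable lborel h" "\<And>x. cmod (h x) \<le> B"
    "sqnorm (\<lambda>x. f x - h x) \<le> ennreal e"
proof -
  \<comment> \<open>Argument and value are cut at the same level, which is the form that
    \<open>L2_approx_bounded\<close> accepts.\<close>
  define A where "A n = {x. norm x \<le> real n \<and> cmod (f x) \<le> real n}" for n
  have [measurable]: "A n \<in> sets borel" for n unfolding A_def by measurable
  have "eventually (\<lambda>n. x \<in> A n) sequentially" for x
    unfolding A_def using eventually_conj[OF eventually_ge_at_top[of "nat \<lceil>norm x\<rceil>"] eventually_ge_at_top[of "nat \<lceil>cmod (f x)\<rceil>"]]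
    by (simp add: nat_le_iff ceiling_le_iff)
  then have "(\<lambda>n. sqnorm (\<lambda>x. f x - (if x \<in> A n then f x else 0))) \<longlonglongrightarrow> 0"
    by (intro L2_truncation_tendsto fin) measurable
  then have "eventually (\<lambda>n. sqnorm (\<lambda>x. f x - (if x \<in> A n then f x else 0)) < ennreal (e / 4)) sequentially"
    using e by (intro order_tendstoD) auto
  \<comment> \<open>The index is shifted to \<open>Suc n\<close> because
    \<open>L2_approx_bounded\<close> asks for a positive level; e / 4 is what the factors 2 of
    \<open>sqnorm_diff_triangle\<close> leave for each part.\<close>
  then obtain n where n: "sqnorm (\<lambda>x. f x - (if x \<in> A (Suc n) then f x else 0)) < ennreal (e / 4)"
    unfolding eventually_sequentially by (metis le_Suc_eq le_refl)
  obtain h B where h: "continuous_on UNIV h" "integrable lborel h" "\<And>x. cmod (h x) \<le> B"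
    "sqnorm (\<lambda>x. (if x \<in> A (Suc n) then f x else 0) - h x) \<le> ennreal (e / 4)"
    by (rule L2_approx_bounded[of "\<lambda>x. if x \<in> A (Suc n) then f x else 0" "real (Suc n)" "e / 4"])
       (use e in \<open>auto simp: A_def\<close>)
  have [measurable]: "h \<in> borel_measurable borel" using h(2) by auto
  have "sqnorm (\<lambda>x. f x - h x) \<le> 2 * sqnorm (\<lambda>x. f x - (if x \<in> A (Suc n) then f x else 0)) + 2 * sqnorm (\<lambda>x. (if x \<in> A (Suc n) then f x else 0) - h x)"
    by (rule sqnorm_diff_triangle) measurable
  also have "\<dots> \<le> 2 * ennreal (e / 4) + 2 * ennreal (e / 4)"
    using n h(4) by (intro add_mono mult_left_mono) auto
  also have "\<dots> = ennreal e" using e by (simp add: mult_2 ennreal_plus[symmetric] del: ennreal_plus)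
  finally show ?thesis using that[OF h(1-3)] by simp
qed

text \<open>Riesz-Fischer for squared norms: along a subsequence the squared increments have
  integral at most 4^(-k), so even with weights 2^k their sum \<open>S\<close> is integrable. Where
  \<open>S\<close> is finite the increments are O(2^(-k/2)) and the subsequence converges. Fatou's
  lemma then compares the whole sequence with the limit.\<close>

lemma L2_complete:
  fixes h :: "nat \<Rightarrow> 'a::euclidean_space \<Rightarrow> complex"
  assumes [measurable]: "\<And>n. h n \<in> borel_measurable borel"
    and cau: "\<And>e::real. 0 < e \<Longrightarrow> \<exists>N. \<forall>m\<ge>N. \<forall>n\<ge>N. sqnorm (\<lambda>x. h m x - h n x) \<le> ennreal e"
  obtains g where "g \<in> borel_measurable borel" "(\<lambda>n. sqnorm (\<lambda>x. h n x - g x)) \<longlonglongrightarrow> 0"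
proof -
  have "\<exists>N. \<forall>m\<ge>N. \<forall>n\<ge>N. sqnorm (\<lambda>x. h m x - h n x) \<le> ennreal ((1/4)^k)" for k :: nat by (rule cau) simp
  then obtain N where N: "\<And>k m n. m \<ge> N k \<Longrightarrow> n \<ge> N k \<Longrightarrow> sqnorm (\<lambda>x. h m x - h n x) \<le> ennreal ((1/4)^k)" by metis
  \<comment> \<open>The extra 1 in every summand gives k <= s k, besides monotonicity and N k <= s
    k; it is used to infer s j >= N k from j >= N k in the Fatou step.\<close>
  define s where "s = (\<lambda>k. \<Sum>i\<le>k. N i + 1)"
  have sN: "N k \<le> s k" for k unfolding s_def by (rule order_trans[OF _ member_le_sum[of k]]) auto
  have sS: "s (Suc k) \<ge> s k" for k by (simp add: s_def)
  have sk: "k \<le> s k" for k unfolding s_def by (induction k) auto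
  define u where "u k = h (s k)" for k
  have [measurable]: "u k \<in> borel_measurable borel" for k unfolding u_def by simp
  define S where "S x = (\<Sum>k. ennreal (2^k) * ennreal ((cmod (u (Suc k) x - u k x))\<^sup>2))" for x
  have [measurable]: "S \<in> borel_measurable borel" unfolding S_def[abs_def] by measurable
  have "(\<integral>\<^sup>+x. S x \<partial>lborel) = (\<Sum>k. \<integral>\<^sup>+x. ennreal (2^k) * ennreal ((cmod (u (Suc k) x - u k x))\<^sup>2) \<partial>lborel)"
    unfolding S_def by (rule nn_integral_suminf) measurable
  also have "\<dots> = (\<Sum>k. ennreal (2^k) * sqnorm (\<lambda>x. u (Suc k) x - u k x))"
    unfolding sqnorm_def by (intro suminf_cong nn_integral_cmult) measurable
  also have "\<dots> \<le> (\<Sum>k. ennreal ((1/2)^k))"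
  proof (intro suminf_le allI)
    fix k
    have "sqnorm (\<lambda>x. u (Suc k) x - u k x) \<le> ennreal ((1/4)^k)"
      unfolding u_def using sN[of k] sS[of k] by (intro N) auto
    then have "ennreal (2^k) * sqnorm (\<lambda>x. u (Suc k) x - u k x) \<le> ennreal (2^k) * ennreal ((1/4)^k)" by (intro mult_left_mono) auto
    also have "\<dots> = ennreal ((1/2)^k)" by (subst ennreal_mult[symmetric]) (auto simp: power_mult_distrib[symmetric])
    finally show "ennreal (2^k) * sqnorm (\<lambda>x. u (Suc k) x - u k x) \<le> ennreal ((1/2)^k)" .
  qed auto
  also have "\<dots> = ennreal (\<Sum>k. (1/2)^k)" by (rule suminf_ennreal2) auto
  finally have "(\<integral>\<^sup>+x. S x \<partial>lborel) < \<infinity>" by (auto intro: le_less_trans)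
  then have "AE x in lborel. S x \<noteq> \<infinity>" by (intro nn_integral_PInf_AE) auto
  then have conv: "AE x in lborel. convergent (\<lambda>k. u k x)"
  proof eventually_elim
    fix x assume Sx: "S x \<noteq> \<infinity>"
    then obtain c where c: "S x = ennreal c" "0 \<le> c" by (cases "S x") auto
    have b: "cmod (u (Suc k) x - u k x) \<le> sqrt c * (1 / sqrt 2)^k" for k
    proof -
      have "ennreal (2^k) * ennreal ((cmod (u (Suc k) x - u k x))\<^sup>2) \<le> S x"
        unfolding S_def using sum_le_suminf[of "\<lambda>k. ennreal (2^k) * ennreal ((cmod (u (Suc k) x - u k x))\<^sup>2)" "{k}"] by auto
      then have "2^k * (cmod (u (Suc k) x - u k x))\<^sup>2 \<le> c" using c by (simp add: ennreal_mult[symmetric])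
      then have "(cmod (u (Suc k) x - u k x))\<^sup>2 \<le> c * (1/2)^k" by (simp add: field_simps power_divide)
      also have "\<dots> = (sqrt c * (1 / sqrt 2)^k)\<^sup>2" using c(2)
        by (simp add: power_mult_distrib power_divide flip: power_mult) (simp add: power_mult mult.commute[of k])
      finally show ?thesis using c(2) by (intro power2_le_imp_le[of "cmod (u (Suc k) x - u k x)"]) auto
    qed
    have "summable (\<lambda>k. sqrt c * (1 / sqrt 2)^k)" by (intro summable_mult summable_geometric) simp
    then have "summable (\<lambda>k. u (Suc k) x - u k x)" by (rule summable_comparison_test') (rule b)
    then show "convergent (\<lambda>k. u k x)" by (simp add: telescope_summable' summable_iff_convergent sum_lessThan_telescope[of "\<lambda>k. u k x"] convergent_diff_const_right_iff)
  qed
  define g where "g x = lim (\<lambda>k. u k x)" for x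
  have [measurable]: "g \<in> borel_measurable borel" unfolding g_def[abs_def] by measurable
  have lim: "AE x in lborel. (\<lambda>k. u k x) \<longlonglongrightarrow> g x" using conv by eventually_elim (simp add: g_def convergent_LIMSEQ_iff)
  have bound: "sqnorm (\<lambda>x. h n x - g x) \<le> ennreal ((1/4)^k)" if n: "n \<ge> N k" for n k
  proof -
    have "sqnorm (\<lambda>x. h n x - g x) = (\<integral>\<^sup>+x. liminf (\<lambda>j. ennreal ((cmod (h n x - u j x))\<^sup>2)) \<partial>lborel)"
      unfolding sqnorm_def
    proof (rule nn_integral_cong_AE, use lim in eventually_elim)
      fix x assume "(\<lambda>k. u k x) \<longlonglongrightarrow> g x"
      then have "(\<lambda>j. ennreal ((cmod (h n x - u j x))\<^sup>2)) \<longlonglongrightarrow> ennreal ((cmod (h n x - g x))\<^sup>2)"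
        by (intro tendsto_ennrealI tendsto_intros)
      then show "ennreal ((cmod (h n x - g x))\<^sup>2) = liminf (\<lambda>j. ennreal ((cmod (h n x - u j x))\<^sup>2))"
        by (intro lim_imp_Liminf[symmetric]) auto
    qed
    also have "\<dots> \<le> liminf (\<lambda>j. sqnorm (\<lambda>x. h n x - u j x))"
      unfolding sqnorm_def by (rule nn_integral_liminf) measurable
    also have "\<dots> \<le> liminf (\<lambda>j. ennreal ((1/4)^k))"
    proof (rule Liminf_mono)
      show "eventually (\<lambda>j. sqnorm (\<lambda>x. h n x - u j x) \<le> ennreal ((1/4)^k)) sequentially"
        using eventually_ge_at_top[of "N k"]
        by eventually_elim (auto simp: u_def intro!: N n order_trans[OF _ sk])
    qed
    finally show ?thesis by (simp add: Liminf_const)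
  qed
  have "(\<lambda>n. sqnorm (\<lambda>x. h n x - g x)) \<longlonglongrightarrow> 0"
  proof (rule order_tendstoI)
    fix a :: ennreal assume "0 < a"
    have "(\<lambda>k. ennreal ((1/4)^k)) \<longlonglongrightarrow> ennreal 0" by (intro tendsto_ennrealI LIMSEQ_power_zero) simp
    then have "eventually (\<lambda>k. ennreal ((1/4)^k) < a) sequentially" using \<open>0 < a\<close> by (intro order_tendstoD) auto
    then obtain k where "ennreal ((1/4)^k) < a" by (auto simp: eventually_sequentially)
    then show "eventually (\<lambda>n. sqnorm (\<lambda>x. h n x - g x) < a) sequentially"
      by (intro eventually_mono[OF eventually_ge_at_top[of "N k"]] le_less_trans[OF bound])
  qed (auto simp: not_less_zero)
  then show ?thesis by (rule that[rotated]) measurable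
qed

section \<open>The unitary Fourier transform on L^2 and its inversion\<close>

definition nFT :: "('a::euclidean_space \<Rightarrow> complex) \<Rightarrow> 'a \<Rightarrow> complex" where
  "nFT f y = of_real ((2 * pi) powr (- real DIM('a) / 2)) * FT f y"

definition inFT :: "('a::euclidean_space \<Rightarrow> complex) \<Rightarrow> 'a \<Rightarrow> complex" where
  "inFT f y = nFT f (- y)"

lemma borel_measurable_nFT [measurable]:
  "f \<in> borel_measurable borel \<Longrightarrow> nFT f \<in> borel_measurable borel"
  unfolding nFT_def[abs_def] by measurable

lemma borel_measurable_inFT [measurable]:
  assumes [measurable]: "f \<in> borel_measurable borel" shows "inFT f \<in> borel_measurable borel"
  unfolding inFT_def[abs_def] by measurable

lemma nFT_const_sq: "((2 * pi) powr (- real n / 2))\<^sup>2 * (2 * pi) ^ n = 1"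
proof -
  have "((2 * pi) powr (- real n / 2))\<^sup>2 = (2 * pi) powr (- real n)"
    by (simp add: power2_eq_square powr_add[symmetric])
  then show ?thesis by (simp add: powr_minus powr_realpow power_mult_distrib field_simps)
qed

lemma sqnorm_nFT:
  fixes f :: "'a::euclidean_space \<Rightarrow> complex"
  assumes [measurable]: "f \<in> borel_measurable borel"
  shows "sqnorm (nFT f) = ennreal (((2 * pi) powr (- real DIM('a) / 2))\<^sup>2) * sqnorm (FT f)"
  unfolding nFT_def[abs_def] by (subst sqnorm_cmult) auto

lemma nFT_const_cancel: "ennreal (((2 * pi) powr (- real n / 2))\<^sup>2) * (ennreal ((2 * pi) ^ n) * x) = x"
proof -
  have "ennreal (((2 * pi) powr (- real n / 2))\<^sup>2) * ennreal ((2 * pi) ^ n) = 1"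
    by (subst ennreal_mult[symmetric]) (simp, simp, simp only: nFT_const_sq ennreal_1)
  then show ?thesis by (simp only: mult.assoc[symmetric] mult_1_left)
qed

lemma ennreal_finite_of_le:
  assumes "a \<le> 2 * b + 2 * c" "b < \<infinity>" "c < (\<infinity>::ennreal)" shows "a < \<infinity>"
proof -
  have "2 * b + 2 * c < \<infinity>" using assms by (simp add: ennreal_mult_less_top)
  then show ?thesis using assms(1) by (rule le_less_trans[rotated])
qed

lemma sqnorm_nFT_le:
  fixes f :: "'a::euclidean_space \<Rightarrow> complex"
  assumes f: "integrable lborel f" shows "sqnorm (nFT f) \<le> sqnorm f"
proof -
  have [measurable]: "f \<in> borel_measurable borel" using f by auto
  have "sqnorm (nFT f) \<le> ennreal (((2 * pi) powr (- real DIM('a) / 2))\<^sup>2) * (ennreal ((2 * pi) ^ DIM('a)) * sqnorm f)"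
    by (subst sqnorm_nFT, measurable) (intro mult_left_mono sqnorm_FT_le f, simp)
  then show ?thesis by (simp only: nFT_const_cancel)
qed

lemma sqnorm_nFT_ge:
  fixes f :: "'a::euclidean_space \<Rightarrow> complex"
  assumes f: "integrable lborel f" and c: "continuous_on UNIV f" and b: "\<And>x. cmod (f x) \<le> B"
  shows "sqnorm f \<le> sqnorm (nFT f)"
proof -
  have [measurable]: "f \<in> borel_measurable borel" using f by auto
  have "ennreal (((2 * pi) powr (- real DIM('a) / 2))\<^sup>2) * (ennreal ((2 * pi) ^ DIM('a)) * sqnorm f) \<le> sqnorm (nFT f)"
    by (subst sqnorm_nFT, measurable) (intro mult_left_mono sqnorm_FT_ge[OF f c b], simp)
  then show ?thesis by (simp only: nFT_const_cancel)
qed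

lemma sqnorm_inFT_le:
  assumes f: "integrable lborel f" shows "sqnorm (inFT f) \<le> sqnorm f"
proof -
  have [measurable]: "f \<in> borel_measurable borel" using f by auto
  have "sqnorm (inFT f) = sqnorm (nFT f)"
    unfolding inFT_def[abs_def] by (rule sqnorm_uminus_arg) measurable
  then show ?thesis using sqnorm_nFT_le[OF f] by simp
qed

lemma FT_diff:
  assumes "integrable lborel f" "integrable lborel g"
  shows "FT (\<lambda>x. f x - g x) y = FT f y - FT g y"
  unfolding FT_def using assms
  by (simp add: right_diff_distrib integrable_cis_mult Bochner_Integration.integral_diff)

lemma nFT_diff:
  assumes "integrable lborel f" "integrable lborel g"
  shows "nFT (\<lambda>x. f x - g x) y = nFT f y - nFT g y"
  by (simp add: nFT_def FT_diff[OF assms] right_diff_distrib)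

lemma inFT_diff:
  assumes "integrable lborel f" "integrable lborel g"
  shows "inFT (\<lambda>x. f x - g x) y = inFT f y - inFT g y"
  by (simp add: inFT_def nFT_diff[OF assms])

lemma norm_nFT_le: "cmod (nFT (f :: 'a::euclidean_space \<Rightarrow> complex) y) \<le> (2 * pi) powr (- real DIM('a) / 2) * (LINT x|lborel. cmod (f x))"
  by (simp add: nFT_def norm_mult norm_FT_le mult_left_mono)

lemma norm_inFT_le: "cmod (inFT (f :: 'a::euclidean_space \<Rightarrow> complex) y) \<le> (2 * pi) powr (- real DIM('a) / 2) * (LINT x|lborel. cmod (f x))"
  unfolding inFT_def by (rule norm_nFT_le)

lemma emeasure_ball_finite: "emeasure lborel (ball (c::'a::euclidean_space) r) < \<infinity>"
  using emeasure_lborel_ball_finite by (auto simp: less_top)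

definition trunc_ball :: "nat \<Rightarrow> ('a::euclidean_space \<Rightarrow> complex) \<Rightarrow> 'a \<Rightarrow> complex" where
  "trunc_ball n f = (\<lambda>x. if x \<in> ball 0 (real n) then f x else 0)"

lemma trunc_ball_L2:
  fixes f :: "'a::euclidean_space \<Rightarrow> complex"
  assumes [measurable]: "f \<in> borel_measurable borel" and f: "sqnorm f < \<infinity>"
  shows "integrable lborel (trunc_ball n f)" and "trunc_ball n f \<in> borel_measurable borel"
    and "(\<lambda>n. sqnorm (\<lambda>x. f x - trunc_ball n f x)) \<longlonglongrightarrow> 0"
proof -
  show i: "integrable lborel (trunc_ball n f)" unfolding trunc_ball_def
    by (rule integrable_L2_truncation) (use f emeasure_ball_finite in auto)
  show "trunc_ball n f \<in> borel_measurable borel" using i by auto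
  have "eventually (\<lambda>n. x \<in> ball 0 (real n)) sequentially" for x :: 'a
    using eventually_gt_at_top[of "nat \<lceil>norm x\<rceil>"] by eventually_elim (auto, linarith)
  then show "(\<lambda>n. sqnorm (\<lambda>x. f x - trunc_ball n f x)) \<longlonglongrightarrow> 0"
    unfolding trunc_ball_def by (intro L2_truncation_tendsto f) auto
qed

text \<open>The counterpart of \<open>is_fourier_L2\<close> for Borel representatives and squared
  norms; \<open>is_fourier_L2_iff\<close> compares the two.\<close>

definition plancherel_pair :: "('a::euclidean_space \<Rightarrow> complex) \<Rightarrow> ('a \<Rightarrow> complex) \<Rightarrow> bool" where
  "plancherel_pair f g \<longleftrightarrow> f \<in> borel_measurable borel \<and> g \<in> borel_measurable borel \<and> sqnorm f < \<infinity> \<and> sqnorm g < \<infinity>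
     \<and> (\<lambda>n. sqnorm (\<lambda>y. nFT (trunc_ball n f) y - g y)) \<longlonglongrightarrow> 0"

lemma ennreal_2_plus: "0 \<le> a \<Longrightarrow> 0 \<le> b \<Longrightarrow> 2 * ennreal a + 2 * ennreal b = ennreal (2 * a + 2 * b)"
  by (subst ennreal_plus) (simp_all add: ennreal_mult')

text \<open>The truncations of f are Cauchy in L^2, \<open>sqnorm_nFT_le\<close> carries this over
  to their transforms, and completeness supplies the limit.\<close>

lemma plancherel_pair_exists:
  assumes f[measurable]: "f \<in> borel_measurable borel" and fin: "sqnorm f < \<infinity>"
  obtains g where "plancherel_pair f g"
proof -
  note [measurable] = trunc_ball_L2(2)[OF f fin]
  have lim: "(\<lambda>n. sqnorm (\<lambda>x. f x - trunc_ball n f x)) \<longlonglongrightarrow> 0" by (rule trunc_ball_L2(3)[OF f fin])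
  have "\<exists>N. \<forall>m\<ge>N. \<forall>n\<ge>N. sqnorm (\<lambda>x. nFT (trunc_ball m f) x - nFT (trunc_ball n f) x) \<le> ennreal e" if "0 < e" for e
  proof -
    have "eventually (\<lambda>n. sqnorm (\<lambda>x. f x - trunc_ball n f x) < ennreal (e / 4)) sequentially"
      using that lim by (intro order_tendstoD) auto
    then obtain N where N: "\<And>n. n \<ge> N \<Longrightarrow> sqnorm (\<lambda>x. f x - trunc_ball n f x) < ennreal (e / 4)"
      by (auto simp: eventually_sequentially)
    have "sqnorm (\<lambda>x. nFT (trunc_ball m f) x - nFT (trunc_ball n f) x) \<le> ennreal e" if mn: "m \<ge> N" "n \<ge> N" for m n
    proof -
      have "sqnorm (\<lambda>x. nFT (trunc_ball m f) x - nFT (trunc_ball n f) x) = sqnorm (nFT (\<lambda>x. trunc_ball m f x - trunc_ball n f x))"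
        by (simp add: nFT_diff[OF trunc_ball_L2(1)[OF f fin] trunc_ball_L2(1)[OF f fin], abs_def])
      also have "\<dots> \<le> sqnorm (\<lambda>x. trunc_ball m f x - trunc_ball n f x)"
        by (intro sqnorm_nFT_le Bochner_Integration.integrable_diff trunc_ball_L2(1)[OF f fin])
      also have "\<dots> \<le> 2 * sqnorm (\<lambda>x. trunc_ball m f x - f x) + 2 * sqnorm (\<lambda>x. f x - trunc_ball n f x)"
        by (rule sqnorm_diff_triangle) measurable
      also have "\<dots> \<le> 2 * ennreal (e / 4) + 2 * ennreal (e / 4)"
        using N[OF mn(1)] N[OF mn(2)] by (intro add_mono mult_left_mono) (auto simp: sqnorm_minus_commute[of "trunc_ball m f"])
      also have "\<dots> = ennreal e" using \<open>0 < e\<close> by (subst ennreal_2_plus) auto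
      finally show ?thesis .
    qed
    then show ?thesis by blast
  qed
  then obtain g where g[measurable]: "g \<in> borel_measurable borel" and gl: "(\<lambda>n. sqnorm (\<lambda>y. nFT (trunc_ball n f) y - g y)) \<longlonglongrightarrow> 0"
    by (rule L2_complete[rotated]) measurable
  have "eventually (\<lambda>n. sqnorm (\<lambda>y. nFT (trunc_ball n f) y - g y) < 1 \<and> sqnorm (\<lambda>x. f x - trunc_ball n f x) < 1) sequentially"
    using gl lim by (intro eventually_conj order_tendstoD) auto
  then obtain n where n: "sqnorm (\<lambda>y. nFT (trunc_ball n f) y - g y) < 1" "sqnorm (\<lambda>x. f x - trunc_ball n f x) < 1"
    by (auto simp: eventually_sequentially)
  have g1: "sqnorm g \<le> 2 * sqnorm (\<lambda>y. g y - nFT (trunc_ball n f) y) + 2 * sqnorm (nFT (trunc_ball n f))"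
    using sqnorm_add_le[of "\<lambda>y. g y - nFT (trunc_ball n f) y" "nFT (trunc_ball n f)"] by simp
  have g2: "sqnorm (nFT (trunc_ball n f)) \<le> sqnorm f"
    using sqnorm_nFT_le[OF trunc_ball_L2(1)[OF f fin]]
    by (rule order_trans) (auto simp: sqnorm_def trunc_ball_def intro!: nn_integral_mono)
  have "sqnorm g < \<infinity>"
  proof (rule ennreal_finite_of_le[OF g1])
    show "sqnorm (\<lambda>y. g y - nFT (trunc_ball n f) y) < \<infinity>"
      using n(1) by (subst sqnorm_minus_commute) (auto intro: order_less_trans)
    show "sqnorm (nFT (trunc_ball n f)) < \<infinity>" using g2 fin by (rule le_less_trans)
  qed
  then have "plancherel_pair f g" using gl fin f g by (simp add: plancherel_pair_def)
  then show ?thesis by (rule that)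
qed

text \<open>For nice functions the tail identity needs no inversion theorem: expanding the square, the cross
  term is computed by Fubini.\<close>

lemma inversion_tail_nice:
  fixes h :: "'a::euclidean_space \<Rightarrow> complex"
  assumes h: "integrable lborel h" and hc: "continuous_on UNIV h" and hb: "\<And>x. cmod (h x) \<le> B"
    and [measurable]: "S \<in> sets borel" and Sf: "emeasure lborel S < \<infinity>"
  shows "sqnorm (\<lambda>x. h x - inFT (\<lambda>y. if y \<in> S then nFT h y else 0) x) \<le> sqnorm (\<lambda>y. if y \<in> S then 0 else nFT h y)"
proof -
  have [measurable]: "h \<in> borel_measurable borel" using h by auto
  have B0: "0 \<le> B" using order_trans[OF norm_ge_zero hb] .
  define c where "c = (2 * pi) powr (- real DIM('a) / 2)"
  define k where "k = (\<lambda>y. if y \<in> S then nFT h y else 0)"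
  define G where "G = inFT k"
  have h2: "integrable lborel (\<lambda>x. (cmod (h x))\<^sup>2)"
    by (rule Bochner_Integration.integrable_bound[OF integrable_mult_right[OF integrable_norm[OF h], of B]])
       (use hb B0 in \<open>auto simp: power2_eq_square intro!: mult_right_mono\<close>)
  have hfin: "sqnorm h < \<infinity>" unfolding sqnorm_def by (subst nn_integral_eq_integral[OF h2]) auto
  have nfin: "sqnorm (nFT h) < \<infinity>" using sqnorm_nFT_le[OF h] hfin by (rule le_less_trans)
  have k: "integrable lborel k" unfolding k_def by (rule integrable_L2_truncation) (use nfin Sf in auto)
  have [measurable]: "k \<in> borel_measurable borel" using k by auto
  have [measurable]: "G \<in> borel_measurable borel" unfolding G_def by measurable
  have Gfin: "sqnorm G \<le> sqnorm k" unfolding G_def by (rule sqnorm_inFT_le[OF k])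
  have kle: "sqnorm k \<le> sqnorm (nFT h)" unfolding sqnorm_def k_def by (intro nn_integral_mono) auto
  have sqr: "integrable lborel (\<lambda>x. (cmod (u x))\<^sup>2)" if "u \<in> borel_measurable borel" "sqnorm u < \<infinity>" for u :: "'a \<Rightarrow> complex"
    using that unfolding integrable_iff_bounded sqnorm_def by auto
  have sqe: "sqnorm u = ennreal (LINT x|lborel. (cmod (u x))\<^sup>2)" if "u \<in> borel_measurable borel" "sqnorm u < \<infinity>" for u :: "'a \<Rightarrow> complex"
    unfolding sqnorm_def by (intro nn_integral_eq_integral sqr that) auto
  have kfin: "sqnorm k < \<infinity>" using kle nfin by (rule le_less_trans)
  have Gf: "sqnorm G < \<infinity>" using Gfin kfin by (rule le_less_trans)
  have k2: "integrable lborel (\<lambda>x. (cmod (k x))\<^sup>2)" by (rule sqr[OF _ kfin]) measurable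
  have G2: "integrable lborel (\<lambda>x. (cmod (G x))\<^sup>2)" by (rule sqr[OF _ Gf]) measurable
  have n2: "integrable lborel (\<lambda>x. (cmod (nFT h x))\<^sup>2)" by (rule sqr[OF _ nfin]) measurable
  have hGi: "integrable lborel (\<lambda>x. cnj (h x) * G x)"
  proof (rule Bochner_Integration.integrable_bound[OF integrable_mult_right[OF integrable_norm[OF h], of "c * (LINT x|lborel. cmod (k x))"]])
    show "AE x in lborel. cmod (cnj (h x) * G x) \<le> norm (c * (LINT x|lborel. cmod (k x)) * norm (h x))"
      unfolding G_def c_def using norm_inFT_le[of k] by (intro AE_I2) (auto simp: norm_mult abs_mult mult.commute[of "cmod (h _)"] intro!: mult_right_mono order_trans[OF norm_inFT_le])
  qed measurable
  \<comment> \<open>By Fubini the pairing of h with the inverse transform of \<open>k\<close> is the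
    pairing of \<open>nFT h\<close> with \<open>k\<close>. The two agree on S, so the cross term is
    the squared norm of \<open>k\<close>.\<close>
  have cross: "(LINT x|lborel. cnj (h x) * G x) = of_real (LINT y|lborel. (cmod (k y))\<^sup>2)"
  proof -
    have ip: "integrable (lborel \<Otimes>\<^sub>M lborel) (\<lambda>(x, y). cis (x \<bullet> y) * (cnj (h x) * k y))"
      using integrable_cis_mult[OF integrable_pair_mult[OF sigma_finite_lborel sigma_finite_lborel, of "\<lambda>x. cnj (h x)" k], of "\<lambda>p. fst p \<bullet> snd p"] h k
      by (simp add: split_beta')
    have "(LINT x|lborel. cnj (h x) * G x) = (LINT x|lborel. of_real c * (LINT y|lborel. cis (x \<bullet> y) * (cnj (h x) * k y)))"
      by (intro Bochner_Integration.integral_cong refl)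
         (simp add: G_def inFT_def nFT_def FT_def c_def integral_mult_right_zero[symmetric] ac_simps inner_commute del: integral_mult_right_zero)
    also have "\<dots> = of_real c * (LINT x|lborel. (LINT y|lborel. cis (x \<bullet> y) * (cnj (h x) * k y)))"
      by (rule integral_mult_right_zero)
    also have "(LINT x|lborel. (LINT y|lborel. cis (x \<bullet> y) * (cnj (h x) * k y))) = (LINT y|lborel. (LINT x|lborel. cis (x \<bullet> y) * (cnj (h x) * k y)))"
      by (rule lborel_pair.Fubini_integral[symmetric]) (rule ip)
    also have "of_real c * \<dots> = (LINT y|lborel. of_real c * (LINT x|lborel. cis (x \<bullet> y) * (cnj (h x) * k y)))"
      by (rule integral_mult_right_zero[symmetric])
    also have "\<dots> = (LINT y|lborel. complex_of_real ((cmod (k y))\<^sup>2))"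
    proof (intro Bochner_Integration.integral_cong refl)
      fix y
      have "(LINT x|lborel. cis (x \<bullet> y) * (cnj (h x) * k y)) = (LINT x|lborel. cnj (cis (- (x \<bullet> y)) * h x)) * k y"
        by (subst integral_mult_left_zero[symmetric]) (simp add: cis_cnj mult.assoc)
      also have "\<dots> = cnj (FT h y) * k y" by (simp only: Bochner_Integration.integral_cnj FT_def)
      finally have "of_real c * (LINT x|lborel. cis (x \<bullet> y) * (cnj (h x) * k y)) = k y * cnj (nFT h y)"
        by (simp add: nFT_def c_def)
      then show "of_real c * (LINT x|lborel. cis (x \<bullet> y) * (cnj (h x) * k y)) = complex_of_real ((cmod (k y))\<^sup>2)"
        by (simp only: complex_norm_square k_def) auto
    qed
    finally show ?thesis by (simp only: integral_complex_of_real)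
  qed
  define w where "w x = Re (cnj (h x) * G x)" for x
  have w: "integrable lborel w" unfolding w_def[abs_def] by (rule integrable_Re[OF hGi])
  have exp: "(cmod (h x - G x))\<^sup>2 = (cmod (h x))\<^sup>2 - 2 * w x + (cmod (G x))\<^sup>2" for x
    by (simp add: cmod_power2 w_def) (simp add: power2_eq_square algebra_simps)
  have "(LINT x|lborel. (cmod (h x - G x))\<^sup>2) = (LINT x|lborel. (cmod (h x))\<^sup>2) - 2 * (LINT x|lborel. w x) + (LINT x|lborel. (cmod (G x))\<^sup>2)"
    unfolding exp using h2 G2 w by simp
  also have "(LINT x|lborel. w x) = (LINT y|lborel. (cmod (k y))\<^sup>2)"
    unfolding w_def integral_Re[OF hGi] cross by simp
  \<comment> \<open>The two Plancherel inequalities are used in opposite directions: the upper one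
    for the inverse transform \<open>G\<close>, the lower one for h, which is why h is continuous
    and bounded.\<close>
  also have "(LINT x|lborel. (cmod (h x))\<^sup>2) - 2 * (LINT y|lborel. (cmod (k y))\<^sup>2) + (LINT x|lborel. (cmod (G x))\<^sup>2)
      \<le> (LINT y|lborel. (cmod (nFT h y))\<^sup>2) - (LINT y|lborel. (cmod (k y))\<^sup>2)"
  proof -
    have "(LINT x|lborel. (cmod (G x))\<^sup>2) \<le> (LINT y|lborel. (cmod (k y))\<^sup>2)"
      using Gfin sqe[OF _ kfin] sqe[OF _ Gf] by (simp add: ennreal_le_iff)
    moreover have "(LINT x|lborel. (cmod (h x))\<^sup>2) \<le> (LINT y|lborel. (cmod (nFT h y))\<^sup>2)"
      using sqnorm_nFT_ge[OF h hc hb] sqe[OF _ hfin] sqe[OF _ nfin] by (simp add: ennreal_le_iff)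
    ultimately show ?thesis by simp
  qed
  also have "\<dots> = (LINT y|lborel. (cmod (if y \<in> S then 0 else nFT h y))\<^sup>2)"
    by (subst Bochner_Integration.integral_diff[OF n2 k2, symmetric]) (auto simp: k_def intro!: Bochner_Integration.integral_cong)
  finally have le: "(LINT x|lborel. (cmod (h x - G x))\<^sup>2) \<le> (LINT y|lborel. (cmod (if y \<in> S then 0 else nFT h y))\<^sup>2)" .
  have f1: "sqnorm (\<lambda>x. h x - G x) < \<infinity>"
    using sqnorm_add_le[of h "\<lambda>x. - G x"] hfin Gf
    by (auto simp: sqnorm_def ennreal_mult_less_top intro: le_less_trans)
  have f2: "sqnorm (\<lambda>y. if y \<in> S then 0 else nFT h y) < \<infinity>"
    using nfin by (rule le_less_trans[rotated]) (auto simp: sqnorm_def intro!: nn_integral_mono)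
  show ?thesis
    unfolding k_def[symmetric] G_def[symmetric]
    by (subst sqe[OF _ f1], measurable, subst sqe[OF _ f2], measurable) (intro ennreal_leI le)
qed

text \<open>f is replaced by a nice h, whose transform is close to g because the Plancherel bound
  applies to the difference of h and a truncation of f. The tail passes through the inequality for
  squares of sums in \<open>c3\<close>, \<open>c4\<close> and \<open>b1\<close> and collects 2^3 =
  8; everything else is a multiple of e.\<close>

lemma inversion_tail:
  fixes f :: "'a::euclidean_space \<Rightarrow> complex"
  assumes fg: "plancherel_pair f g"
    and S[measurable]: "S \<in> sets borel" and Sf: "emeasure lborel S < \<infinity>"
  shows "sqnorm (\<lambda>x. f x - inFT (\<lambda>y. if y \<in> S then g y else 0) x) \<le> 8 * sqnorm (\<lambda>y. if y \<in> S then 0 else g y)"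
proof -
  have [measurable]: "f \<in> borel_measurable borel" "g \<in> borel_measurable borel" and ff: "sqnorm f < \<infinity>" and gf: "sqnorm g < \<infinity>"
    and lim: "(\<lambda>n. sqnorm (\<lambda>y. nFT (trunc_ball n f) y - g y)) \<longlonglongrightarrow> 0"
    using fg by (auto simp: plancherel_pair_def)
  note [measurable] = trunc_ball_L2(2)[OF _ ff]
  have gi: "integrable lborel (\<lambda>y. if y \<in> S then g y else 0)"
    by (rule integrable_L2_truncation) (use gf Sf in auto)
  have main: "sqnorm (\<lambda>x. f x - inFT (\<lambda>y. if y \<in> S then g y else 0) x) \<le> 8 * sqnorm (\<lambda>y. if y \<in> S then 0 else g y) + ennreal (124 * e)"
    if e: "0 < e" for e
  proof -
    obtain h B where hc: "continuous_on UNIV h" and h: "integrable lborel h" and hb: "\<And>x. cmod (h x) \<le> B"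
      and fh: "sqnorm (\<lambda>x. f x - h x) \<le> ennreal e"
      by (rule L2_approx[of f e]) (use ff e in auto)
    have [measurable]: "h \<in> borel_measurable borel" using h by auto
    have "eventually (\<lambda>n. sqnorm (\<lambda>y. nFT (trunc_ball n f) y - g y) < ennreal e \<and> sqnorm (\<lambda>x. f x - trunc_ball n f x) < ennreal e) sequentially"
      using lim trunc_ball_L2(3)[OF _ ff] e by (intro eventually_conj order_tendstoD) auto
    then obtain n where n: "sqnorm (\<lambda>y. nFT (trunc_ball n f) y - g y) < ennreal e" "sqnorm (\<lambda>x. f x - trunc_ball n f x) < ennreal e"
      by (auto simp: eventually_sequentially)
    have ti: "integrable lborel (trunc_ball n f)" by (rule trunc_ball_L2(1)[OF _ ff]) measurable
    have "sqnorm (\<lambda>y. nFT h y - nFT (trunc_ball n f) y) = sqnorm (nFT (\<lambda>x. h x - trunc_ball n f x))"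
      by (simp add: nFT_diff[OF h ti, abs_def])
    also have "\<dots> \<le> sqnorm (\<lambda>x. h x - trunc_ball n f x)" by (intro sqnorm_nFT_le Bochner_Integration.integrable_diff h ti)
    also have "\<dots> \<le> 2 * sqnorm (\<lambda>x. h x - f x) + 2 * sqnorm (\<lambda>x. f x - trunc_ball n f x)" by (rule sqnorm_diff_triangle) measurable
    also have "\<dots> \<le> 2 * ennreal e + 2 * ennreal e" using fh n(2) by (intro add_mono mult_left_mono) (auto simp: sqnorm_minus_commute[of h])
    also have "\<dots> = ennreal (4 * e)" using e by (subst ennreal_2_plus) auto
    finally have a1: "sqnorm (\<lambda>y. nFT h y - nFT (trunc_ball n f) y) \<le> ennreal (4 * e)" .
    have "sqnorm (\<lambda>y. nFT h y - g y) \<le> 2 * sqnorm (\<lambda>y. nFT h y - nFT (trunc_ball n f) y) + 2 * sqnorm (\<lambda>y. nFT (trunc_ball n f) y - g y)"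
      by (rule sqnorm_diff_triangle) measurable
    also have "\<dots> \<le> 2 * ennreal (4 * e) + 2 * ennreal e" using a1 n(1) by (intro add_mono mult_left_mono) auto
    also have "\<dots> = ennreal (10 * e)" using e by (subst ennreal_2_plus) auto
    finally have a2: "sqnorm (\<lambda>y. nFT h y - g y) \<le> ennreal (10 * e)" .
    have hfin: "sqnorm (nFT h) < \<infinity>"
    proof -
      have "sqnorm (nFT h) \<le> 2 * sqnorm (\<lambda>y. nFT h y - g y) + 2 * sqnorm g"
        using sqnorm_add_le[of "\<lambda>y. nFT h y - g y" g] by simp
      then show ?thesis by (rule ennreal_finite_of_le) (use a2 gf in \<open>auto intro: le_less_trans\<close>)
    qed
    define k where "k = (\<lambda>y. if y \<in> S then nFT h y else 0)"
    have ki: "integrable lborel k" unfolding k_def by (rule integrable_L2_truncation) (use hfin Sf in auto)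
    have [measurable]: "k \<in> borel_measurable borel" using ki by auto
    have b1: "sqnorm (\<lambda>x. h x - inFT k x) \<le> 2 * ennreal (10 * e) + 2 * sqnorm (\<lambda>y. if y \<in> S then 0 else g y)"
    proof -
      have "sqnorm (\<lambda>x. h x - inFT k x) \<le> sqnorm (\<lambda>y. if y \<in> S then 0 else nFT h y)"
        unfolding k_def by (rule inversion_tail_nice[OF h hc hb]) (use Sf in auto)
      also have "\<dots> = sqnorm (\<lambda>y. (if y \<in> S then 0 else nFT h y - g y) + (if y \<in> S then 0 else g y))"
        unfolding sqnorm_def by (intro nn_integral_cong) auto
      also have "\<dots> \<le> 2 * sqnorm (\<lambda>y. (if y \<in> S then 0 else nFT h y - g y)) + 2 * sqnorm (\<lambda>y. if y \<in> S then 0 else g y)"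
        by (rule sqnorm_add_le) measurable
      finally have c1: "sqnorm (\<lambda>x. h x - inFT k x) \<le> 2 * sqnorm (\<lambda>y. (if y \<in> S then 0 else nFT h y - g y)) + 2 * sqnorm (\<lambda>y. if y \<in> S then 0 else g y)" .
      have c2: "sqnorm (\<lambda>y. (if y \<in> S then 0 else nFT h y - g y)) \<le> sqnorm (\<lambda>y. nFT h y - g y)"
        unfolding sqnorm_def by (intro nn_integral_mono) auto
      show ?thesis by (rule order_trans[OF c1]) (intro add_right_mono mult_left_mono order_trans[OF c2 a2], simp)
    qed
    have b2: "sqnorm (\<lambda>x. inFT k x - inFT (\<lambda>y. if y \<in> S then g y else 0) x) \<le> ennreal (10 * e)"
    proof -
      have "sqnorm (\<lambda>x. inFT k x - inFT (\<lambda>y. if y \<in> S then g y else 0) x) = sqnorm (inFT (\<lambda>y. k y - (if y \<in> S then g y else 0)))"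
        by (simp add: inFT_diff[OF ki gi, abs_def])
      also have "\<dots> \<le> sqnorm (\<lambda>y. k y - (if y \<in> S then g y else 0))" by (intro sqnorm_inFT_le Bochner_Integration.integrable_diff ki gi)
      also have "\<dots> \<le> sqnorm (\<lambda>y. nFT h y - g y)" unfolding sqnorm_def k_def by (intro nn_integral_mono) auto
      finally show ?thesis using a2 by simp
    qed
    have c3: "sqnorm (\<lambda>x. f x - inFT (\<lambda>y. if y \<in> S then g y else 0) x)
       \<le> 2 * sqnorm (\<lambda>x. f x - h x) + 2 * sqnorm (\<lambda>x. h x - inFT (\<lambda>y. if y \<in> S then g y else 0) x)"
      by (rule sqnorm_diff_triangle) measurable
    have c4: "sqnorm (\<lambda>x. h x - inFT (\<lambda>y. if y \<in> S then g y else 0) x)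
       \<le> 2 * sqnorm (\<lambda>x. h x - inFT k x) + 2 * sqnorm (\<lambda>x. inFT k x - inFT (\<lambda>y. if y \<in> S then g y else 0) x)"
      by (rule sqnorm_diff_triangle) measurable
    have "sqnorm (\<lambda>x. f x - inFT (\<lambda>y. if y \<in> S then g y else 0) x)
      \<le> 2 * ennreal e + 2 * (2 * (2 * ennreal (10 * e) + 2 * sqnorm (\<lambda>y. if y \<in> S then 0 else g y)) + 2 * ennreal (10 * e))"
      by (rule order_trans[OF c3], intro add_mono mult_left_mono fh order_trans[OF c4] b1 b2) auto
    also have "\<dots> = 8 * sqnorm (\<lambda>y. if y \<in> S then 0 else g y) + ennreal (122 * e)"
    proof -
      have m: "2 * ennreal x = ennreal (2 * x)" "8 * ennreal x = ennreal (8 * x)" for x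
        by (simp_all add: ennreal_mult')
      have "2 * ennreal e + 2 * (2 * (2 * ennreal (10 * e) + 2 * T) + 2 * ennreal (10 * e)) = 8 * T + ennreal (122 * e)" for T
        by (cases T) (use e in \<open>simp_all add: m ennreal_plus[symmetric] ennreal_mult_top del: ennreal_plus\<close>)
      then show ?thesis .
    qed
    also have "\<dots> \<le> 8 * sqnorm (\<lambda>y. if y \<in> S then 0 else g y) + ennreal (124 * e)" using e by (intro add_left_mono ennreal_leI) auto
    finally show ?thesis .
  qed
  show ?thesis
  proof (rule ennreal_le_epsilon)
    fix e :: real assume "0 < e"
    then show "sqnorm (\<lambda>x. f x - inFT (\<lambda>y. if y \<in> S then g y else 0) x) \<le> 8 * sqnorm (\<lambda>y. if y \<in> S then 0 else g y) + ennreal e"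
      using main[of "e / 124"] by simp
  qed
qed

section \<open>The dispersive estimate\<close>

abbreviation partial_at :: "(real^'n::finite \<Rightarrow> 'b::real_normed_vector) \<Rightarrow> 'n \<Rightarrow> real^'n \<Rightarrow> 'b \<Rightarrow> bool" where
  "partial_at f i x v \<equiv> ((\<lambda>s. f (x + s *\<^sub>R axis i 1)) has_vector_derivative v) (at 0)"

definition bdd_cont :: "'p set \<Rightarrow> (real^'n::finite) set \<Rightarrow> ('p \<Rightarrow> real^'n \<Rightarrow> complex) \<Rightarrow> bool" where
  "bdd_cont P S f \<longleftrightarrow> (\<exists>C. \<forall>p\<in>P. \<forall>x\<in>S. cmod (f p x) \<le> C) \<and> (\<forall>p\<in>P. continuous_on S (f p))"

text \<open>\<open>jet n P S f\<close>: the family \<open>f p\<close>, \<open>p \<in> P\<close>, has partial derivatives up to order \<open>n\<close> on \<open>S\<close>, all of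
  them continuous and bounded uniformly in \<open>p\<close>.\<close>

primrec jet :: "nat \<Rightarrow> 'p set \<Rightarrow> (real^'n::finite) set \<Rightarrow> ('p \<Rightarrow> real^'n \<Rightarrow> complex) \<Rightarrow> bool" where
  "jet 0 P S f = bdd_cont P S f"
| "jet (Suc n) P S f = (bdd_cont P S f \<and> (\<forall>i. \<exists>f'. jet n P S f' \<and> (\<forall>p\<in>P. \<forall>x\<in>S. partial_at (f p) i x (f' p x))))"

lemma jet_bdd_cont: "jet n P S f \<Longrightarrow> bdd_cont P S f"
  by (cases n) auto

lemma jet_pred: "jet (Suc n) P S f \<Longrightarrow> jet n P S f"
proof (induction n arbitrary: f)
  case (Suc n)
  then show ?case by (subst jet.simps(2)) (metis jet.simps(2))
qed simp

lemma jet_subset: "jet n P S f \<Longrightarrow> P' \<subseteq> P \<Longrightarrow> S' \<subseteq> S \<Longrightarrow> jet n P' S' f"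
proof (induction n arbitrary: f)
  case 0
  then show ?case unfolding jet.simps bdd_cont_def by (meson continuous_on_subset subsetD)
next
  case (Suc n)
  have "bdd_cont P' S' f" using Suc.prems unfolding jet.simps bdd_cont_def by (meson continuous_on_subset subsetD)
  moreover have "\<exists>f'. jet n P' S' f' \<and> (\<forall>p\<in>P'. \<forall>x\<in>S'. partial_at (f p) i x (f' p x))" for i
  proof -
    from Suc.prems obtain f' where "jet n P S f'" "\<forall>p\<in>P. \<forall>x\<in>S. partial_at (f p) i x (f' p x)" by (metis jet.simps(2))
    then show ?thesis using Suc.IH[of f'] Suc.prems by (intro exI[of _ f']) auto
  qed
  ultimately show ?case by simp
qed

lemma jet_reparam: "jet n P S f \<Longrightarrow> (\<And>q. q \<in> Q \<Longrightarrow> h q \<in> P) \<Longrightarrow> jet n Q S (\<lambda>q. f (h q))"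
proof (induction n arbitrary: f)
  case 0
  then show ?case unfolding jet.simps bdd_cont_def by meson
next
  case (Suc n)
  have "bdd_cont Q S (\<lambda>q. f (h q))" using Suc.prems unfolding jet.simps bdd_cont_def by meson
  moreover have "\<exists>f'. jet n Q S f' \<and> (\<forall>p\<in>Q. \<forall>x\<in>S. partial_at (f (h p)) i x (f' p x))" for i
  proof -
    from Suc.prems obtain f' where "jet n P S f'" "\<forall>p\<in>P. \<forall>x\<in>S. partial_at (f p) i x (f' p x)" by (metis jet.simps(2))
    then show ?thesis using Suc.IH[of f'] Suc.prems by (intro exI[of _ "\<lambda>q. f' (h q)"]) auto
  qed
  ultimately show ?case by simp
qed

lemma open_line: "open S \<Longrightarrow> open {s::real. x + s *\<^sub>R (v::'a::real_normed_vector) \<in> S}"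
  using open_vimage[of S "\<lambda>s. x + s *\<^sub>R v"] by (simp add: vimage_def continuous_intros)

lemma partial_at_cong:
  assumes "open S" "x \<in> S" "\<And>y. y \<in> S \<Longrightarrow> f y = g y" "partial_at f i x v"
  shows "partial_at g i x v"
  by (rule has_vector_derivative_transform_within_open[OF assms(4) open_line[OF assms(1)]]) (use assms in auto)

lemma bdd_cont_add:
  assumes "bdd_cont P S f" "bdd_cont P S g" shows "bdd_cont P S (\<lambda>p x. f p x + g p x)"
proof -
  obtain C D where "\<forall>p\<in>P. \<forall>x\<in>S. cmod (f p x) \<le> C" "\<forall>p\<in>P. \<forall>x\<in>S. cmod (g p x) \<le> D"
    using assms unfolding bdd_cont_def by auto
  then have "\<forall>p\<in>P. \<forall>x\<in>S. cmod (f p x + g p x) \<le> C + D" by (meson add_mono norm_triangle_le)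
  then show ?thesis using assms unfolding bdd_cont_def by (auto intro: continuous_intros)
qed

lemma bdd_cont_mult:
  assumes "bdd_cont P S f" "bdd_cont P S g" shows "bdd_cont P S (\<lambda>p x. f p x * g p x)"
proof -
  obtain C D where C: "\<forall>p\<in>P. \<forall>x\<in>S. cmod (f p x) \<le> C" and D: "\<forall>p\<in>P. \<forall>x\<in>S. cmod (g p x) \<le> D"
    using assms unfolding bdd_cont_def by auto
  have "cmod (f p x * g p x) \<le> C * D" if "p \<in> P" "x \<in> S" for p x
    unfolding norm_mult using C D that by (intro mult_mono) (auto intro: order_trans[OF norm_ge_zero])
  then show ?thesis using assms unfolding bdd_cont_def by (auto intro!: continuous_intros)
qed

lemma jet_add: "jet n P S f \<Longrightarrow> jet n P S g \<Longrightarrow> jet n P S (\<lambda>p x. f p x + g p x)"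
proof (induction n arbitrary: f g)
  case (Suc n)
  have "\<exists>h'. jet n P S h' \<and> (\<forall>p\<in>P. \<forall>x\<in>S. partial_at (\<lambda>x. f p x + g p x) i x (h' p x))" for i
  proof -
    from Suc.prems obtain f' g' where "jet n P S f'" "\<forall>p\<in>P. \<forall>x\<in>S. partial_at (f p) i x (f' p x)"
      "jet n P S g'" "\<forall>p\<in>P. \<forall>x\<in>S. partial_at (g p) i x (g' p x)" by (metis jet.simps(2))
    then show ?thesis using Suc.IH[of f' g'] by (intro exI[of _ "\<lambda>p x. f' p x + g' p x"]) (auto intro!: has_vector_derivative_add)
  qed
  then show ?case using Suc.prems by (auto intro: bdd_cont_add)
qed (auto intro: bdd_cont_add)

lemma jet_mult: "jet n P S f \<Longrightarrow> jet n P S g \<Longrightarrow> jet n P S (\<lambda>p x. f p x * g p x)"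
proof (induction n arbitrary: f g)
  case (Suc n)
  have "\<exists>h'. jet n P S h' \<and> (\<forall>p\<in>P. \<forall>x\<in>S. partial_at (\<lambda>x. f p x * g p x) i x (h' p x))" for i
  proof -
    from Suc.prems obtain f' g' where f': "jet n P S f'" "\<forall>p\<in>P. \<forall>x\<in>S. partial_at (f p) i x (f' p x)" and
      g': "jet n P S g'" "\<forall>p\<in>P. \<forall>x\<in>S. partial_at (g p) i x (g' p x)" by (metis jet.simps(2))
    have "jet n P S (\<lambda>p x. f p x * g' p x + f' p x * g p x)"
      using Suc.prems[THEN jet_pred] f' g' by (intro jet_add Suc.IH)
    moreover have "partial_at (\<lambda>x. f p x * g p x) i x (f p x * g' p x + f' p x * g p x)" if "p \<in> P" "x \<in> S" for p x
      using has_vector_derivative_mult[OF f'(2)[rule_format, OF that] g'(2)[rule_format, OF that]] by simp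
    ultimately show ?thesis by (intro exI[of _ "\<lambda>p x. f p x * g' p x + f' p x * g p x"]) auto
  qed
  then show ?case using Suc.prems by (auto intro: bdd_cont_mult)
qed (auto intro: bdd_cont_mult)

lemma jet_const: "jet n P S (\<lambda>p x. c)"
proof (induction n arbitrary: c)
  case (Suc n)
  have "\<exists>h'. jet n P S h' \<and> (\<forall>p\<in>P. \<forall>x\<in>S. partial_at (\<lambda>x. c) i x (h' p x))" for i
    by (intro exI[of _ "\<lambda>_ _. 0"]) (auto intro: Suc)
  then show ?case by (auto simp: bdd_cont_def intro: continuous_intros)
qed (auto simp: bdd_cont_def intro: continuous_intros)

lemma jet_sum: "finite I \<Longrightarrow> (\<And>i. i \<in> I \<Longrightarrow> jet n P S (f i)) \<Longrightarrow> jet n P S (\<lambda>p x. \<Sum>i\<in>I. f i p x)"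
  by (induction I rule: finite_induct) (auto intro: jet_const jet_add)

lemma bdd_cont_inverse:
  assumes "bdd_cont P S f" and c: "0 < c" "\<And>p x. p \<in> P \<Longrightarrow> x \<in> S \<Longrightarrow> c \<le> cmod (f p x)"
  shows "bdd_cont P S (\<lambda>p x. inverse (f p x))"
proof -
  have "\<forall>p\<in>P. \<forall>x\<in>S. cmod (inverse (f p x)) \<le> inverse c"
    using c by (auto simp: norm_inverse intro!: le_imp_inverse_le)
  moreover have "f p x \<noteq> 0" if "p \<in> P" "x \<in> S" for p x using c(1) c(2)[OF that] by auto
  ultimately show ?thesis using assms unfolding bdd_cont_def by (auto intro!: continuous_on_inverse)
qed

text \<open>The derivative -f' / f^2 involves 1 / f only to one order less, which the induction
  supplies; the lower bound c gives uniformity in p.\<close>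

lemma jet_inverse:
  assumes c: "0 < c" "\<And>p x. p \<in> P \<Longrightarrow> x \<in> S \<Longrightarrow> c \<le> cmod (f p x)"
  shows "jet n P S f \<Longrightarrow> jet n P S (\<lambda>p x. inverse (f p x))"
proof (induction n)
  case 0
  then show ?case using bdd_cont_inverse[OF _ c] by simp
next
  case (Suc n)
  have nz: "f p x \<noteq> 0" if "p \<in> P" "x \<in> S" for p x using c(1) c(2)[OF that] by auto
  have "\<exists>h'. jet n P S h' \<and> (\<forall>p\<in>P. \<forall>x\<in>S. partial_at (\<lambda>x. inverse (f p x)) i x (h' p x))" for i
  proof -
    from Suc.prems obtain f' where f': "jet n P S f'" "\<forall>p\<in>P. \<forall>x\<in>S. partial_at (f p) i x (f' p x)" by (metis jet.simps(2))
    have inv: "jet n P S (\<lambda>p x. inverse (f p x))" using Suc.IH jet_pred[OF Suc.prems] by simp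
    have "jet n P S (\<lambda>p x. f' p x * ((-1) * (inverse (f p x) * inverse (f p x))))"
      by (intro jet_mult jet_const f' inv)
    moreover have "partial_at (\<lambda>x. inverse (f p x)) i x (f' p x * ((-1) * (inverse (f p x) * inverse (f p x))))" if px: "p \<in> P" "x \<in> S" for p x
    proof -
      have "(inverse has_field_derivative (-1) * (inverse (f p x) * inverse (f p x))) (at (f p (x + 0 *\<^sub>R axis i 1)))"
        using nz[OF px] by (auto intro!: derivative_eq_intros simp: power2_eq_square)
      from field_vector_diff_chain_at[OF f'(2)[rule_format, OF px] this] show ?thesis by (simp add: o_def)
    qed
    ultimately show ?thesis by blast
  qed
  moreover have "bdd_cont P S (\<lambda>p x. inverse (f p x))" using Suc.prems bdd_cont_inverse[OF _ c] by auto
  ultimately show ?case by simp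
qed

section \<open>Integration by parts and nonstationary phase\<close>

lemma partial_at_shift:
  assumes "partial_at g i (x + s *\<^sub>R axis i 1) v"
  shows "((\<lambda>s. g (x + s *\<^sub>R axis i 1)) has_vector_derivative v) (at s)"
proof -
  have "((\<lambda>u. u - s) has_vector_derivative 1) (at s)" by (auto intro!: derivative_eq_intros)
  from vector_diff_chain_at[OF this, of "\<lambda>u. g ((x + s *\<^sub>R axis i 1) + u *\<^sub>R axis i 1)" v] assms
  show ?thesis by (simp add: o_def algebra_simps)
qed

lemma partial_increment_bound:
  assumes d: "\<And>y. partial_at g i y (g' y)" and C: "\<And>y. norm (g' y) \<le> C"
  shows "norm (g (x + s *\<^sub>R axis i 1) - g x) \<le> C * \<bar>s\<bar>"
proof -
  have "norm (g (x + s *\<^sub>R axis i 1) - g (x + 0 *\<^sub>R axis i 1)) \<le> C * norm (s - 0)"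
  proof (rule differentiable_bound[of UNIV _ "\<lambda>s h. h *\<^sub>R g' (x + s *\<^sub>R axis i 1)"])
    show "((\<lambda>s. g (x + s *\<^sub>R axis i 1)) has_derivative (\<lambda>h. h *\<^sub>R g' (x + u *\<^sub>R axis i 1))) (at u within UNIV)" for u
      using partial_at_shift[OF d[of "x + u *\<^sub>R axis i 1"]] by (simp add: has_vector_derivative_def)
    show "onorm (\<lambda>h. h *\<^sub>R g' (x + u *\<^sub>R axis i 1)) \<le> C" for u
      using C by (intro onorm_le) (simp add: mult.commute[of C] mult_left_mono)
  qed auto
  then show ?thesis by simp
qed

text \<open>Translation invariance makes the integral of every difference quotient of g zero. The
  quotients are bounded by C by the mean value inequality, and steps of length at most 1 keep their
  supports in the ball of radius R + 1, so dominated convergence passes to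
  \<open>g'\<close>.\<close>

lemma integral_partial_zero:
  fixes g :: "real^'n::finite \<Rightarrow> complex"
  assumes gc: "continuous_on UNIV g" and d: "\<And>x. partial_at g i x (g' x)" and C: "\<And>x. cmod (g' x) \<le> C"
    and supp: "\<And>x. R < norm x \<Longrightarrow> g x = 0"
  shows "integrable lborel g'" and "(LINT x|lborel. g' x) = 0"
proof -
  have C0: "0 \<le> C" using order_trans[OF norm_ge_zero C] .
  have gm[measurable]: "g \<in> borel_measurable borel" using gc by (rule borel_measurable_continuous_onI)
  have fin: "emeasure lborel (cball (0::real^'n) r) < \<infinity>" for r
    by (cases "0 \<le> r") (auto simp: emeasure_cball)
  have "compact (g ` cball 0 R)" by (intro compact_continuous_image continuous_on_subset[OF gc]) auto
  then obtain B where B: "\<And>x. x \<in> cball 0 R \<Longrightarrow> cmod (g x) \<le> B" by (meson bounded_iff compact_imp_bounded imageI)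
  have gi: "integrable lborel g"
  proof (rule Bochner_Integration.integrable_bound)
    show "integrable lborel (\<lambda>x. B * indicator (cball (0::real^'n) R) x)" using fin by (intro integrable_mult_right) auto
    show "AE x in lborel. cmod (g x) \<le> norm (B * indicator (cball (0::real^'n) R) x)"
    proof (rule AE_I2)
      fix x :: "real^'n"
      show "cmod (g x) \<le> norm (B * indicator (cball (0::real^'n) R) x)"
        using B[of x] supp[of x] by (cases "norm x \<le> R") (auto simp: indicator_def not_le)
    qed
  qed measurable
  define D where "D n x = of_real (real (Suc n)) * (g (x + (1 / real (Suc n)) *\<^sub>R axis i 1) - g x)" for n x
  have Dm: "D n \<in> borel_measurable borel" for n unfolding D_def[abs_def] by measurable
  have tr: "integrable lborel (\<lambda>x. g (x + v))" "(LINT x|lborel. g (x + v)) = (LINT x|lborel. g x)" for v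
    using integrable_affine_euclidean[OF gi, of 1 v] integral_affine_euclidean[OF gm, of 1 v] by (simp_all add: add.commute)
  have D0: "(LINT x|lborel. D n x) = 0" for n
    unfolding D_def by (subst integral_mult_right_zero, subst Bochner_Integration.integral_diff) (auto simp: tr gi)
  have lim: "(\<lambda>n. D n x) \<longlonglongrightarrow> g' x" for x
  proof -
    let ?f = "\<lambda>s. g (x + s *\<^sub>R axis i 1)"
    have l0: "((\<lambda>y. (?f y - ?f 0 - y *\<^sub>R g' x) /\<^sub>R norm y) \<longlongrightarrow> 0) (at 0)"
      using d[of x] unfolding has_vector_derivative_def has_derivative_def by simp
    have "filterlim (\<lambda>n. 1 / real (Suc n)) (at 0) sequentially"
      by (intro filterlim_atI LIMSEQ_Suc[OF lim_const_over_n[of 1]]) auto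
    from filterlim_compose[OF l0 this]
    have "(\<lambda>n. (?f (1 / real (Suc n)) - ?f 0 - (1 / real (Suc n)) *\<^sub>R g' x) /\<^sub>R norm (1 / real (Suc n))) \<longlonglongrightarrow> 0" .
    moreover have "(?f (1 / real (Suc n)) - ?f 0 - (1 / real (Suc n)) *\<^sub>R g' x) /\<^sub>R norm (1 / real (Suc n)) = D n x - g' x" for n
      by (simp add: D_def scaleR_conv_of_real field_simps del: of_nat_Suc)
    ultimately have "(\<lambda>n. D n x - g' x) \<longlonglongrightarrow> 0" by simp
    then show ?thesis by (simp add: LIM_zero_iff)
  qed
  have Db: "cmod (D n x) \<le> C * indicator (cball 0 (R + 1)) x" for n x
  proof -
    have "cmod (D n x) \<le> real (Suc n) * (C * \<bar>1 / real (Suc n)\<bar>)"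
      unfolding D_def norm_mult by (intro mult_mono partial_increment_bound[OF d C]) (auto simp del: of_nat_Suc)
    then have "cmod (D n x) \<le> C" by simp
    moreover have "D n x = 0" if "R + 1 < norm x"
    proof -
      have "norm x \<le> norm (x + (1 / real (Suc n)) *\<^sub>R axis i 1) + norm ((1 / real (Suc n)) *\<^sub>R axis i (1::real))"
        by (metis add_diff_cancel_right' norm_triangle_ineq4)
      also have "norm ((1 / real (Suc n)) *\<^sub>R axis i (1::real)) \<le> 1" by (simp add: norm_axis_1)
      finally have "R < norm (x + (1 / real (Suc n)) *\<^sub>R axis i 1)" using that by simp
      then show ?thesis using supp that by (simp add: D_def)
    qed
    ultimately show ?thesis using C0 by (auto simp: indicator_def not_le)
  qed
  have w: "integrable lborel (\<lambda>x. C * indicator (cball (0::real^'n) (R + 1)) x)" using fin by (intro integrable_mult_right) auto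
  have g'm: "g' \<in> borel_measurable lborel"
    by (rule borel_measurable_LIMSEQ_metric[where f=D]) (use Dm lim in auto)
  show "integrable lborel g'"
    using integrable_dominated_convergence[OF g'm _ w, of D] Dm lim Db by auto
  have "(\<lambda>n. LINT x|lborel. D n x) \<longlonglongrightarrow> (LINT x|lborel. g' x)"
    by (rule integral_dominated_convergence[OF g'm _ w]) (use Dm lim Db in auto)
  then show "(LINT x|lborel. g' x) = 0" by (simp add: D0 LIMSEQ_const_iff)
qed

text \<open>Each integration by parts along the field \<open>\<nabla>\<theta> / |\<nabla>\<theta>|\<^sup>2\<close> gains a factor \<open>1 / \<tau>\<close>.\<close>

lemma nonstationary_phase:
  fixes \<theta> :: "'p \<Rightarrow> real^'n::finite \<Rightarrow> real" and K S :: "(real^'n) set"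
  assumes S: "open S" "S \<subseteq> ball 0 1" and K: "closed K" "K \<subseteq> S"
    and tc: "\<And>p. p \<in> P \<Longrightarrow> continuous_on S (\<theta> p)"
    and td: "\<And>p x i. p \<in> P \<Longrightarrow> x \<in> S \<Longrightarrow> partial_at (\<theta> p) i x (\<theta>' i p x)"
    and tj: "\<And>n i. jet n P S (\<lambda>p x. of_real (\<theta>' i p x))"
    and c: "0 < c" "\<And>p x. p \<in> P \<Longrightarrow> x \<in> S \<Longrightarrow> c \<le> (\<Sum>i\<in>UNIV. (\<theta>' i p x)\<^sup>2)"
  shows "jet N P S b \<Longrightarrow> (\<And>p x. p \<in> P \<Longrightarrow> x \<in> S - K \<Longrightarrow> b p x = 0) \<Longrightarrow>
    \<exists>C\<ge>0. \<forall>p\<in>P. \<forall>\<tau>. \<tau> \<noteq> 0 \<longrightarrow>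
      integrable lborel (\<lambda>x. if x \<in> S then cis (\<tau> * \<theta> p x) * b p x else 0) \<and>
      cmod (LINT x|lborel. (if x \<in> S then cis (\<tau> * \<theta> p x) * b p x else 0)) \<le> C / \<bar>\<tau>\<bar> ^ N"
proof (induction N arbitrary: b)
  have [measurable]: "S \<in> sets borel" using S by auto
  have fin: "emeasure lborel S < \<infinity>"
    using emeasure_mono[OF S(2), of lborel] emeasure_ball_finite[of "0::real^'n" 1] by (auto intro: le_less_trans)
  have meas: "(\<lambda>x. if x \<in> S then f x else 0) \<in> borel_measurable borel" if "continuous_on S f" for f :: "real^'n \<Rightarrow> complex"
  proof -
    have "(\<lambda>x. indicator S x *\<^sub>R f x) \<in> borel_measurable borel"
      using that by (intro borel_measurable_continuous_on_indicator) auto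
    moreover have "(\<lambda>x. indicator S x *\<^sub>R f x) = (\<lambda>x. if x \<in> S then f x else 0)" by (auto simp: indicator_def)
    ultimately show ?thesis by simp
  qed
  have int: "integrable lborel (\<lambda>x. if x \<in> S then cis (\<tau> * \<theta> p x) * b p x else 0)"
    and bound: "cmod (LINT x|lborel. (if x \<in> S then cis (\<tau> * \<theta> p x) * b p x else 0)) \<le> C * measure lborel S"
    if b: "continuous_on S (b p)" "\<forall>x\<in>S. cmod (b p x) \<le> C" and p: "p \<in> P" for b p \<tau> and C :: real
  proof -
    have "continuous_on S (\<lambda>x. cis (\<tau> * \<theta> p x) * b p x)" using b tc[OF p] by (intro continuous_intros)
    note m = meas[OF this]
    have w: "integrable lborel (\<lambda>x. C * indicator S x)" using fin by (intro integrable_mult_right) auto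
    have le: "cmod (if x \<in> S then cis (\<tau> * \<theta> p x) * b p x else 0) \<le> C * indicator S x" for x
      using b by (auto simp: norm_mult)
    show "integrable lborel (\<lambda>x. if x \<in> S then cis (\<tau> * \<theta> p x) * b p x else 0)"
    proof (rule Bochner_Integration.integrable_bound[OF w])
      show "AE x in lborel. cmod (if x \<in> S then cis (\<tau> * \<theta> p x) * b p x else 0) \<le> norm (C * indicator S x)"
        unfolding real_norm_def by (intro AE_I2 order_trans[OF le abs_ge_self])
    qed (use m in simp)
    then show "cmod (LINT x|lborel. (if x \<in> S then cis (\<tau> * \<theta> p x) * b p x else 0)) \<le> C * measure lborel S"
      using Bochner_Integration.integral_norm_bound_integral[OF _ w le] by simp
  qed
  {
    case (0 b)
    then obtain C where C: "\<forall>p\<in>P. \<forall>x\<in>S. cmod (b p x) \<le> C" and bc: "\<forall>p\<in>P. continuous_on S (b p)" by (auto simp: bdd_cont_def)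
    have "\<forall>p\<in>P. \<forall>x\<in>S. cmod (b p x) \<le> max C 0" using C by (meson max.coboundedI1)
    then show ?case
      using bc by (intro exI[of _ "max C 0 * measure lborel S"]) (auto intro!: int[of b _ "max C 0"] bound)
  next
    case (Suc N b)
    define q where "q p x = (\<Sum>i\<in>UNIV. complex_of_real (\<theta>' i p x) * complex_of_real (\<theta>' i p x))" for p x
    have q: "q p x = of_real (\<Sum>i\<in>UNIV. (\<theta>' i p x)\<^sup>2)" for p x by (simp add: q_def power2_eq_square)
    have qc: "c \<le> cmod (q p x)" if "p \<in> P" "x \<in> S" for p x
      unfolding q norm_of_real using c(2)[OF that] by simp
    have jq: "jet n P S (\<lambda>p x. inverse (q p x))" for n
      by (rule jet_inverse[OF c(1) qc]) (auto simp: q_def intro!: jet_sum jet_mult tj)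
    \<comment> \<open>This field pairs to 1 with the gradient of the phase, so the divergence of
      cis(\<tau> \<theta>) b u is cis(\<tau> \<theta>) (i \<tau> b + div (b u)). As its integral
      vanishes, b is traded for div (b u) with a gain of 1 / |\<tau>|.\<close>
    define u where "u i p x = of_real (\<theta>' i p x) * inverse (q p x)" for i p x
    have ju: "jet n P S (u i)" for n i unfolding u_def[abs_def] by (intro jet_mult tj jq)
    have u1: "(\<Sum>i\<in>UNIV. of_real (\<theta>' i p x) * u i p x) = 1" if "p \<in> P" "x \<in> S" for p x
    proof -
      have "q p x \<noteq> 0" using qc[OF that] c(1) by auto
      moreover have "(\<Sum>i\<in>UNIV. of_real (\<theta>' i p x) * u i p x) = q p x * inverse (q p x)"
        unfolding u_def q_def by (simp add: sum_distrib_right mult.assoc)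
      ultimately show ?thesis by simp
    qed
    define v where "v i p x = b p x * u i p x" for i p x
    have jv: "jet (Suc N) P S (v i)" for i unfolding v_def[abs_def] by (intro jet_mult ju Suc(2))
    then have "\<forall>i. \<exists>v'. jet N P S v' \<and> (\<forall>p\<in>P. \<forall>x\<in>S. partial_at (v i p) i x (v' p x))" by (metis jet.simps(2))
    then obtain v' where v': "\<And>i. jet N P S (v' i)" "\<And>i p x. p \<in> P \<Longrightarrow> x \<in> S \<Longrightarrow> partial_at (v i p) i x (v' i p x)" by metis
    have v0: "v i p x = 0" if "p \<in> P" "x \<in> S - K" for i p x using Suc(3)[OF that] by (simp add: v_def)
    \<comment> \<open>\<open>S - K\<close> is open, so vanishing there passes to derivatives; the
      new amplitude \<open>B\<close> = div (b u) again satisfies the hypotheses of the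
      induction.\<close>
    have v'0: "v' i p x = 0" if px: "p \<in> P" "x \<in> S - K" for i p x
    proof -
      have "partial_at (\<lambda>x. 0) i x (v' i p x)"
        by (rule partial_at_cong[of "S - K" _ "v i p"]) (use S K px v0 v'(2) in \<open>auto intro: open_Diff\<close>)
      then show ?thesis using vector_derivative_unique_at[OF _ has_vector_derivative_const] by blast
    qed
    define B where "B p x = (\<Sum>i\<in>UNIV. v' i p x)" for p x
    have jB: "jet N P S B" unfolding B_def[abs_def] by (intro jet_sum v') auto
    have B0: "B p x = 0" if "p \<in> P" "x \<in> S - K" for p x using v'0[OF that] by (simp add: B_def)
    obtain C where C0: "0 \<le> C" and C: "\<And>p \<tau>. p \<in> P \<Longrightarrow> \<tau> \<noteq> 0 \<Longrightarrow> integrable lborel (\<lambda>x. if x \<in> S then cis (\<tau> * \<theta> p x) * B p x else 0)"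
      "\<And>p \<tau>. p \<in> P \<Longrightarrow> \<tau> \<noteq> 0 \<Longrightarrow> cmod (LINT x|lborel. (if x \<in> S then cis (\<tau> * \<theta> p x) * B p x else 0)) \<le> C / \<bar>\<tau>\<bar> ^ N"
      using Suc(1)[OF jB B0] by blast
    have "integrable lborel (\<lambda>x. if x \<in> S then cis (\<tau> * \<theta> p x) * b p x else 0) \<and>
      cmod (LINT x|lborel. (if x \<in> S then cis (\<tau> * \<theta> p x) * b p x else 0)) \<le> C / \<bar>\<tau>\<bar> ^ Suc N"
      if p: "p \<in> P" and t: "\<tau> \<noteq> 0" for p \<tau>
    proof
      obtain Cb where Cb: "\<forall>x\<in>S. cmod (b p x) \<le> Cb" and bc: "continuous_on S (b p)"
        using jet_bdd_cont[OF Suc(2)] p by (auto simp: bdd_cont_def)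
      show ib: "integrable lborel (\<lambda>x. if x \<in> S then cis (\<tau> * \<theta> p x) * b p x else 0)" by (rule int[of b p Cb]) (use bc Cb p in auto)
      \<comment> \<open>Extended by 0, this is continuous and has its partial derivative everywhere,
        since it vanishes off the closed set K and the open sets S and -K cover the space.\<close>
      define g where "g i x = (if x \<in> S then cis (\<tau> * \<theta> p x) * v i p x else 0)" for i x
      define g' where "g' i x = (if x \<in> S then cis (\<tau> * \<theta> p x) * (\<i> * of_real (\<tau> * \<theta>' i p x) * v i p x + v' i p x) else 0)" for i x
      have gK: "g i x = 0" if "x \<in> - K" for i x using v0[OF p, of x i] that by (auto simp: g_def)
      have U: "S \<union> - K = UNIV" using K by auto
      have vc: "continuous_on S (v i p)" for i using jet_bdd_cont[OF jv[of i]] p by (auto simp: bdd_cont_def)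
      have gc: "continuous_on UNIV (g i)" for i
        unfolding U[symmetric]
      proof (rule continuous_on_open_Un)
        have "continuous_on S (\<lambda>x. cis (\<tau> * \<theta> p x) * v i p x)" using vc tc[OF p] by (intro continuous_intros)
        then show "continuous_on S (g i)" by (rule continuous_on_eq) (simp add: g_def)
        show "continuous_on (- K) (g i)" by (rule continuous_on_eq[OF continuous_on_const[of _ 0]]) (use gK in auto)
      qed (use S K in auto)
      have gd: "partial_at (g i) i x (g' i x)" for i x
      proof (cases "x \<in> S")
        case True
        have "((\<lambda>s. cis (\<tau> * s)) has_vector_derivative (\<i> * of_real \<tau> * cis (\<tau> * s))) (at s)" for s
        proof -
          have "((\<lambda>z. exp (\<i> * of_real \<tau> * z)) has_field_derivative \<i> * of_real \<tau> * exp (\<i> * of_real \<tau> * of_real s)) (at (of_real s))"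
            by (auto intro!: derivative_eq_intros)
          from has_vector_derivative_real_field[OF this, of UNIV] show ?thesis
            by (simp add: cis_conv_exp mult.assoc)
        qed
        from vector_diff_chain_at[OF td[OF p True] this[of "\<theta> p (x + 0 *\<^sub>R axis i 1)"]]
        have "partial_at (\<lambda>x. cis (\<tau> * \<theta> p x)) i x (\<theta>' i p x *\<^sub>R (\<i> * of_real \<tau> * cis (\<tau> * \<theta> p x)))" by (simp add: o_def)
        from has_vector_derivative_mult[OF this v'(2)[OF p True]]
        have "partial_at (\<lambda>x. cis (\<tau> * \<theta> p x) * v i p x) i x (g' i x)"
          using True by (simp add: g'_def scaleR_conv_of_real algebra_simps)
        then show ?thesis by (rule partial_at_cong[OF S(1) True, rotated]) (simp add: g_def)
      next
        case False
        have "partial_at (\<lambda>x. 0) i x (g' i x)" using False by (simp add: g'_def)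
        then show ?thesis by (rule partial_at_cong[of "- K", rotated -1]) (use K False gK in auto)
      qed
      have gb: "\<exists>C. \<forall>x. cmod (g' i x) \<le> C" for i
      proof -
        obtain C1 C2 C3 where "\<forall>x\<in>S. cmod (of_real (\<theta>' i p x)) \<le> C1" "\<forall>x\<in>S. cmod (v i p x) \<le> C2" "\<forall>x\<in>S. cmod (v' i p x) \<le> C3"
          using jet_bdd_cont[OF tj[of 0 i]] jet_bdd_cont[OF jv[of i]] jet_bdd_cont[OF v'(1)[of i]] p unfolding bdd_cont_def by blast
        note Cs = this
        have "cmod (g' i x) \<le> \<bar>\<tau>\<bar> * C1 * C2 + C3" if x: "x \<in> S" for x
        proof -
          have C1: "\<bar>\<theta>' i p x\<bar> \<le> C1" using Cs(1) x by simp
          have "cmod (g' i x) = cmod (\<i> * of_real (\<tau> * \<theta>' i p x) * v i p x + v' i p x)"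
            using x by (simp add: g'_def norm_mult)
          also have "\<dots> \<le> \<bar>\<tau>\<bar> * \<bar>\<theta>' i p x\<bar> * cmod (v i p x) + cmod (v' i p x)"
            by (rule order_trans[OF norm_triangle_ineq]) (simp add: norm_mult abs_mult)
          also have "\<dots> \<le> \<bar>\<tau>\<bar> * C1 * C2 + C3"
            using Cs(2,3) x C1 order_trans[OF abs_ge_zero C1] by (intro add_mono mult_mono) auto
          finally show ?thesis .
        qed
        then have "cmod (g' i x) \<le> max (\<bar>\<tau>\<bar> * C1 * C2 + C3) 0" for x by (cases "x \<in> S") (auto simp: g'_def max.coboundedI1)
        then show ?thesis by blast
      qed
      have g'i: "integrable lborel (g' i)" "(LINT x|lborel. g' i x) = 0" for i
      proof -
        obtain D where D: "\<And>x. cmod (g' i x) \<le> D" using gb by blast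
        have supp: "1 < norm x \<Longrightarrow> g i x = 0" for x using S(2) by (auto simp: g_def)
        show "integrable lborel (g' i)" "(LINT x|lborel. g' i x) = 0"
          using integral_partial_zero[OF gc gd D supp] by auto
      qed
      have sumg: "(\<Sum>i\<in>UNIV. g' i x) = \<i> * of_real \<tau> * (if x \<in> S then cis (\<tau> * \<theta> p x) * b p x else 0) + (if x \<in> S then cis (\<tau> * \<theta> p x) * B p x else 0)" for x
      proof (cases "x \<in> S")
        case True
        have "(\<Sum>i\<in>UNIV. g' i x) = cis (\<tau> * \<theta> p x) * (\<i> * of_real \<tau> * b p x * (\<Sum>i\<in>UNIV. of_real (\<theta>' i p x) * u i p x) + B p x)"
          using True by (simp add: g'_def B_def v_def sum.distrib sum_distrib_left algebra_simps)
        then show ?thesis using True u1[OF p True] by (simp add: algebra_simps)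
      qed (simp add: g'_def)
      have "0 = (LINT x|lborel. (\<Sum>i\<in>UNIV. g' i x))" by (simp add: g'i)
      also have "\<dots> = \<i> * of_real \<tau> * (LINT x|lborel. (if x \<in> S then cis (\<tau> * \<theta> p x) * b p x else 0)) + (LINT x|lborel. (if x \<in> S then cis (\<tau> * \<theta> p x) * B p x else 0))"
        unfolding sumg by (subst Bochner_Integration.integral_add[OF integrable_mult_right[OF ib] C(1)[OF p t]]) simp
      finally have "\<i> * of_real \<tau> * (LINT x|lborel. (if x \<in> S then cis (\<tau> * \<theta> p x) * b p x else 0)) = - (LINT x|lborel. (if x \<in> S then cis (\<tau> * \<theta> p x) * B p x else 0))"
        by (simp add: add_eq_0_iff)
      then have "\<bar>\<tau>\<bar> * cmod (LINT x|lborel. (if x \<in> S then cis (\<tau> * \<theta> p x) * b p x else 0)) = cmod (LINT x|lborel. (if x \<in> S then cis (\<tau> * \<theta> p x) * B p x else 0))"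
        by (drule_tac arg_cong[where f=cmod]) (simp only: norm_mult norm_minus_cancel norm_ii norm_of_real mult_1_left)
      also have "\<dots> \<le> C / \<bar>\<tau>\<bar> ^ N" by (rule C(2)[OF p t])
      finally show "cmod (LINT x|lborel. (if x \<in> S then cis (\<tau> * \<theta> p x) * b p x else 0)) \<le> C / \<bar>\<tau>\<bar> ^ Suc N"
        using t by (simp add: field_simps)
    qed
    then show ?case using C0 by blast
  }
qed

section \<open>Smooth functions, their translates and their difference quotients\<close>

lemma iter_partial_append: "iter_partial (xs @ ys) f = iter_partial xs (iter_partial ys f)"
  by (induction xs) auto

lemma smooth_partial_deriv: "smooth f \<Longrightarrow> smooth (partial_deriv i f)"
  unfolding smooth_def using iter_partial_append[of _ "[i]" f] by (metis iter_partial.simps)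

lemma smooth_has_derivative:
  assumes "smooth f" shows "(f has_derivative frechet_derivative f (at x)) (at x)"
proof -
  have "f differentiable (at x)" using assms unfolding smooth_def by (metis iter_partial.simps(1))
  then show ?thesis by (simp add: frechet_derivative_works)
qed

lemma smooth_continuous_on: "smooth f \<Longrightarrow> continuous_on S f"
  by (meson has_derivative_continuous smooth_has_derivative continuous_at_imp_continuous_on)

lemma frechet_derivative_partials:
  fixes f :: "real^'n::finite \<Rightarrow> 'b::real_normed_vector"
  assumes "smooth f"
  shows "frechet_derivative f (at x) h = (\<Sum>i\<in>UNIV. h $ i *\<^sub>R partial_deriv i f x)"
proof -
  have lin: "linear (frechet_derivative f (at x))" using smooth_has_derivative[OF assms] by (rule has_derivative_linear)
  have "h = (\<Sum>i\<in>UNIV. h $ i *\<^sub>R axis i 1)"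
    by (metis (no_types, lifting) basis_expansion scalar_mult_eq_scaleR sum.cong)
  then have "frechet_derivative f (at x) h = frechet_derivative f (at x) (\<Sum>i\<in>UNIV. h $ i *\<^sub>R axis i 1)" by (rule arg_cong)
  also have "\<dots> = (\<Sum>i\<in>UNIV. frechet_derivative f (at x) (h $ i *\<^sub>R axis i 1))" by (rule linear_sum[OF lin])
  finally show ?thesis by (simp only: linear_scale[OF lin] partial_deriv_def)
qed

lemma smooth_partial_at:
  fixes f :: "real^'n::finite \<Rightarrow> 'b::real_normed_vector"
  assumes "smooth f" shows "partial_at f i x (partial_deriv i f x)"
proof -
  have D: "(f has_derivative frechet_derivative f (at x)) (at (x + 0 *\<^sub>R axis i 1))" using smooth_has_derivative[OF assms, of x] by simp
  have "((\<lambda>s. x + s *\<^sub>R axis i 1) has_derivative (\<lambda>s. s *\<^sub>R axis i 1)) (at (0::real))" by (auto intro!: derivative_eq_intros)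
  from has_derivative_compose[OF this D] show ?thesis
    using linear_scale[OF has_derivative_linear[OF smooth_has_derivative[OF assms, of x]]]
    by (simp add: has_vector_derivative_def partial_deriv_def)
qed

lemma smooth_bounded:
  fixes f :: "real^'n::finite \<Rightarrow> 'b::real_normed_vector"
  assumes "smooth f" obtains B where "0 \<le> B" "\<And>x. x \<in> cball 0 R \<Longrightarrow> norm (f x) \<le> B"
proof -
  have "compact (f ` cball 0 R)" by (intro compact_continuous_image smooth_continuous_on assms) auto
  then obtain B where "\<And>x. x \<in> cball 0 R \<Longrightarrow> norm (f x) \<le> B" by (meson bounded_iff compact_imp_bounded imageI)
  then show ?thesis using that[of "max B 0"] by (simp add: max.coboundedI1)
qed

lemma smooth_lipschitz:
  fixes f :: "real^'n::finite \<Rightarrow> 'b::real_normed_vector"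
  assumes f: "smooth f"
  obtains B where "0 \<le> B" "\<And>x y. x \<in> cball 0 R \<Longrightarrow> y \<in> cball 0 R \<Longrightarrow> norm (f x - f y) \<le> B * norm (x - y)"
proof -
  have "\<exists>B\<ge>0. \<forall>x\<in>cball 0 R. norm (partial_deriv i f x) \<le> B" for i
    using smooth_bounded[OF smooth_partial_deriv[OF f]] by metis
  then obtain B where B: "\<And>i. 0 \<le> B i" "\<And>i x. x \<in> cball 0 R \<Longrightarrow> norm (partial_deriv i f x) \<le> B i" by metis
  show ?thesis
  proof (rule that)
    show "0 \<le> (\<Sum>i\<in>UNIV. B i)" by (intro sum_nonneg B)
    fix x y :: "real^'n" assume xy: "x \<in> cball 0 R" "y \<in> cball 0 R"
    show "norm (f x - f y) \<le> (\<Sum>i\<in>UNIV. B i) * norm (x - y)"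
    proof (rule differentiable_bound[OF convex_cball _ _ xy])
      fix z assume z: "z \<in> cball (0::real^'n) R"
      show "(f has_derivative frechet_derivative f (at z)) (at z within cball 0 R)"
        using smooth_has_derivative[OF f] by (rule has_derivative_at_withinI)
      show "onorm (frechet_derivative f (at z)) \<le> (\<Sum>i\<in>UNIV. B i)"
      proof (rule onorm_le)
        fix h
        have "norm (frechet_derivative f (at z) h) \<le> (\<Sum>i\<in>UNIV. \<bar>h $ i\<bar> * norm (partial_deriv i f z))"
          unfolding frechet_derivative_partials[OF f] by (rule order_trans[OF norm_sum]) simp
        also have "\<dots> \<le> (\<Sum>i\<in>UNIV. norm h * B i)" using B z by (intro sum_mono mult_mono component_le_norm_cart) auto
        also have "\<dots> = (\<Sum>i\<in>UNIV. B i) * norm h" by (subst sum_distrib_right) (simp only: mult.commute)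
        finally show "norm (frechet_derivative f (at z) h) \<le> (\<Sum>i\<in>UNIV. B i) * norm h" .
      qed
    qed
  qed
qed

text \<open>With |k| <= 1 the points x + k stay in the ball of radius 2, a compact set on which
  every derivative is bounded; this is the uniformity in k. The bounded linear \<open>L\<close> lets
  one induction serve a function and its conjugate.\<close>

lemma jet_shift:
  fixes f :: "real^'n::finite \<Rightarrow> 'b::real_normed_vector"
  assumes L: "bounded_linear L"
  shows "smooth f \<Longrightarrow> jet n {k. norm k \<le> 1} (ball 0 1) (\<lambda>k x. L (f (x + k)))"
proof (induction n arbitrary: f)
  interpret bounded_linear L by fact
  have bc: "bdd_cont {k. norm k \<le> 1} (ball 0 1) (\<lambda>k x. L (f (x + k)))" if f: "smooth f" for f :: "real^'n \<Rightarrow> 'b"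
  proof -
    obtain B where B: "0 \<le> B" "\<And>x. x \<in> cball 0 2 \<Longrightarrow> norm (f x) \<le> B" using smooth_bounded[OF f] by metis
    obtain M where M: "\<And>x. norm (L x) \<le> norm x * M" "0 < M" using pos_bounded by blast
    have "cmod (L (f (x + k))) \<le> B * M" if "norm k \<le> 1" "x \<in> ball 0 1" for k x
    proof -
      have "norm (x + k) \<le> 2" using norm_triangle_ineq[of x k] that by simp
      then show ?thesis using B(2)[of "x + k"] M by (intro order_trans[OF M(1)] mult_right_mono) auto
    qed
    moreover have "continuous_on (ball 0 1) (\<lambda>x. L (f (x + k)))" for k
      by (intro continuous_on continuous_on_compose2[OF smooth_continuous_on[OF f, of UNIV]] continuous_intros) auto
    ultimately show ?thesis unfolding bdd_cont_def by blast
  qed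
  case (0 f)
  then show ?case using bc by simp
next
  interpret bounded_linear L by fact
  case (Suc n f)
  have "\<exists>f'. jet n {k. norm k \<le> 1} (ball 0 1) f' \<and> (\<forall>p\<in>{k. norm k \<le> 1}. \<forall>x\<in>ball 0 1. partial_at (\<lambda>x. L (f (x + p))) i x (f' p x))" for i
  proof (intro exI conjI ballI)
    show "jet n {k. norm k \<le> 1} (ball 0 1) (\<lambda>k x. L (partial_deriv i f (x + k)))" by (intro Suc smooth_partial_deriv)
    fix p x :: "real^'n"
    show "partial_at (\<lambda>x. L (f (x + p))) i x (L (partial_deriv i f (x + p)))"
      using has_vector_derivative[OF smooth_partial_at[OF Suc.prems, of "x + p" i]] by (simp add: add_ac)
  qed
  moreover have "bdd_cont {k. norm k \<le> 1} (ball 0 1) (\<lambda>k x. L (f (x + k)))"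
    using Suc.IH[OF Suc.prems] by (rule jet_bdd_cont)
  ultimately show ?case by simp
qed

text \<open>Dividing by |k| keeps the phases of the correlations comparable as k tends to 0: the
  quotients commute with partial derivatives, and each is bounded by a Lipschitz constant
  independent of k.\<close>

lemma jet_diff_quotient:
  fixes f :: "real^'n::finite \<Rightarrow> 'b::real_normed_vector"
  assumes L: "bounded_linear L"
  shows "smooth f \<Longrightarrow> jet n {k. 0 < norm k \<and> norm k \<le> 1} (ball 0 1) (\<lambda>k x. L ((f (x + k) - f x) /\<^sub>R norm k))"
proof (induction n arbitrary: f)
  interpret bounded_linear L by fact
  have bc: "bdd_cont {k. 0 < norm k \<and> norm k \<le> 1} (ball 0 1) (\<lambda>k x. L ((f (x + k) - f x) /\<^sub>R norm k))" if f: "smooth f" for f :: "real^'n \<Rightarrow> 'b"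
  proof -
    obtain B where B: "0 \<le> B" "\<And>x y. x \<in> cball 0 2 \<Longrightarrow> y \<in> cball 0 2 \<Longrightarrow> norm (f x - f y) \<le> B * norm (x - y)"
      using smooth_lipschitz[OF f] by metis
    obtain M where M: "\<And>x. norm (L x) \<le> norm x * M" "0 < M" using pos_bounded by blast
    have "cmod (L ((f (x + k) - f x) /\<^sub>R norm k)) \<le> B * M" if k: "0 < norm k" "norm k \<le> 1" and x: "x \<in> ball 0 1" for k x
    proof -
      have "norm (x + k) \<le> 2" using norm_triangle_ineq[of x k] k x by simp
      then have "norm (f (x + k) - f x) \<le> B * norm k" using B(2)[of "x + k" x] x by simp
      then have "norm (f (x + k) - f x) / norm k \<le> B" using k by (simp add: pos_divide_le_eq)
      then have "norm ((f (x + k) - f x) /\<^sub>R norm k) \<le> B" by (simp add: divide_inverse mult.commute)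
      then show ?thesis using M by (intro order_trans[OF M(1)] mult_right_mono) auto
    qed
    moreover have "continuous_on (ball 0 1) (\<lambda>x. L ((f (x + k) - f x) /\<^sub>R norm k))" for k
      by (intro continuous_on continuous_on_compose2[OF smooth_continuous_on[OF f, of UNIV], of _ "\<lambda>x. x + k"] continuous_intros smooth_continuous_on[OF f]) auto
    ultimately show ?thesis unfolding bdd_cont_def by blast
  qed
  case (0 f)
  then show ?case using bc by simp
next
  interpret bounded_linear L by fact
  case (Suc n f)
  have "\<exists>f'. jet n {k. 0 < norm k \<and> norm k \<le> 1} (ball 0 1) f' \<and> (\<forall>p\<in>{k. 0 < norm k \<and> norm k \<le> 1}. \<forall>x\<in>ball 0 1. partial_at (\<lambda>x. L ((f (x + p) - f x) /\<^sub>R norm p)) i x (f' p x))" for i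
  proof (intro exI conjI ballI)
    show "jet n {k. 0 < norm k \<and> norm k \<le> 1} (ball 0 1) (\<lambda>k x. L ((partial_deriv i f (x + k) - partial_deriv i f x) /\<^sub>R norm k))" by (intro Suc smooth_partial_deriv)
    fix p x :: "real^'n"
    have a: "partial_at (\<lambda>x. f (x + p)) i x (partial_deriv i f (x + p))"
      using smooth_partial_at[OF Suc.prems, of "x + p" i] by (simp add: add_ac)
    have "((\<lambda>s. (f (x + s *\<^sub>R axis i 1 + p) - f (x + s *\<^sub>R axis i 1)) /\<^sub>R norm p) has_vector_derivative (partial_deriv i f (x + p) - partial_deriv i f x) /\<^sub>R norm p) (at 0)"
      by (rule bounded_linear.has_vector_derivative[OF bounded_linear_scaleR_right has_vector_derivative_diff[OF a smooth_partial_at[OF Suc.prems]]])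
    from has_vector_derivative[OF this]
    show "partial_at (\<lambda>x. L ((f (x + p) - f x) /\<^sub>R norm p)) i x (L ((partial_deriv i f (x + p) - partial_deriv i f x) /\<^sub>R norm p))" .
  qed
  moreover have "bdd_cont {k. 0 < norm k \<and> norm k \<le> 1} (ball 0 1) (\<lambda>k x. L ((f (x + k) - f x) /\<^sub>R norm k))"
    using Suc.IH[OF Suc.prems] by (rule jet_bdd_cont)
  ultimately show ?case by simp
qed

section \<open>Decay of oscillatory integrals with nondegenerate Hessian\<close>

lemma norm_sq_vec: "(norm (v::real^'n::finite))\<^sup>2 = (\<Sum>i\<in>UNIV. (v $ i)\<^sup>2)"
  unfolding power2_norm_eq_inner inner_vec_def by (simp add: power2_eq_square)

text \<open>By compactness the Hessian on K stretches every vector by a factor at least m > 0. Near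
  K the increment of the gradient differs from the Hessian applied to k by at most (m / 2) |k|, by
  uniform continuity of the second derivatives, so a factor m / 2 survives.\<close>

lemma gradient_difference_lower_bound:
  fixes \<phi> :: "real^'n::finite \<Rightarrow> real"
  assumes phi: "smooth \<phi>" and K: "compact K" "K \<subseteq> ball 0 1" and hess: "\<forall>\<xi>\<in>K. det (hessian \<phi> \<xi>) \<noteq> 0"
  obtains \<rho> c S where "0 < \<rho>" "\<rho> \<le> 1" "0 < c" "open S" "K \<subseteq> S" "S \<subseteq> ball 0 1"
    "\<And>k x. 0 < norm k \<Longrightarrow> norm k \<le> \<rho> \<Longrightarrow> x \<in> S \<Longrightarrow> c \<le> (\<Sum>i\<in>UNIV. ((partial_deriv i \<phi> (x + k) - partial_deriv i \<phi> x) / norm k)\<^sup>2)"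
proof (cases "K = {}")
  case True
  then show ?thesis by (intro that[of 1 1 "{}"]) auto
next
  case False
  \<comment> \<open>The derivative matrix of the gradient, rows indexed by its components, is the
    transpose of \<open>hessian\<close>; the determinants agree, which is how the hypothesis
    applies.\<close>
  define G where "G y = (\<chi> i j. partial_deriv j (partial_deriv i \<phi>) y)" for y
  have Gt: "G y = transpose (hessian \<phi> y)" for y by (simp add: G_def hessian_def transpose_def)
  have Gc: "continuous_on T G" for T
    unfolding G_def[abs_def] by (intro continuous_intros smooth_continuous_on smooth_partial_deriv phi)
  define A where "A = (\<lambda>p. norm (G (fst p) *v (snd p)))"
  have "continuous_on (K \<times> sphere 0 1) A"
  proof -
    have "continuous_on (K \<times> sphere 0 1) (\<lambda>p. G (fst p) *v (snd p :: real^'n))"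
      unfolding matrix_vector_mult_def
      by (intro continuous_intros continuous_on_compose2[OF Gc[of UNIV]]) auto
    then show ?thesis unfolding A_def by (intro continuous_intros)
  qed
  moreover have "compact (K \<times> sphere (0::real^'n) 1)" "K \<times> sphere (0::real^'n) 1 \<noteq> {}"
    using K False by (auto intro: compact_Times)
  ultimately obtain p0 where p0: "p0 \<in> K \<times> sphere 0 1" "\<And>p. p \<in> K \<times> sphere 0 1 \<Longrightarrow> A p0 \<le> A p"
    using continuous_attains_inf[of "K \<times> sphere 0 1" A] by blast
  define m where "m = A p0"
  have m0: "0 < m"
  proof -
    have "invertible (G (fst p0))"
      using p0(1) hess unfolding Gt invertible_det_nz by (auto simp: det_transpose)
    then have "G (fst p0) *v snd p0 \<noteq> 0"
      using p0(1) by (metis invertible_def mem_Times_iff mem_sphere_0 norm_zero zero_neq_one matrix_vector_mul_assoc matrix_vector_mul_lid matrix_vector_mult_0_right)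
    then show ?thesis by (simp add: m_def A_def)
  qed
  have mb: "m * norm w \<le> norm (G y *v w)" if "y \<in> K" for y w
  proof (cases "w = 0")
    case False
    then have "A p0 \<le> A (y, w /\<^sub>R norm w)" using that by (intro p0) auto
    also have "\<dots> = norm (G y *v w) / norm w" by (simp add: A_def matrix_vector_mult_scaleR divide_inverse_commute)
    finally show ?thesis using False by (simp add: m_def field_simps)
  qed simp
  define N where "N = real CARD('n)"
  have N: "1 \<le> N" by (simp add: N_def Suc_leI)
  \<comment> \<open>Each entry of \<open>G\<close> may vary by e, so each component of the error is
    at most N e |k|, and the N components add up to (m / 2) |k|.\<close>
  define e where "e = m / (2 * N * N)"
  have e0: "0 < e" using m0 N by (simp add: e_def)
  have "uniformly_continuous_on (cball 0 2) G" by (intro compact_uniformly_continuous Gc) auto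
  then obtain d where d: "0 < d" "\<And>y z. y \<in> cball 0 2 \<Longrightarrow> z \<in> cball 0 2 \<Longrightarrow> dist z y < d \<Longrightarrow> dist (G z) (G y) < e"
    unfolding uniformly_continuous_on_def using e0 by metis
  \<comment> \<open>Twice r is at most d, so x and x + k both stay within d of the point y of K that
    is close to x.\<close>
  define r where "r = min 1 (d / 2)"
  define S where "S = ball 0 1 \<inter> (\<Union>y\<in>K. ball y r)"
  have r: "0 < r" "r \<le> 1" "2 * r \<le> d" using d by (auto simp: r_def)
  show ?thesis
  proof (rule that[of r "(m / 2)\<^sup>2" S])
    show "0 < (m / 2)\<^sup>2" using m0 by simp
    show "open S" by (auto simp: S_def)
    show "K \<subseteq> S" using K r by (force simp: S_def)
    show "S \<subseteq> ball 0 1" by (auto simp: S_def)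
    fix k x :: "real^'n" assume k: "0 < norm k" "norm k \<le> r" and x: "x \<in> S"
    then obtain y where y: "y \<in> K" "dist y x < r" by (auto simp: S_def)
    define v where "v = (\<chi> i. partial_deriv i \<phi> (x + k) - partial_deriv i \<phi> x)"
    have comp: "\<bar>(v - G y *v k) $ i\<bar> \<le> N * e * norm k" for i
    proof -
      \<comment> \<open>The mean value inequality on the convex set \<open>T\<close> is applied to a
        gradient component minus its linear model at y; the derivative of this difference is the
        variation of \<open>G\<close>.\<close>
      define f where "f z = partial_deriv i \<phi> z - (\<Sum>j\<in>UNIV. z $ j * G y $ i $ j)" for z
      define T where "T = ball y d \<inter> ball 0 2"
      have xT: "x \<in> T" "x + k \<in> T"
      proof -
        have "dist y (x + k) \<le> dist y x + norm k" by (metis add_diff_cancel_left' dist_commute dist_norm dist_triangle)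
        then show "x \<in> T" "x + k \<in> T" using y k r x norm_triangle_ineq[of x k] by (auto simp: T_def S_def)
      qed
      have "norm (f (x + k) - f x) \<le> (N * e) * norm (x + k - x)"
      proof (rule differentiable_bound[of T _ "\<lambda>z h. frechet_derivative (partial_deriv i \<phi>) (at z) h - (\<Sum>j\<in>UNIV. h $ j * G y $ i $ j)"])
        show "convex T" by (auto simp: T_def intro: convex_Int)
        fix z assume z: "z \<in> T"
        have "((\<lambda>z. \<Sum>j\<in>UNIV. z $ j * G y $ i $ j) has_derivative (\<lambda>h. \<Sum>j\<in>UNIV. h $ j * G y $ i $ j)) (at z within T)"
          by (intro bounded_linear_imp_has_derivative bounded_linear_sum bounded_linear_mult_left[THEN bounded_linear_compose] bounded_linear_vec_nth)
        then show "(f has_derivative (\<lambda>h. frechet_derivative (partial_deriv i \<phi>) (at z) h - (\<Sum>j\<in>UNIV. h $ j * G y $ i $ j))) (at z within T)"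
          unfolding f_def by (intro has_derivative_diff has_derivative_at_withinI[OF smooth_has_derivative[OF smooth_partial_deriv[OF phi]]])
        show "onorm (\<lambda>h. frechet_derivative (partial_deriv i \<phi>) (at z) h - (\<Sum>j\<in>UNIV. h $ j * G y $ i $ j)) \<le> N * e"
        proof (rule onorm_le)
          fix h :: "real^'n"
          have Gd: "\<bar>G z $ i $ j - G y $ i $ j\<bar> \<le> e" for j
          proof -
            have "\<bar>G z $ i $ j - G y $ i $ j\<bar> = norm ((G z - G y) $ i $ j)" by simp
            also have "\<dots> \<le> norm (G z - G y)" by (rule order_trans[OF Finite_Cartesian_Product.norm_nth_le Finite_Cartesian_Product.norm_nth_le])
            also have "\<dots> \<le> e" using d(2)[of y z] z y(1) K by (auto simp: T_def dist_norm dist_commute subset_eq norm_minus_commute)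
            finally show ?thesis .
          qed
          have "frechet_derivative (partial_deriv i \<phi>) (at z) h - (\<Sum>j\<in>UNIV. h $ j * G y $ i $ j) = (\<Sum>j\<in>UNIV. h $ j * (G z $ i $ j - G y $ i $ j))"
            by (simp add: frechet_derivative_partials[OF smooth_partial_deriv[OF phi]] G_def right_diff_distrib sum_subtractf)
          then have "norm (frechet_derivative (partial_deriv i \<phi>) (at z) h - (\<Sum>j\<in>UNIV. h $ j * G y $ i $ j)) \<le> (\<Sum>j\<in>UNIV. \<bar>h $ j\<bar> * \<bar>G z $ i $ j - G y $ i $ j\<bar>)"
            by (simp add: sum_abs[THEN order_trans] abs_mult)
          also have "\<dots> \<le> (\<Sum>j\<in>(UNIV::'n set). norm h * e)" using Gd by (intro sum_mono mult_mono component_le_norm_cart) auto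
          finally show "norm (frechet_derivative (partial_deriv i \<phi>) (at z) h - (\<Sum>j\<in>UNIV. h $ j * G y $ i $ j)) \<le> N * e * norm h"
            by (simp add: N_def mult_ac)
        qed
      qed (use xT in auto)
      moreover have "f (x + k) - f x = (v - G y *v k) $ i"
        by (simp add: f_def v_def matrix_vector_mult_def sum.distrib algebra_simps)
      ultimately show ?thesis by simp
    qed
    have nv: "(norm v)\<^sup>2 = (\<Sum>i\<in>UNIV. (partial_deriv i \<phi> (x + k) - partial_deriv i \<phi> x)\<^sup>2)"
      unfolding norm_sq_vec by (simp add: v_def)
    have "norm (v - G y *v k) \<le> (\<Sum>i\<in>UNIV. \<bar>(v - G y *v k) $ i\<bar>)" by (rule norm_le_l1_cart)
    also have "\<dots> \<le> (\<Sum>i\<in>(UNIV::'n set). N * e * norm k)" by (intro sum_mono comp)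
    also have "\<dots> = m / 2 * norm k" using N by (simp add: e_def N_def field_simps)
    finally have "norm (v - G y *v k) \<le> m / 2 * norm k" .
    then have "m / 2 * norm k \<le> norm v"
      using mb[OF y(1), of k] norm_triangle_ineq3[of v "G y *v k"] by (simp add: abs_le_iff)
    then have "(m / 2 * norm k)\<^sup>2 \<le> (norm v)\<^sup>2" using m0 by (intro power_mono) auto
    then have "(m / 2)\<^sup>2 * (norm k)\<^sup>2 \<le> (\<Sum>i\<in>UNIV. (partial_deriv i \<phi> (x + k) - partial_deriv i \<phi> x)\<^sup>2)"
      by (simp only: nv power_mult_distrib)
    then have "(m / 2)\<^sup>2 \<le> (\<Sum>i\<in>UNIV. (partial_deriv i \<phi> (x + k) - partial_deriv i \<phi> x)\<^sup>2) / (norm k)\<^sup>2"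
      using k by (simp add: pos_le_divide_eq)
    then show "(m / 2)\<^sup>2 \<le> (\<Sum>i\<in>UNIV. ((partial_deriv i \<phi> (x + k) - partial_deriv i \<phi> x) / norm k)\<^sup>2)"
      by (simp add: sum_divide_distrib power_divide)
  qed (use r in auto)
qed

text \<open>Averaging over small translations restricts the van der Corput correlations to small shifts, where the
  phase differences are nonstationary.\<close>

lemma van_der_corput:
  fixes F :: "'a::euclidean_space \<Rightarrow> complex"
  assumes F[measurable]: "F \<in> borel_measurable borel" and Fb: "\<And>x. cmod (F x) \<le> B" and supp: "\<And>x. 1 < norm x \<Longrightarrow> F x = 0"
    and \<rho>: "0 < \<rho>" "\<rho> \<le> 1"
  defines "v \<equiv> \<lambda>r. measure lborel (ball (0::'a) r)"
  shows "ennreal (v (\<rho> / 2) * (cmod (LINT x|lborel. F x))\<^sup>2)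
    \<le> ennreal (v 2) * (\<integral>\<^sup>+k. ennreal (cmod (LINT x|lborel. F (x + k) * cnj (F x))) * indicator {k. norm k \<le> \<rho>} k \<partial>lborel)"
proof -
  let ?P = "lborel \<Otimes>\<^sub>M lborel :: ('a \<times> 'a) measure"
  define D where "D = ball (0::'a) (\<rho> / 2)"
  have [measurable]: "D \<in> sets borel" by (simp add: D_def)
  have [measurable]: "ball (0::'a) 2 \<in> sets borel" by simp
  have B0: "0 \<le> B" using order_trans[OF norm_ge_zero Fb] .
  have bfin: "emeasure lborel (ball (0::'a) r) < \<infinity>" for r by (rule emeasure_ball_finite)
  have ev: "emeasure lborel (ball (0::'a) r) = ennreal (v r)" for r
    using bfin[of r] unfolding v_def by (intro emeasure_eq_ennreal_measure) auto
  have vpos: "0 < v r" if "0 < r" for r unfolding v_def using content_ball_pos[OF that, of "0::'a"] by simp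
  have Dm: "measure lborel D = v (\<rho> / 2)" by (simp add: D_def v_def)
  have Dfin: "emeasure lborel D < \<infinity>" unfolding D_def by (rule bfin)
  have bi: "integrable lborel (\<lambda>x. c * indicator (ball (0::'a) r) x)" for c :: real and r
    using bfin[of r] by (intro integrable_mult_right) auto
  have iD: "integrable lborel (\<lambda>x. indicator D x :: real)" using Dfin by simp
  have supp2: "F x = 0" if "x \<notin> ball 0 2" for x using supp[of x] that by auto
  have Fle: "cmod (F x) \<le> B * indicator (ball 0 2) x" for x
    using Fb supp2 by (auto simp: indicator_def)
  have Fi: "integrable lborel F"
  proof (rule Bochner_Integration.integrable_bound[OF bi[of B 2]])
    show "AE x in lborel. cmod (F x) \<le> norm (B * indicator (ball 0 2) x)"
      unfolding real_norm_def by (intro AE_I2 order_trans[OF Fle abs_ge_self])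
  qed measurable
  have Ftr: "integrable lborel (\<lambda>x. F (x + h))" "(LINT x|lborel. F (x + h)) = (LINT x|lborel. F x)" for h
    using integrable_affine_euclidean[OF Fi, of 1 h] integral_affine_euclidean[OF F, of 1 h] by (simp_all add: add.commute)
  \<comment> \<open>Averaging over shifts in D multiplies the integral by |D| and keeps the support
    in the ball of radius 2, so Cauchy-Schwarz costs only \<open>v 2\<close>. Expanding |G|^2
    produces correlations at differences of two points of D, which have norm at most \<rho>.\<close>
  define G where "G x = (LINT h|lborel. indicator D h * F (x + h))" for x
  have [measurable]: "G \<in> borel_measurable borel" unfolding G_def[abs_def] by measurable
  have s2: "F (x + h) = 0" if "h \<in> D" "x \<notin> ball 0 2" for x h
  proof -
    have "norm x \<le> norm (x + h) + norm h" using norm_triangle_ineq4[of "x + h" h] by simp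
    then have "1 < norm (x + h)" using that \<rho> by (auto simp: D_def)
    then show ?thesis by (rule supp)
  qed
  have G2: "G x = 0" if "x \<notin> ball 0 2" for x
  proof -
    have "G x = (LINT h|(lborel::'a measure). 0)" unfolding G_def
      by (rule Bochner_Integration.integral_cong) (use s2 that in \<open>auto simp: indicator_def\<close>)
    then show ?thesis by simp
  qed
  have iP: "integrable ?P (\<lambda>(x, h). indicator D h * F (x + h))"
  proof (rule Bochner_Integration.integrable_bound)
    show "integrable ?P (\<lambda>p. (B * indicator (ball 0 2) (fst p)) * indicator D (snd p))"
      by (rule integrable_pair_mult[OF sigma_finite_lborel sigma_finite_lborel bi iD])
    show "AE p in ?P. cmod (case p of (x, h) \<Rightarrow> indicator D h * F (x + h)) \<le> norm (B * indicator (ball 0 2) (fst p) * indicator D (snd p))"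
      using Fb B0 s2 by (intro AE_I2) (auto simp: indicator_def norm_mult split: prod.splits)
  qed measurable
  have IG: "(LINT x|lborel. G x) = of_real (v (\<rho> / 2)) * (LINT x|lborel. F x)"
  proof -
    have "(LINT x|lborel. G x) = (LINT h|lborel. LINT x|lborel. indicator D h * F (x + h))"
      unfolding G_def by (rule lborel_pair.Fubini_integral[symmetric]) (rule iP)
    also have "\<dots> = (LINT h|lborel. indicator D h * (LINT x|lborel. F x))"
      by (simp add: Ftr)
    also have "\<dots> = (LINT h|lborel. of_real (indicator D h)) * (LINT x|lborel. F x)"
      by (subst integral_mult_left_zero[symmetric]) (auto simp: of_real_indicator intro!: Bochner_Integration.integral_cong)
    also have "(LINT h|lborel. complex_of_real (indicator D h)) = of_real (v (\<rho> / 2))"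
      unfolding integral_complex_of_real using Dfin Dm by simp
    finally show ?thesis .
  qed
  have Gle: "cmod (G x) \<le> B * v (\<rho> / 2) * indicator (ball 0 2) x" for x
  proof (cases "x \<in> ball 0 2")
    case True
    have "cmod (G x) \<le> (LINT h|lborel. B * indicator D h)" unfolding G_def
    proof (rule Bochner_Integration.integral_norm_bound_integral)
      show "integrable lborel (\<lambda>h. indicator D h * F (x + h))"
        using Ftr(1)[of x] by (intro Bochner_Integration.integrable_bound[OF Ftr(1)[of x]]) (auto simp: indicator_def norm_mult add.commute)
      show "integrable lborel (\<lambda>h. B * indicator D h)" using iD by simp
    qed (use Fb in \<open>auto simp: indicator_def norm_mult\<close>)
    then show ?thesis using True Dfin Dm by simp
  qed (use G2 in auto)
  have G2i: "integrable lborel (\<lambda>x. (cmod (G x))\<^sup>2)"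
  proof (rule Bochner_Integration.integrable_bound[OF bi[of "(B * v (\<rho> / 2))\<^sup>2" 2]])
    show "AE x in lborel. norm ((cmod (G x))\<^sup>2) \<le> norm ((B * v (\<rho> / 2))\<^sup>2 * indicator (ball 0 2) x)"
    proof (rule AE_I2)
      fix x
      have "(cmod (G x))\<^sup>2 \<le> (B * v (\<rho> / 2) * indicator (ball 0 2) x)\<^sup>2" using Gle by (intro power_mono) auto
      then show "norm ((cmod (G x))\<^sup>2) \<le> norm ((B * v (\<rho> / 2))\<^sup>2 * indicator (ball 0 2) x)"
        by (auto simp: indicator_def)
    qed
  qed measurable
  have CS: "ennreal ((cmod (LINT x|lborel. G x))\<^sup>2) \<le> ennreal (v 2) * ennreal (LINT x|lborel. (cmod (G x))\<^sup>2)"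
  proof -
    have "ennreal (cmod (LINT x|lborel. G x)) \<le> (\<integral>\<^sup>+x. ennreal (cmod (G x)) \<partial>lborel)" by (rule ennreal_norm_integral_le)
    also have "\<dots> = (\<integral>\<^sup>+x. indicator (ball 0 2) x * ennreal (cmod (G x)) \<partial>lborel)"
      using G2 by (intro nn_integral_cong) (auto simp: indicator_def)
    finally have "(ennreal (cmod (LINT x|lborel. G x)))\<^sup>2 \<le> (\<integral>\<^sup>+x. indicator (ball 0 2) x * ennreal (cmod (G x)) \<partial>lborel)\<^sup>2"
      by (intro power_mono) auto
    also have "\<dots> \<le> (\<integral>\<^sup>+x. (indicator (ball (0::'a) 2) x)\<^sup>2 \<partial>lborel) * (\<integral>\<^sup>+x. (ennreal (cmod (G x)))\<^sup>2 \<partial>lborel)"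
      by (rule Cauchy_Schwarz_nn_integral) measurable
    also have "(\<integral>\<^sup>+x. (indicator (ball (0::'a) 2) x)\<^sup>2 \<partial>lborel) = (\<integral>\<^sup>+x. indicator (ball (0::'a) 2) x \<partial>lborel)"
      by (intro nn_integral_cong) (auto simp: indicator_def)
    also have "\<dots> = ennreal (v 2)" by (simp add: ev)
    also have "(\<integral>\<^sup>+x. (ennreal (cmod (G x)))\<^sup>2 \<partial>lborel) = ennreal (LINT x|lborel. (cmod (G x))\<^sup>2)"
      by (subst nn_integral_eq_integral[OF G2i, symmetric]) (auto simp: ennreal_power)
    finally show ?thesis by (simp add: ennreal_power)
  qed
  define J where "J k = (LINT x|lborel. F (x + k) * cnj (F x))" for k
  have [measurable]: "J \<in> borel_measurable borel" unfolding J_def[abs_def] by measurable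
  have Jhh: "(LINT x|lborel. F (x + h) * cnj (F (x + h'))) = J (h - h')" for h h'
    unfolding J_def using integral_affine_euclidean[of "\<lambda>x. F (x + (h - h')) * cnj (F x)" 1 h'] by (simp add: algebra_simps)
  have GG: "complex_of_real (LINT x|lborel. (cmod (G x))\<^sup>2) = (LINT p|?P. indicator D (fst p) * indicator D (snd p) * J (fst p - snd p))"
  proof -
    interpret P: pair_sigma_finite "lborel::'a measure" ?P unfolding lborel_prod by standard
    have int: "integrable (lborel \<Otimes>\<^sub>M ?P) (\<lambda>(x, p). (indicator D (fst p) * F (x + fst p)) * (indicator D (snd p) * cnj (F (x + snd p))))"
    proof (rule Bochner_Integration.integrable_bound)
      have iDD: "integrable ?P (\<lambda>p. indicator D (fst p) * indicator D (snd p) :: real)"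
        by (rule integrable_pair_mult[OF sigma_finite_lborel sigma_finite_lborel iD iD])
      show "integrable (lborel \<Otimes>\<^sub>M ?P) (\<lambda>q. (B * B * indicator (ball (0::'a) 2) (fst q)) * (indicator D (fst (snd q)) * indicator D (snd (snd q))))"
        by (rule integrable_pair_mult[OF _ _ bi[of "B * B" 2] iDD]) (auto simp: lborel_prod sigma_finite_lborel)
      show "AE q in lborel \<Otimes>\<^sub>M ?P. cmod (case q of (x, p) \<Rightarrow> (indicator D (fst p) * F (x + fst p)) * (indicator D (snd p) * cnj (F (x + snd p))))
         \<le> norm ((B * B * indicator (ball 0 2) (fst q)) * (indicator D (fst (snd q)) * indicator D (snd (snd q))))"
        using Fb B0 s2 by (intro AE_I2) (auto simp: indicator_def norm_mult split: prod.splits intro!: mult_mono)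
    qed measurable
    have sq: "complex_of_real ((cmod (G x))\<^sup>2) = (LINT p|?P. (indicator D (fst p) * F (x + fst p)) * (indicator D (snd p) * cnj (F (x + snd p))))" for x
    proof -
      have ci: "cnj (indicator D h) = (indicator D h :: complex)" for h by (simp add: indicator_def)
      have iFD: "integrable lborel (\<lambda>h. indicator D h * F (x + h))"
        by (intro Bochner_Integration.integrable_bound[OF Ftr(1)[of x]]) (auto simp: indicator_def norm_mult add.commute)
      have "complex_of_real ((cmod (G x))\<^sup>2) = G x * cnj (G x)" by (rule complex_norm_square)
      also have "\<dots> = (LINT h|lborel. indicator D h * F (x + h)) * (LINT h|lborel. cnj (indicator D h * F (x + h)))"
        by (simp only: G_def Bochner_Integration.integral_cnj)
      also have "\<dots> = (LINT p|?P. (indicator D (fst p) * F (x + fst p)) * cnj (indicator D (snd p) * F (x + snd p)))"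
        using iFD by (intro integral_pair_mult[symmetric] sigma_finite_lborel) (auto simp del: complex_cnj_mult)
      finally show ?thesis by (simp add: ci)
    qed
    have "complex_of_real (LINT x|lborel. (cmod (G x))\<^sup>2) = (LINT x|lborel. complex_of_real ((cmod (G x))\<^sup>2))"
      by (simp only: integral_complex_of_real)
    also have "\<dots> = (LINT x|lborel. LINT p|?P. (indicator D (fst p) * F (x + fst p)) * (indicator D (snd p) * cnj (F (x + snd p))))"
      by (simp only: sq)
    also have "\<dots> = (LINT p|?P. LINT x|lborel. (indicator D (fst p) * F (x + fst p)) * (indicator D (snd p) * cnj (F (x + snd p))))"
      by (rule P.Fubini_integral[symmetric]) (rule int)
    also have "\<dots> = (LINT p|?P. indicator D (fst p) * indicator D (snd p) * J (fst p - snd p))"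
    proof (rule Bochner_Integration.integral_cong[OF refl])
      fix p :: "'a \<times> 'a"
      have "(LINT x|lborel. (indicator D (fst p) * F (x + fst p)) * (indicator D (snd p) * cnj (F (x + snd p))))
        = (LINT x|lborel. (indicator D (fst p) * indicator D (snd p)) * (F (x + fst p) * cnj (F (x + snd p))))"
        by (simp add: mult_ac)
      then show "(LINT x|lborel. (indicator D (fst p) * F (x + fst p)) * (indicator D (snd p) * cnj (F (x + snd p)))) = indicator D (fst p) * indicator D (snd p) * J (fst p - snd p)"
        by (simp only: integral_mult_right_zero Jhh)
    qed
    finally show ?thesis .
  qed
  let ?I = "\<integral>\<^sup>+k. ennreal (cmod (J k)) * indicator {k. norm k \<le> \<rho>} k \<partial>lborel"
  have mp: "(\<lambda>p. indicator D (fst p) * indicator D (snd p) * ennreal (cmod (J (fst p - snd p)))) \<in> borel_measurable ?P" by measurable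
  have "ennreal (LINT x|lborel. (cmod (G x))\<^sup>2) = ennreal (cmod (complex_of_real (LINT x|lborel. (cmod (G x))\<^sup>2)))"
    by (simp add: integral_nonneg_AE)
  also have "\<dots> \<le> (\<integral>\<^sup>+p. ennreal (cmod (indicator D (fst p) * indicator D (snd p) * J (fst p - snd p))) \<partial>?P)"
    unfolding GG by (rule ennreal_norm_integral_le)
  also have "\<dots> = (\<integral>\<^sup>+p. indicator D (fst p) * indicator D (snd p) * ennreal (cmod (J (fst p - snd p))) \<partial>?P)"
    by (intro nn_integral_cong) (auto simp: indicator_def)
  also have "\<dots> = (\<integral>\<^sup>+h'. \<integral>\<^sup>+h. indicator D h * indicator D h' * ennreal (cmod (J (h - h'))) \<partial>lborel \<partial>lborel)"
    using lborel_pair.nn_integral_snd[OF mp] by simp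
  also have "\<dots> \<le> (\<integral>\<^sup>+h'. indicator D h' * ?I \<partial>lborel)"
  proof (rule nn_integral_mono)
    fix h' :: 'a
    show "(\<integral>\<^sup>+h. indicator D h * indicator D h' * ennreal (cmod (J (h - h'))) \<partial>lborel) \<le> indicator D h' * ?I"
    proof (cases "h' \<in> D")
      case True
      have "(\<integral>\<^sup>+h. indicator D h * indicator D h' * ennreal (cmod (J (h - h'))) \<partial>lborel)
        \<le> (\<integral>\<^sup>+h. ennreal (cmod (J (- h' + h))) * indicator {k. norm k \<le> \<rho>} (- h' + h) \<partial>lborel)"
      proof (rule nn_integral_mono)
        fix h
        have "norm (h - h') \<le> \<rho>" if "h \<in> D" using that True norm_triangle_ineq4[of h h'] by (auto simp: D_def)
        then show "indicator D h * indicator D h' * ennreal (cmod (J (h - h'))) \<le> ennreal (cmod (J (- h' + h))) * indicator {k. norm k \<le> \<rho>} (- h' + h)"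
          by (auto simp: indicator_def)
      qed
      also have "\<dots> = ?I" by (rule nn_integral_translate) measurable
      finally show ?thesis using True by simp
    qed simp
  qed
  also have "\<dots> = ennreal (v (\<rho> / 2)) * ?I"
  proof -
    have "(\<integral>\<^sup>+h'. indicator D h' \<partial>lborel) = ennreal (v (\<rho> / 2))" by (simp add: D_def ev)
    then show ?thesis by (subst nn_integral_multc) auto
  qed
  finally have main: "ennreal (LINT x|lborel. (cmod (G x))\<^sup>2) \<le> ennreal (v (\<rho> / 2)) * ?I" .
  have vp: "0 < v (\<rho> / 2)" using vpos \<rho> by simp
  have "ennreal ((v (\<rho> / 2))\<^sup>2 * (cmod (LINT x|lborel. F x))\<^sup>2) \<le> ennreal (v 2) * (ennreal (v (\<rho> / 2)) * ?I)"
    using order_trans[OF CS mult_left_mono[OF main, of "ennreal (v 2)"]] vp by (simp add: IG norm_mult power_mult_distrib)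
  \<comment> \<open>The average contributes |D|^2 on the left and the integration over the second
    shift one |D| on the right; one factor is cancelled.\<close>
  then have "ennreal (v (\<rho> / 2)) * ennreal (v (\<rho> / 2) * (cmod (LINT x|lborel. F x))\<^sup>2) \<le> ennreal (v (\<rho> / 2)) * (ennreal (v 2) * ?I)"
    using vp by (simp add: ennreal_mult[symmetric] power2_eq_square mult_ac)
  then show ?thesis unfolding J_def[symmetric]
    using vp by (subst (asm) ennreal_mult_le_mult_iff) auto
qed

text \<open>The correlation at shift k has phase t |k| \<open>\<theta> k\<close>, with gradient at
  least a constant times |t| |k|, so it is bounded by a constant and by a multiple of (|t|
  |k|)^(-N). Integrating over k gives O(|t|^(-d)), and van der Corput turns this into a bound for
  the square of the integral. The linear phase leaves only the constant
  \<open>cis (x \<bullet> k)\<close>, hence the uniformity in x.\<close>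

lemma dispersive_estimate:
  fixes \<phi> :: "real^'n::finite \<Rightarrow> real" and A :: "real^'n \<Rightarrow> complex"
  assumes phi: "smooth \<phi>" and K: "compact K" "K \<subseteq> ball 0 1" and hess: "\<forall>\<xi>\<in>K. det (hessian \<phi> \<xi>) \<noteq> 0"
    and Ac: "continuous_on UNIV A" and A0: "\<And>x. x \<notin> K \<Longrightarrow> A x = 0"
    and Aj: "\<And>n. jet n {k. norm k \<le> 1} (ball 0 1) (\<lambda>k x. A (x + k))"
    and Aj': "\<And>n. jet n {k. norm k \<le> 1} (ball 0 1) (\<lambda>k x. cnj (A (x + k)))"
  obtains C where "0 < C" "\<And>t x. t \<noteq> 0 \<Longrightarrow>
    cmod (LINT \<xi>|lborel. cis (x \<bullet> \<xi> + t * \<phi> \<xi>) * A \<xi>) \<le> C * \<bar>t\<bar> powr (- real CARD('n) / 2)"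
proof -
  define d where "d = CARD('n)"
  have dd: "real DIM(real^'n) = real d" by (simp add: d_def)
  obtain \<rho> c S where \<rho>: "0 < \<rho>" "\<rho> \<le> 1" and c: "0 < c" and S: "open S" "K \<subseteq> S" "S \<subseteq> ball 0 1"
    and low: "\<And>k x. 0 < norm k \<Longrightarrow> norm k \<le> \<rho> \<Longrightarrow> x \<in> S \<Longrightarrow> c \<le> (\<Sum>i\<in>UNIV. ((partial_deriv i \<phi> (x + k) - partial_deriv i \<phi> x) / norm k)\<^sup>2)"
    using gradient_difference_lower_bound[OF phi K hess] by blast
  define P where "P = {k::real^'n. 0 < norm k \<and> norm k \<le> \<rho>}"
  \<comment> \<open>Normalised by |k|, so that the large parameter becomes t |k| and all shifts form
    one family with uniform bounds.\<close>
  define \<theta> where "\<theta> k x = (\<phi> (x + k) - \<phi> x) / norm k" for k x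
  define \<theta>' where "\<theta>' i k x = (partial_deriv i \<phi> (x + k) - partial_deriv i \<phi> x) / norm k" for i k x
  define b where "b k x = A (x + k) * cnj (A x)" for k x
  have jb: "jet n P S b" for n
  proof -
    have 1: "jet n P S (\<lambda>k x. A (x + k))" by (rule jet_subset[OF Aj]) (use \<rho> S in \<open>auto simp: P_def\<close>)
    have "jet n P (ball 0 1) (\<lambda>k x. cnj (A (x + 0)))" by (rule jet_reparam[OF Aj']) auto
    then have 2: "jet n P S (\<lambda>k x. cnj (A x))" using S by (auto intro: jet_subset)
    show ?thesis unfolding b_def[abs_def] by (rule jet_mult[OF 1 2])
  qed
  have tj: "jet n P S (\<lambda>p x. of_real (\<theta>' i p x))" for n i
  proof -
    have "jet n P S (\<lambda>k x. complex_of_real ((partial_deriv i \<phi> (x + k) - partial_deriv i \<phi> x) /\<^sub>R norm k))"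
      by (rule jet_subset[OF jet_diff_quotient[OF bounded_linear_of_real smooth_partial_deriv[OF phi]]]) (use \<rho> S in \<open>auto simp: P_def\<close>)
    then show ?thesis by (simp add: \<theta>'_def[abs_def] divide_inverse_commute)
  qed
  have tc: "continuous_on S (\<theta> p)" for p
    unfolding \<theta>_def[abs_def] divide_inverse
    by (intro continuous_on_mult continuous_on_diff continuous_on_const smooth_continuous_on[OF phi]
        continuous_on_compose2[OF smooth_continuous_on[OF phi, of UNIV], of _ "\<lambda>x. x + p"] continuous_on_add continuous_on_id) auto
  have td: "partial_at (\<theta> p) i x (\<theta>' i p x)" for p i x
  proof -
    have a: "partial_at (\<lambda>x. \<phi> (x + p)) i x (partial_deriv i \<phi> (x + p))"
      using smooth_partial_at[OF phi, of "x + p" i] by (simp add: add_ac)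
    show ?thesis unfolding \<theta>_def \<theta>'_def
      by (intro has_vector_derivative_divide has_vector_derivative_diff a smooth_partial_at[OF phi])
  qed
  have b0: "b p x = 0" if "x \<in> S - K" for p x using that A0 by (simp add: b_def)
  \<comment> \<open>The least integer for which |k|^(-N) is integrable at infinity.\<close>
  define N where "N = d + 1"
  obtain C1 where C1: "0 \<le> C1" and J1: "\<And>p \<tau>. p \<in> P \<Longrightarrow> \<tau> \<noteq> 0 \<Longrightarrow>
      cmod (LINT x|lborel. (if x \<in> S then cis (\<tau> * \<theta> p x) * b p x else 0)) \<le> C1 / \<bar>\<tau>\<bar> ^ N"
  proof -
    have "\<exists>C\<ge>0. \<forall>p\<in>P. \<forall>\<tau>. \<tau> \<noteq> 0 \<longrightarrow>
      integrable lborel (\<lambda>x. if x \<in> S then cis (\<tau> * \<theta> p x) * b p x else 0) \<and>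
      cmod (LINT x|lborel. (if x \<in> S then cis (\<tau> * \<theta> p x) * b p x else 0)) \<le> C / \<bar>\<tau>\<bar> ^ N"
      by (rule nonstationary_phase[where K=K and \<theta>'=\<theta>' and c=c])
         (use S K tc td tj c jb b0 low in \<open>auto simp: P_def \<theta>'_def compact_imp_closed\<close>)
    then show ?thesis using that by blast
  qed
  obtain B where B0: "0 \<le> B" and B: "\<And>x. cmod (A x) \<le> B"
  proof -
    have "compact (A ` K)" by (intro compact_continuous_image continuous_on_subset[OF Ac] K) auto
    then obtain B where "\<And>x. x \<in> K \<Longrightarrow> cmod (A x) \<le> B" by (meson bounded_iff compact_imp_bounded imageI)
    then have "cmod (A x) \<le> max B 0" for x using A0[of x] by (cases "x \<in> K") (auto simp: max.coboundedI1)
    then show ?thesis using that[of "max B 0"] by simp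
  qed
  define v where "v r = measure lborel (ball (0::real^'n) r)" for r
  have vpos: "0 < v r" if "0 < r" for r unfolding v_def using content_ball_pos[OF that, of "0::real^'n"] by simp
  define u where "u = unit_ball_vol (real d)"
  have u0: "0 \<le> u" by (simp add: u_def)
  define C0 where "C0 = B * B * v 1"
  define C2 where "C2 = C0 * u + C1 * (u * real N / (real N - real d))"
  have C20: "0 \<le> C2" unfolding C2_def C0_def N_def using B0 C1 u0 vpos[of 1] by (intro add_nonneg_nonneg mult_nonneg_nonneg divide_nonneg_nonneg) auto
  \<comment> \<open>The summand 1 makes the constant positive even if \<open>C2\<close> is
    0.\<close>
  define C where "C = sqrt (v 2 * C2 / v (\<rho> / 2)) + 1"
  show ?thesis
  proof (rule that[of C])
    show "0 < C" unfolding C_def using C20 vpos[of 2] vpos[of "\<rho> / 2"] \<rho> by (intro add_nonneg_pos) auto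
    fix t :: real and x :: "real^'n" assume t: "t \<noteq> 0"
    define F where "F \<xi> = cis (x \<bullet> \<xi> + t * \<phi> \<xi>) * A \<xi>" for \<xi>
    have "continuous_on UNIV F" unfolding F_def[abs_def] by (intro continuous_intros smooth_continuous_on[OF phi] Ac)
    then have Fm[measurable]: "F \<in> borel_measurable borel" by (rule borel_measurable_continuous_onI)
    have Fb: "cmod (F \<xi>) \<le> B" for \<xi> using B by (simp add: F_def norm_mult)
    have Fs: "F \<xi> = 0" if "\<xi> \<notin> ball 0 1" for \<xi> using A0[of \<xi>] subsetD[OF K(2), of \<xi>] that by (auto simp: F_def)
    define J where "J k = (LINT \<xi>|lborel. F (\<xi> + k) * cnj (F \<xi>))" for k
    have [measurable]: "J \<in> borel_measurable borel" unfolding J_def[abs_def] by measurable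
    have Ja: "cmod (J k) \<le> C0" for k
    proof -
      have bfin: "emeasure lborel (ball (0::real^'n) 1) < \<infinity>" by (rule emeasure_ball_finite)
      have le: "cmod (F (\<xi> + k) * cnj (F \<xi>)) \<le> B * B * indicator (ball 0 1) \<xi>" for \<xi>
        using Fb Fs[of \<xi>] B0 by (auto simp: indicator_def norm_mult intro!: mult_mono)
      have w: "integrable lborel (\<lambda>\<xi>::real^'n. B * B * indicator (ball 0 1) \<xi>)" using bfin by (intro integrable_mult_right) auto
      have "integrable lborel (\<lambda>\<xi>. F (\<xi> + k) * cnj (F \<xi>))"
      proof (rule Bochner_Integration.integrable_bound[OF w])
        show "AE \<xi> in lborel. cmod (F (\<xi> + k) * cnj (F \<xi>)) \<le> norm (B * B * indicator (ball 0 1) \<xi>)"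
          unfolding real_norm_def by (intro AE_I2 order_trans[OF le abs_ge_self])
      qed measurable
      then have "cmod (J k) \<le> (LINT \<xi>|lborel. B * B * indicator (ball (0::real^'n) 1) \<xi>)"
        unfolding J_def by (rule Bochner_Integration.integral_norm_bound_integral[OF _ w le])
      then show ?thesis using bfin by (simp add: C0_def v_def)
    qed
    have Jb: "cmod (J k) \<le> C1 * \<bar>t\<bar> powr (- real N) * norm k powr (- real N)" if k: "k \<in> P" for k
    proof -
      have nk: "0 < norm k" using k by (simp add: P_def)
      \<comment> \<open>Outside S the conjugated factor vanishes, since A is supported in K; inside,
        the linear phases cancel up to the constant x . k.\<close>
      have "J k = (LINT \<xi>|lborel. cis (x \<bullet> k) * (if \<xi> \<in> S then cis (t * norm k * \<theta> k \<xi>) * b k \<xi> else 0))"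
        unfolding J_def
      proof (rule Bochner_Integration.integral_cong[OF refl])
        fix \<xi>
        show "F (\<xi> + k) * cnj (F \<xi>) = cis (x \<bullet> k) * (if \<xi> \<in> S then cis (t * norm k * \<theta> k \<xi>) * b k \<xi> else 0)"
        proof (cases "\<xi> \<in> S")
          case True
          have e: "t * norm k * \<theta> k \<xi> = t * (\<phi> (\<xi> + k) - \<phi> \<xi>)" using nk by (simp add: \<theta>_def)
          have "cis (x \<bullet> (\<xi> + k) + t * \<phi> (\<xi> + k)) * cis (- (x \<bullet> \<xi> + t * \<phi> \<xi>)) = cis (x \<bullet> k) * cis (t * norm k * \<theta> k \<xi>)"
            unfolding cis_mult e by (intro arg_cong[where f=cis]) (simp add: inner_add_right algebra_simps)
          then show ?thesis using True by (simp add: F_def b_def cis_cnj)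
        next
          case False
          then show ?thesis using A0[of \<xi>] S by (auto simp: F_def)
        qed
      qed
      also have "cmod \<dots> = cmod (LINT \<xi>|lborel. (if \<xi> \<in> S then cis (t * norm k * \<theta> k \<xi>) * b k \<xi> else 0))"
        by (simp only: integral_mult_right_zero norm_mult norm_cis mult_1_left)
      also have "\<dots> \<le> C1 / \<bar>t * norm k\<bar> ^ N" using t nk by (intro J1 k) auto
      also have "\<dots> = C1 * \<bar>t\<bar> powr (- real N) * norm k powr (- real N)"
        using t nk by (simp add: abs_mult power_mult_distrib powr_minus powr_realpow divide_inverse)
      finally show ?thesis .
    qed
    \<comment> \<open>The trivial bound is used for |k| <= 1 / |t|, where there is no oscillation to
      exploit, and nonstationary phase beyond; each range contributes a multiple of
      |t|^(-d).\<close>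
    have "(\<integral>\<^sup>+k. ennreal (cmod (J k)) * indicator {k. norm k \<le> \<rho>} k \<partial>lborel)
      \<le> (\<integral>\<^sup>+(k::real^'n). ennreal C0 * indicator {k. norm k \<le> 1 / \<bar>t\<bar>} k + ennreal (C1 * \<bar>t\<bar> powr (- real N)) * (ennreal (norm k powr (- real N)) * indicator {k. 1 / \<bar>t\<bar> < norm k} k) \<partial>lborel)"
    proof (rule nn_integral_mono)
      fix k :: "real^'n"
      show "ennreal (cmod (J k)) * indicator {k. norm k \<le> \<rho>} k \<le> ennreal C0 * indicator {k. norm k \<le> 1 / \<bar>t\<bar>} k + ennreal (C1 * \<bar>t\<bar> powr (- real N)) * (ennreal (norm k powr (- real N)) * indicator {k. 1 / \<bar>t\<bar> < norm k} k)"
      proof (cases "norm k \<le> 1 / \<bar>t\<bar>")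
        case True
        then show ?thesis using Ja[of k] by (auto simp: indicator_def intro: ennreal_leI)
      next
        case False
        then have "0 < norm k" using t by (intro le_less_trans[of 0 "1 / \<bar>t\<bar>"]) auto
        then have "norm k \<le> \<rho> \<Longrightarrow> k \<in> P" by (simp add: P_def)
        then show ?thesis using False Jb[of k] C1 by (auto simp: indicator_def ennreal_mult'[symmetric] intro: ennreal_leI)
      qed
    qed
    also have "\<dots> = (\<integral>\<^sup>+(k::real^'n). ennreal C0 * indicator {k. norm k \<le> 1 / \<bar>t\<bar>} k \<partial>lborel)
        + (\<integral>\<^sup>+(k::real^'n). ennreal (C1 * \<bar>t\<bar> powr (- real N)) * (ennreal (norm k powr (- real N)) * indicator {k. 1 / \<bar>t\<bar> < norm k} k) \<partial>lborel)"
      by (rule nn_integral_add) measurable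
    also have "(\<integral>\<^sup>+(k::real^'n). ennreal C0 * indicator {k. norm k \<le> 1 / \<bar>t\<bar>} k \<partial>lborel) = ennreal C0 * emeasure lborel {k::real^'n. norm k \<le> 1 / \<bar>t\<bar>}"
      by (rule nn_integral_cmult_indicator) measurable
    also have "(\<integral>\<^sup>+(k::real^'n). ennreal (C1 * \<bar>t\<bar> powr (- real N)) * (ennreal (norm k powr (- real N)) * indicator {k. 1 / \<bar>t\<bar> < norm k} k) \<partial>lborel)
        = ennreal (C1 * \<bar>t\<bar> powr (- real N)) * (\<integral>\<^sup>+(k::real^'n). ennreal (norm k powr (- real N)) * indicator {k. 1 / \<bar>t\<bar> < norm k} k \<partial>lborel)"
      by (rule nn_integral_cmult) measurable
    also have "ennreal C0 * emeasure lborel {k::real^'n. norm k \<le> 1 / \<bar>t\<bar>} + ennreal (C1 * \<bar>t\<bar> powr (- real N)) * (\<integral>\<^sup>+(k::real^'n). ennreal (norm k powr (- real N)) * indicator {k. 1 / \<bar>t\<bar> < norm k} k \<partial>lborel)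
      \<le> ennreal C0 * ennreal (u * (1 / \<bar>t\<bar>) powr real d) + ennreal (C1 * \<bar>t\<bar> powr (- real N)) * ennreal (u * real N / (real N - real d) * (1 / \<bar>t\<bar>) powr (real d - real N))"
    proof (intro add_mono mult_left_mono)
      show "emeasure lborel {k::real^'n. norm k \<le> 1 / \<bar>t\<bar>} \<le> ennreal (u * (1 / \<bar>t\<bar>) powr real d)"
        by (subst emeasure_cball_0) (auto simp: u_def d_def)
      show "(\<integral>\<^sup>+(k::real^'n). ennreal (norm k powr (- real N)) * indicator {k. 1 / \<bar>t\<bar> < norm k} k \<partial>lborel) \<le> ennreal (u * real N / (real N - real d) * (1 / \<bar>t\<bar>) powr (real d - real N))"
        using nn_integral_norm_powr_outside[where 'a="real^'n", of "real N" "1 / \<bar>t\<bar>"] t unfolding dd by (simp add: N_def u_def)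
    qed auto
    also have "\<dots> = ennreal (C2 * \<bar>t\<bar> powr (- real d))"
    proof -
      have e: "(1 / \<bar>t\<bar>) powr a = \<bar>t\<bar> powr (- a)" for a using t by (simp add: powr_divide powr_minus_divide)
      have e1: "(1 / \<bar>t\<bar>) powr real d = \<bar>t\<bar> powr (- real d)" by (rule e)
      have e2: "(1 / \<bar>t\<bar>) powr (real d - real N) = \<bar>t\<bar> powr (real N - real d)" by (subst e) simp
      have e3: "\<bar>t\<bar> powr (- real N) * \<bar>t\<bar> powr (real N - real d) = \<bar>t\<bar> powr (- real d)" by (simp add: powr_add[symmetric])
      have "C0 * (u * \<bar>t\<bar> powr (- real d)) + C1 * \<bar>t\<bar> powr (- real N) * (u * real N / (real N - real d) * \<bar>t\<bar> powr (real N - real d))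
        = C0 * (u * \<bar>t\<bar> powr (- real d)) + C1 * (u * real N / (real N - real d)) * (\<bar>t\<bar> powr (- real N) * \<bar>t\<bar> powr (real N - real d))"
        by (simp add: mult_ac)
      also have "\<dots> = C2 * \<bar>t\<bar> powr (- real d)" unfolding e3 by (simp add: C2_def algebra_simps)
      finally have *: "C0 * (u * \<bar>t\<bar> powr (- real d)) + C1 * \<bar>t\<bar> powr (- real N) * (u * real N / (real N - real d) * \<bar>t\<bar> powr (real N - real d)) = C2 * \<bar>t\<bar> powr (- real d)" .
      have gen: "ennreal a * ennreal b + ennreal c * ennreal d = ennreal (a * b + c * d)"
        if "0 \<le> a" "0 \<le> b" "0 \<le> c" "0 \<le> d" for a b c d using that by (simp add: ennreal_mult ennreal_plus)
      have C00: "0 \<le> C0" unfolding C0_def using B0 vpos[of 1] by auto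
      have nd: "0 \<le> u * real N / (real N - real d)" using u0 by (auto simp: N_def)
      show ?thesis unfolding e1 e2 *[symmetric]
        by (rule gen; intro mult_nonneg_nonneg nd C00 C1 u0 powr_ge_zero)
    qed
    finally have I: "(\<integral>\<^sup>+k. ennreal (cmod (J k)) * indicator {k. norm k \<le> \<rho>} k \<partial>lborel) \<le> ennreal (C2 * \<bar>t\<bar> powr (- real d))" .
    have "ennreal (v (\<rho> / 2) * (cmod (LINT \<xi>|lborel. F \<xi>))\<^sup>2) \<le> ennreal (v 2) * (\<integral>\<^sup>+k. ennreal (cmod (J k)) * indicator {k. norm k \<le> \<rho>} k \<partial>lborel)"
      unfolding v_def J_def by (rule van_der_corput[of F B]) (use Fm Fb Fs \<rho> in auto)
    also have "\<dots> \<le> ennreal (v 2) * ennreal (C2 * \<bar>t\<bar> powr (- real d))" by (intro mult_left_mono I) auto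
    also have "\<dots> = ennreal (v 2 * (C2 * \<bar>t\<bar> powr (- real d)))" using vpos[of 2] by (subst ennreal_mult') auto
    finally have "v (\<rho> / 2) * (cmod (LINT \<xi>|lborel. F \<xi>))\<^sup>2 \<le> v 2 * (C2 * \<bar>t\<bar> powr (- real d))"
      using vpos[of 2] C20 by (subst (asm) ennreal_le_iff) auto
    then have "(cmod (LINT \<xi>|lborel. F \<xi>))\<^sup>2 \<le> v 2 * C2 / v (\<rho> / 2) * \<bar>t\<bar> powr (- real d)"
      using vpos[of "\<rho> / 2"] \<rho> by (simp add: field_simps)
    also have "\<dots> = (sqrt (v 2 * C2 / v (\<rho> / 2)) * \<bar>t\<bar> powr (- real d / 2))\<^sup>2"
      using vpos[of "\<rho> / 2"] vpos[of 2] \<rho> C20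
      by (simp add: power_mult_distrib power2_eq_square[of "_ powr _"] powr_add[symmetric])
    finally have "cmod (LINT \<xi>|lborel. F \<xi>) \<le> sqrt (v 2 * C2 / v (\<rho> / 2)) * \<bar>t\<bar> powr (- real d / 2)"
      by (rule power2_le_imp_le) (use vpos[of "\<rho> / 2"] vpos[of 2] \<rho> C20 in auto)
    also have "\<dots> \<le> C * \<bar>t\<bar> powr (- real d / 2)" unfolding C_def by (intro mult_right_mono) auto
    finally show "cmod (LINT \<xi>|lborel. cis (x \<bullet> \<xi> + t * \<phi> \<xi>) * A \<xi>) \<le> C * \<bar>t\<bar> powr (- real CARD('n) / 2)"
      by (simp add: F_def d_def)
  qed
qed

section \<open>Estimates at a fixed time\<close>

text \<open>Chebyshev's inequality for \<open>F2\<close>, which must reach l / 2 wherever F reaches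
  l; 4 is the square of 2. The result has the shape of the hypothesis in
  \<open>strong_type_of_level_sets\<close>.\<close>

lemma level_set_split:
  fixes F :: "'a::euclidean_space \<Rightarrow> complex"
  assumes [measurable]: "F2 \<in> borel_measurable borel" and F: "\<And>x. F x = F1 x + F2 x" and F1: "\<And>x. cmod (F1 x) \<le> l / 2" and l: "0 < l"
  shows "emeasure lborel {x \<in> space lborel. l \<le> cmod (F x)} \<le> ennreal (l powr (-2)) * (4 * sqnorm F2)"
proof -
  have "emeasure lborel {x \<in> space lborel. l \<le> cmod (F x)} \<le> emeasure lborel {x. l / 2 \<le> cmod (F2 x)}"
  proof (rule emeasure_mono)
    show "{x \<in> space lborel. l \<le> cmod (F x)} \<subseteq> {x. l / 2 \<le> cmod (F2 x)}"
    proof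
      fix x assume "x \<in> {x \<in> space lborel. l \<le> cmod (F x)}"
      then have "l \<le> cmod (F1 x + F2 x)" by (simp add: F)
      also have "\<dots> \<le> cmod (F1 x) + cmod (F2 x)" by (rule norm_triangle_ineq)
      finally show "x \<in> {x. l / 2 \<le> cmod (F2 x)}" using F1[of x] by simp
    qed
  qed measurable
  also have "\<dots> = (\<integral>\<^sup>+x. indicator {x. l / 2 \<le> cmod (F2 x)} x \<partial>lborel)" by simp
  also have "\<dots> \<le> (\<integral>\<^sup>+x. ennreal (4 * l powr (-2)) * ennreal ((cmod (F2 x))\<^sup>2) \<partial>lborel)"
  proof (rule nn_integral_mono)
    fix x
    have "1 \<le> 4 * l powr (-2) * (cmod (F2 x))\<^sup>2" if "l / 2 \<le> cmod (F2 x)"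
    proof -
      have "(l / 2)\<^sup>2 \<le> (cmod (F2 x))\<^sup>2" using that l by (intro power_mono) auto
      then show ?thesis using l by (simp add: powr_minus powr_realpow[of l 2, simplified] field_simps)
    qed
    then show "indicator {x. l / 2 \<le> cmod (F2 x)} x \<le> ennreal (4 * l powr (-2)) * ennreal ((cmod (F2 x))\<^sup>2)"
      using ennreal_leI[of 1 "4 * l powr (-2) * (cmod (F2 x))\<^sup>2"] by (auto simp: indicator_def ennreal_mult'[symmetric])
  qed
  also have "\<dots> = ennreal (4 * l powr (-2)) * sqnorm F2" unfolding sqnorm_def by (rule nn_integral_cmult) measurable
  also have "\<dots> = ennreal (l powr (-2)) * (4 * sqnorm F2)" by (simp add: ennreal_mult mult_ac)
  finally show ?thesis .
qed

lemma ennreal_le_of_sq_le: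
  assumes "x\<^sup>2 \<le> (ennreal c)\<^sup>2" "0 \<le> c" shows "x \<le> ennreal c"
proof (cases x)
  case (real r)
  then have "r\<^sup>2 \<le> c\<^sup>2" using assms by (simp add: ennreal_power)
  then show ?thesis using real assms by (auto intro: ennreal_leI power2_le_imp_le)
next
  case top
  then show ?thesis using assms by (simp add: ennreal_power top_unique)
qed

lemma powr_times_self: "x powr s * x powr s = x powr (2 * s)" for x s :: real
  by (simp only: powr_add[symmetric] mult_2)

lemma sqnorm_mult_le:
  assumes [measurable]: "f \<in> borel_measurable borel" and b: "\<And>x. cmod (b x) \<le> B"
  shows "sqnorm (\<lambda>x. b x * f x) \<le> ennreal (B\<^sup>2) * sqnorm f"
proof -
  have "sqnorm (\<lambda>x. b x * f x) \<le> (\<integral>\<^sup>+x. ennreal (B\<^sup>2) * ennreal ((cmod (f x))\<^sup>2) \<partial>lborel)"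
    unfolding sqnorm_def
  proof (rule nn_integral_mono)
    fix x
    have "(cmod (b x))\<^sup>2 * (cmod (f x))\<^sup>2 \<le> B\<^sup>2 * (cmod (f x))\<^sup>2" using b by (intro mult_right_mono power_mono) auto
    then show "ennreal ((cmod (b x * f x))\<^sup>2) \<le> ennreal (B\<^sup>2) * ennreal ((cmod (f x))\<^sup>2)"
      by (simp add: norm_mult power_mult_distrib ennreal_mult'[symmetric] ennreal_leI)
  qed
  also have "\<dots> = ennreal (B\<^sup>2) * sqnorm f" unfolding sqnorm_def by (rule nn_integral_cmult) measurable
  finally show ?thesis .
qed

text \<open>From here on phase and amplitude enter only through a size bound, the support and the
  decay of two kernels. \<open>disp\<close> serves the operator itself, applied to inverse
  transforms; \<open>disp_sq\<close>, with amplitude |a|^2, is the kernel of the operator composed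
  with its adjoint.\<close>

locale dispersive_operator =
  fixes \<phi> :: "'a::euclidean_space \<Rightarrow> real" and a :: "'a \<Rightarrow> complex" and A D :: real
  assumes phi_meas [measurable]: "\<phi> \<in> borel_measurable borel" and a_meas [measurable]: "a \<in> borel_measurable borel"
    and a_bd: "cmod (a \<xi>) \<le> A" and a_supp: "\<xi> \<notin> ball 0 1 \<Longrightarrow> a \<xi> = 0" and A_pos: "0 < A" and D_pos: "0 < D"
    and disp: "t \<noteq> 0 \<Longrightarrow> cmod (LINT \<xi>|lborel. cis (x \<bullet> \<xi> + t * \<phi> \<xi>) * a \<xi>) \<le> D * \<bar>t\<bar> powr (- real DIM('a) / 2)"
    and disp_sq: "t \<noteq> 0 \<Longrightarrow> cmod (LINT \<xi>|lborel. cis (x \<bullet> \<xi> + t * \<phi> \<xi>) * (a \<xi> * cnj (a \<xi>))) \<le> D * \<bar>t\<bar> powr (- real DIM('a) / 2)"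
begin

definition T :: "real \<Rightarrow> ('a \<Rightarrow> complex) \<Rightarrow> 'a \<Rightarrow> complex" where
  "T t f x = (LINT \<xi>|lborel. cis (x \<bullet> \<xi> + t * \<phi> \<xi>) * (a \<xi> * f \<xi>))"

lemma measurable_T_pair [measurable]:
  assumes [measurable]: "f \<in> borel_measurable borel"
  shows "(\<lambda>p. T (fst p) f (snd p)) \<in> borel_measurable (borel \<Otimes>\<^sub>M borel)"
  unfolding T_def by measurable

lemma measurable_T [measurable]:
  assumes [measurable]: "f \<in> borel_measurable borel"
  shows "T t f \<in> borel_measurable borel"
  unfolding T_def[abs_def] by measurable

lemma integrable_af:
  assumes [measurable]: "f \<in> borel_measurable borel" and f: "sqnorm f < \<infinity>"
  shows "integrable lborel (\<lambda>\<xi>. a \<xi> * f \<xi>)"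
proof -
  have "integrable lborel (\<lambda>x. A * cmod (if x \<in> ball 0 1 then f x else 0))"
    by (intro integrable_mult_right integrable_norm integrable_L2_truncation f emeasure_ball_finite) auto
  then show ?thesis
    by (rule Bochner_Integration.integrable_bound)
       (use a_bd a_supp A_pos in \<open>auto simp: norm_mult abs_mult intro!: mult_right_mono\<close>)
qed

lemma integrable_T:
  assumes [measurable]: "f \<in> borel_measurable borel" and f: "sqnorm f < \<infinity>"
  shows "integrable lborel (\<lambda>\<xi>. cis (x \<bullet> \<xi> + t * \<phi> \<xi>) * (a \<xi> * f \<xi>))"
  by (intro integrable_cis_mult integrable_af f) measurable

lemma T_add:
  assumes [measurable]: "f \<in> borel_measurable borel" "g \<in> borel_measurable borel" and f: "sqnorm f < \<infinity>" "sqnorm g < \<infinity>"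
  shows "T t (\<lambda>x. f x + g x) x = T t f x + T t g x"
  unfolding T_def using Bochner_Integration.integral_add[OF integrable_T[OF _ f(1)] integrable_T[OF _ f(2)]]
  by (simp add: distrib_left)

definition L2_const :: real where "L2_const = (2 * pi) ^ DIM('a) * A\<^sup>2"

lemma L2_const_pos: "0 < L2_const" unfolding L2_const_def using A_pos by simp

text \<open>At fixed t this is, up to a reflection, the Fourier transform of a f times a unimodular
  factor, so Plancherel's inequality applies and loses (2 pi)^d A^2.\<close>

lemma sqnorm_T_le:
  assumes [measurable]: "f \<in> borel_measurable borel" and f: "sqnorm f < \<infinity>"
  shows "sqnorm (T t f) \<le> ennreal L2_const * sqnorm f"
proof -
  define h where "h \<xi> = cis (t * \<phi> \<xi>) * (a \<xi> * f \<xi>)" for \<xi>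
  have hi: "integrable lborel h" unfolding h_def[abs_def] by (intro integrable_cis_mult integrable_af f) measurable
  then have [measurable]: "h \<in> borel_measurable borel" by auto
  have "T t f x = FT h (- x)" for x
    unfolding T_def FT_def h_def by (simp add: cis_mult[symmetric] inner_commute mult.assoc)
  then have "sqnorm (T t f) = sqnorm (\<lambda>x. FT h (- x))" by (simp add: sqnorm_def)
  also have "\<dots> = sqnorm (FT h)" by (rule sqnorm_uminus_arg) measurable
  also have "\<dots> \<le> ennreal ((2 * pi) ^ DIM('a)) * sqnorm h" by (rule sqnorm_FT_le[OF hi])
  also have "sqnorm h = sqnorm (\<lambda>\<xi>. (cis (t * \<phi> \<xi>) * a \<xi>) * f \<xi>)" by (simp add: h_def[abs_def] mult.assoc)
  also have "\<dots> \<le> ennreal (A\<^sup>2) * sqnorm f" by (rule sqnorm_mult_le) (use a_bd in \<open>auto simp: norm_mult\<close>)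
  finally have "sqnorm (T t f) \<le> ennreal ((2 * pi) ^ DIM('a)) * (ennreal (A\<^sup>2) * sqnorm f)"
    by (simp add: mult_left_mono)
  then show ?thesis by (simp only: L2_const_def ennreal_mult' mult.assoc zero_le_power2 ennreal_mult'')
qed

definition sup_const :: real where "sup_const = A * sqrt (measure lborel (ball (0::'a) 1))"

text \<open>Cauchy-Schwarz on the unit ball, where the amplitude lives. The bound is uniform in time
  and includes t = 0, where the dispersive bounds are silent.\<close>

lemma norm_T_le:
  assumes [measurable]: "f \<in> borel_measurable borel" and f: "sqnorm f \<le> ennreal (W\<^sup>2)" and W: "0 \<le> W"
  shows "cmod (T t f x) \<le> sup_const * W"
proof -
  define v where "v = measure lborel (ball (0::'a) 1)"
  have v: "0 \<le> v" by (simp add: v_def)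
  have ev: "emeasure lborel (ball (0::'a) 1) = ennreal v"
    unfolding v_def using emeasure_ball_finite[of "0::'a" 1] by (intro emeasure_eq_ennreal_measure) auto
  have [measurable]: "ball (0::'a) 1 \<in> sets borel" by simp
  have "ennreal (cmod (T t f x)) \<le> (\<integral>\<^sup>+\<xi>. ennreal (cmod (cis (x \<bullet> \<xi> + t * \<phi> \<xi>) * (a \<xi> * f \<xi>))) \<partial>lborel)"
    unfolding T_def by (rule ennreal_norm_integral_le)
  also have "\<dots> \<le> (\<integral>\<^sup>+\<xi>. (ennreal A * indicator (ball 0 1) \<xi>) * ennreal (cmod (f \<xi>)) \<partial>lborel)"
    using a_bd a_supp A_pos
    by (intro nn_integral_mono) (auto simp: norm_mult indicator_def ennreal_mult'[symmetric] intro!: ennreal_leI mult_right_mono)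
  finally have "(ennreal (cmod (T t f x)))\<^sup>2 \<le> (\<integral>\<^sup>+\<xi>. (ennreal A * indicator (ball 0 1) \<xi>) * ennreal (cmod (f \<xi>)) \<partial>lborel)\<^sup>2"
    by (intro power_mono) auto
  also have "\<dots> \<le> (\<integral>\<^sup>+\<xi>. (ennreal A * indicator (ball (0::'a) 1) \<xi>)\<^sup>2 \<partial>lborel) * (\<integral>\<^sup>+\<xi>. (ennreal (cmod (f \<xi>)))\<^sup>2 \<partial>lborel)"
    by (rule Cauchy_Schwarz_nn_integral) measurable
  also have "(\<integral>\<^sup>+\<xi>. (ennreal A * indicator (ball (0::'a) 1) \<xi>)\<^sup>2 \<partial>lborel) = (\<integral>\<^sup>+\<xi>. ennreal (A\<^sup>2) * indicator (ball (0::'a) 1) \<xi> \<partial>lborel)"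
    using A_pos by (intro nn_integral_cong) (auto simp: indicator_def ennreal_power)
  also have "\<dots> = ennreal (A\<^sup>2 * v)"
    using v by (subst nn_integral_cmult_indicator) (auto simp: ev ennreal_mult)
  also have "(\<integral>\<^sup>+\<xi>. (ennreal (cmod (f \<xi>)))\<^sup>2 \<partial>lborel) = sqnorm f" by (simp add: sqnorm_def ennreal_power)
  finally have "ennreal ((cmod (T t f x))\<^sup>2) \<le> ennreal (A\<^sup>2 * v) * sqnorm f" by (simp add: ennreal_power)
  also have "\<dots> \<le> ennreal (A\<^sup>2 * v) * ennreal (W\<^sup>2)" by (intro mult_left_mono f) auto
  also have "\<dots> = ennreal ((sup_const * W)\<^sup>2)"
    using v A_pos by (subst ennreal_mult[symmetric]) (auto simp: sup_const_def v_def[symmetric] power_mult_distrib)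
  finally have "(cmod (T t f x))\<^sup>2 \<le> (sup_const * W)\<^sup>2" by (subst (asm) ennreal_le_iff) auto
  then show ?thesis by (rule power2_le_imp_le) (use A_pos W in \<open>auto simp: sup_const_def\<close>)
qed

text \<open>Fubini turns the operator applied to an inverse transform into integration of k against
  the kernel of \<open>disp\<close> at x + y, so L^1 data on the transform side decay
  uniformly.\<close>

lemma T_inFT_bound:
  assumes k: "integrable lborel k" and t: "t \<noteq> 0"
  shows "cmod (T t (inFT k) x) \<le> (2 * pi) powr (- real DIM('a) / 2) * (D * \<bar>t\<bar> powr (- real DIM('a) / 2)) * (LINT y|lborel. cmod (k y))"
proof -
  define c where "c = (2 * pi) powr (- real DIM('a) / 2)"
  have c0: "0 \<le> c" by (simp add: c_def)
  define E where "E = D * \<bar>t\<bar> powr (- real DIM('a) / 2)"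
  have [measurable]: "k \<in> borel_measurable borel" using k by auto
  have ai: "integrable lborel a"
  proof (rule Bochner_Integration.integrable_bound[of lborel "\<lambda>x. A * indicator (ball 0 1) x"])
    show "integrable lborel (\<lambda>x::'a. A * indicator (ball 0 1) x)" using emeasure_ball_finite[of "0::'a" 1] by (intro integrable_mult_right) auto
    show "AE x in lborel. cmod (a x) \<le> norm (A * indicator (ball 0 1) x)"
      using a_bd a_supp A_pos by (intro AE_I2) (auto simp: indicator_def abs_mult)
  qed measurable
  have int: "integrable (lborel \<Otimes>\<^sub>M lborel) (\<lambda>(\<xi>, y). cis (x \<bullet> \<xi> + t * \<phi> \<xi> + y \<bullet> \<xi>) * (a \<xi> * k y))"
    using integrable_cis_mult[OF integrable_pair_mult[OF sigma_finite_lborel sigma_finite_lborel ai k], of "\<lambda>p. x \<bullet> fst p + t * \<phi> (fst p) + snd p \<bullet> fst p"]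
    by (simp add: split_beta')
  have "T t (inFT k) x = (LINT \<xi>|lborel. of_real c * (LINT y|lborel. cis (x \<bullet> \<xi> + t * \<phi> \<xi> + y \<bullet> \<xi>) * (a \<xi> * k y)))"
    unfolding T_def
  proof (rule Bochner_Integration.integral_cong[OF refl])
    fix \<xi>
    have "(LINT y|lborel. cis (x \<bullet> \<xi> + t * \<phi> \<xi> + y \<bullet> \<xi>) * (a \<xi> * k y)) = (LINT y|lborel. (cis (x \<bullet> \<xi> + t * \<phi> \<xi>) * a \<xi>) * (cis (- (y \<bullet> - \<xi>)) * k y))"
      by (intro Bochner_Integration.integral_cong refl) (simp add: cis_mult[symmetric])
    also have "\<dots> = cis (x \<bullet> \<xi> + t * \<phi> \<xi>) * a \<xi> * FT k (- \<xi>)" by (simp only: integral_mult_right_zero FT_def)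
    finally show "cis (x \<bullet> \<xi> + t * \<phi> \<xi>) * (a \<xi> * inFT k \<xi>) = of_real c * (LINT y|lborel. cis (x \<bullet> \<xi> + t * \<phi> \<xi> + y \<bullet> \<xi>) * (a \<xi> * k y))"
      by (simp add: inFT_def nFT_def c_def)
  qed
  also have "\<dots> = of_real c * (LINT \<xi>|lborel. LINT y|lborel. cis (x \<bullet> \<xi> + t * \<phi> \<xi> + y \<bullet> \<xi>) * (a \<xi> * k y))"
    by (rule integral_mult_right_zero)
  also have "(LINT \<xi>|lborel. LINT y|lborel. cis (x \<bullet> \<xi> + t * \<phi> \<xi> + y \<bullet> \<xi>) * (a \<xi> * k y)) = (LINT y|lborel. LINT \<xi>|lborel. cis (x \<bullet> \<xi> + t * \<phi> \<xi> + y \<bullet> \<xi>) * (a \<xi> * k y))"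
    by (rule lborel_pair.Fubini_integral[symmetric]) (rule int)
  also have "\<dots> = (LINT y|lborel. (LINT \<xi>|lborel. cis ((x + y) \<bullet> \<xi> + t * \<phi> \<xi>) * a \<xi>) * k y)"
    by (intro Bochner_Integration.integral_cong refl, subst integral_mult_left_zero[symmetric])
       (simp add: inner_add_left algebra_simps)
  finally have eq: "T t (inFT k) x = of_real c * (LINT y|lborel. (LINT \<xi>|lborel. cis ((x + y) \<bullet> \<xi> + t * \<phi> \<xi>) * a \<xi>) * k y)" .
  have le: "cmod ((LINT \<xi>|lborel. cis ((x + y) \<bullet> \<xi> + t * \<phi> \<xi>) * a \<xi>) * k y) \<le> E * cmod (k y)" for y
    unfolding norm_mult E_def by (intro mult_right_mono disp t) auto
  have "cmod (LINT y|lborel. (LINT \<xi>|lborel. cis ((x + y) \<bullet> \<xi> + t * \<phi> \<xi>) * a \<xi>) * k y) \<le> (LINT y|lborel. E * cmod (k y))"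
  proof (rule Bochner_Integration.integral_norm_bound_integral[OF _ _ le])
    show w: "integrable lborel (\<lambda>y. E * cmod (k y))" by (intro integrable_mult_right integrable_norm k)
    show "integrable lborel (\<lambda>y. (LINT \<xi>|lborel. cis ((x + y) \<bullet> \<xi> + t * \<phi> \<xi>) * a \<xi>) * k y)"
    proof (rule Bochner_Integration.integrable_bound[OF w])
      show "AE y in lborel. cmod ((LINT \<xi>|lborel. cis ((x + y) \<bullet> \<xi> + t * \<phi> \<xi>) * a \<xi>) * k y) \<le> norm (E * cmod (k y))"
        unfolding real_norm_def by (intro AE_I2 order_trans[OF le abs_ge_self])
    qed measurable
  qed
  then show ?thesis unfolding eq c_def[symmetric] E_def[symmetric] norm_mult
    using c0 by (simp add: mult.assoc mult_left_mono)
qed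

text \<open>Cauchy-Schwarz against |y|^(-\<delta>), which is square integrable near 0 because 2
  \<delta> < d; its L^2 norm on the ball is a multiple of R^(d/2 - \<delta>).\<close>

lemma integral_norm_le_weighted:
  fixes g :: "'a \<Rightarrow> complex"
  assumes [measurable]: "g \<in> borel_measurable borel" and \<delta>: "0 \<le> \<delta>" "2 * \<delta> < real DIM('a)"
    and W: "0 \<le> W" "(\<integral>\<^sup>+y. ennreal (norm y powr (2 * \<delta>)) * ennreal ((cmod (g y))\<^sup>2) \<partial>lborel) \<le> ennreal (W\<^sup>2)" and R: "0 < R"
  shows "(LINT y|lborel. cmod (if y \<in> {y. norm y \<le> R} then g y else 0))
    \<le> sqrt (unit_ball_vol (real DIM('a)) * real DIM('a) / (real DIM('a) - 2 * \<delta>)) * W * R powr (real DIM('a) / 2 - \<delta>)"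
proof -
  define V where "V = unit_ball_vol (real DIM('a)) * real DIM('a) / (real DIM('a) - 2 * \<delta>)"
  have V0: "0 \<le> V" using \<delta> by (auto simp: V_def)
  let ?k = "\<lambda>y. if y \<in> {y. norm y \<le> R} then g y else 0"
  have "(\<integral>\<^sup>+y. ennreal (cmod (?k y)) \<partial>lborel) = (\<integral>\<^sup>+y. (ennreal (norm y powr (- \<delta>)) * indicator {y. norm y \<le> R} y) * (ennreal (norm y powr \<delta>) * ennreal (cmod (g y))) \<partial>lborel)"
    by (intro nn_integral_cong_AE, use AE_lborel_singleton[of "0::'a"] in eventually_elim)
       (auto simp: indicator_def ennreal_mult'[symmetric] mult.assoc[symmetric] powr_add[symmetric])
  then have "(\<integral>\<^sup>+y. ennreal (cmod (?k y)) \<partial>lborel)\<^sup>2 \<le> (\<integral>\<^sup>+y. (ennreal (norm y powr (- \<delta>)) * indicator {y::'a. norm y \<le> R} y)\<^sup>2 \<partial>lborel) * (\<integral>\<^sup>+y. (ennreal (norm y powr \<delta>) * ennreal (cmod (g y)))\<^sup>2 \<partial>lborel)"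
    by (simp only:) (rule Cauchy_Schwarz_nn_integral, measurable)
  also have "(\<integral>\<^sup>+y. (ennreal (norm y powr (- \<delta>)) * indicator {y::'a. norm y \<le> R} y)\<^sup>2 \<partial>lborel) = (\<integral>\<^sup>+y. ennreal (norm y powr (- (2 * \<delta>))) * indicator {y::'a. norm y \<le> R} y \<partial>lborel)"
    by (intro nn_integral_cong) (auto simp: indicator_def power2_eq_square ennreal_mult'[symmetric] powr_times_self)
  also have "(\<integral>\<^sup>+y. (ennreal (norm y powr \<delta>) * ennreal (cmod (g y)))\<^sup>2 \<partial>lborel) = (\<integral>\<^sup>+y. ennreal (norm y powr (2 * \<delta>)) * ennreal ((cmod (g y))\<^sup>2) \<partial>lborel)"
    by (intro nn_integral_cong) (simp add: power_mult_distrib ennreal_power, simp add: power2_eq_square powr_times_self)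
  finally have "(\<integral>\<^sup>+y. ennreal (cmod (?k y)) \<partial>lborel)\<^sup>2 \<le> ennreal (V * R powr (real DIM('a) - 2 * \<delta>)) * ennreal (W\<^sup>2)"
    using nn_integral_norm_powr_cball[where 'a='a, of "2 * \<delta>" R] \<delta> R W unfolding V_def
    by (elim order_trans) (intro mult_mono, auto)
  also have "\<dots> = ennreal ((sqrt V * W * R powr (real DIM('a) / 2 - \<delta>))\<^sup>2)"
  proof -
    have "(R powr (real DIM('a) / 2 - \<delta>))\<^sup>2 = R powr (real DIM('a) - 2 * \<delta>)"
      by (simp add: power2_eq_square powr_times_self algebra_simps)
    then show ?thesis using V0 by (subst ennreal_mult[symmetric]) (auto simp: power_mult_distrib mult_ac)
  qed
  finally have le: "(\<integral>\<^sup>+y. ennreal (cmod (?k y)) \<partial>lborel)\<^sup>2 \<le> (ennreal (sqrt V * W * R powr (real DIM('a) / 2 - \<delta>)))\<^sup>2"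
    using V0 W by (simp add: ennreal_power)
  have "(\<integral>\<^sup>+y. ennreal (cmod (?k y)) \<partial>lborel) \<le> ennreal (sqrt V * W * R powr (real DIM('a) / 2 - \<delta>))"
    by (rule ennreal_le_of_sq_le[OF le]) (use V0 W in auto)
  then show ?thesis unfolding V_def[symmetric] using V0 W
    by (intro integral_real_bounded) auto
qed

end

text \<open>The part of Fourier inversion that is used, for cutting off on the Fourier side.  The factor \<open>8\<close> comes from
  approximating \<open>f\<close> in \<open>L\<^sup>2\<close> by functions for which it is \<open>1\<close>.\<close>

definition inversion_pair :: "('a::euclidean_space \<Rightarrow> complex) \<Rightarrow> ('a \<Rightarrow> complex) \<Rightarrow> bool" where
  "inversion_pair f g \<longleftrightarrow> f \<in> borel_measurable borel \<and> g \<in> borel_measurable borel \<and> sqnorm f < \<infinity> \<and> sqnorm g < \<infinity> \<and>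
    (\<forall>S. S \<in> sets borel \<and> emeasure lborel S < \<infinity> \<longrightarrow>
      sqnorm (\<lambda>x. f x - inFT (\<lambda>y. if y \<in> S then g y else 0) x) \<le> 8 * sqnorm (\<lambda>y. if y \<in> S then 0 else g y))"

lemma inversion_pair_of_plancherel: "plancherel_pair f g \<Longrightarrow> inversion_pair f g"
  unfolding inversion_pair_def by (auto simp: plancherel_pair_def intro!: inversion_tail)

text \<open>For an inverse transform the difference is the inverse transform of the tail, so the
  bound holds with constant 1 <= 8. This readmits the low part of a decomposition as data for the
  fixed time bound.\<close>

lemma inversion_pair_inFT:
  assumes g: "integrable lborel g" and g2: "sqnorm g < \<infinity>"
  shows "inversion_pair (inFT g) g"
proof -
  have [measurable]: "g \<in> borel_measurable borel" using g by auto
  have "sqnorm (\<lambda>x. inFT g x - inFT (\<lambda>y. if y \<in> S then g y else 0) x) \<le> 8 * sqnorm (\<lambda>y. if y \<in> S then 0 else g y)"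
    if S[measurable]: "S \<in> sets borel" for S
  proof -
    have i: "integrable lborel (\<lambda>y. if y \<in> S then g y else 0)"
      by (rule Bochner_Integration.integrable_bound[OF g]) auto
    have "sqnorm (\<lambda>x. inFT g x - inFT (\<lambda>y. if y \<in> S then g y else 0) x) = sqnorm (inFT (\<lambda>y. g y - (if y \<in> S then g y else 0)))"
      by (simp add: inFT_diff[OF g i, abs_def])
    also have "\<dots> \<le> sqnorm (\<lambda>y. g y - (if y \<in> S then g y else 0))" by (intro sqnorm_inFT_le Bochner_Integration.integrable_diff g i)
    also have "(\<lambda>y. g y - (if y \<in> S then g y else 0)) = (\<lambda>y. if y \<in> S then 0 else g y)" by auto
    also have "sqnorm (\<lambda>y. if y \<in> S then 0 else g y) \<le> 8 * sqnorm (\<lambda>y. if y \<in> S then 0 else g y)"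
      using mult_right_mono[of 1 "8::ennreal" "sqnorm (\<lambda>y. if y \<in> S then 0 else g y)"] by simp
    finally show ?thesis .
  qed
  moreover have "sqnorm (inFT g) < \<infinity>" using sqnorm_inFT_le[OF g] g2 by (rule le_less_trans)
  moreover have "inFT g \<in> borel_measurable borel" by measurable
  ultimately show ?thesis using g2 unfolding inversion_pair_def by auto
qed

lemma ennreal_mult_assoc: "0 \<le> a \<Longrightarrow> 0 \<le> b \<Longrightarrow> 0 \<le> c \<Longrightarrow> ennreal a * (ennreal b * ennreal c) = ennreal (a * (b * c))"
  by (simp add: ennreal_mult)

context dispersive_operator
begin

text \<open>Real interpolation by hand: at height \<open>l\<close> the Fourier transform \<open>g\<close> of \<open>f\<close> is cut at the radius \<open>R\<close>
  for which the low part contributes at most \<open>l / 2\<close> in \<open>L\<^sup>\<infinity>\<close>.\<close>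

lemma fixed_time_estimate:
  assumes \<delta>: "0 < \<delta>" "2 * \<delta> < real DIM('a)" and r: "2 < r" "\<delta> = real DIM('a) * (1 / 2 - 1 / r)"
  obtains C where "0 < C" "\<And>f g t W. inversion_pair f g \<Longrightarrow> t \<noteq> 0 \<Longrightarrow> 0 < W \<Longrightarrow>
    (\<integral>\<^sup>+y. ennreal (norm y powr (2 * \<delta>)) * ennreal ((cmod (g y))\<^sup>2) \<partial>lborel) \<le> ennreal (W\<^sup>2) \<Longrightarrow>
    (\<integral>\<^sup>+x. ennreal (cmod (T t f x) powr r) \<partial>lborel) \<le> ennreal (C * (\<bar>t\<bar> powr (- \<delta>) * W) powr r)"
proof -
  define d where "d = real DIM('a)"
  define V where "V = unit_ball_vol d * d / (d - 2 * \<delta>)"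
  have V0: "0 < V" using \<delta> by (auto simp: V_def d_def intro!: divide_pos_pos mult_pos_pos)
  define c where "c = (2 * pi) powr (- d / 2)"
  have c0: "0 < c" by (simp add: c_def)
  \<comment> \<open>This is d / r, the power of R in \<open>integral_norm_le_weighted\<close>; the
    identity e (r - 2) = 2 \<delta> is what makes the level set formula return the weight |y|^(2
    \<delta>).\<close>
  define e where "e = d / 2 - \<delta>"
  have e0: "0 < e" using \<delta> by (simp add: e_def d_def)
  have er: "e * (r - 2) = 2 * \<delta>" using r by (simp add: e_def d_def field_simps)
  \<comment> \<open>32 is the 4 of \<open>level_set_split\<close> times the 8 of
    \<open>inversion_pair\<close>.\<close>
  define C where "C = r / (r - 2) * (32 * L2_const) * (2 * c * D * sqrt V) powr (r - 2)"
  have "0 < C" unfolding C_def using r L2_const_pos c0 D_pos V0 by (intro mult_pos_pos divide_pos_pos) auto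
  moreover have "(\<integral>\<^sup>+x. ennreal (cmod (T t f x) powr r) \<partial>lborel) \<le> ennreal (C * (\<bar>t\<bar> powr (- \<delta>) * W) powr r)"
    if fg: "inversion_pair f g" and t: "t \<noteq> 0" and W: "0 < W"
      and wg: "(\<integral>\<^sup>+y. ennreal (norm y powr (2 * \<delta>)) * ennreal ((cmod (g y))\<^sup>2) \<partial>lborel) \<le> ennreal (W\<^sup>2)" for f g t W
  proof -
    have [measurable]: "f \<in> borel_measurable borel" "g \<in> borel_measurable borel" and gf: "sqnorm g < \<infinity>"
      using fg by (auto simp: inversion_pair_def)
    define H where "H = c * (D * \<bar>t\<bar> powr (- d / 2)) * (sqrt V * W)"
    have H0: "0 < H" unfolding H_def using c0 D_pos t V0 W by (intro mult_pos_pos) auto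
    have "(\<integral>\<^sup>+x. ennreal (cmod (T t f x) powr r) \<partial>lborel) \<le> ennreal (r / (r - 2)) *
        (\<integral>\<^sup>+y. (ennreal (32 * L2_const) * ennreal ((cmod (g y))\<^sup>2)) * ennreal ((2 * H * norm y powr e) powr (r - 2)) \<partial>lborel)"
    proof (rule strong_type_of_level_sets)
      show "sigma_finite_measure (lborel :: 'a measure)" "sigma_finite_measure (lborel :: 'a measure)" by (auto simp: sigma_finite_lborel)
      fix l :: real assume l: "0 < l"
      \<comment> \<open>Solves H R^e = l / 2, where H R^e is the sup bound for the part of g in |y|
        <= R. Outside this ball 2 H |y|^e is at least l, so the remaining part is seen by the level
        set hypothesis.\<close>
      define R where "R = (l / (2 * H)) powr (1 / e)"
      have R0: "0 < R" using l H0 by (simp add: R_def)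
      have Re: "H * R powr e = l / 2" using l H0 e0 by (simp add: R_def powr_powr)
      define S where "S = {y::'a. norm y \<le> R}"
      have [measurable]: "S \<in> sets borel" unfolding S_def by measurable
      have Sf: "emeasure lborel S < \<infinity>" unfolding S_def using R0 by (subst emeasure_cball_0) auto
      define k where "k = (\<lambda>y. if y \<in> S then g y else 0)"
      have ki: "integrable lborel k" unfolding k_def by (rule integrable_L2_truncation) (use gf Sf in auto)
      then have [measurable]: "k \<in> borel_measurable borel" by auto
      define f2 where "f2 x = f x - inFT k x" for x
      have [measurable]: "f2 \<in> borel_measurable borel" unfolding f2_def[abs_def] by measurable
      have f2n: "sqnorm f2 \<le> 8 * sqnorm (\<lambda>y. if y \<in> S then 0 else g y)"
        unfolding f2_def k_def using fg Sf by (auto simp: inversion_pair_def)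
      have "sqnorm (\<lambda>y. if y \<in> S then 0 else g y) \<le> sqnorm g" unfolding sqnorm_def by (intro nn_integral_mono) auto
      then have "8 * sqnorm (\<lambda>y. if y \<in> S then 0 else g y) < \<infinity>" using gf by (auto simp: ennreal_mult_less_top intro: le_less_trans)
      then have f2f: "sqnorm f2 < \<infinity>" using f2n by (rule le_less_trans[rotated])
      have kf: "sqnorm (inFT k) < \<infinity>"
      proof -
        have "sqnorm (inFT k) \<le> sqnorm k" by (rule sqnorm_inFT_le[OF ki])
        also have "\<dots> \<le> sqnorm g" unfolding sqnorm_def k_def by (intro nn_integral_mono) auto
        finally show ?thesis using gf by (rule le_less_trans)
      qed
      have T2: "sqnorm (T t f2) \<le> ennreal L2_const * (8 * sqnorm (\<lambda>y. if y \<in> S then 0 else g y))"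
        by (rule order_trans[OF sqnorm_T_le[OF _ f2f]]) (auto intro!: mult_left_mono f2n)
      have "emeasure lborel {x \<in> space lborel. l \<le> cmod (T t f x)} \<le> ennreal (l powr (-2)) * (4 * sqnorm (T t f2))"
      proof (rule level_set_split[where ?F1.0 = "T t (inFT k)"])
        fix x
        have "T t (\<lambda>x. inFT k x + f2 x) x = T t (inFT k) x + T t f2 x" by (rule T_add) (use kf f2f in auto)
        then show "T t f x = T t (inFT k) x + T t f2 x" by (simp add: f2_def)
        have "cmod (T t (inFT k) x) \<le> c * (D * \<bar>t\<bar> powr (- d / 2)) * (LINT y|lborel. cmod (k y))"
          unfolding c_def d_def by (rule T_inFT_bound[OF ki t])
        also have "\<dots> \<le> c * (D * \<bar>t\<bar> powr (- d / 2)) * (sqrt V * W * R powr e)"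
          unfolding k_def S_def e_def V_def d_def
          by (intro mult_left_mono integral_norm_le_weighted) (use \<delta> W wg R0 D_pos in \<open>auto simp: c_def\<close>)
        also have "\<dots> = H * R powr e" by (simp add: H_def)
        also have "\<dots> = l / 2" by (rule Re)
        finally show "cmod (T t (inFT k) x) \<le> l / 2" .
      qed (use l in auto)
      also have "\<dots> \<le> ennreal (l powr (-2)) * (4 * (ennreal L2_const * (8 * sqnorm (\<lambda>y. if y \<in> S then 0 else g y))))"
        by (intro mult_left_mono T2) auto
      also have "4 * (ennreal L2_const * (8 * sqnorm (\<lambda>y. if y \<in> S then 0 else g y))) = ennreal (32 * L2_const) * sqnorm (\<lambda>y. if y \<in> S then 0 else g y)"
      proof -
        have "ennreal (32 * L2_const) = 4 * ennreal L2_const * 8" using L2_const_pos by (simp add: ennreal_mult' mult.commute[of _ "ennreal L2_const"] mult.assoc)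
        then show ?thesis by (simp add: mult_ac)
      qed
      also have "\<dots> = (\<integral>\<^sup>+y. ennreal (32 * L2_const) * ennreal ((cmod (if y \<in> S then 0 else g y))\<^sup>2) \<partial>lborel)"
        unfolding sqnorm_def by (rule nn_integral_cmult[symmetric]) measurable
      also have "\<dots> \<le> (\<integral>\<^sup>+y. (ennreal (32 * L2_const) * ennreal ((cmod (g y))\<^sup>2)) * indicator {y. l \<le> 2 * H * norm y powr e} y \<partial>lborel)"
      proof (rule nn_integral_mono)
        fix y :: 'a
        have "l \<le> 2 * H * norm y powr e" if "y \<notin> S"
        proof -
          have "R powr e \<le> norm y powr e" using that R0 e0 by (intro powr_mono2) (auto simp: S_def)
          then have "2 * (H * R powr e) \<le> 2 * (H * norm y powr e)" using H0 by simp
          then show ?thesis unfolding Re by simp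
        qed
        then show "ennreal (32 * L2_const) * ennreal ((cmod (if y \<in> S then 0 else g y))\<^sup>2) \<le> (ennreal (32 * L2_const) * ennreal ((cmod (g y))\<^sup>2)) * indicator {y. l \<le> 2 * H * norm y powr e} y"
          by (auto simp: indicator_def)
      qed
      finally show "emeasure lborel {x \<in> space lborel. l \<le> cmod (T t f x)} \<le> ennreal (l powr - 2) * (\<integral>\<^sup>+y. (ennreal (32 * L2_const) * ennreal ((cmod (g y))\<^sup>2)) * indicator {y. l \<le> 2 * H * norm y powr e} y \<partial>lborel)"
        by (simp add: mult_left_mono)
    qed (use r H0 in auto)
    also have "(\<integral>\<^sup>+y. (ennreal (32 * L2_const) * ennreal ((cmod (g y))\<^sup>2)) * ennreal ((2 * H * norm y powr e) powr (r - 2)) \<partial>lborel)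
      = (\<integral>\<^sup>+y. ennreal (32 * L2_const * (2 * H) powr (r - 2)) * (ennreal (norm y powr (2 * \<delta>)) * ennreal ((cmod (g y))\<^sup>2)) \<partial>lborel)"
    proof (rule nn_integral_cong)
      fix y :: 'a
      have "(2 * H * norm y powr e) powr (r - 2) = (2 * H) powr (r - 2) * norm y powr (2 * \<delta>)"
        using H0 by (simp add: powr_mult powr_powr er)
      then show "(ennreal (32 * L2_const) * ennreal ((cmod (g y))\<^sup>2)) * ennreal ((2 * H * norm y powr e) powr (r - 2)) = ennreal (32 * L2_const * (2 * H) powr (r - 2)) * (ennreal (norm y powr (2 * \<delta>)) * ennreal ((cmod (g y))\<^sup>2))"
        using L2_const_pos by (simp add: ennreal_mult mult_ac)
    qed
    also have "\<dots> = ennreal (32 * L2_const * (2 * H) powr (r - 2)) * (\<integral>\<^sup>+y. ennreal (norm y powr (2 * \<delta>)) * ennreal ((cmod (g y))\<^sup>2) \<partial>lborel)"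
      by (rule nn_integral_cmult) measurable
    also have "ennreal (r / (r - 2)) * \<dots> \<le> ennreal (r / (r - 2)) * (ennreal (32 * L2_const * (2 * H) powr (r - 2)) * ennreal (W\<^sup>2))"
      by (intro mult_left_mono wg) auto
    also have "\<dots> = ennreal (r / (r - 2) * (32 * L2_const * (2 * H) powr (r - 2) * W\<^sup>2))"
      by (rule ennreal_mult_assoc) (use r L2_const_pos in auto)
    also have "r / (r - 2) * (32 * L2_const * (2 * H) powr (r - 2) * W\<^sup>2) = C * (\<bar>t\<bar> powr (- \<delta>) * W) powr r"
    proof -
      have a1: "(2 * H) powr (r - 2) = (2 * c * D * sqrt V) powr (r - 2) * (\<bar>t\<bar> powr (- \<delta> * r) * W powr (r - 2))"
      proof -
        have "2 * H = (2 * c * D * sqrt V) * (\<bar>t\<bar> powr (- d / 2) * W)" by (simp add: H_def mult_ac)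
        moreover have "- d / 2 * (r - 2) = - \<delta> * r" using r by (simp add: d_def field_simps)
        ultimately show ?thesis using c0 D_pos V0 W t by (simp add: powr_mult powr_powr)
      qed
      have a2: "W powr (r - 2) * W\<^sup>2 = W powr r" using W by (simp add: powr_diff)
      have a3: "(\<bar>t\<bar> powr (- \<delta>) * W) powr r = \<bar>t\<bar> powr (- \<delta> * r) * W powr r" using W by (simp add: powr_mult powr_powr)
      have "r / (r - 2) * (32 * L2_const * (2 * H) powr (r - 2) * W\<^sup>2) = C * \<bar>t\<bar> powr (- \<delta> * r) * (W powr (r - 2) * W\<^sup>2)"
        unfolding a1 C_def by (simp only: mult_ac)
      then show ?thesis unfolding a2 a3 by (simp only: mult_ac)
    qed
    finally show ?thesis .
  qed
  ultimately show ?thesis by (rule that)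
qed

text \<open>The operator at time t composed with its adjoint at time 0. Since only the difference of
  times matters, \<open>U (t - s)\<close> is the composition for the times t and s.\<close>

definition U :: "real \<Rightarrow> ('a \<Rightarrow> complex) \<Rightarrow> 'a \<Rightarrow> complex" where
  "U t G = T t (\<lambda>\<xi>. cnj (a \<xi>) * FT G \<xi>)"

lemma sqnorm_amp_FT:
  assumes G: "integrable lborel G"
  shows "sqnorm (\<lambda>\<xi>. cnj (a \<xi>) * FT G \<xi>) \<le> ennreal L2_const * sqnorm G"
proof -
  have [measurable]: "G \<in> borel_measurable borel" using G by auto
  have "sqnorm (\<lambda>\<xi>. cnj (a \<xi>) * FT G \<xi>) \<le> ennreal (A\<^sup>2) * sqnorm (FT G)"
    by (rule sqnorm_mult_le) (use a_bd in auto)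
  also have "\<dots> \<le> ennreal (A\<^sup>2) * (ennreal ((2 * pi) ^ DIM('a)) * sqnorm G)" by (intro mult_left_mono sqnorm_FT_le G) auto
  also have "\<dots> = ennreal L2_const * sqnorm G" unfolding L2_const_def
    by (simp only: ennreal_mult' mult_ac zero_le_power2 ennreal_mult'')
  finally show ?thesis .
qed

text \<open>The kernel of \<open>U t\<close> is the one bounded in \<open>disp_sq\<close>, at x -
  y.\<close>

lemma U_bound:
  assumes G: "integrable lborel G" and t: "t \<noteq> 0"
  shows "cmod (U t G x) \<le> D * \<bar>t\<bar> powr (- real DIM('a) / 2) * (LINT y|lborel. cmod (G y))"
proof -
  define E where "E = D * \<bar>t\<bar> powr (- real DIM('a) / 2)"
  have [measurable]: "G \<in> borel_measurable borel" using G by auto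
  have ai: "integrable lborel (\<lambda>\<xi>. a \<xi> * cnj (a \<xi>))"
  proof (rule Bochner_Integration.integrable_bound[of lborel "\<lambda>x. A * A * indicator (ball 0 1) x"])
    show "integrable lborel (\<lambda>x::'a. A * A * indicator (ball 0 1) x)" using emeasure_ball_finite[of "0::'a" 1] by (intro integrable_mult_right) auto
    show "AE x in lborel. cmod (a x * cnj (a x)) \<le> norm (A * A * indicator (ball 0 1) x)"
      using a_bd a_supp A_pos by (intro AE_I2) (auto simp: indicator_def abs_mult norm_mult intro!: mult_mono)
  qed measurable
  have int: "integrable (lborel \<Otimes>\<^sub>M lborel) (\<lambda>(\<xi>, y). cis (x \<bullet> \<xi> + t * \<phi> \<xi> - y \<bullet> \<xi>) * ((a \<xi> * cnj (a \<xi>)) * G y))"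
    using integrable_cis_mult[OF integrable_pair_mult[OF sigma_finite_lborel sigma_finite_lborel ai G], of "\<lambda>p. x \<bullet> fst p + t * \<phi> (fst p) - snd p \<bullet> fst p"]
    by (simp add: split_beta')
  have "U t G x = (LINT \<xi>|lborel. LINT y|lborel. cis (x \<bullet> \<xi> + t * \<phi> \<xi> - y \<bullet> \<xi>) * ((a \<xi> * cnj (a \<xi>)) * G y))"
    unfolding U_def T_def
  proof (rule Bochner_Integration.integral_cong[OF refl])
    fix \<xi>
    have "(LINT y|lborel. cis (x \<bullet> \<xi> + t * \<phi> \<xi> - y \<bullet> \<xi>) * ((a \<xi> * cnj (a \<xi>)) * G y)) = (LINT y|lborel. (cis (x \<bullet> \<xi> + t * \<phi> \<xi>) * (a \<xi> * cnj (a \<xi>))) * (cis (- (y \<bullet> \<xi>)) * G y))"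
      by (intro Bochner_Integration.integral_cong refl) (simp add: cis_mult mult_ac flip: mult.assoc[of "cis _" "cis _"])
    also have "\<dots> = cis (x \<bullet> \<xi> + t * \<phi> \<xi>) * (a \<xi> * cnj (a \<xi>)) * FT G \<xi>" by (simp only: integral_mult_right_zero FT_def)
    finally show "cis (x \<bullet> \<xi> + t * \<phi> \<xi>) * (a \<xi> * (cnj (a \<xi>) * FT G \<xi>)) = (LINT y|lborel. cis (x \<bullet> \<xi> + t * \<phi> \<xi> - y \<bullet> \<xi>) * ((a \<xi> * cnj (a \<xi>)) * G y))"
      by (simp only: mult.assoc)
  qed
  also have "\<dots> = (LINT y|lborel. LINT \<xi>|lborel. cis (x \<bullet> \<xi> + t * \<phi> \<xi> - y \<bullet> \<xi>) * ((a \<xi> * cnj (a \<xi>)) * G y))"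
    by (rule lborel_pair.Fubini_integral[symmetric]) (rule int)
  also have "\<dots> = (LINT y|lborel. (LINT \<xi>|lborel. cis ((x - y) \<bullet> \<xi> + t * \<phi> \<xi>) * (a \<xi> * cnj (a \<xi>))) * G y)"
    by (intro Bochner_Integration.integral_cong refl, subst integral_mult_left_zero[symmetric])
       (simp add: inner_diff_left algebra_simps)
  finally have eq: "U t G x = (LINT y|lborel. (LINT \<xi>|lborel. cis ((x - y) \<bullet> \<xi> + t * \<phi> \<xi>) * (a \<xi> * cnj (a \<xi>))) * G y)" .
  have le: "cmod ((LINT \<xi>|lborel. cis ((x - y) \<bullet> \<xi> + t * \<phi> \<xi>) * (a \<xi> * cnj (a \<xi>))) * G y) \<le> E * cmod (G y)" for y
    unfolding norm_mult[of _ "G y"] E_def by (intro mult_right_mono disp_sq t) auto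
  have "cmod (LINT y|lborel. (LINT \<xi>|lborel. cis ((x - y) \<bullet> \<xi> + t * \<phi> \<xi>) * (a \<xi> * cnj (a \<xi>))) * G y) \<le> (LINT y|lborel. E * cmod (G y))"
  proof (rule Bochner_Integration.integral_norm_bound_integral[OF _ _ le])
    show w: "integrable lborel (\<lambda>y. E * cmod (G y))" by (intro integrable_mult_right integrable_norm G)
    show "integrable lborel (\<lambda>y. (LINT \<xi>|lborel. cis ((x - y) \<bullet> \<xi> + t * \<phi> \<xi>) * (a \<xi> * cnj (a \<xi>))) * G y)"
    proof (rule Bochner_Integration.integrable_bound[OF w])
      show "AE y in lborel. cmod ((LINT \<xi>|lborel. cis ((x - y) \<bullet> \<xi> + t * \<phi> \<xi>) * (a \<xi> * cnj (a \<xi>))) * G y) \<le> norm (E * cmod (G y))"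
        unfolding real_norm_def by (intro AE_I2 order_trans[OF le abs_ge_self])
    qed measurable
  qed
  then show ?thesis unfolding eq E_def[symmetric] by simp
qed

text \<open>The Hardy--Littlewood--Sobolev-type input for the \<open>TT\<^sup>*\<close> argument: now the data is cut by height.\<close>

lemma U_dual_estimate:
  assumes r: "2 < r" and \<delta>: "\<delta> = real DIM('a) * (1 / 2 - 1 / r)"
  obtains C where "0 < C" "\<And>G t. integrable lborel G \<Longrightarrow> sqnorm G < \<infinity> \<Longrightarrow> t \<noteq> 0 \<Longrightarrow>
    (\<integral>\<^sup>+x. ennreal (cmod (G x) powr (r / (r - 1))) \<partial>lborel) \<le> 1 \<Longrightarrow>
    (\<integral>\<^sup>+x. ennreal (cmod (U t G x) powr r) \<partial>lborel) \<le> ennreal (C * (\<bar>t\<bar> powr (- \<delta>)) powr r)"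
proof -
  define d where "d = real DIM('a)"
  \<comment> \<open>1 + s is the exponent conjugate to r; the identity 2 - s (r - 2) = 1 + s lets
    |G|^2 and the weight of the level set formula combine to |G|^(1 + s).\<close>
  define s where "s = 1 / (r - 1)"
  have s0: "0 < s" using r by (simp add: s_def)
  have rs: "r / (r - 1) = 1 + s" using r by (simp add: s_def field_simps)
  have sr: "2 - s * (r - 2) = 1 + s" using r by (simp add: s_def field_simps)
  define C where "C = r / (r - 2) * (4 * L2_const * L2_const) * (2 * D) powr (r - 2)"
  have "0 < C" unfolding C_def using r L2_const_pos D_pos by (intro mult_pos_pos divide_pos_pos) auto
  moreover have "(\<integral>\<^sup>+x. ennreal (cmod (U t G x) powr r) \<partial>lborel) \<le> ennreal (C * (\<bar>t\<bar> powr (- \<delta>)) powr r)"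
    if Gi: "integrable lborel G" and G2: "sqnorm G < \<infinity>" and t: "t \<noteq> 0" and Gr: "(\<integral>\<^sup>+x. ennreal (cmod (G x) powr (r / (r - 1))) \<partial>lborel) \<le> 1" for G t
  proof -
    have [measurable]: "G \<in> borel_measurable borel" using Gi by auto
    have Gr': "(\<integral>\<^sup>+x. ennreal (cmod (G x) powr (1 + s)) \<partial>lborel) \<le> 1" using Gr unfolding rs .
    define H where "H = D * \<bar>t\<bar> powr (- d / 2)"
    have H0: "0 < H" unfolding H_def using D_pos t by auto
    have "(\<integral>\<^sup>+x. ennreal (cmod (U t G x) powr r) \<partial>lborel) \<le> ennreal (r / (r - 2)) *
        (\<integral>\<^sup>+y. (ennreal (4 * L2_const * L2_const) * ennreal ((cmod (G y))\<^sup>2)) * ennreal ((2 * H * cmod (G y) powr (- s)) powr (r - 2)) \<partial>lborel)"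
    proof (rule strong_type_of_level_sets)
      show "sigma_finite_measure (lborel :: 'a measure)" "sigma_finite_measure (lborel :: 'a measure)" by (auto simp: sigma_finite_lborel)
      show "(\<lambda>x. cmod (U t G x)) \<in> borel_measurable lborel" unfolding U_def by measurable
      fix l :: real assume l: "0 < l"
      \<comment> \<open>The part of G above height m has L^1 norm at most m^(-s), because |G| <=
        m^(-s) |G|^(1 + s) there; m is chosen so that its image is at most l / 2.\<close>
      define m where "m = (l / (2 * H)) powr (- (1 / s))"
      have m0: "0 < m" using l H0 by (simp add: m_def)
      have me: "H * m powr (- s) = l / 2" using l H0 s0 by (simp add: m_def powr_powr)
      define G1 where "G1 = (\<lambda>y. if m < cmod (G y) then G y else 0)"
      define G2 where "G2 = (\<lambda>y. if m < cmod (G y) then 0 else G y)"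
      have [measurable]: "G1 \<in> borel_measurable borel" unfolding G1_def by measurable
      have [measurable]: "G2 \<in> borel_measurable borel" unfolding G2_def by measurable
      have i1: "integrable lborel G1" by (rule Bochner_Integration.integrable_bound[OF Gi]) (auto simp: G1_def)
      have i2: "integrable lborel G2" by (rule Bochner_Integration.integrable_bound[OF Gi]) (auto simp: G2_def)
      have "sqnorm G1 \<le> sqnorm G" unfolding sqnorm_def G1_def by (intro nn_integral_mono) auto
      then have n1: "sqnorm G1 < \<infinity>" using \<open>sqnorm G < \<infinity>\<close> by (rule le_less_trans)
      have "sqnorm G2 \<le> sqnorm G" unfolding sqnorm_def G2_def by (intro nn_integral_mono) auto
      then have n2: "sqnorm G2 < \<infinity>" using \<open>sqnorm G < \<infinity>\<close> by (rule le_less_trans)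
      have af: "sqnorm (\<lambda>\<xi>. cnj (a \<xi>) * FT K \<xi>) < \<infinity>" if "integrable lborel K" "sqnorm K < \<infinity>" for K
        by (rule le_less_trans[OF sqnorm_amp_FT[OF that(1)]]) (use that(2) in \<open>simp add: ennreal_mult_less_top\<close>)
      have "emeasure lborel {x \<in> space lborel. l \<le> cmod (U t G x)} \<le> ennreal (l powr (-2)) * (4 * sqnorm (U t G2))"
      proof (rule level_set_split[where ?F1.0 = "U t G1"])
        show "U t G2 \<in> borel_measurable borel" unfolding U_def by measurable
        fix x
        have FTs: "FT G \<xi> = FT G1 \<xi> + FT G2 \<xi>" for \<xi>
        proof -
          have "FT (\<lambda>x. G x - G1 x) \<xi> = FT G \<xi> - FT G1 \<xi>" by (rule FT_diff[OF Gi i1])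
          moreover have "(\<lambda>x. G x - G1 x) = G2" by (auto simp: G1_def G2_def)
          ultimately show ?thesis by simp
        qed
        have "T t (\<lambda>\<xi>. cnj (a \<xi>) * FT G1 \<xi> + cnj (a \<xi>) * FT G2 \<xi>) x = U t G1 x + U t G2 x"
          unfolding U_def by (rule T_add) (use af[OF i1 n1] af[OF i2 n2] in auto)
        then show "U t G x = U t G1 x + U t G2 x" unfolding U_def[of t G] FTs by (simp add: distrib_left)
        have L1: "(LINT y|lborel. cmod (G1 y)) \<le> m powr (- s)"
        proof (rule integral_real_bounded)
          have "(\<integral>\<^sup>+y. ennreal (cmod (G1 y)) \<partial>lborel) \<le> (\<integral>\<^sup>+y. ennreal (m powr (- s)) * ennreal (cmod (G y) powr (1 + s)) \<partial>lborel)"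
          proof (rule nn_integral_mono)
            fix y :: 'a
            have "cmod (G y) \<le> m powr (- s) * cmod (G y) powr (1 + s)" if y: "m < cmod (G y)"
            proof -
              have "cmod (G y) powr (- s) \<le> m powr (- s)" using y m0 s0 by (intro powr_mono2') auto
              then have "cmod (G y) powr (- s) * cmod (G y) powr (1 + s) \<le> m powr (- s) * cmod (G y) powr (1 + s)" by (intro mult_right_mono) auto
              moreover have "cmod (G y) powr (- s) * cmod (G y) powr (1 + s) = cmod (G y)"
                using y m0 by (subst powr_add[symmetric]) auto
              ultimately show ?thesis by simp
            qed
            then show "ennreal (cmod (G1 y)) \<le> ennreal (m powr (- s)) * ennreal (cmod (G y) powr (1 + s))"
              by (auto simp: G1_def ennreal_mult'[symmetric] intro: ennreal_leI)
          qed
          also have "\<dots> = ennreal (m powr (- s)) * (\<integral>\<^sup>+y. ennreal (cmod (G y) powr (1 + s)) \<partial>lborel)" by (rule nn_integral_cmult) measurable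
          also have "\<dots> \<le> ennreal (m powr (- s)) * 1" by (intro mult_left_mono Gr') auto
          finally show "(\<integral>\<^sup>+y. ennreal (cmod (G1 y)) \<partial>lborel) \<le> ennreal (m powr (- s))" by simp
        qed auto
        have "cmod (U t G1 x) \<le> H * (LINT y|lborel. cmod (G1 y))" unfolding H_def d_def by (rule U_bound[OF i1 t])
        also have "\<dots> \<le> H * m powr (- s)" using H0 by (intro mult_left_mono L1) auto
        also have "\<dots> = l / 2" by (rule me)
        finally show "cmod (U t G1 x) \<le> l / 2" .
      qed (use l in auto)
      also have "sqnorm (U t G2) \<le> ennreal L2_const * (ennreal L2_const * sqnorm G2)"
        unfolding U_def by (rule order_trans[OF sqnorm_T_le[OF _ af[OF i2 n2]]], measurable) (intro mult_left_mono sqnorm_amp_FT i2, simp)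
      finally have "emeasure lborel {x \<in> space lborel. l \<le> cmod (U t G x)} \<le> ennreal (l powr (-2)) * (4 * (ennreal L2_const * (ennreal L2_const * sqnorm G2)))"
        by (simp add: mult_left_mono)
      also have "4 * (ennreal L2_const * (ennreal L2_const * sqnorm G2)) = ennreal (4 * L2_const * L2_const) * sqnorm G2"
        using L2_const_pos by (simp add: ennreal_mult mult_ac)
      also have "\<dots> = (\<integral>\<^sup>+y. ennreal (4 * L2_const * L2_const) * ennreal ((cmod (G2 y))\<^sup>2) \<partial>lborel)"
        unfolding sqnorm_def by (rule nn_integral_cmult[symmetric]) measurable
      also have "\<dots> \<le> (\<integral>\<^sup>+y. (ennreal (4 * L2_const * L2_const) * ennreal ((cmod (G y))\<^sup>2)) * indicator {y. l \<le> 2 * H * cmod (G y) powr (- s)} y \<partial>lborel)"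
      proof (rule nn_integral_mono)
        fix y :: 'a
        \<comment> \<open>Zeros of G are excluded: there \<open>powr\<close> with a negative
          exponent gives 0, while the integrand to be bounded vanishes.\<close>
        have "l \<le> 2 * H * cmod (G y) powr (- s)" if "cmod (G y) \<le> m" "G y \<noteq> 0"
        proof -
          have "m powr (- s) \<le> cmod (G y) powr (- s)" using that s0 by (intro powr_mono2') auto
          then have "2 * (H * m powr (- s)) \<le> 2 * (H * cmod (G y) powr (- s))" using H0 by simp
          then show ?thesis unfolding me by simp
        qed
        then show "ennreal (4 * L2_const * L2_const) * ennreal ((cmod (G2 y))\<^sup>2) \<le> (ennreal (4 * L2_const * L2_const) * ennreal ((cmod (G y))\<^sup>2)) * indicator {y. l \<le> 2 * H * cmod (G y) powr (- s)} y"
          by (cases "G y = 0") (auto simp: indicator_def G2_def)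
      qed
      finally show "emeasure lborel {x \<in> space lborel. l \<le> cmod (U t G x)} \<le> ennreal (l powr - 2) * (\<integral>\<^sup>+y. (ennreal (4 * L2_const * L2_const) * ennreal ((cmod (G y))\<^sup>2)) * indicator {y. l \<le> 2 * H * cmod (G y) powr (- s)} y \<partial>lborel)"
        by (simp add: mult_left_mono)
    qed (use r H0 in auto)
    also have "(\<integral>\<^sup>+y. (ennreal (4 * L2_const * L2_const) * ennreal ((cmod (G y))\<^sup>2)) * ennreal ((2 * H * cmod (G y) powr (- s)) powr (r - 2)) \<partial>lborel)
      = (\<integral>\<^sup>+y. ennreal (4 * L2_const * L2_const * (2 * H) powr (r - 2)) * ennreal (cmod (G y) powr (1 + s)) \<partial>lborel)"
    proof (rule nn_integral_cong)
      fix y :: 'a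
      show "(ennreal (4 * L2_const * L2_const) * ennreal ((cmod (G y))\<^sup>2)) * ennreal ((2 * H * cmod (G y) powr (- s)) powr (r - 2)) = ennreal (4 * L2_const * L2_const * (2 * H) powr (r - 2)) * ennreal (cmod (G y) powr (1 + s))"
      proof (cases "G y = 0")
        case False
        have "(2 * H * cmod (G y) powr (- s)) powr (r - 2) = (2 * H) powr (r - 2) * cmod (G y) powr (- s * (r - 2))"
          using H0 by (simp add: powr_mult powr_powr)
        moreover have "(cmod (G y))\<^sup>2 * cmod (G y) powr (- s * (r - 2)) = cmod (G y) powr (1 + s)"
        proof -
          have "(cmod (G y))\<^sup>2 = cmod (G y) powr 2" using False by simp
          then show ?thesis by (simp only: powr_add[symmetric]) (simp add: sr[symmetric])
        qed
        ultimately have "4 * L2_const * L2_const * (cmod (G y))\<^sup>2 * (2 * H * cmod (G y) powr (- s)) powr (r - 2) = 4 * L2_const * L2_const * (2 * H) powr (r - 2) * cmod (G y) powr (1 + s)"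
          by (simp add: mult_ac)
        then show ?thesis using L2_const_pos by (simp only: ennreal_mult'[symmetric] ennreal_mult''[symmetric] zero_le_power2 powr_ge_zero)
      qed simp
    qed
    also have "\<dots> = ennreal (4 * L2_const * L2_const * (2 * H) powr (r - 2)) * (\<integral>\<^sup>+y. ennreal (cmod (G y) powr (1 + s)) \<partial>lborel)"
      by (rule nn_integral_cmult) measurable
    also have "ennreal (r / (r - 2)) * \<dots> \<le> ennreal (r / (r - 2)) * (ennreal (4 * L2_const * L2_const * (2 * H) powr (r - 2)) * 1)"
      by (intro mult_left_mono Gr') auto
    also have "\<dots> = ennreal (r / (r - 2) * (4 * L2_const * L2_const * (2 * H) powr (r - 2)))"
      using r L2_const_pos by (subst mult_1_right, subst ennreal_mult[symmetric]) auto
    also have "r / (r - 2) * (4 * L2_const * L2_const * (2 * H) powr (r - 2)) = C * (\<bar>t\<bar> powr (- \<delta>)) powr r"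
    proof -
      have a1: "(2 * H) powr (r - 2) = (2 * D) powr (r - 2) * \<bar>t\<bar> powr (- \<delta> * r)"
      proof -
        have "2 * H = (2 * D) * \<bar>t\<bar> powr (- d / 2)" by (simp add: H_def mult_ac)
        moreover have "- d / 2 * (r - 2) = - \<delta> * r" using r \<delta> by (simp add: d_def field_simps)
        ultimately show ?thesis using D_pos t by (simp add: powr_mult powr_powr)
      qed
      show ?thesis unfolding a1 C_def powr_powr by (simp only: mult_ac)
    qed
    finally show ?thesis .
  qed
  ultimately show ?thesis by (rule that)
qed

end

section \<open>Weak-type Strichartz estimates\<close>

text \<open>Split at |t - s| = m: the near part is an explicit integral, and on the far part the
  kernel is at most m^(-\<delta>) on a set of measure at most m. Testing on sets is what a weak type
  bound in time calls for.\<close>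

lemma riesz_potential_of_set:
  fixes E :: "real set"
  assumes [measurable]: "E \<in> sets borel" and m: "emeasure lborel E = ennreal m" "0 < m" and \<delta>: "0 < \<delta>" "\<delta> < 1"
  shows "(\<integral>\<^sup>+s. ennreal (\<bar>t - s\<bar> powr (- \<delta>)) * indicator E s \<partial>lborel) \<le> ennreal ((unit_ball_vol 1 / (1 - \<delta>) + 1) * m powr (1 - \<delta>))"
proof -
  have "(\<integral>\<^sup>+s. ennreal (\<bar>t - s\<bar> powr (- \<delta>)) * indicator E s \<partial>lborel)
    \<le> (\<integral>\<^sup>+s. ennreal (norm (t - s) powr (- \<delta>)) * indicator {y. norm y \<le> m} (t - s) + ennreal (m powr (- \<delta>)) * indicator E s \<partial>lborel)"
  proof (rule nn_integral_mono)
    fix s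
    have "\<bar>t - s\<bar> powr (- \<delta>) \<le> m powr (- \<delta>)" if "\<not> \<bar>t - s\<bar> \<le> m"
      using that m \<delta> by (intro powr_mono2') auto
    then show "ennreal (\<bar>t - s\<bar> powr (- \<delta>)) * indicator E s \<le> ennreal (norm (t - s) powr (- \<delta>)) * indicator {y. norm y \<le> m} (t - s) + ennreal (m powr (- \<delta>)) * indicator E s"
      by (auto simp: indicator_def intro: ennreal_leI add_increasing2)
  qed
  also have "\<dots> = (\<integral>\<^sup>+s. ennreal (norm (t - s) powr (- \<delta>)) * indicator {y. norm y \<le> m} (t - s) \<partial>lborel) + (\<integral>\<^sup>+s. ennreal (m powr (- \<delta>)) * indicator E s \<partial>lborel)"
    by (rule nn_integral_add) measurable
  also have "(\<integral>\<^sup>+s. ennreal (norm (t - s) powr (- \<delta>)) * indicator {y. norm y \<le> m} (t - s) \<partial>lborel) = (\<integral>\<^sup>+(y::real). ennreal (norm y powr (- \<delta>)) * indicator {y. norm y \<le> m} y \<partial>lborel)"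
    by (rule nn_integral_reflect[of "\<lambda>y. ennreal (norm y powr (- \<delta>)) * indicator {y. norm y \<le> m} y"]) measurable
  also have "(\<integral>\<^sup>+s. ennreal (m powr (- \<delta>)) * indicator E s \<partial>lborel) = ennreal (m powr (1 - \<delta>))"
  proof -
    have "m powr (- \<delta>) * m = m powr (1 - \<delta>)" using m by (simp add: powr_diff powr_minus divide_inverse mult.commute)
    then show ?thesis using m by (subst nn_integral_cmult_indicator) (auto simp: ennreal_mult[symmetric])
  qed
  also have "(\<integral>\<^sup>+y. ennreal (norm y powr (- \<delta>)) * indicator {y::real. norm y \<le> m} y \<partial>lborel) + ennreal (m powr (1 - \<delta>))
     \<le> ennreal (unit_ball_vol 1 * 1 / (1 - \<delta>) * m powr (1 - \<delta>)) + ennreal (m powr (1 - \<delta>))"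
    using nn_integral_norm_powr_cball[where 'a=real, of \<delta> m] \<delta> m by (intro add_right_mono) simp
  also have "\<dots> = ennreal ((unit_ball_vol 1 / (1 - \<delta>) + 1) * m powr (1 - \<delta>))"
    using \<delta> by (subst ennreal_plus[symmetric]) (auto simp: algebra_simps)
  finally show ?thesis .
qed

text \<open>Young's inequality with constants 1: if v <= u^(1/(r - 1)) the first term alone
  dominates the product, otherwise the second does.\<close>

lemma mult_le_powr_conjugate:
  fixes u v r :: real
  assumes "0 \<le> u" "0 \<le> v" "1 < r"
  shows "u * v \<le> u powr (r / (r - 1)) + v powr r"
proof (cases "u = 0 \<or> v = 0")
  case False
  then have uv: "0 < u" "0 < v" using assms by auto
  show ?thesis
  proof (cases "v \<le> u powr (1 / (r - 1))")
    case True
    then have "u * v \<le> u powr 1 * u powr (1 / (r - 1))" using uv by simp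
    also have "\<dots> = u powr (r / (r - 1))" using assms by (simp only: powr_add[symmetric]) (simp add: field_simps)
    finally show ?thesis by (simp add: add_increasing2)
  next
    case False
    then have "(u powr (1 / (r - 1))) powr (r - 1) \<le> v powr (r - 1)" using assms by (intro powr_mono2) auto
    then have "u \<le> v powr (r - 1)" using assms uv by (simp add: powr_powr)
    then have "u * v \<le> v powr (r - 1) * v powr 1" using uv by simp
    also have "\<dots> = v powr r" by (simp only: powr_add[symmetric]) simp
    finally show ?thesis by (simp add: add_increasing)
  qed
qed (auto)

context dispersive_operator
begin

text \<open>The pairing is bilinear, without conjugation, which is why the transform of H appears at
  -\<xi>.\<close>

lemma T_pairing:
  assumes H: "integrable lborel H" and [measurable]: "f \<in> borel_measurable borel" and f: "sqnorm f < \<infinity>"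
  shows "(LINT x|lborel. H x * T t f x) = (LINT \<xi>|lborel. cis (t * \<phi> \<xi>) * (a \<xi> * f \<xi>) * FT H (- \<xi>))"
proof -
  have [measurable]: "H \<in> borel_measurable borel" using H by auto
  have af: "integrable lborel (\<lambda>\<xi>. a \<xi> * f \<xi>)" by (intro integrable_af f) measurable
  have int: "integrable (lborel \<Otimes>\<^sub>M lborel) (\<lambda>(x, \<xi>). cis (x \<bullet> \<xi> + t * \<phi> \<xi>) * (H x * (a \<xi> * f \<xi>)))"
    using integrable_cis_mult[OF integrable_pair_mult[OF sigma_finite_lborel sigma_finite_lborel H af], of "\<lambda>p. fst p \<bullet> snd p + t * \<phi> (snd p)"]
    by (simp add: split_beta')
  have "(LINT x|lborel. H x * T t f x) = (LINT x|lborel. LINT \<xi>|lborel. cis (x \<bullet> \<xi> + t * \<phi> \<xi>) * (H x * (a \<xi> * f \<xi>)))"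
    unfolding T_def
    by (intro Bochner_Integration.integral_cong refl, subst integral_mult_right_zero[symmetric]) (simp add: mult_ac)
  also have "\<dots> = (LINT \<xi>|lborel. LINT x|lborel. cis (x \<bullet> \<xi> + t * \<phi> \<xi>) * (H x * (a \<xi> * f \<xi>)))"
    by (rule lborel_pair.Fubini_integral[symmetric]) (rule int)
  also have "\<dots> = (LINT \<xi>|lborel. cis (t * \<phi> \<xi>) * (a \<xi> * f \<xi>) * FT H (- \<xi>))"
  proof (rule Bochner_Integration.integral_cong[OF refl])
    fix \<xi>
    have "(LINT x|lborel. cis (x \<bullet> \<xi> + t * \<phi> \<xi>) * (H x * (a \<xi> * f \<xi>))) = (LINT x|lborel. (cis (t * \<phi> \<xi>) * (a \<xi> * f \<xi>)) * (cis (- (x \<bullet> - \<xi>)) * H x))"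
      by (intro Bochner_Integration.integral_cong refl) (simp add: cis_mult[symmetric])
    then show "(LINT x|lborel. cis (x \<bullet> \<xi> + t * \<phi> \<xi>) * (H x * (a \<xi> * f \<xi>))) = cis (t * \<phi> \<xi>) * (a \<xi> * f \<xi>) * FT H (- \<xi>)"
      by (simp only: integral_mult_right_zero FT_def)
  qed
  finally show ?thesis .
qed

lemma FT_cnj: "FT (\<lambda>x. cnj (G x)) \<xi> = cnj (FT G (- \<xi>))"
proof -
  have "cnj (FT G (- \<xi>)) = (LINT x|lborel. cnj (cis (- (x \<bullet> - \<xi>)) * G x))"
    unfolding FT_def by (simp only: Bochner_Integration.integral_cnj)
  then show ?thesis by (simp add: FT_def cis_cnj)
qed

text \<open>Duality form of \<open>TT\<^sup>*\<close>: the square of a superposition of the adjoints is controlled by the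
  pairings at two times, and these see only \<open>t - s\<close>.\<close>

lemma strichartz_dual_form:
  assumes r: "2 < r" and \<delta>: "\<delta> = real DIM('a) * (1 / 2 - 1 / r)" "0 < \<delta>" "\<delta> < 1"
  obtains C where "0 < C" "\<And>G E m L R. (\<lambda>p. G (fst p) (snd p)) \<in> borel_measurable (borel \<Otimes>\<^sub>M borel) \<Longrightarrow>
    E \<in> sets borel \<Longrightarrow> emeasure lborel E = ennreal m \<Longrightarrow> 0 < m \<Longrightarrow> 0 \<le> L \<Longrightarrow>
    (\<And>t x. cmod (G t x) \<le> L * indicator E t * indicator (cball 0 R) x) \<Longrightarrow>
    (\<And>t. (\<integral>\<^sup>+x. ennreal (cmod (G t x) powr (r / (r - 1))) \<partial>lborel) \<le> 1) \<Longrightarrow>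
    sqnorm (\<lambda>\<xi>. a \<xi> * (LINT t|lborel. cis (t * \<phi> \<xi>) * FT (G t) (- \<xi>))) \<le> ennreal (C * m powr (2 - \<delta>))"
proof -
  obtain C1 where C1: "0 < C1" and U: "\<And>G t. integrable lborel G \<Longrightarrow> sqnorm G < \<infinity> \<Longrightarrow> t \<noteq> 0 \<Longrightarrow>
    (\<integral>\<^sup>+x. ennreal (cmod (G x) powr (r / (r - 1))) \<partial>lborel) \<le> 1 \<Longrightarrow>
    (\<integral>\<^sup>+x. ennreal (cmod (U t G x) powr r) \<partial>lborel) \<le> ennreal (C1 * (\<bar>t\<bar> powr (- \<delta>)) powr r)"
    using U_dual_estimate[OF r \<delta>(1)] by metis
  \<comment> \<open>2 counts the two terms of Young's inequality below, each at most C1^(1/r) |t -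
    s|^(-\<delta>).\<close>
  define \<kappa> where "\<kappa> = 2 * C1 powr (1 / r)"
  have \<kappa>0: "0 < \<kappa>" using C1 by (simp add: \<kappa>_def)
  define C2 where "C2 = unit_ball_vol 1 / (1 - \<delta>) + 1"
  have C20: "0 < C2" unfolding C2_def using \<delta> by (intro add_nonneg_pos) auto
  have "0 < \<kappa> * C2" using \<kappa>0 C20 by simp
  moreover have "sqnorm (\<lambda>\<xi>. a \<xi> * (LINT t|lborel. cis (t * \<phi> \<xi>) * FT (G t) (- \<xi>))) \<le> ennreal (\<kappa> * C2 * m powr (2 - \<delta>))"
    if Gm[measurable]: "(\<lambda>p. G (fst p) (snd p)) \<in> borel_measurable (borel \<Otimes>\<^sub>M borel)" and [measurable]: "E \<in> sets borel" and m: "emeasure lborel E = ennreal m" "0 < m"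
      and L: "0 \<le> L" and Gb: "\<And>t x. cmod (G t x) \<le> L * indicator E t * indicator (cball 0 R) x"
      and Gr: "\<And>t. (\<integral>\<^sup>+x. ennreal (cmod (G t x) powr (r / (r - 1))) \<partial>lborel) \<le> 1"
    for G :: "real \<Rightarrow> 'a \<Rightarrow> complex" and E m L R
  proof -
    let ?P = "lborel \<Otimes>\<^sub>M lborel :: (real \<times> real) measure"
    have [measurable]: "G t \<in> borel_measurable borel" for t
      using measurable_compose[OF measurable_Pair1' Gm, of t] by simp
    have cfin: "emeasure lborel (cball (0::'a) R) < \<infinity>" by (cases "0 \<le> R") (auto simp: emeasure_cball)
    define v where "v = measure lborel (cball (0::'a) R)"
    have v0: "0 \<le> v" by (simp add: v_def)
    have wi: "integrable lborel (\<lambda>x::'a. c * indicator (cball 0 R) x)" for c :: real using cfin by (intro integrable_mult_right) auto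
    \<comment> \<open>The bound by L on a bounded set makes every exchange of integrals below
      absolutely convergent; in the final estimate G is represented only by m.\<close>
    have Gi: "integrable lborel (G t)" for t
    proof (rule Bochner_Integration.integrable_bound[OF wi[of "L * indicator E t"]])
      show "AE x in lborel. cmod (G t x) \<le> norm (L * indicator E t * indicator (cball 0 R) x)"
        unfolding real_norm_def by (intro AE_I2 order_trans[OF Gb abs_ge_self])
    qed measurable
    have G2: "sqnorm (G t) < \<infinity>" for t
    proof -
      have "sqnorm (G t) \<le> (\<integral>\<^sup>+x. ennreal (L\<^sup>2 * indicator (cball (0::'a) R) x) \<partial>lborel)"
        unfolding sqnorm_def
      proof (rule nn_integral_mono)
        fix x
        have "cmod (G t x) \<le> L * indicator (cball 0 R) x" using Gb[of t x] L by (cases "t \<in> E") (auto simp: indicator_def)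
        then have "(cmod (G t x))\<^sup>2 \<le> (L * indicator (cball 0 R) x)\<^sup>2" by (intro power_mono) auto
        then show "ennreal ((cmod (G t x))\<^sup>2) \<le> ennreal (L\<^sup>2 * indicator (cball 0 R) x)"
          by (intro ennreal_leI) (auto simp: indicator_def)
      qed
      also have "\<dots> < \<infinity>" using wi[of "L\<^sup>2"] by (subst nn_integral_eq_integral) auto
      finally show ?thesis .
    qed
    define g where "g t \<xi> = FT (G t) (- \<xi>)" for t \<xi>
    have gm[measurable]: "(\<lambda>p. g (fst p) (snd p)) \<in> borel_measurable (borel \<Otimes>\<^sub>M borel)"
    proof -
      have 1: "(\<lambda>q. G (fst (fst q)) (snd q)) \<in> borel_measurable ((borel \<Otimes>\<^sub>M borel) \<Otimes>\<^sub>M lborel)"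
        using measurable_compose[OF _ Gm, of "\<lambda>q. (fst (fst q), snd q)" "(borel \<Otimes>\<^sub>M borel) \<Otimes>\<^sub>M lborel"] by simp
      have "(\<lambda>q. cis (- (snd q \<bullet> - snd (fst q))) * G (fst (fst q)) (snd q)) \<in> borel_measurable ((borel \<Otimes>\<^sub>M borel) \<Otimes>\<^sub>M lborel)"
        by (intro borel_measurable_times 1) measurable
      from lborel.borel_measurable_lebesgue_integral[of "\<lambda>p x. cis (- (x \<bullet> - snd p)) * G (fst p) x", unfolded split_beta', OF this]
      show ?thesis unfolding g_def FT_def .
    qed
    have [measurable]: "g t \<in> borel_measurable borel" for t
      using measurable_compose[OF measurable_Pair1' gm, of t] by simp
    have [measurable]: "(\<lambda>t. g t \<xi>) \<in> borel_measurable borel" for \<xi>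
      using measurable_compose[OF measurable_Pair2' gm, of \<xi>] by simp
    define L' where "L' = L * v"
    have L'0: "0 \<le> L'" using L v0 by (simp add: L'_def)
    have gb: "cmod (g t \<xi>) \<le> L' * indicator E t" for t \<xi>
    proof -
      have "cmod (g t \<xi>) \<le> (LINT x|lborel. cmod (G t x))" unfolding g_def by (rule norm_FT_le)
      also have "\<dots> \<le> (LINT x|lborel. L * indicator E t * indicator (cball (0::'a) R) x)"
        by (intro Bochner_Integration.integral_mono integrable_norm Gi wi Gb)
      also have "\<dots> = L' * indicator E t" using cfin by (simp add: L'_def v_def)
      finally show ?thesis .
    qed
    have iE: "integrable lborel (\<lambda>t. c * indicator E t)" for c :: real using m by (intro integrable_mult_right) auto
    have gi: "integrable lborel (\<lambda>t. cis (t * \<phi> \<xi>) * g t \<xi>)" for \<xi>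
    proof (rule Bochner_Integration.integrable_bound[OF iE[of L']])
      show "AE t in lborel. cmod (cis (t * \<phi> \<xi>) * g t \<xi>) \<le> norm (L' * indicator E t)"
        unfolding real_norm_def by (intro AE_I2 order_trans[OF _ abs_ge_self]) (simp add: norm_mult gb)
    qed measurable
    define H where "H \<xi> = (LINT t|lborel. cis (t * \<phi> \<xi>) * g t \<xi>)" for \<xi>
    have [measurable]: "H \<in> borel_measurable borel" unfolding H_def[abs_def]
    proof -
      have 1: "(\<lambda>q. g (snd q) (fst q)) \<in> borel_measurable (borel \<Otimes>\<^sub>M lborel)"
        using measurable_compose[OF _ gm, of "\<lambda>q. (snd q, fst q)" "borel \<Otimes>\<^sub>M lborel"] by simp
      have "(\<lambda>q. cis (snd q * \<phi> (fst q)) * g (snd q) (fst q)) \<in> borel_measurable (borel \<Otimes>\<^sub>M lborel)"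
        by (intro borel_measurable_times 1) measurable
      from lborel.borel_measurable_lebesgue_integral[of "\<lambda>\<xi> t. cis (t * \<phi> \<xi>) * g t \<xi>", unfolded split_beta', OF this]
      show "(\<lambda>\<xi>. LINT t|lborel. cis (t * \<phi> \<xi>) * g t \<xi>) \<in> borel_measurable borel" .
    qed
    \<comment> \<open>By \<open>T_pairing\<close> and \<open>FT_cnj\<close> this is the pairing of
      \<open>G t\<close> with \<open>U (t - s)\<close> applied to the conjugate of
      \<open>G s\<close>; in that form it is estimated in \<open>Qb\<close>.\<close>
    define Q where "Q t s = (LINT \<xi>|lborel. cis ((t - s) * \<phi> \<xi>) * (a \<xi> * (cnj (a \<xi>) * cnj (g s \<xi>))) * g t \<xi>)" for t s
    have bi: "integrable lborel (\<lambda>x::'a. c * indicator (ball 0 1) x)" for c :: real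
      using emeasure_ball_finite[of "0::'a" 1] by (intro integrable_mult_right) auto
    have Hb: "cmod (H \<xi>) \<le> L' * m" for \<xi>
    proof -
      have "cmod (H \<xi>) \<le> (LINT t|lborel. L' * indicator E t)" unfolding H_def
        by (rule Bochner_Integration.integral_norm_bound_integral[OF gi iE]) (simp add: norm_mult gb)
      then show ?thesis using m by (simp add: measure_def)
    qed
    have aH2: "integrable lborel (\<lambda>\<xi>. (cmod (a \<xi> * H \<xi>))\<^sup>2)"
    proof (rule Bochner_Integration.integrable_bound[OF bi[of "(A * (L' * m))\<^sup>2"]])
      show "AE \<xi> in lborel. norm ((cmod (a \<xi> * H \<xi>))\<^sup>2) \<le> norm ((A * (L' * m))\<^sup>2 * indicator (ball 0 1) \<xi>)"
      proof (rule AE_I2)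
        fix \<xi>
        have "cmod (a \<xi> * H \<xi>) \<le> A * (L' * m)" unfolding norm_mult using a_bd Hb A_pos by (intro mult_mono) auto
        then have "(cmod (a \<xi> * H \<xi>))\<^sup>2 \<le> (A * (L' * m))\<^sup>2" by (intro power_mono) auto
        then show "norm ((cmod (a \<xi> * H \<xi>))\<^sup>2) \<le> norm ((A * (L' * m))\<^sup>2 * indicator (ball 0 1) \<xi>)"
          using a_supp[of \<xi>] by (auto simp: indicator_def)
      qed
    qed measurable
    have form: "complex_of_real (LINT \<xi>|lborel. (cmod (a \<xi> * H \<xi>))\<^sup>2) = (LINT p|?P. Q (fst p) (snd p))"
    proof -
      interpret P: pair_sigma_finite "lborel::'a measure" ?P unfolding lborel_prod by standard
      have m1: "(\<lambda>q. g (fst (snd q)) (fst q)) \<in> borel_measurable (lborel \<Otimes>\<^sub>M ?P)"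
        using measurable_compose[OF _ gm, of "\<lambda>q. (fst (snd q), fst q)" "lborel \<Otimes>\<^sub>M ?P"] by simp
      have m2: "(\<lambda>q. g (snd (snd q)) (fst q)) \<in> borel_measurable (lborel \<Otimes>\<^sub>M ?P)"
        using measurable_compose[OF _ gm, of "\<lambda>q. (snd (snd q), fst q)" "lborel \<Otimes>\<^sub>M ?P"] by simp
      have int: "integrable (lborel \<Otimes>\<^sub>M ?P) (\<lambda>(\<xi>, p). cis ((fst p - snd p) * \<phi> \<xi>) * (a \<xi> * (cnj (a \<xi>) * cnj (g (snd p) \<xi>))) * g (fst p) \<xi>)"
      proof (rule Bochner_Integration.integrable_bound)
        have iDD: "integrable ?P (\<lambda>p. (L' * indicator E (fst p)) * (L' * indicator E (snd p)) :: real)"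
          by (rule integrable_pair_mult[OF sigma_finite_lborel sigma_finite_lborel iE iE])
        show "integrable (lborel \<Otimes>\<^sub>M ?P) (\<lambda>q. (A * A * indicator (ball (0::'a) 1) (fst q)) * ((L' * indicator E (fst (snd q))) * (L' * indicator E (snd (snd q)))))"
          by (rule integrable_pair_mult[OF _ _ bi[of "A * A"] iDD]) (auto simp: lborel_prod sigma_finite_lborel)
        show "(\<lambda>(\<xi>, p). cis ((fst p - snd p) * \<phi> \<xi>) * (a \<xi> * (cnj (a \<xi>) * cnj (g (snd p) \<xi>))) * g (fst p) \<xi>) \<in> borel_measurable (lborel \<Otimes>\<^sub>M ?P)"
          unfolding split_beta' by (intro borel_measurable_times borel_measurable_cnj' m1 m2) measurable
        show "AE q in lborel \<Otimes>\<^sub>M ?P. cmod (case q of (\<xi>, p) \<Rightarrow> cis ((fst p - snd p) * \<phi> \<xi>) * (a \<xi> * (cnj (a \<xi>) * cnj (g (snd p) \<xi>))) * g (fst p) \<xi>)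
           \<le> norm ((A * A * indicator (ball (0::'a) 1) (fst q)) * ((L' * indicator E (fst (snd q))) * (L' * indicator E (snd (snd q)))))"
        proof (rule AE_I2)
          fix q :: "'a \<times> real \<times> real"
          obtain \<xi> t s where q: "q = (\<xi>, t, s)" by (cases q) auto
          have ai: "cmod (a \<xi>) \<le> A * indicator (ball 0 1) \<xi>" using a_bd a_supp[of \<xi>] by (auto simp: indicator_def)
          have "cmod (a \<xi>) * cmod (a \<xi>) * (cmod (g t \<xi>) * cmod (g s \<xi>))
             \<le> (A * indicator (ball 0 1) \<xi>) * (A * indicator (ball 0 1) \<xi>) * ((L' * indicator E t) * (L' * indicator E s))"
            using ai gb[of t \<xi>] gb[of s \<xi>] A_pos L'0 by (intro mult_mono mult_nonneg_nonneg) auto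
          also have "\<dots> = (A * A * indicator (ball 0 1) \<xi>) * ((L' * indicator E t) * (L' * indicator E s))" by (auto simp: indicator_def)
          finally show "cmod (case q of (\<xi>, p) \<Rightarrow> cis ((fst p - snd p) * \<phi> \<xi>) * (a \<xi> * (cnj (a \<xi>) * cnj (g (snd p) \<xi>))) * g (fst p) \<xi>)
            \<le> norm ((A * A * indicator (ball (0::'a) 1) (fst q)) * ((L' * indicator E (fst (snd q))) * (L' * indicator E (snd (snd q)))))"
            unfolding q real_norm_def by (intro order_trans[OF _ abs_ge_self]) (simp add: norm_mult mult_ac)
        qed
      qed
      have sq: "complex_of_real ((cmod (a \<xi> * H \<xi>))\<^sup>2) = (LINT p|?P. cis ((fst p - snd p) * \<phi> \<xi>) * (a \<xi> * (cnj (a \<xi>) * cnj (g (snd p) \<xi>))) * g (fst p) \<xi>)" for \<xi>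
      proof -
        have "complex_of_real ((cmod (a \<xi> * H \<xi>))\<^sup>2) = (a \<xi> * cnj (a \<xi>)) * (H \<xi> * cnj (H \<xi>))" by (simp only: complex_norm_square complex_cnj_mult mult_ac)
        also have "H \<xi> * cnj (H \<xi>) = (LINT t|lborel. cis (t * \<phi> \<xi>) * g t \<xi>) * (LINT t|lborel. cnj (cis (t * \<phi> \<xi>) * g t \<xi>))"
          by (simp only: H_def Bochner_Integration.integral_cnj)
        also have "\<dots> = (LINT p|?P. (cis (fst p * \<phi> \<xi>) * g (fst p) \<xi>) * cnj (cis (snd p * \<phi> \<xi>) * g (snd p) \<xi>))"
          using gi[of \<xi>] by (intro integral_pair_mult[symmetric] sigma_finite_lborel) (auto simp del: complex_cnj_mult)
        also have "(a \<xi> * cnj (a \<xi>)) * \<dots> = (LINT p|?P. (a \<xi> * cnj (a \<xi>)) * ((cis (fst p * \<phi> \<xi>) * g (fst p) \<xi>) * cnj (cis (snd p * \<phi> \<xi>) * g (snd p) \<xi>)))"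
          by (rule integral_mult_right_zero[symmetric])
        also have "\<dots> = (LINT p|?P. cis ((fst p - snd p) * \<phi> \<xi>) * (a \<xi> * (cnj (a \<xi>) * cnj (g (snd p) \<xi>))) * g (fst p) \<xi>)"
        proof (rule Bochner_Integration.integral_cong[OF refl])
          fix p :: "real \<times> real"
          have "cis ((fst p - snd p) * \<phi> \<xi>) = cis (fst p * \<phi> \<xi>) * cis (- (snd p * \<phi> \<xi>))" by (simp add: cis_mult left_diff_distrib)
          then show "(a \<xi> * cnj (a \<xi>)) * ((cis (fst p * \<phi> \<xi>) * g (fst p) \<xi>) * cnj (cis (snd p * \<phi> \<xi>) * g (snd p) \<xi>)) = cis ((fst p - snd p) * \<phi> \<xi>) * (a \<xi> * (cnj (a \<xi>) * cnj (g (snd p) \<xi>))) * g (fst p) \<xi>"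
            by (simp add: cis_cnj mult_ac)
        qed
        finally show ?thesis .
      qed
      have "complex_of_real (LINT \<xi>|lborel. (cmod (a \<xi> * H \<xi>))\<^sup>2) = (LINT \<xi>|lborel. complex_of_real ((cmod (a \<xi> * H \<xi>))\<^sup>2))"
        by (simp only: integral_complex_of_real)
      also have "\<dots> = (LINT \<xi>|lborel. LINT p|?P. cis ((fst p - snd p) * \<phi> \<xi>) * (a \<xi> * (cnj (a \<xi>) * cnj (g (snd p) \<xi>))) * g (fst p) \<xi>)" by (simp only: sq)
      also have "\<dots> = (LINT p|?P. Q (fst p) (snd p))" unfolding Q_def
        by (rule P.Fubini_integral[symmetric]) (rule int)
      finally show ?thesis .
    qed
    have Qb: "ennreal (cmod (Q t s)) \<le> ennreal (\<kappa> * \<bar>t - s\<bar> powr (- \<delta>)) * (indicator E t * indicator E s)" if ts: "t \<noteq> s" for t s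
    proof (cases "t \<in> E \<and> s \<in> E")
      case False
      then have "g t \<xi> = 0 \<or> g s \<xi> = 0" for \<xi> using gb[of t \<xi>] gb[of s \<xi>] by (auto simp: indicator_def)
      then have "cis ((t - s) * \<phi> \<xi>) * (a \<xi> * (cnj (a \<xi>) * cnj (g s \<xi>))) * g t \<xi> = 0" for \<xi> by (metis mult_zero_left mult_zero_right complex_cnj_zero)
      then have "Q t s = (LINT \<xi>|(lborel::'a measure). 0)" unfolding Q_def by (rule Bochner_Integration.integral_cong[OF refl])
      then have "Q t s = 0" by simp
      then show ?thesis by simp
    next
      case True
      define G' where "G' = (\<lambda>x. cnj (G s x))"
      have G'i: "integrable lborel G'" unfolding G'_def using Gi[of s] by simp
      have G'2: "sqnorm G' < \<infinity>" using G2[of s] by (simp add: sqnorm_def G'_def)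
      have G'r: "(\<integral>\<^sup>+x. ennreal (cmod (G' x) powr (r / (r - 1))) \<partial>lborel) \<le> 1" using Gr[of s] by (simp add: G'_def)
      have [measurable]: "G' \<in> borel_measurable borel" using G'i by auto
      have f': "sqnorm (\<lambda>\<xi>. cnj (a \<xi>) * FT G' \<xi>) < \<infinity>"
        by (rule le_less_trans[OF sqnorm_amp_FT[OF G'i]]) (use G'2 in \<open>simp add: ennreal_mult_less_top\<close>)
      have [measurable]: "U (t - s) G' \<in> borel_measurable borel" unfolding U_def by measurable
      \<comment> \<open>A bound for the L^r norm of the second factor. Dividing by it before
        applying Young's inequality makes both resulting terms at most \<tau>, which amounts to
        Hoelder's inequality up to a factor 2.\<close>
      define \<tau> where "\<tau> = C1 powr (1 / r) * \<bar>t - s\<bar> powr (- \<delta>)"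
      have \<tau>0: "0 < \<tau>" using C1 ts by (simp add: \<tau>_def)
      have \<tau>r: "\<tau> powr r = C1 * (\<bar>t - s\<bar> powr (- \<delta>)) powr r" using C1 r by (simp add: \<tau>_def powr_mult powr_powr)
      have "Q t s = (LINT x|lborel. G t x * U (t - s) G' x)"
        unfolding U_def by (subst T_pairing[OF Gi _ f']) (auto simp: Q_def g_def G'_def FT_cnj)
      then have "ennreal (cmod (Q t s)) \<le> (\<integral>\<^sup>+x. ennreal (cmod (G t x * U (t - s) G' x)) \<partial>lborel)"
        by (simp only: ennreal_norm_integral_le)
      also have "\<dots> \<le> (\<integral>\<^sup>+x. ennreal \<tau> * ennreal (cmod (G t x) powr (r / (r - 1))) + ennreal (\<tau> * \<tau> powr (- r)) * ennreal (cmod (U (t - s) G' x) powr r) \<partial>lborel)"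
      proof (rule nn_integral_mono)
        fix x
        have "cmod (G t x) * (cmod (U (t - s) G' x) / \<tau>) \<le> cmod (G t x) powr (r / (r - 1)) + (cmod (U (t - s) G' x) / \<tau>) powr r"
          using \<tau>0 r by (intro mult_le_powr_conjugate) auto
        also have "(cmod (U (t - s) G' x) / \<tau>) powr r = \<tau> powr (- r) * cmod (U (t - s) G' x) powr r"
          using \<tau>0 by (simp add: powr_divide powr_minus_divide)
        finally have "\<tau> * (cmod (G t x) * (cmod (U (t - s) G' x) / \<tau>)) \<le> \<tau> * (cmod (G t x) powr (r / (r - 1)) + \<tau> powr (- r) * cmod (U (t - s) G' x) powr r)"
          using \<tau>0 by (intro mult_left_mono) auto
        then have "cmod (G t x * U (t - s) G' x) \<le> \<tau> * cmod (G t x) powr (r / (r - 1)) + \<tau> * \<tau> powr (- r) * cmod (U (t - s) G' x) powr r"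
          using \<tau>0 by (simp add: norm_mult algebra_simps)
        then show "ennreal (cmod (G t x * U (t - s) G' x)) \<le> ennreal \<tau> * ennreal (cmod (G t x) powr (r / (r - 1))) + ennreal (\<tau> * \<tau> powr (- r)) * ennreal (cmod (U (t - s) G' x) powr r)"
          using \<tau>0 by (subst (1 2) ennreal_mult[symmetric], simp_all, subst ennreal_plus[symmetric]) (auto intro: ennreal_leI simp del: ennreal_plus)
      qed
      also have "\<dots> = (\<integral>\<^sup>+x. ennreal \<tau> * ennreal (cmod (G t x) powr (r / (r - 1))) \<partial>lborel) + (\<integral>\<^sup>+x. ennreal (\<tau> * \<tau> powr (- r)) * ennreal (cmod (U (t - s) G' x) powr r) \<partial>lborel)"
        by (rule nn_integral_add) measurable
      also have "(\<integral>\<^sup>+x. ennreal \<tau> * ennreal (cmod (G t x) powr (r / (r - 1))) \<partial>lborel) = ennreal \<tau> * (\<integral>\<^sup>+x. ennreal (cmod (G t x) powr (r / (r - 1))) \<partial>lborel)"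
        by (rule nn_integral_cmult) measurable
      also have "(\<integral>\<^sup>+x. ennreal (\<tau> * \<tau> powr (- r)) * ennreal (cmod (U (t - s) G' x) powr r) \<partial>lborel) = ennreal (\<tau> * \<tau> powr (- r)) * (\<integral>\<^sup>+x. ennreal (cmod (U (t - s) G' x) powr r) \<partial>lborel)"
        by (rule nn_integral_cmult) measurable
      also have "ennreal \<tau> * (\<integral>\<^sup>+x. ennreal (cmod (G t x) powr (r / (r - 1))) \<partial>lborel) + ennreal (\<tau> * \<tau> powr (- r)) * (\<integral>\<^sup>+x. ennreal (cmod (U (t - s) G' x) powr r) \<partial>lborel)
        \<le> ennreal \<tau> * 1 + ennreal (\<tau> * \<tau> powr (- r)) * ennreal (\<tau> powr r)"
        unfolding \<tau>r using ts by (intro add_mono mult_left_mono Gr U G'i G'2 G'r) auto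
      also have "\<dots> = ennreal (\<kappa> * \<bar>t - s\<bar> powr (- \<delta>))"
      proof -
        have "\<tau> * \<tau> powr (- r) * \<tau> powr r = \<tau>" using \<tau>0 by (simp add: mult.assoc powr_add[symmetric])
        then have "ennreal (\<tau> * \<tau> powr (- r)) * ennreal (\<tau> powr r) = ennreal \<tau>" using \<tau>0 by (subst ennreal_mult[symmetric]) auto
        then have "ennreal \<tau> * 1 + ennreal (\<tau> * \<tau> powr (- r)) * ennreal (\<tau> powr r) = ennreal (\<tau> + \<tau>)" using less_imp_le[OF \<tau>0] by (simp only: mult_1_right ennreal_plus)
        also have "\<tau> + \<tau> = \<kappa> * \<bar>t - s\<bar> powr (- \<delta>)" by (simp add: \<tau>_def \<kappa>_def)
        finally show ?thesis .
      qed
      finally show ?thesis using True by simp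
    qed
    have "sqnorm (\<lambda>\<xi>. a \<xi> * H \<xi>) = ennreal (LINT \<xi>|lborel. (cmod (a \<xi> * H \<xi>))\<^sup>2)"
      unfolding sqnorm_def by (intro nn_integral_eq_integral aH2) auto
    also have "\<dots> = ennreal (cmod (complex_of_real (LINT \<xi>|lborel. (cmod (a \<xi> * H \<xi>))\<^sup>2)))" by (simp add: integral_nonneg_AE)
    also have "\<dots> \<le> (\<integral>\<^sup>+p. ennreal (cmod (Q (fst p) (snd p))) \<partial>?P)" unfolding form by (rule ennreal_norm_integral_le)
    also have "\<dots> \<le> (\<integral>\<^sup>+p. ennreal (\<kappa> * \<bar>fst p - snd p\<bar> powr (- \<delta>)) * (indicator E (fst p) * indicator E (snd p)) \<partial>?P)"
    proof (rule nn_integral_mono_AE)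
      \<comment> \<open>The bound by |t - s|^(-\<delta>) is available off the diagonal only, and the
        diagonal is a null set of the plane.\<close>
      have s: "{p \<in> space ?P. fst p \<noteq> snd p} \<in> sets ?P" by measurable
      have ae: "AE t in lborel. AE s in lborel. t \<noteq> (s::real)"
      proof (rule AE_I2)
        fix t :: real
        show "AE s in lborel. t \<noteq> s" using AE_lborel_singleton[of t] by eventually_elim auto
      qed
      have "AE p in ?P. fst p \<noteq> snd p" by (rule lborel_pair.AE_pair_measure[OF s]) (use ae in simp)
      then show "AE p in ?P. ennreal (cmod (Q (fst p) (snd p))) \<le> ennreal (\<kappa> * \<bar>fst p - snd p\<bar> powr (- \<delta>)) * (indicator E (fst p) * indicator E (snd p))"
        by eventually_elim (rule Qb)
    qed
    also have "\<dots> = (\<integral>\<^sup>+t. \<integral>\<^sup>+s. ennreal (\<kappa> * \<bar>t - s\<bar> powr (- \<delta>)) * (indicator E t * indicator E s) \<partial>lborel \<partial>lborel)"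
    proof -
      have "(\<lambda>p. ennreal (\<kappa> * \<bar>fst p - snd p\<bar> powr (- \<delta>)) * (indicator E (fst p) * indicator E (snd p))) \<in> borel_measurable ?P" by measurable
      from lborel.nn_integral_fst[OF this] show ?thesis by simp
    qed
    also have "\<dots> \<le> (\<integral>\<^sup>+t. ennreal (\<kappa> * (C2 * m powr (1 - \<delta>))) * indicator E t \<partial>lborel)"
    proof (rule nn_integral_mono)
      fix t :: real
      have "(\<integral>\<^sup>+s. ennreal (\<kappa> * \<bar>t - s\<bar> powr (- \<delta>)) * (indicator E t * indicator E s) \<partial>lborel) = (\<integral>\<^sup>+s. (ennreal \<kappa> * indicator E t) * (ennreal (\<bar>t - s\<bar> powr (- \<delta>)) * indicator E s) \<partial>lborel)"
        using \<kappa>0 by (intro nn_integral_cong) (simp add: ennreal_mult mult_ac)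
      also have "\<dots> = (ennreal \<kappa> * indicator E t) * (\<integral>\<^sup>+s. ennreal (\<bar>t - s\<bar> powr (- \<delta>)) * indicator E s \<partial>lborel)"
        by (rule nn_integral_cmult) measurable
      also have "\<dots> \<le> (ennreal \<kappa> * indicator E t) * ennreal (C2 * m powr (1 - \<delta>))"
        unfolding C2_def by (intro mult_left_mono riesz_potential_of_set m \<delta>) auto
      also have "\<dots> = ennreal (\<kappa> * (C2 * m powr (1 - \<delta>))) * indicator E t"
        using \<kappa>0 C20 by (simp add: ennreal_mult mult_ac)
      finally show "(\<integral>\<^sup>+s. ennreal (\<kappa> * \<bar>t - s\<bar> powr (- \<delta>)) * (indicator E t * indicator E s) \<partial>lborel) \<le> ennreal (\<kappa> * (C2 * m powr (1 - \<delta>))) * indicator E t" .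
    qed
    also have "\<dots> = ennreal (\<kappa> * (C2 * m powr (1 - \<delta>))) * ennreal m"
      by (subst nn_integral_cmult_indicator) (auto simp: m)
    also have "\<dots> = ennreal (\<kappa> * C2 * m powr (2 - \<delta>))"
    proof -
      have "m powr (1 - \<delta>) * m = m powr (2 - \<delta>)" using m by (simp add: powr_diff power2_eq_square)
      then have e: "\<kappa> * (C2 * m powr (1 - \<delta>)) * m = \<kappa> * C2 * m powr (2 - \<delta>)" by (simp only: mult.assoc)
      show ?thesis unfolding e[symmetric] using m(2) by (simp add: ennreal_mult'')
    qed
    finally show ?thesis unfolding H_def g_def .
  qed
  ultimately show ?thesis by (rule that)
qed

end

context dispersive_operator
begin

text \<open>Duality tested on the exceptional set itself: \<open>G\<close> norms T f at each t in
  \<open>E\<close>, so the pairing is at least l m, while Cauchy-Schwarz and the dual form bound it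
  by W (C m^(2 - \<delta>))^(1/2). Solving for m gives the claim. Restricting to |t| <= R and to a
  ball in x makes m and all integrals finite beforehand, so that powers of m may be
  cancelled.\<close>

lemma weak_strichartz_local:
  assumes r: "2 < r" and \<delta>: "0 < \<delta>" "\<delta> < 1" and f[measurable]: "f \<in> borel_measurable borel" and fW: "sqnorm f \<le> ennreal (W\<^sup>2)" and W: "0 < W" and l: "0 < l"
    and C: "0 < C" and dual: "\<And>G E m L R. (\<lambda>p. G (fst p) (snd p)) \<in> borel_measurable (borel \<Otimes>\<^sub>M borel) \<Longrightarrow>
    E \<in> sets borel \<Longrightarrow> emeasure lborel E = ennreal m \<Longrightarrow> 0 < m \<Longrightarrow> 0 \<le> L \<Longrightarrow>
    (\<And>t x. cmod (G t x) \<le> L * indicator E t * indicator (cball 0 R) x) \<Longrightarrow>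
    (\<And>t. (\<integral>\<^sup>+x. ennreal (cmod (G t x) powr (r / (r - 1))) \<partial>lborel) \<le> 1) \<Longrightarrow>
    sqnorm (\<lambda>\<xi>. a \<xi> * (LINT t|lborel. cis (t * \<phi> \<xi>) * FT (G t) (- \<xi>))) \<le> ennreal (C * m powr (2 - \<delta>))"
  shows "emeasure lborel {t. \<bar>t\<bar> \<le> R \<and> ennreal (l powr r) < (\<integral>\<^sup>+x. ennreal (cmod (T t f x) powr r) * indicator (cball 0 R) x \<partial>lborel)}
     \<le> ennreal (C powr (1 / \<delta>) * (W / l) powr (2 / \<delta>))"
proof -
  define h where "h t = (\<integral>\<^sup>+x. ennreal (cmod (T t f x) powr r) * indicator (cball 0 R) x \<partial>lborel)" for t
  define E where "E = {t. \<bar>t\<bar> \<le> R \<and> ennreal (l powr r) < h t}"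
  have ff: "sqnorm f < \<infinity>" using fW by (rule le_less_trans) simp
  have [measurable]: "cball (0::'a) R \<in> sets borel" by simp
  have [measurable]: "(\<lambda>p. T (fst p) f (snd p)) \<in> borel_measurable (borel \<Otimes>\<^sub>M borel)" by measurable
  have [measurable]: "h \<in> borel_measurable borel"
  proof -
    have 1: "(\<lambda>p. ennreal (cmod (T (fst p) f (snd p)) powr r) * indicator (cball 0 R) (snd p)) \<in> borel_measurable (borel \<Otimes>\<^sub>M lborel)"
      by measurable
    from lborel.borel_measurable_nn_integral[of "\<lambda>t x. ennreal (cmod (T t f x) powr r) * indicator (cball 0 R) x", unfolded split_beta', OF this]
    show ?thesis unfolding h_def[abs_def] .
  qed
  have [measurable]: "E \<in> sets borel" unfolding E_def by measurable
  have Efin: "emeasure lborel E < \<infinity>"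
  proof -
    have "emeasure lborel E \<le> emeasure lborel (cball (0::real) R)" by (rule emeasure_mono) (auto simp: E_def)
    also have "\<dots> < \<infinity>" by (cases "0 \<le> R") (auto simp: emeasure_cball)
    finally show ?thesis .
  qed
  define m where "m = measure lborel E"
  have m: "emeasure lborel E = ennreal m" unfolding m_def using Efin by (intro emeasure_eq_ennreal_measure) auto
  show ?thesis unfolding h_def[symmetric] E_def[symmetric]
  proof (cases "m = 0")
    case True then show "emeasure lborel E \<le> ennreal (C powr (1 / \<delta>) * (W / l) powr (2 / \<delta>))" using m by simp
  next
    case False
    then have m0: "0 < m" by (simp add: m_def zero_less_measure_iff)
    define B where "B = sup_const * W"
    have B: "cmod (T t f x) \<le> B" for t x unfolding B_def by (rule norm_T_le) (use fW W in auto)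
    have cfin: "emeasure lborel (cball (0::'a) R) < \<infinity>" by (cases "0 \<le> R") (auto simp: emeasure_cball)
    have hfin: "h t < \<infinity>" for t
    proof -
      have "h t \<le> (\<integral>\<^sup>+(x::'a). ennreal (B powr r) * indicator (cball 0 R) x \<partial>lborel)"
        unfolding h_def using B r by (intro nn_integral_mono mult_right_mono ennreal_leI powr_mono2) auto
      also have "\<dots> < \<infinity>" using cfin by (subst nn_integral_cmult_indicator) (auto simp: ennreal_mult_less_top)
      finally show ?thesis .
    qed
    define n where "n t = enn2real (h t)" for t
    have hn: "h t = ennreal (n t)" for t using hfin[of t] by (simp add: n_def ennreal_enn2real_if)
    have [measurable]: "n \<in> borel_measurable borel" unfolding n_def[abs_def] by measurable
    have n0: "0 \<le> n t" for t by (simp add: n_def)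
    have lr: "0 < l powr r" using l by simp
    have nl: "l powr r < n t" if "t \<in> E" for t using that hn[of t] n0[of t] by (simp add: E_def ennreal_less_iff)
    \<comment> \<open>The normalised extremal function of Hoelder's inequality on the ball: its
      modulus is |T f|^(r - 1) over the (r - 1)-st power of the norm
      \<open>n t powr (1 / r)\<close>, so its norm with the conjugate exponent is 1 and its pairing
      with T f is that norm.\<close>
    define G where "G t x = (if t \<in> E \<and> x \<in> cball 0 R then cnj (T t f x) * of_real (cmod (T t f x) powr (r - 2) * n t powr (- (r - 1) / r)) else 0)" for t x
    have Gm: "(\<lambda>p. G (fst p) (snd p)) \<in> borel_measurable (borel \<Otimes>\<^sub>M borel)" unfolding G_def by measurable
    have [measurable]: "G t \<in> borel_measurable borel" for t
      using measurable_compose[OF measurable_Pair1' Gm, of t] by simp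
    have pw: "z * z powr (r - 2) = z powr (r - 1)" if "0 \<le> z" for z :: real
      using that r by (cases "z = 0") (auto simp: powr_mult_base)
    have Gn: "cmod (G t x) = cmod (T t f x) powr (r - 1) * n t powr (- (r - 1) / r)" if "t \<in> E" "x \<in> cball 0 R" for t x
      using that pw[of "cmod (T t f x)"] by (simp add: G_def norm_mult mult.assoc[symmetric])
    \<comment> \<open>On \<open>E\<close> the quantity \<open>n t\<close> exceeds l^r, which
      controls its negative power.\<close>
    define L where "L = B powr (r - 1) * (l powr r) powr (- (r - 1) / r)"
    have L0: "0 \<le> L" by (simp add: L_def)
    have Gb: "cmod (G t x) \<le> L * indicator E t * indicator (cball 0 R) x" for t x
    proof (cases "t \<in> E \<and> x \<in> cball 0 R")
      case True
      have "cmod (T t f x) powr (r - 1) * n t powr (- (r - 1) / r) \<le> L" unfolding L_def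
        using True B nl[of t] r lr by (intro mult_mono powr_mono2 powr_mono2') (auto simp: divide_nonpos_pos)
      then show ?thesis using True Gn[of t x] by simp
    qed (auto simp: G_def)
    have Gr: "(\<integral>\<^sup>+x. ennreal (cmod (G t x) powr (r / (r - 1))) \<partial>lborel) \<le> 1" for t
    proof (cases "t \<in> E")
      case True
      have np: "0 < n t" using nl[OF True] lr by linarith
      have "(\<integral>\<^sup>+x. ennreal (cmod (G t x) powr (r / (r - 1))) \<partial>lborel) = (\<integral>\<^sup>+x. ennreal (1 / n t) * (ennreal (cmod (T t f x) powr r) * indicator (cball 0 R) x) \<partial>lborel)"
      proof (rule nn_integral_cong)
        fix x
        show "ennreal (cmod (G t x) powr (r / (r - 1))) = ennreal (1 / n t) * (ennreal (cmod (T t f x) powr r) * indicator (cball 0 R) x)"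
        proof (cases "x \<in> cball 0 R")
          case x: True
          have e1: "- (r - 1) / r * (r / (r - 1)) = - 1" using r by (simp add: field_simps)
          have e2: "(r - 1) * (r / (r - 1)) = r" using r by simp
          have "cmod (G t x) powr (r / (r - 1)) = cmod (T t f x) powr r * n t powr (- 1)"
            unfolding Gn[OF True x] by (subst powr_mult) (simp_all only: powr_powr e1 e2 powr_ge_zero)
          also have "\<dots> = 1 / n t * cmod (T t f x) powr r" using np by (simp add: powr_minus divide_inverse mult.commute)
          finally have e: "cmod (G t x) powr (r / (r - 1)) = 1 / n t * cmod (T t f x) powr r" .
          show ?thesis unfolding e using x np by (subst ennreal_mult) auto
        qed (auto simp: G_def)
      qed
      also have "\<dots> = ennreal (1 / n t) * h t" unfolding h_def by (rule nn_integral_cmult) measurable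
      also have "\<dots> = 1" using np unfolding hn by (subst ennreal_mult[symmetric]) auto
      finally show ?thesis by simp
    next
      case False
      then show ?thesis by (simp add: G_def)
    qed
    have wi: "integrable lborel (\<lambda>x::'a. c * indicator (cball 0 R) x)" for c :: real using cfin by (intro integrable_mult_right) auto
    have iE: "integrable lborel (\<lambda>t. c * indicator E t)" for c :: real using Efin by (intro integrable_mult_right) auto
    have Gi: "integrable lborel (G t)" for t
    proof (rule Bochner_Integration.integrable_bound[OF wi[of "L * indicator E t"]])
      show "AE x in lborel. cmod (G t x) \<le> norm (L * indicator E t * indicator (cball 0 R) x)"
        unfolding real_norm_def by (intro AE_I2 order_trans[OF Gb abs_ge_self])
    qed measurable
    define I where "I t = (LINT x|lborel. G t x * T t f x)" for t
    have Iv: "I t = of_real (n t powr (1 / r) * indicator E t)" for t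
    proof (cases "t \<in> E")
      case True
      have np: "0 < n t" using nl[OF True] lr by linarith
      have p2: "z\<^sup>2 * z powr (r - 2) = z powr r" if "0 \<le> z" for z :: real
        using that r by (cases "z = 0") (auto simp: powr_diff)
      have "I t = (LINT x|lborel. complex_of_real (n t powr (- (r - 1) / r) * (cmod (T t f x) powr r * indicator (cball 0 R) x)))"
        unfolding I_def
      proof (rule Bochner_Integration.integral_cong[OF refl])
        fix x
        have e: "cnj (T t f x) * T t f x = of_real ((cmod (T t f x))\<^sup>2)" by (simp only: complex_norm_square mult.commute)
        have "cnj (T t f x) * of_real (cmod (T t f x) powr (r - 2) * n t powr (- (r - 1) / r)) * T t f x
          = (cnj (T t f x) * T t f x) * of_real (cmod (T t f x) powr (r - 2) * n t powr (- (r - 1) / r))" by (simp only: mult_ac)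
        also have "\<dots> = of_real (n t powr (- (r - 1) / r) * ((cmod (T t f x))\<^sup>2 * cmod (T t f x) powr (r - 2)))"
          unfolding e by (simp only: of_real_mult[symmetric] mult_ac)
        finally have "cnj (T t f x) * of_real (cmod (T t f x) powr (r - 2) * n t powr (- (r - 1) / r)) * T t f x
          = of_real (n t powr (- (r - 1) / r) * ((cmod (T t f x))\<^sup>2 * cmod (T t f x) powr (r - 2)))" .
        then show "G t x * T t f x = complex_of_real (n t powr (- (r - 1) / r) * (cmod (T t f x) powr r * indicator (cball 0 R) x))"
          using True p2[of "cmod (T t f x)"] by (simp add: G_def)
      qed
      also have "\<dots> = of_real (n t powr (- (r - 1) / r) * (LINT x|lborel. cmod (T t f x) powr r * indicator (cball 0 R) x))"
        by (simp only: integral_complex_of_real integral_mult_right_zero)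
      also have "(LINT x|lborel. cmod (T t f x) powr r * indicator (cball 0 R) x) = n t"
        unfolding n_def h_def
        by (subst integral_eq_nn_integral) (auto intro!: arg_cong[where f=enn2real] nn_integral_cong simp: indicator_def)
      also have "n t powr (- (r - 1) / r) * n t = n t powr (1 / r)"
      proof -
        have "n t powr (- (r - 1) / r) * n t powr 1 = n t powr (1 / r)" using r by (simp only: powr_add[symmetric]) (simp add: field_simps)
        then show ?thesis using np by simp
      qed
      finally show ?thesis using True by simp
    qed (simp add: I_def G_def)
    \<comment> \<open>By Fubini the integral of the pairings over \<open>E\<close> is the pairing of
      f with \<open>a \<xi> * H \<xi>\<close>, the function bounded by the dual form.\<close>
    define H where "H \<xi> = (LINT t|lborel. cis (t * \<phi> \<xi>) * FT (G t) (- \<xi>))" for \<xi>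
    have Hn: "sqnorm (\<lambda>\<xi>. a \<xi> * H \<xi>) \<le> ennreal (C * m powr (2 - \<delta>))"
      unfolding H_def by (rule dual[OF Gm _ m m0 L0 Gb Gr]) measurable
    define g where "g t \<xi> = FT (G t) (- \<xi>)" for t \<xi>
    have gm: "(\<lambda>p. g (fst p) (snd p)) \<in> borel_measurable (borel \<Otimes>\<^sub>M borel)"
    proof -
      have 1: "(\<lambda>q. G (fst (fst q)) (snd q)) \<in> borel_measurable ((borel \<Otimes>\<^sub>M borel) \<Otimes>\<^sub>M lborel)"
        using measurable_compose[OF _ Gm, of "\<lambda>q. (fst (fst q), snd q)" "(borel \<Otimes>\<^sub>M borel) \<Otimes>\<^sub>M lborel"] by simp
      have "(\<lambda>q. cis (- (snd q \<bullet> - snd (fst q))) * G (fst (fst q)) (snd q)) \<in> borel_measurable ((borel \<Otimes>\<^sub>M borel) \<Otimes>\<^sub>M lborel)"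
        by (intro borel_measurable_times 1) measurable
      from lborel.borel_measurable_lebesgue_integral[of "\<lambda>p x. cis (- (x \<bullet> - snd p)) * G (fst p) x", unfolded split_beta', OF this]
      show ?thesis unfolding g_def FT_def .
    qed
    have gm': "(\<lambda>q. g (fst q) (snd q)) \<in> borel_measurable (lborel \<Otimes>\<^sub>M lborel)"
      using gm by (simp cong: measurable_cong_sets)
    have [measurable]: "H \<in> borel_measurable borel"
    proof -
      have 1: "(\<lambda>q. g (snd q) (fst q)) \<in> borel_measurable (borel \<Otimes>\<^sub>M lborel)"
        using measurable_compose[OF _ gm, of "\<lambda>q. (snd q, fst q)" "borel \<Otimes>\<^sub>M lborel"] by simp
      have "(\<lambda>q. cis (snd q * \<phi> (fst q)) * g (snd q) (fst q)) \<in> borel_measurable (borel \<Otimes>\<^sub>M lborel)"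
        by (intro borel_measurable_times 1) measurable
      from lborel.borel_measurable_lebesgue_integral[of "\<lambda>\<xi> t. cis (t * \<phi> \<xi>) * g t \<xi>", unfolded split_beta', OF this]
      show ?thesis unfolding H_def[abs_def] g_def .
    qed
    have gb: "cmod (g t \<xi>) \<le> L * measure lborel (cball (0::'a) R) * indicator E t" for t \<xi>
    proof -
      have "cmod (g t \<xi>) \<le> (LINT x|lborel. cmod (G t x))" unfolding g_def by (rule norm_FT_le)
      also have "\<dots> \<le> (LINT x|lborel. L * indicator E t * indicator (cball (0::'a) R) x)"
        by (intro Bochner_Integration.integral_mono integrable_norm Gi wi Gb)
      also have "\<dots> = L * measure lborel (cball (0::'a) R) * indicator E t" using cfin by simp
      finally show ?thesis .
    qed
    have af: "integrable lborel (\<lambda>\<xi>. a \<xi> * f \<xi>)" by (intro integrable_af ff) measurable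
    have int: "integrable (lborel \<Otimes>\<^sub>M lborel) (\<lambda>(t, \<xi>). cis (t * \<phi> \<xi>) * (a \<xi> * f \<xi>) * g t \<xi>)"
    proof (rule Bochner_Integration.integrable_bound)
      show "integrable (lborel \<Otimes>\<^sub>M lborel) (\<lambda>p. (L * measure lborel (cball (0::'a) R) * indicator E (fst p)) * cmod (a (snd p) * f (snd p)))"
        by (rule integrable_pair_mult[OF sigma_finite_lborel sigma_finite_lborel iE integrable_norm[OF af]])
      show "(\<lambda>(t, \<xi>). cis (t * \<phi> \<xi>) * (a \<xi> * f \<xi>) * g t \<xi>) \<in> borel_measurable (lborel \<Otimes>\<^sub>M lborel)"
        unfolding split_beta' by (intro borel_measurable_times gm') measurable
      show "AE p in lborel \<Otimes>\<^sub>M lborel. cmod (case p of (t, \<xi>) \<Rightarrow> cis (t * \<phi> \<xi>) * (a \<xi> * f \<xi>) * g t \<xi>)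
         \<le> norm ((L * measure lborel (cball (0::'a) R) * indicator E (fst p)) * cmod (a (snd p) * f (snd p)))"
      proof (rule AE_I2)
        fix p :: "real \<times> 'a"
        obtain t \<xi> where p: "p = (t, \<xi>)" by (cases p) auto
        have "cmod (a \<xi> * f \<xi>) * cmod (g t \<xi>) \<le> cmod (a \<xi> * f \<xi>) * (L * measure lborel (cball (0::'a) R) * indicator E t)"
          by (intro mult_left_mono gb) auto
        then show "cmod (case p of (t, \<xi>) \<Rightarrow> cis (t * \<phi> \<xi>) * (a \<xi> * f \<xi>) * g t \<xi>) \<le> norm ((L * measure lborel (cball (0::'a) R) * indicator E (fst p)) * cmod (a (snd p) * f (snd p)))"
          unfolding p real_norm_def by (intro order_trans[OF _ abs_ge_self]) (simp add: norm_mult mult_ac)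
      qed
    qed
    have Ig: "I t = (LINT \<xi>|lborel. cis (t * \<phi> \<xi>) * (a \<xi> * f \<xi>) * g t \<xi>)" for t
      unfolding I_def g_def by (rule T_pairing[OF Gi f ff])
    have Ii: "integrable lborel I" unfolding Ig[abs_def] using lborel_pair.integrable_fst[OF int] .
    have SI: "(LINT t|lborel. I t) = (LINT \<xi>|lborel. f \<xi> * (a \<xi> * H \<xi>))"
    proof -
      have "(LINT t|lborel. I t) = (LINT \<xi>|lborel. LINT t|lborel. cis (t * \<phi> \<xi>) * (a \<xi> * f \<xi>) * g t \<xi>)"
        unfolding Ig by (rule lborel_pair.Fubini_integral[symmetric]) (rule int)
      also have "\<dots> = (LINT \<xi>|lborel. (a \<xi> * f \<xi>) * H \<xi>)"
        unfolding H_def g_def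
        by (intro Bochner_Integration.integral_cong refl, subst integral_mult_right_zero[symmetric]) (simp add: mult_ac)
      finally show ?thesis by (simp add: mult_ac)
    qed
    have low: "l * m \<le> cmod (LINT t|lborel. I t)"
    proof -
      have In: "integrable lborel (\<lambda>t. n t powr (1 / r) * indicator E t)"
        using Ii unfolding Iv[abs_def] by (simp only: complex_of_real_integrable_eq)
      have "l * m = (LINT t|lborel. l * indicator E t)" using Efin by (simp add: m_def)
      also have "\<dots> \<le> (LINT t|lborel. n t powr (1 / r) * indicator E t)"
      proof (rule Bochner_Integration.integral_mono[OF iE In])
        fix t
        have "l \<le> n t powr (1 / r)" if "t \<in> E"
        proof -
          have "(l powr r) powr (1 / r) \<le> n t powr (1 / r)" using nl[OF that] r by (intro powr_mono2) auto
          then show ?thesis using l r by (simp add: powr_powr)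
        qed
        then show "l * indicator E t \<le> n t powr (1 / r) * indicator E t" by (auto simp: indicator_def)
      qed
      also have "\<dots> \<le> cmod (LINT t|lborel. I t)" unfolding Iv integral_complex_of_real norm_of_real by (rule abs_ge_self)
      finally show ?thesis .
    qed
    have "ennreal (l * m) \<le> ennreal (cmod (LINT \<xi>|lborel. f \<xi> * (a \<xi> * H \<xi>)))" using low unfolding SI by (rule ennreal_leI)
    also have "\<dots> \<le> (\<integral>\<^sup>+\<xi>. ennreal (cmod (f \<xi> * (a \<xi> * H \<xi>))) \<partial>lborel)" by (rule ennreal_norm_integral_le)
    also have "\<dots> = (\<integral>\<^sup>+\<xi>. ennreal (cmod (f \<xi>)) * ennreal (cmod (a \<xi> * H \<xi>)) \<partial>lborel)"
      by (intro nn_integral_cong) (simp only: norm_mult[of "f _"] ennreal_mult norm_ge_zero)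
    finally have "(ennreal (l * m))\<^sup>2 \<le> (\<integral>\<^sup>+\<xi>. ennreal (cmod (f \<xi>)) * ennreal (cmod (a \<xi> * H \<xi>)) \<partial>lborel)\<^sup>2" by (intro power_mono) auto
    also have "\<dots> \<le> (\<integral>\<^sup>+\<xi>. (ennreal (cmod (f \<xi>)))\<^sup>2 \<partial>lborel) * (\<integral>\<^sup>+\<xi>. (ennreal (cmod (a \<xi> * H \<xi>)))\<^sup>2 \<partial>lborel)"
      by (rule Cauchy_Schwarz_nn_integral) measurable
    also have "\<dots> = sqnorm f * sqnorm (\<lambda>\<xi>. a \<xi> * H \<xi>)" by (simp only: sqnorm_def ennreal_power norm_ge_zero)
    also have "\<dots> \<le> ennreal (W\<^sup>2) * ennreal (C * m powr (2 - \<delta>))" by (intro mult_mono fW Hn) auto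
    also have "\<dots> = ennreal (W\<^sup>2 * (C * m powr (2 - \<delta>)))" using C by (subst ennreal_mult) auto
    finally have "(l * m)\<^sup>2 \<le> W\<^sup>2 * (C * m powr (2 - \<delta>))"
      using l m0 C by (simp add: ennreal_power ennreal_le_iff del: ennreal_mult)
    \<comment> \<open>m^2 is split as m^\<delta> m^(2 - \<delta>), so that the positive factor m^(2
      - \<delta>) cancels.\<close>
    then have "l\<^sup>2 * (m powr \<delta> * m powr (2 - \<delta>)) \<le> (W\<^sup>2 * C) * m powr (2 - \<delta>)"
      using m0 by (simp add: powr_add[symmetric] power_mult_distrib mult.assoc)
    then have "l\<^sup>2 * m powr \<delta> \<le> W\<^sup>2 * C" using m0 by (simp add: mult.assoc[symmetric])
    then have "m powr \<delta> \<le> C * (W / l)\<^sup>2" using l by (simp add: field_simps power_divide)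
    then have "(m powr \<delta>) powr (1 / \<delta>) \<le> (C * (W / l)\<^sup>2) powr (1 / \<delta>)" using \<delta> by (intro powr_mono2) auto
    also have "(m powr \<delta>) powr (1 / \<delta>) = m" using m0 \<delta> by (simp add: powr_powr)
    also have "(C * (W / l)\<^sup>2) powr (1 / \<delta>) = C powr (1 / \<delta>) * (W / l) powr (2 / \<delta>)"
    proof -
      have "(W / l)\<^sup>2 = (W / l) powr 2" using W l by simp
      then show ?thesis using C by (simp only: powr_mult powr_powr) (simp add: powr_mult powr_powr)
    qed
    finally show "emeasure lborel E \<le> ennreal (C powr (1 / \<delta>) * (W / l) powr (2 / \<delta>))" unfolding m by (rule ennreal_leI)
  qed
qed

text \<open>The local bound is uniform in R, and the local level sets increase to a set containing
  the full one: an integral strictly above l^r is so already on some ball. Hence the strict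
  inequality in the level sets.\<close>

lemma weak_strichartz:
  assumes r: "2 < r" and \<delta>: "\<delta> = real DIM('a) * (1 / 2 - 1 / r)" "0 < \<delta>" "\<delta> < 1"
  obtains C where "0 < C" "\<And>f W l. f \<in> borel_measurable borel \<Longrightarrow> sqnorm f \<le> ennreal (W\<^sup>2) \<Longrightarrow> 0 < W \<Longrightarrow> 0 < l \<Longrightarrow>
    emeasure lborel {t. ennreal (l powr r) < (\<integral>\<^sup>+x. ennreal (cmod (T t f x) powr r) \<partial>lborel)} \<le> ennreal (C * (W / l) powr (2 / \<delta>))"
proof -
  obtain C where C: "0 < C" and dual: "\<And>G E m L R. (\<lambda>p. G (fst p) (snd p)) \<in> borel_measurable (borel \<Otimes>\<^sub>M borel) \<Longrightarrow>
    E \<in> sets borel \<Longrightarrow> emeasure lborel E = ennreal m \<Longrightarrow> 0 < m \<Longrightarrow> 0 \<le> L \<Longrightarrow>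
    (\<And>t x. cmod (G t x) \<le> L * indicator E t * indicator (cball 0 R) x) \<Longrightarrow>
    (\<And>t. (\<integral>\<^sup>+x. ennreal (cmod (G t x) powr (r / (r - 1))) \<partial>lborel) \<le> 1) \<Longrightarrow>
    sqnorm (\<lambda>\<xi>. a \<xi> * (LINT t|lborel. cis (t * \<phi> \<xi>) * FT (G t) (- \<xi>))) \<le> ennreal (C * m powr (2 - \<delta>))"
    using strichartz_dual_form[OF r \<delta>] by blast
  show ?thesis
  proof (rule that)
    show "0 < C powr (1 / \<delta>)" using C by simp
    fix f :: "'a \<Rightarrow> complex" and W l assume f[measurable]: "f \<in> borel_measurable borel" and fW: "sqnorm f \<le> ennreal (W\<^sup>2)" and W: "0 < W" and l: "0 < (l::real)"
    define h where "h R t = (\<integral>\<^sup>+x. ennreal (cmod (T t f x) powr r) * indicator (cball 0 R) x \<partial>lborel)" for R t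
    define E where "E k = {t. \<bar>t\<bar> \<le> real k \<and> ennreal (l powr r) < h (real k) t}" for k :: nat
    have [measurable]: "h R \<in> borel_measurable borel" for R
    proof -
      have [measurable]: "cball (0::'a) R \<in> sets borel" by simp
      have [measurable]: "(\<lambda>p. T (fst p) f (snd p)) \<in> borel_measurable (borel \<Otimes>\<^sub>M borel)" by measurable
      have 1: "(\<lambda>p. ennreal (cmod (T (fst p) f (snd p)) powr r) * indicator (cball 0 R) (snd p)) \<in> borel_measurable (borel \<Otimes>\<^sub>M lborel)"
        by measurable
      from lborel.borel_measurable_nn_integral[of "\<lambda>t x. ennreal (cmod (T t f x) powr r) * indicator (cball 0 R) x", unfolded split_beta', OF this]
      show ?thesis unfolding h_def[abs_def] .
    qed
    have [measurable]: "cball (0::'a) (real k) \<in> sets borel" for k by simp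
    have Em: "range E \<subseteq> sets lborel" unfolding E_def by auto
    have hmono: "h R t \<le> h R' t" if "R \<le> R'" for R R' t
      unfolding h_def using that by (intro nn_integral_mono mult_left_mono) (auto simp: indicator_def)
    have "incseq E"
    proof (intro monoI subsetI)
      fix i j :: nat and t assume "i \<le> j" "t \<in> E i"
      then show "t \<in> E j" using hmono[of "real i" "real j" t] by (auto simp: E_def intro: less_le_trans)
    qed
    have sup: "(\<integral>\<^sup>+x. ennreal (cmod (T t f x) powr r) \<partial>lborel) = (SUP k. h (real k) t)" for t
    proof -
      have "(SUP k. ennreal (cmod (T t f x) powr r) * indicator (cball 0 (real k)) x) = ennreal (cmod (T t f x) powr r)" for x :: 'a
      proof (rule antisym)
        obtain k :: nat where "norm x \<le> real k" using real_arch_simple by blast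
        then show "ennreal (cmod (T t f x) powr r) \<le> (SUP k. ennreal (cmod (T t f x) powr r) * indicator (cball 0 (real k)) x)"
          by (intro SUP_upper2[of k]) auto
      qed (auto intro!: SUP_least simp: indicator_def)
      then have "(\<integral>\<^sup>+x. ennreal (cmod (T t f x) powr r) \<partial>lborel) = (\<integral>\<^sup>+x. (SUP k. ennreal (cmod (T t f x) powr r) * indicator (cball 0 (real k)) x) \<partial>lborel)" by simp
      also have "\<dots> = (SUP k. h (real k) t)" unfolding h_def
      proof (rule nn_integral_monotone_convergence_SUP)
        show "incseq (\<lambda>k x. ennreal (cmod (T t f x) powr r) * indicator (cball 0 (real k)) x)"
          by (intro monoI le_funI mult_left_mono) (auto simp: indicator_def)
      qed measurable
      finally show ?thesis .
    qed
    have "{t. ennreal (l powr r) < (\<integral>\<^sup>+x. ennreal (cmod (T t f x) powr r) \<partial>lborel)} \<subseteq> (\<Union>k. E k)"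
    proof
      fix t assume "t \<in> {t. ennreal (l powr r) < (\<integral>\<^sup>+x. ennreal (cmod (T t f x) powr r) \<partial>lborel)}"
      then obtain k1 where k1: "ennreal (l powr r) < h (real k1) t" unfolding sup by (auto simp: less_SUP_iff)
      obtain k2 :: nat where k2: "\<bar>t\<bar> \<le> real k2" using real_arch_simple by blast
      have "t \<in> E (max k1 k2)" using k2 less_le_trans[OF k1 hmono[of "real k1" "real (max k1 k2)" t]] by (auto simp: E_def)
      then show "t \<in> (\<Union>k. E k)" by blast
    qed
    then have "emeasure lborel {t. ennreal (l powr r) < (\<integral>\<^sup>+x. ennreal (cmod (T t f x) powr r) \<partial>lborel)} \<le> emeasure lborel (\<Union>k. E k)"
      using Em by (intro emeasure_mono) auto
    also have "\<dots> = (SUP k. emeasure lborel (E k))" using SUP_emeasure_incseq[OF Em \<open>incseq E\<close>] by simp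
    also have "\<dots> \<le> ennreal (C powr (1 / \<delta>) * (W / l) powr (2 / \<delta>))"
      unfolding E_def h_def by (intro SUP_least weak_strichartz_local[OF r \<delta>(2,3) f fW W l C dual])
    finally show "emeasure lborel {t. ennreal (l powr r) < (\<integral>\<^sup>+x. ennreal (cmod (T t f x) powr r) \<partial>lborel)} \<le> ennreal (C powr (1 / \<delta>) * (W / l) powr (2 / \<delta>))" .
  qed
qed

end

section \<open>Mixed norm estimates\<close>

lemma suminf_geometric_tail:
  fixes x M :: real
  assumes x: "0 < x" "x < 1" and P: "\<And>j. P j \<Longrightarrow> x ^ j \<le> M" and M: "0 \<le> M"
  shows "(\<Sum>j. ennreal (x ^ j) * (if P j then 1 else 0)) \<le> ennreal (M / (1 - x))"
proof (cases "\<exists>j. P j")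
  case True
  define j0 where "j0 = (LEAST j. P j)"
  have j0: "P j0" using True unfolding j0_def by (metis LeastI)
  have le: "j0 \<le> j" if "P j" for j using that unfolding j0_def by (rule Least_le)
  have "(\<Sum>j. ennreal (x ^ j) * (if P j then 1 else 0)) \<le> (\<Sum>j. ennreal (if j0 \<le> j then x ^ j else 0))"
    using le by (intro suminf_le) auto
  also have "\<dots> = (\<Sum>j. ennreal (if j0 \<le> j + j0 then x ^ (j + j0) else 0)) + (\<Sum>j<j0. ennreal (if j0 \<le> j then x ^ j else 0))"
    by (rule suminf_offset) auto
  also have "(\<Sum>j<j0. ennreal (if j0 \<le> j then x ^ j else 0)) = 0" by (intro sum.neutral) auto
  also have "(\<Sum>j. ennreal (if j0 \<le> j + j0 then x ^ (j + j0) else 0)) = (\<Sum>j. ennreal (x ^ j0 * x ^ j))"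
    by (simp add: power_add mult.commute)
  also have "\<dots> = ennreal (\<Sum>j. x ^ j0 * x ^ j)"
    using x by (intro suminf_ennreal2) (auto intro!: summable_mult summable_geometric)
  also have "(\<Sum>j. x ^ j0 * x ^ j) = x ^ j0 / (1 - x)"
    using x by (subst suminf_mult) (auto simp: suminf_geometric summable_geometric)
  also have "ennreal (x ^ j0 / (1 - x)) \<le> ennreal (M / (1 - x))"
    using P[OF j0] x by (intro ennreal_leI divide_right_mono) auto
  finally show ?thesis by simp
next
  case False
  then show ?thesis by simp
qed

text \<open>Since (1 / x)^j is unbounded, P has a last index \<open>J\<close> if any; read backwards
  from there the terms decrease geometrically with ratio x from a value at most M.\<close>

lemma suminf_geometric_head:
  fixes x M :: real
  assumes x: "0 < x" "x < 1" and P: "\<And>j. P j \<Longrightarrow> (1 / x) ^ j \<le> M" and M: "0 \<le> M"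
  shows "(\<Sum>j. ennreal ((1 / x) ^ j) * (if P j then 1 else 0)) \<le> ennreal (M / (1 - x))"
proof (cases "\<exists>j. P j")
  case True
  obtain k where k: "M < (1 / x) ^ k" using x real_arch_pow[of "1 / x" M] by auto
  have bd: "j < k" if "P j" for j
  proof (rule ccontr)
    assume "\<not> j < k"
    then have "(1 / x) ^ k \<le> (1 / x) ^ j" using x by (intro power_increasing) auto
    then show False using P[OF that] k by simp
  qed
  define J where "J = Max {j. P j}"
  have fin: "finite {j. P j}" by (rule finite_subset[of _ "{..<k}"]) (use bd in blast, simp)
  have ne: "{j. P j} \<noteq> {}" using True by blast
  have J: "P J" using Max_in[OF fin ne] unfolding J_def by simp
  have le: "j \<le> J" if "P j" for j unfolding J_def by (rule Max_ge[OF fin]) (use that in simp)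
  have "(\<Sum>j. ennreal ((1 / x) ^ j) * (if P j then 1 else 0)) = (\<Sum>j\<le>J. ennreal ((1 / x) ^ j) * (if P j then 1 else 0))"
    using le by (intro suminf_finite) (auto simp: not_le[symmetric])
  also have "\<dots> \<le> (\<Sum>j\<le>J. ennreal (M * x ^ (J - j)))"
  proof (rule sum_mono)
    fix j assume "j \<in> {..J}"
    then have "(1 / x) ^ J = (1 / x) ^ j * (1 / x) ^ (J - j)" by (simp add: power_add[symmetric])
    then have "(1 / x) ^ j = (1 / x) ^ J * x ^ (J - j)" using x by (simp add: power_one_over field_simps)
    also have "\<dots> \<le> M * x ^ (J - j)" using P[OF J] x by (intro mult_right_mono) auto
    finally show "ennreal ((1 / x) ^ j) * (if P j then 1 else 0) \<le> ennreal (M * x ^ (J - j))" by (auto intro: ennreal_leI)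
  qed
  also have "\<dots> = ennreal (\<Sum>j\<le>J. M * x ^ (J - j))" using M x by (intro sum_ennreal) auto
  also have "(\<Sum>j\<le>J. M * x ^ (J - j)) = (\<Sum>j\<le>J. M * x ^ j)"
    by (rule sum.reindex_bij_witness[of _ "\<lambda>j. J - j" "\<lambda>j. J - j"]) auto
  also have "\<dots> \<le> M / (1 - x)"
  proof -
    have "(\<Sum>j\<le>J. x ^ j) \<le> (\<Sum>j. x ^ j)" using x by (intro sum_le_suminf summable_geometric) auto
    also have "\<dots> = 1 / (1 - x)" using x by (intro suminf_geometric) auto
    finally show ?thesis using M by (simp add: sum_distrib_left[symmetric] mult_left_mono) (metis mult_left_mono times_divide_eq_right mult.right_neutral)
  qed
  finally show ?thesis by (simp add: ennreal_leI)
next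
  case False
  then show ?thesis by simp
qed

text \<open>Every term is at most K, so its p-th power is at most K^(p - 1) times the term. The
  application has p = q / 2, hence q >= 2.\<close>

lemma suminf_powr_le:
  fixes x :: "nat \<Rightarrow> real" and p K :: real
  assumes x0: "\<And>j. 0 \<le> x j" and p: "1 \<le> p" and K: "0 < K" and S: "(\<Sum>j. ennreal (x j)) \<le> ennreal K"
  shows "(\<Sum>j. ennreal (x j powr p)) \<le> ennreal (K powr p)"
proof -
  have xK: "x j \<le> K" for j
  proof -
    have "ennreal (x j) \<le> (\<Sum>j. ennreal (x j))" using sum_le_suminf[of "\<lambda>j. ennreal (x j)" "{j}"] by auto
    then have "ennreal (x j) \<le> ennreal K" using S by (rule order_trans)
    then show ?thesis using K by (simp add: ennreal_le_iff)
  qed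
  have "(\<Sum>j. ennreal (x j powr p)) \<le> (\<Sum>j. ennreal (K powr (p - 1)) * ennreal (x j))"
  proof (intro suminf_le allI)
    fix j
    have "x j powr p = x j powr (p - 1) * x j" using x0[of j] by (cases "x j = 0") (auto simp: powr_diff)
    also have "\<dots> \<le> K powr (p - 1) * x j" using x0 xK p by (intro mult_right_mono powr_mono2) auto
    finally show "ennreal (x j powr p) \<le> ennreal (K powr (p - 1)) * ennreal (x j)"
      using x0 by (simp add: ennreal_mult'[symmetric] ennreal_mult''[symmetric] ennreal_leI)
  qed auto
  also have "\<dots> = ennreal (K powr (p - 1)) * (\<Sum>j. ennreal (x j))" by simp
  also have "\<dots> \<le> ennreal (K powr (p - 1)) * ennreal K" by (intro mult_left_mono S) auto
  also have "\<dots> = ennreal (K powr p)" using K by (subst ennreal_mult[symmetric]) (auto simp: powr_diff)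
  finally show ?thesis .
qed

lemma powr_add_le: "0 \<le> a \<Longrightarrow> 0 \<le> b \<Longrightarrow> 0 < p \<Longrightarrow> (a + b) powr p \<le> 2 powr p * (a powr p + b powr p)" for a b p :: real
proof -
  assume a: "0 \<le> a" "0 \<le> b" "0 < p"
  have "(a + b) powr p \<le> (2 * max a b) powr p" using a by (intro powr_mono2) auto
  also have "\<dots> = 2 powr p * (max a b) powr p" using a by (simp add: powr_mult)
  also have "\<dots> \<le> 2 powr p * (a powr p + b powr p)" using a by (intro mult_left_mono) (auto simp: max_def)
  finally show ?thesis .
qed

text \<open>Layer cake with two bounds on the level sets: the measure of I at heights up to
  \<open>l0\<close>, and the weak type bound above, where q < q0 gives convergence. The threshold
  stays free so that the application can balance the two terms.\<close>

lemma nn_integral_of_weak_type: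
  fixes h :: "real \<Rightarrow> real" and q q0 C \<Lambda> N l0 :: real
  assumes [measurable]: "h \<in> borel_measurable borel" "I \<in> sets borel" and h0: "\<And>t. 0 \<le> h t"
    and weak: "\<And>l. 0 < l \<Longrightarrow> emeasure lborel {t. l \<le> h t} \<le> ennreal (C * (\<Lambda> / l) powr q0)"
    and I: "emeasure lborel I \<le> ennreal N" and q: "0 < q" "q < q0" and pos: "0 \<le> C" "0 < \<Lambda>" "0 \<le> N" "0 < l0"
  shows "(\<integral>\<^sup>+t. ennreal (h t powr q) * indicator I t \<partial>lborel)
    \<le> ennreal (N * l0 powr q + C * q / (q0 - q) * \<Lambda> powr q0 * l0 powr (q - q0))"
proof -
  have "(\<integral>\<^sup>+t. ennreal (h t powr q) * indicator I t \<partial>lborel) = (\<integral>\<^sup>+t. ennreal ((h t * indicator I t) powr q) \<partial>lborel)"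
    by (intro nn_integral_cong) (auto simp: indicator_def)
  also have "\<dots> = (\<integral>\<^sup>+l. ennreal (q * l powr (q - 1)) * indicator {0<..} l * emeasure lborel {t\<in>space lborel. l \<le> h t * indicator I t} \<partial>lborel)"
    using q h0 by (intro layer_cake_powr sigma_finite_lborel) (auto simp: indicator_def)
  also have "\<dots> \<le> (\<integral>\<^sup>+l. ennreal N * (ennreal (q * l powr (q - 1)) * indicator {0<..l0} l)
      + ennreal (C * q / (q0 - q) * \<Lambda> powr q0) * (ennreal ((q0 - q) * l powr (- (q0 - q) - 1)) * indicator {l0..} l) \<partial>lborel)"
  proof (rule nn_integral_mono)
    fix l :: real
    let ?S = "{t\<in>space lborel. l \<le> h t * indicator I t}"
    define m where "m = emeasure lborel ?S"
    have "ennreal (q * l powr (q - 1)) * indicator {0<..} l * m \<le> ennreal N * (ennreal (q * l powr (q - 1)) * indicator {0<..l0} l)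
      + ennreal (C * q / (q0 - q) * \<Lambda> powr q0) * (ennreal ((q0 - q) * l powr (- (q0 - q) - 1)) * indicator {l0..} l)"
    proof (cases "0 < l")
      case l: True
      have S1: "?S \<subseteq> I" "?S \<subseteq> {t. l \<le> h t}" using l by (auto simp: indicator_def split: if_splits)
      show ?thesis
      proof (cases "l \<le> l0")
        case True
        have "m \<le> ennreal N" unfolding m_def by (rule order_trans[OF emeasure_mono[OF S1(1)] I]) simp
        then have "ennreal (q * l powr (q - 1)) * m \<le> ennreal (q * l powr (q - 1)) * ennreal N" by (intro mult_left_mono) auto
        then show ?thesis using True l by (auto simp: indicator_def mult.commute intro: add_increasing2)
      next
        case False
        have "m \<le> emeasure lborel {t. l \<le> h t}" unfolding m_def using S1(2) by (intro emeasure_mono) auto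
        then have "m \<le> ennreal (C * (\<Lambda> / l) powr q0)" using weak[OF l] by (rule order_trans)
        then have "ennreal (q * l powr (q - 1)) * m \<le> ennreal (q * l powr (q - 1)) * ennreal (C * (\<Lambda> / l) powr q0)" by (intro mult_left_mono) auto
        also have "\<dots> = ennreal (C * q / (q0 - q) * \<Lambda> powr q0) * ennreal ((q0 - q) * l powr (- (q0 - q) - 1))"
        proof -
          have "l powr (q - 1) * (\<Lambda> / l) powr q0 = \<Lambda> powr q0 * l powr (- (q0 - q) - 1)"
          proof -
            have "(\<Lambda> / l) powr q0 = \<Lambda> powr q0 * l powr (- q0)" using l pos by (simp add: powr_divide powr_minus_divide)
            moreover have "l powr (q - 1) * l powr (- q0) = l powr (- (q0 - q) - 1)" by (simp add: powr_add[symmetric] algebra_simps)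
            ultimately show ?thesis by (simp add: mult_ac)
          qed
          then have "q * l powr (q - 1) * (C * (\<Lambda> / l) powr q0) = q * C * (\<Lambda> powr q0 * l powr (- (q0 - q) - 1))" by (simp add: mult_ac)
          also have "\<dots> = C * q / (q0 - q) * \<Lambda> powr q0 * ((q0 - q) * l powr (- (q0 - q) - 1))" using q by simp
          finally show ?thesis using q pos by (subst (1 2) ennreal_mult[symmetric]) auto
        qed
        finally show ?thesis using False l by (auto simp: indicator_def)
      qed
    qed simp
    then show "ennreal (q * l powr (q - 1)) * indicator {0<..} l * emeasure lborel ?S \<le> ennreal N * (ennreal (q * l powr (q - 1)) * indicator {0<..l0} l)
      + ennreal (C * q / (q0 - q) * \<Lambda> powr q0) * (ennreal ((q0 - q) * l powr (- (q0 - q) - 1)) * indicator {l0..} l)"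
      unfolding m_def .
  qed
  also have "\<dots> = ennreal N * ennreal (l0 powr q) + ennreal (C * q / (q0 - q) * \<Lambda> powr q0) * ennreal (l0 powr (- (q0 - q)))"
  proof -
    have "(\<integral>\<^sup>+l. ennreal N * (ennreal (q * l powr (q - 1)) * indicator {0<..l0} l) \<partial>lborel) = ennreal N * ennreal (l0 powr q)"
      using q pos by (subst nn_integral_cmult, measurable) (subst nn_integral_powr_initial, auto)
    moreover have "(\<integral>\<^sup>+l. ennreal (C * q / (q0 - q) * \<Lambda> powr q0) * (ennreal ((q0 - q) * l powr (- (q0 - q) - 1)) * indicator {l0..} l) \<partial>lborel)
       = ennreal (C * q / (q0 - q) * \<Lambda> powr q0) * ennreal (l0 powr (- (q0 - q)))"
      using q pos by (subst nn_integral_cmult, measurable) (subst nn_integral_powr_tail, auto)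
    ultimately show ?thesis by (subst nn_integral_add) auto
  qed
  also have "\<dots> = ennreal (N * l0 powr q + C * q / (q0 - q) * \<Lambda> powr q0 * l0 powr (q - q0))"
  proof -
    have gen: "ennreal a * ennreal b + ennreal c * ennreal d = ennreal (a * b + c * d)"
      if "0 \<le> a" "0 \<le> b" "0 \<le> c" "0 \<le> d" for a b c d using that by (simp add: ennreal_mult ennreal_plus)
    have "- (q0 - q) = q - q0" by simp
    then show ?thesis using q pos by (simp only:) (rule gen, auto)
  qed
  finally show ?thesis .
qed

lemma ennreal_mult_add: "0 \<le> c \<Longrightarrow> 0 \<le> x \<Longrightarrow> 0 \<le> y \<Longrightarrow> ennreal c * (ennreal x + ennreal y) = ennreal (c * (x + y))"
  by (simp add: ennreal_mult)

lemma square_powr: "0 < x \<Longrightarrow> (x\<^sup>2) powr p = x powr (2 * p)" for x p :: real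
  by (metis powr_numeral powr_powr less_imp_le)

section \<open>Estimates on a single dyadic time set\<close>

context dispersive_operator
begin

text \<open>The r-th power of the L^r norm at time t, as a real number; by
  \<open>nn_integral_T_powr\<close> no infinite value is lost in the conversion when f is square
  integrable and r > 2.\<close>

definition Lr_power :: "real \<Rightarrow> ('a \<Rightarrow> complex) \<Rightarrow> real \<Rightarrow> real" where
  "Lr_power r f t = enn2real (\<integral>\<^sup>+x. ennreal (cmod (T t f x) powr r) \<partial>lborel)"

lemma Lr_power_nonneg: "0 \<le> Lr_power r f t" by (simp add: Lr_power_def)

text \<open>|T f|^r is at most the (r - 2)-nd power of the sup bound times |T f|^2. Besides
  finiteness this settles the times |t| <= 1, for which decay in t gives nothing.\<close>

lemma nn_integral_T_powr_le:
  assumes [measurable]: "f \<in> borel_measurable borel" and f: "sqnorm f \<le> ennreal (W\<^sup>2)" and W: "0 \<le> W" and r: "2 < r"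
  shows "(\<integral>\<^sup>+x. ennreal (cmod (T t f x) powr r) \<partial>lborel) \<le> ennreal ((sup_const * W) powr (r - 2) * (L2_const * W\<^sup>2))"
proof -
  have ff: "sqnorm f < \<infinity>" using f by (rule le_less_trans) simp
  have "(\<integral>\<^sup>+x. ennreal (cmod (T t f x) powr r) \<partial>lborel) \<le> (\<integral>\<^sup>+x. ennreal ((sup_const * W) powr (r - 2)) * ennreal ((cmod (T t f x))\<^sup>2) \<partial>lborel)"
  proof (rule nn_integral_mono)
    fix x
    have "cmod (T t f x) powr r = cmod (T t f x) powr (r - 2) * (cmod (T t f x))\<^sup>2"
      using r by (cases "T t f x = 0") (auto simp: powr_diff)
    also have "\<dots> \<le> (sup_const * W) powr (r - 2) * (cmod (T t f x))\<^sup>2"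
      using r norm_T_le[of f W t x] f W by (intro mult_right_mono powr_mono2) auto
    finally show "ennreal (cmod (T t f x) powr r) \<le> ennreal ((sup_const * W) powr (r - 2)) * ennreal ((cmod (T t f x))\<^sup>2)"
      by (simp add: ennreal_mult'[symmetric] ennreal_leI)
  qed
  also have "\<dots> = ennreal ((sup_const * W) powr (r - 2)) * sqnorm (T t f)" unfolding sqnorm_def by (rule nn_integral_cmult) measurable
  also have "\<dots> \<le> ennreal ((sup_const * W) powr (r - 2)) * (ennreal L2_const * ennreal (W\<^sup>2))"
    by (intro mult_left_mono order_trans[OF sqnorm_T_le[OF _ ff]] f) auto
  also have "\<dots> = ennreal ((sup_const * W) powr (r - 2) * (L2_const * W\<^sup>2))" by (rule ennreal_mult_assoc) (use L2_const_pos in auto)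
  finally show ?thesis .
qed

lemma nn_integral_T_powr:
  assumes [measurable]: "f \<in> borel_measurable borel" and f: "sqnorm f < \<infinity>" and r: "2 < r"
  shows "(\<integral>\<^sup>+x. ennreal (cmod (T t f x) powr r) \<partial>lborel) = ennreal (Lr_power r f t)"
proof -
  obtain c where c: "sqnorm f = ennreal c" "0 \<le> c" using f by (cases "sqnorm f") auto
  have "sqnorm f \<le> ennreal ((sqrt c)\<^sup>2)" using c by simp
  from nn_integral_T_powr_le[OF _ this _ r, of t] c(2) have "(\<integral>\<^sup>+x. ennreal (cmod (T t f x) powr r) \<partial>lborel) < \<infinity>"
    by (auto intro: le_less_trans)
  then show ?thesis by (simp add: Lr_power_def ennreal_enn2real_if)
qed

lemma borel_measurable_Lr_power [measurable]:
  assumes [measurable]: "f \<in> borel_measurable borel"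
  shows "Lr_power r f \<in> borel_measurable borel"
proof -
  have [measurable]: "(\<lambda>p. T (fst p) f (snd p)) \<in> borel_measurable (borel \<Otimes>\<^sub>M borel)" by measurable
  have "(\<lambda>p. ennreal (cmod (T (fst p) f (snd p)) powr r)) \<in> borel_measurable (borel \<Otimes>\<^sub>M lborel)" by measurable
  from lborel.borel_measurable_nn_integral[of "\<lambda>t x. ennreal (cmod (T t f x) powr r)", unfolded split_beta', OF this]
  show ?thesis unfolding Lr_power_def[abs_def] by measurable
qed

lemma Lr_power_add_le:
  assumes [measurable]: "f1 \<in> borel_measurable borel" "f2 \<in> borel_measurable borel" and f: "sqnorm f1 < \<infinity>" "sqnorm f2 < \<infinity>" and r: "2 < r"
  shows "Lr_power r (\<lambda>x. f1 x + f2 x) t \<le> 2 powr r * (Lr_power r f1 t + Lr_power r f2 t)"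
proof -
  have fin: "sqnorm (\<lambda>x. f1 x + f2 x) < \<infinity>"
    by (rule ennreal_finite_of_le[OF sqnorm_add_le f]) auto
  have "ennreal (Lr_power r (\<lambda>x. f1 x + f2 x) t) = (\<integral>\<^sup>+x. ennreal (cmod (T t (\<lambda>x. f1 x + f2 x) x) powr r) \<partial>lborel)"
    by (rule nn_integral_T_powr[OF _ fin r, symmetric]) measurable
  also have "\<dots> \<le> (\<integral>\<^sup>+x. ennreal (2 powr r) * (ennreal (cmod (T t f1 x) powr r) + ennreal (cmod (T t f2 x) powr r)) \<partial>lborel)"
  proof (rule nn_integral_mono)
    fix x
    have "cmod (T t (\<lambda>x. f1 x + f2 x) x) powr r \<le> (cmod (T t f1 x) + cmod (T t f2 x)) powr r"
      unfolding T_add[OF assms(1,2) f] using r by (intro powr_mono2 norm_triangle_ineq) auto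
    also have "\<dots> \<le> 2 powr r * (cmod (T t f1 x) powr r + cmod (T t f2 x) powr r)" using r by (intro powr_add_le) auto
    finally show "ennreal (cmod (T t (\<lambda>x. f1 x + f2 x) x) powr r) \<le> ennreal (2 powr r) * (ennreal (cmod (T t f1 x) powr r) + ennreal (cmod (T t f2 x) powr r))"
      by (subst ennreal_mult_add) (auto intro: ennreal_leI)
  qed
  also have "\<dots> = ennreal (2 powr r) * ((\<integral>\<^sup>+x. ennreal (cmod (T t f1 x) powr r) \<partial>lborel) + (\<integral>\<^sup>+x. ennreal (cmod (T t f2 x) powr r) \<partial>lborel))"
    by (subst nn_integral_cmult, measurable, subst nn_integral_add) auto
  also have "\<dots> = ennreal (2 powr r * (Lr_power r f1 t + Lr_power r f2 t))"
    unfolding nn_integral_T_powr[OF assms(1) f(1) r] nn_integral_T_powr[OF assms(2) f(2) r] by (rule ennreal_mult_add) (auto simp: Lr_power_nonneg)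
  finally show ?thesis by (simp add: ennreal_le_iff Lr_power_nonneg)
qed

text \<open>For |t| ~ R^2 the low part is at most a multiple of R^(-2\<delta>) \<open>W1\<close> at
  each time, by the fixed time decay, and the time set has measure O(R^2); the high part is handled
  by the weak L^(2/\<delta>) bound on the same set. Both results are written as (q/2)-th powers of
  expressions quadratic in the data, because it is these that get summed over R.\<close>

lemma dyadic_time_estimate:
  assumes r: "2 < r" and \<delta>: "\<delta> = real DIM('a) * (1 / 2 - 1 / r)" and q: "2 \<le> q" "1 / q < \<delta>" "\<delta> < 2 / q"
  obtains C where "0 < C" "\<And>f g R W1 W2. inversion_pair f g \<Longrightarrow> 0 < R \<Longrightarrow> 0 < W1 \<Longrightarrow> 0 < W2 \<Longrightarrow>
      (\<integral>\<^sup>+y. ennreal (norm y powr (2 * \<delta>)) * ennreal ((cmod (if y \<in> {y. norm y \<le> R} then g y else 0))\<^sup>2) \<partial>lborel) \<le> ennreal (W1\<^sup>2) \<Longrightarrow>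
      8 * sqnorm (\<lambda>y. if y \<in> {y. norm y \<le> R} then 0 else g y) \<le> ennreal (W2\<^sup>2) \<Longrightarrow>
      (\<integral>\<^sup>+t. ennreal (Lr_power r f t powr (q / r)) * indicator {t. R\<^sup>2 < \<bar>t\<bar> \<and> \<bar>t\<bar> \<le> 4 * R\<^sup>2} t \<partial>lborel)
        \<le> ennreal (C * ((R powr (- (4 * (\<delta> - 1 / q))) * W1\<^sup>2) powr (q / 2) + (R powr (2 * (2 / q - \<delta>)) * W2\<^sup>2) powr (q / 2)))"
proof -
  have q0: "0 < q" using q by simp
  have d0: "0 < \<delta>" using q(2) q0 by (auto intro: less_trans[of 0 "1 / q"])
  have "2 / q \<le> 1" using q(1) by simp
  then have d1: "\<delta> < 1" using q by linarith
  have d2: "2 * \<delta> < real DIM('a)" unfolding \<delta> using r by (simp add: field_simps)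
  \<comment> \<open>The weak type exponent; q < p restates \<delta> < 2 / q.\<close>
  define p where "p = 2 / \<delta>"
  have qp: "q < p" using q d0 q0 by (simp add: p_def field_simps)
  obtain C1 where C1: "0 < C1" and ft: "\<And>f g t W. inversion_pair f g \<Longrightarrow> t \<noteq> 0 \<Longrightarrow> 0 < W \<Longrightarrow>
    (\<integral>\<^sup>+y. ennreal (norm y powr (2 * \<delta>)) * ennreal ((cmod (g y))\<^sup>2) \<partial>lborel) \<le> ennreal (W\<^sup>2) \<Longrightarrow>
    (\<integral>\<^sup>+x. ennreal (cmod (T t f x) powr r) \<partial>lborel) \<le> ennreal (C1 * (\<bar>t\<bar> powr (- \<delta>) * W) powr r)"
    by (rule fixed_time_estimate[OF d0 d2 r \<delta>], rule that, assumption, assumption)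
  obtain C2 where C2: "0 < C2" and ws: "\<And>f W l. f \<in> borel_measurable borel \<Longrightarrow> sqnorm f \<le> ennreal (W\<^sup>2) \<Longrightarrow> 0 < W \<Longrightarrow> 0 < l \<Longrightarrow>
    emeasure lborel {t. ennreal (l powr r) < (\<integral>\<^sup>+x. ennreal (cmod (T t f x) powr r) \<partial>lborel)} \<le> ennreal (C2 * (W / l) powr (2 / \<delta>))"
    by (rule weak_strichartz[OF r \<delta> d0 d1], rule that, assumption, assumption)
  \<comment> \<open>8 comes from the bound 8 R^2 for the measure of the time set, 2^p from halving
    the height to pass from l <= h to a strict level set.\<close>
  define C3 where "C3 = 8 + C2 * q / (p - q) * 2 powr p"
  have C30: "0 < C3" unfolding C3_def using C2 q0 qp by (intro add_pos_nonneg) auto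
  define C4 where "C4 = (2 powr r) powr (q / r) * 2 powr (q / r)"
  have C40: "0 < C4" by (simp add: C4_def)
  define C where "C = C4 * (8 * C1 powr (q / r) + C3)"
  have C0: "0 < C" unfolding C_def using C40 C30 C1 by (intro mult_pos_pos add_nonneg_pos) auto
  show ?thesis
  proof (rule that[OF C0])
    fix f g :: "'a \<Rightarrow> complex" and R W1 W2 :: real
    assume fg: "inversion_pair f g" and R: "0 < R" and W1: "0 < W1" and W2: "0 < W2"
      and A: "(\<integral>\<^sup>+y. ennreal (norm y powr (2 * \<delta>)) * ennreal ((cmod (if y \<in> {y. norm y \<le> R} then g y else 0))\<^sup>2) \<partial>lborel) \<le> ennreal (W1\<^sup>2)"
      and B: "8 * sqnorm (\<lambda>y. if y \<in> {y. norm y \<le> R} then 0 else g y) \<le> ennreal (W2\<^sup>2)"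
    have [measurable]: "f \<in> borel_measurable borel" "g \<in> borel_measurable borel" and gf: "sqnorm g < \<infinity>"
      using fg by (auto simp: inversion_pair_def)
    define S where "S = {y::'a. norm y \<le> R}"
    have [measurable]: "S \<in> sets borel" unfolding S_def by measurable
    have Sf: "emeasure lborel S < \<infinity>" unfolding S_def using R by (subst emeasure_cball_0) auto
    define g1 where "g1 = (\<lambda>y. if y \<in> S then g y else 0)"
    have g1i: "integrable lborel g1" unfolding g1_def by (rule integrable_L2_truncation) (use gf Sf in auto)
    have [measurable]: "g1 \<in> borel_measurable borel" using g1i by auto
    have "sqnorm g1 \<le> sqnorm g" unfolding sqnorm_def g1_def by (intro nn_integral_mono) auto
    then have g1f: "sqnorm g1 < \<infinity>" using gf by (rule le_less_trans)
    define f1 where "f1 = inFT g1"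
    have fg1: "inversion_pair f1 g1" unfolding f1_def by (rule inversion_pair_inFT[OF g1i g1f])
    have [measurable]: "f1 \<in> borel_measurable borel" and f1f: "sqnorm f1 < \<infinity>" using fg1 by (auto simp: inversion_pair_def)
    define f2 where "f2 = (\<lambda>x. f x - f1 x)"
    have [measurable]: "f2 \<in> borel_measurable borel" unfolding f2_def by measurable
    have "sqnorm f2 \<le> 8 * sqnorm (\<lambda>y. if y \<in> S then 0 else g y)"
      unfolding f2_def f1_def g1_def using fg Sf by (auto simp: inversion_pair_def)
    then have f2W: "sqnorm f2 \<le> ennreal (W2\<^sup>2)" using B unfolding S_def by (rule order_trans)
    then have f2f: "sqnorm f2 < \<infinity>" by (rule le_less_trans) simp
    have fs: "f = (\<lambda>x. f1 x + f2 x)" by (simp add: f2_def)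
    define J where "J = {t::real. R\<^sup>2 < \<bar>t\<bar> \<and> \<bar>t\<bar> \<le> 4 * R\<^sup>2}"
    have [measurable]: "J \<in> sets borel" unfolding J_def by measurable
    have Jm: "emeasure lborel J \<le> ennreal (8 * R\<^sup>2)"
    proof -
      have "emeasure lborel J \<le> emeasure lborel {- (4 * R\<^sup>2)..4 * R\<^sup>2}" by (intro emeasure_mono) (auto simp: J_def)
      then show ?thesis by simp
    qed
    have n1: "Lr_power r f1 t powr (q / r) \<le> C1 powr (q / r) * (R powr (- (2 * \<delta>)) * W1) powr q" if t: "t \<in> J" for t
    proof -
      have t0: "0 < \<bar>t\<bar>" "R\<^sup>2 \<le> \<bar>t\<bar>" using t R by (auto simp: J_def intro: le_less_trans[of 0 "R\<^sup>2"])
      have "ennreal (Lr_power r f1 t) \<le> ennreal (C1 * (\<bar>t\<bar> powr (- \<delta>) * W1) powr r)"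
        unfolding nn_integral_T_powr[OF \<open>f1 \<in> borel_measurable borel\<close> f1f r, symmetric]
        by (rule ft[OF fg1 _ W1]) (use t0 A in \<open>auto simp: g1_def S_def\<close>)
      then have "Lr_power r f1 t \<le> C1 * (\<bar>t\<bar> powr (- \<delta>) * W1) powr r" using C1 by (subst (asm) ennreal_le_iff) auto
      also have "\<dots> \<le> C1 * (R powr (- (2 * \<delta>)) * W1) powr r"
      proof -
        have "\<bar>t\<bar> powr (- \<delta>) \<le> (R\<^sup>2) powr (- \<delta>)" using t0 R d0 by (intro powr_mono2') auto
        also have "(R\<^sup>2) powr (- \<delta>) = R powr (- (2 * \<delta>))" using R by (simp add: square_powr)
        finally show ?thesis using C1 W1 r by (intro mult_left_mono powr_mono2 mult_right_mono) auto
      qed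
      finally have "Lr_power r f1 t powr (q / r) \<le> (C1 * (R powr (- (2 * \<delta>)) * W1) powr r) powr (q / r)"
        using q0 r by (intro powr_mono2) (auto simp: Lr_power_nonneg)
      also have "\<dots> = C1 powr (q / r) * (R powr (- (2 * \<delta>)) * W1) powr q" using C1 r by (simp add: powr_mult powr_powr mult.assoc)
      finally show ?thesis .
    qed
    have e1: "8 * R\<^sup>2 * (C1 powr (q / r) * (R powr (- (2 * \<delta>)) * W1) powr q) = 8 * C1 powr (q / r) * (R powr (- (4 * (\<delta> - 1 / q))) * W1\<^sup>2) powr (q / 2)"
    proof -
      have "R\<^sup>2 * R powr (- (2 * \<delta>) * q) = R powr (2 + - (2 * \<delta>) * q)" unfolding powr_add using R by simp
      also have "2 + - (2 * \<delta>) * q = - (4 * (\<delta> - 1 / q)) * (q / 2)" using q0 by (simp add: field_simps)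
      finally have "R\<^sup>2 * R powr (- (2 * \<delta>) * q) = R powr (- (4 * (\<delta> - 1 / q)) * (q / 2))" .
      moreover have "(W1\<^sup>2) powr (q / 2) = W1 powr q" using W1 by (simp add: square_powr)
      ultimately show ?thesis using R W1 by (simp only: powr_mult powr_powr) (simp add: mult_ac)
    qed
    have I1: "(\<integral>\<^sup>+t. ennreal (Lr_power r f1 t powr (q / r)) * indicator J t \<partial>lborel) \<le> ennreal (8 * C1 powr (q / r) * (R powr (- (4 * (\<delta> - 1 / q))) * W1\<^sup>2) powr (q / 2))"
    proof -
      have "(\<integral>\<^sup>+t. ennreal (Lr_power r f1 t powr (q / r)) * indicator J t \<partial>lborel) \<le> (\<integral>\<^sup>+t. ennreal (C1 powr (q / r) * (R powr (- (2 * \<delta>)) * W1) powr q) * indicator J t \<partial>lborel)"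
        using n1 by (intro nn_integral_mono) (auto simp: indicator_def intro: ennreal_leI)
      also have "\<dots> = ennreal (C1 powr (q / r) * (R powr (- (2 * \<delta>)) * W1) powr q) * emeasure lborel J"
        by (rule nn_integral_cmult_indicator) measurable
      also have "\<dots> \<le> ennreal (C1 powr (q / r) * (R powr (- (2 * \<delta>)) * W1) powr q) * ennreal (8 * R\<^sup>2)" by (intro mult_left_mono Jm) auto
      also have "\<dots> = ennreal (8 * R\<^sup>2 * (C1 powr (q / r) * (R powr (- (2 * \<delta>)) * W1) powr q))"
        by (subst mult.commute) (simp add: ennreal_mult)
      finally show ?thesis unfolding e1 .
    qed
    define h where "h t = Lr_power r f2 t powr (1 / r)" for t
    have [measurable]: "h \<in> borel_measurable borel" unfolding h_def[abs_def] by measurable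
    have hq: "h t powr q = Lr_power r f2 t powr (q / r)" for t by (simp add: h_def powr_powr)
    have weak: "emeasure lborel {t. l \<le> h t} \<le> ennreal (C2 * (2 * W2 / l) powr p)" if l: "0 < l" for l
    proof -
      have "emeasure lborel {t. l \<le> h t} \<le> emeasure lborel {t. ennreal ((l / 2) powr r) < (\<integral>\<^sup>+x. ennreal (cmod (T t f2 x) powr r) \<partial>lborel)}"
      proof (rule emeasure_mono)
        show "{t. l \<le> h t} \<subseteq> {t. ennreal ((l / 2) powr r) < (\<integral>\<^sup>+x. ennreal (cmod (T t f2 x) powr r) \<partial>lborel)}"
        proof
          fix t assume "t \<in> {t. l \<le> h t}"
          then have "l powr r \<le> h t powr r" using l r by (intro powr_mono2) auto
          also have "h t powr r = Lr_power r f2 t" using r by (simp add: h_def powr_powr Lr_power_nonneg)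
          finally have "l powr r \<le> Lr_power r f2 t" .
          moreover have "(l / 2) powr r < l powr r" using l r by (intro powr_less_mono2) auto
          ultimately show "t \<in> {t. ennreal ((l / 2) powr r) < (\<integral>\<^sup>+x. ennreal (cmod (T t f2 x) powr r) \<partial>lborel)}"
            by (simp add: nn_integral_T_powr[OF _ f2f r] ennreal_less_iff)
        qed
        have "{t. ennreal ((l / 2) powr r) < ennreal (Lr_power r f2 t)} \<in> sets borel" by measurable
        then show "{t. ennreal ((l / 2) powr r) < (\<integral>\<^sup>+x. ennreal (cmod (T t f2 x) powr r) \<partial>lborel)} \<in> sets lborel"
          by (simp add: nn_integral_T_powr[OF _ f2f r])
      qed
      also have "\<dots> \<le> ennreal (C2 * (W2 / (l / 2)) powr (2 / \<delta>))" by (rule ws) (use f2W W2 l in auto)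
      finally show ?thesis by (simp add: p_def mult.commute)
    qed
    \<comment> \<open>Balances the two terms of \<open>nn_integral_of_weak_type\<close>: with this
      height (W2 / l0)^p = R^2.\<close>
    define l0 where "l0 = W2 * R powr (- \<delta>)"
    have l0: "0 < l0" using W2 R by (simp add: l0_def)
    have e2: "8 * R\<^sup>2 * l0 powr q + C2 * q / (p - q) * (2 * W2) powr p * l0 powr (q - p) = C3 * (R powr (2 * (2 / q - \<delta>)) * W2\<^sup>2) powr (q / 2)"
    proof -
      have a: "(2 * W2) powr p * l0 powr (q - p) = 2 powr p * R\<^sup>2 * l0 powr q"
      proof -
        have "R\<^sup>2 = R powr 2" using R by simp
        also have "\<dots> = R powr (\<delta> * p)" using d0 by (simp add: p_def)
        finally have "R\<^sup>2 = R powr (\<delta> * p)" .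
        moreover have "l0 powr (q - p) = l0 powr q * (W2 powr (- p) * R powr (\<delta> * p))"
        proof -
          have "l0 powr (q - p) = l0 powr q * l0 powr (- p)" by (simp add: powr_add[symmetric])
          also have "l0 powr (- p) = W2 powr (- p) * (R powr (- \<delta>)) powr (- p)" using W2 R by (simp add: l0_def powr_mult)
          also have "(R powr (- \<delta>)) powr (- p) = R powr (\<delta> * p)" by (simp only: powr_powr) simp
          finally show ?thesis .
        qed
        moreover have "(2 * W2) powr p * W2 powr (- p) = 2 powr p" using W2 by (simp add: powr_mult powr_minus)
        ultimately show ?thesis by (simp add: mult_ac)
      qed
      have b: "R\<^sup>2 * l0 powr q = (R powr (2 * (2 / q - \<delta>)) * W2\<^sup>2) powr (q / 2)"
      proof -
        have "R\<^sup>2 * R powr (- \<delta> * q) = R powr (2 + - \<delta> * q)" unfolding powr_add using R by simp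
        also have "2 + - \<delta> * q = 2 * (2 / q - \<delta>) * (q / 2)" using q0 by (simp add: field_simps)
        finally have "R\<^sup>2 * R powr (- \<delta> * q) = R powr (2 * (2 / q - \<delta>) * (q / 2))" .
        moreover have "(W2\<^sup>2) powr (q / 2) = W2 powr q" using W2 by (simp add: square_powr)
        ultimately show ?thesis using R W2 unfolding l0_def by (simp only: powr_mult powr_powr) (simp add: mult_ac)
      qed
      have "8 * R\<^sup>2 * l0 powr q + C2 * q / (p - q) * (2 * W2) powr p * l0 powr (q - p) = 8 * R\<^sup>2 * l0 powr q + C2 * q / (p - q) * ((2 * W2) powr p * l0 powr (q - p))" by (simp only: mult.assoc)
      also have "\<dots> = C3 * (R\<^sup>2 * l0 powr q)" unfolding a C3_def by (simp add: algebra_simps)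
      finally show ?thesis unfolding b .
    qed
    have I2: "(\<integral>\<^sup>+t. ennreal (Lr_power r f2 t powr (q / r)) * indicator J t \<partial>lborel) \<le> ennreal (C3 * (R powr (2 * (2 / q - \<delta>)) * W2\<^sup>2) powr (q / 2))"
      unfolding hq[symmetric] e2[symmetric]
      by (rule nn_integral_of_weak_type) (use weak Jm q0 qp C2 W2 l0 in \<open>auto simp: h_def\<close>)
    have "(\<integral>\<^sup>+t. ennreal (Lr_power r f t powr (q / r)) * indicator J t \<partial>lborel)
      \<le> (\<integral>\<^sup>+t. ennreal C4 * (ennreal (Lr_power r f1 t powr (q / r)) * indicator J t + ennreal (Lr_power r f2 t powr (q / r)) * indicator J t) \<partial>lborel)"
    proof (rule nn_integral_mono)
      fix t
      have "Lr_power r f t powr (q / r) \<le> (2 powr r * (Lr_power r f1 t + Lr_power r f2 t)) powr (q / r)"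
        using Lr_power_add_le[of f1 f2 r t] f1f f2f r q0 unfolding fs[symmetric] by (intro powr_mono2) (auto simp: Lr_power_nonneg)
      also have "\<dots> = (2 powr r) powr (q / r) * (Lr_power r f1 t + Lr_power r f2 t) powr (q / r)" by (simp add: powr_mult Lr_power_nonneg)
      also have "\<dots> \<le> (2 powr r) powr (q / r) * (2 powr (q / r) * (Lr_power r f1 t powr (q / r) + Lr_power r f2 t powr (q / r)))"
        using q0 r by (intro mult_left_mono powr_add_le) (auto simp: Lr_power_nonneg)
      finally have "Lr_power r f t powr (q / r) \<le> C4 * (Lr_power r f1 t powr (q / r) + Lr_power r f2 t powr (q / r))" by (simp add: C4_def mult.assoc)
      then have "ennreal (Lr_power r f t powr (q / r)) \<le> ennreal C4 * (ennreal (Lr_power r f1 t powr (q / r)) + ennreal (Lr_power r f2 t powr (q / r)))"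
        using C40 by (subst ennreal_mult_add) (auto intro: ennreal_leI)
      then show "ennreal (Lr_power r f t powr (q / r)) * indicator J t \<le> ennreal C4 * (ennreal (Lr_power r f1 t powr (q / r)) * indicator J t + ennreal (Lr_power r f2 t powr (q / r)) * indicator J t)"
        by (auto simp: indicator_def)
    qed
    also have "\<dots> = ennreal C4 * ((\<integral>\<^sup>+t. ennreal (Lr_power r f1 t powr (q / r)) * indicator J t \<partial>lborel) + (\<integral>\<^sup>+t. ennreal (Lr_power r f2 t powr (q / r)) * indicator J t \<partial>lborel))"
      by (subst nn_integral_cmult, measurable, subst nn_integral_add) auto
    also have "\<dots> \<le> ennreal C4 * (ennreal (8 * C1 powr (q / r) * (R powr (- (4 * (\<delta> - 1 / q))) * W1\<^sup>2) powr (q / 2)) + ennreal (C3 * (R powr (2 * (2 / q - \<delta>)) * W2\<^sup>2) powr (q / 2)))"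
      by (intro mult_left_mono add_mono I1 I2) auto
    also have "\<dots> = ennreal (C4 * (8 * C1 powr (q / r) * (R powr (- (4 * (\<delta> - 1 / q))) * W1\<^sup>2) powr (q / 2) + C3 * (R powr (2 * (2 / q - \<delta>)) * W2\<^sup>2) powr (q / 2)))"
      by (rule ennreal_mult_add) (use C40 C30 in auto)
    also have "\<dots> \<le> ennreal (C * ((R powr (- (4 * (\<delta> - 1 / q))) * W1\<^sup>2) powr (q / 2) + (R powr (2 * (2 / q - \<delta>)) * W2\<^sup>2) powr (q / 2)))"
    proof (rule ennreal_leI)
      define X where "X = (R powr (- (4 * (\<delta> - 1 / q))) * W1\<^sup>2) powr (q / 2)"
      define Y where "Y = (R powr (2 * (2 / q - \<delta>)) * W2\<^sup>2) powr (q / 2)"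
      define c where "c = 8 * C1 powr (q / r)"
      have c0: "0 \<le> c" by (simp add: c_def)
      have "0 \<le> C3 * X" "0 \<le> c * Y" using C30 c0 by (auto simp: X_def Y_def)
      then have "c * X + C3 * Y \<le> (c + C3) * (X + Y)" by (simp add: algebra_simps)
      then have "C4 * (c * X + C3 * Y) \<le> C4 * ((c + C3) * (X + Y))" using C40 by (intro mult_left_mono) auto
      then show "C4 * (8 * C1 powr (q / r) * X + C3 * Y) \<le> C * (X + Y)" by (simp add: C_def c_def mult.assoc)
    qed
    finally show "(\<integral>\<^sup>+t. ennreal (Lr_power r f t powr (q / r)) * indicator {t. R\<^sup>2 < \<bar>t\<bar> \<and> \<bar>t\<bar> \<le> 4 * R\<^sup>2} t \<partial>lborel)
        \<le> ennreal (C * ((R powr (- (4 * (\<delta> - 1 / q))) * W1\<^sup>2) powr (q / 2) + (R powr (2 * (2 / q - \<delta>)) * W2\<^sup>2) powr (q / 2)))"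
      unfolding J_def .
  qed
qed

end

section \<open>Summation over dyadic frequencies\<close>

context dispersive_operator
begin

text \<open>After exchanging sum and integral, y meets the indices with 2^j >= |y|: a decreasing
  geometric series of size O(max(1, |y|)^(-4\<beta>)). Against |y|^(2\<delta>) this leaves at most
  max(1, |y|)^(2 s).\<close>

lemma sum_dyadic_low:
  fixes g :: "'a \<Rightarrow> complex"
  assumes [measurable]: "g \<in> borel_measurable borel" and \<beta>: "0 < \<beta>" and s: "s = \<delta> - 2 * \<beta>" "0 < s"
  shows "(\<Sum>j. ennreal ((2 powr (- (4 * \<beta>))) ^ j) * (\<integral>\<^sup>+y. ennreal (norm y powr (2 * \<delta>)) * ennreal ((cmod (if y \<in> {y. norm y \<le> 2 ^ j} then g y else 0))\<^sup>2) \<partial>lborel))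
    \<le> ennreal (1 / (1 - 2 powr (- (4 * \<beta>)))) * (\<integral>\<^sup>+y. ennreal ((1 + (norm y)\<^sup>2) powr s) * ennreal ((cmod (g y))\<^sup>2) \<partial>lborel)"
proof -
  define x :: real where "x = 2 powr (- (4 * \<beta>))"
  have x: "0 < x" "x < 1" using \<beta> by (auto simp: x_def powr_less_one)
  have "(\<Sum>j. ennreal (x ^ j) * (\<integral>\<^sup>+(y::'a). ennreal (norm y powr (2 * \<delta>)) * ennreal ((cmod (if y \<in> {y. norm y \<le> 2 ^ j} then g y else 0))\<^sup>2) \<partial>lborel))
    = (\<Sum>j. \<integral>\<^sup>+(y::'a). ennreal (x ^ j) * (ennreal (norm y powr (2 * \<delta>)) * ennreal ((cmod (if y \<in> {y. norm y \<le> 2 ^ j} then g y else 0))\<^sup>2)) \<partial>lborel)"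
    by (intro suminf_cong nn_integral_cmult[symmetric]) measurable
  also have "\<dots> = (\<integral>\<^sup>+(y::'a). (\<Sum>j. ennreal (x ^ j) * (ennreal (norm y powr (2 * \<delta>)) * ennreal ((cmod (if y \<in> {y. norm y \<le> 2 ^ j} then g y else 0))\<^sup>2))) \<partial>lborel)"
    by (rule nn_integral_suminf[symmetric]) measurable
  also have "\<dots> \<le> (\<integral>\<^sup>+(y::'a). ennreal (1 / (1 - x)) * (ennreal ((1 + (norm y)\<^sup>2) powr s) * ennreal ((cmod (g y))\<^sup>2)) \<partial>lborel)"
  proof (rule nn_integral_mono)
    fix y :: 'a
    define m where "m = max 1 (norm y)"
    have m1: "1 \<le> m" "norm y \<le> m" by (auto simp: m_def)
    define M where "M = m powr (- (4 * \<beta>))"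
    have geo: "(\<Sum>j. ennreal (x ^ j) * (if norm y \<le> 2 ^ j then 1 else 0)) \<le> ennreal (M / (1 - x))"
    proof (rule suminf_geometric_tail[OF x])
      fix j :: nat assume j: "norm y \<le> 2 ^ j"
      have mj: "m \<le> 2 ^ j" using j by (simp add: m_def)
      have "x ^ j = (2 powr real j) powr (- (4 * \<beta>))" unfolding x_def by (simp add: powr_powr powr_power mult_ac)
      also have "\<dots> = (2 ^ j) powr (- (4 * \<beta>))" by (simp add: powr_realpow)
      also have "\<dots> \<le> M" unfolding M_def using mj m1 \<beta> by (intro powr_mono2') auto
      finally show "x ^ j \<le> M" .
    qed (simp add: M_def)
    have key: "norm y powr (2 * \<delta>) * M \<le> (1 + (norm y)\<^sup>2) powr s"
    proof -
      have "norm y powr (2 * \<delta>) * M \<le> m powr (2 * \<delta>) * M" using m1 s \<beta> by (intro mult_right_mono powr_mono2) (auto simp: M_def)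
      also have "\<dots> = m powr (2 * s)"
      proof -
        have "2 * \<delta> + - (4 * \<beta>) = 2 * s" using s by simp
        then show ?thesis unfolding M_def powr_add[symmetric] by (simp only:)
      qed
      also have "\<dots> = (m\<^sup>2) powr s" using m1 by (simp add: square_powr)
      also have "\<dots> \<le> (1 + (norm y)\<^sup>2) powr s" using s by (intro powr_mono2) (auto simp: m_def max_def)
      finally show ?thesis .
    qed
    define c where "c = ennreal (norm y powr (2 * \<delta>)) * ennreal ((cmod (g y))\<^sup>2)"
    have "(\<Sum>j. ennreal (x ^ j) * (ennreal (norm y powr (2 * \<delta>)) * ennreal ((cmod (if y \<in> {y. norm y \<le> 2 ^ j} then g y else 0))\<^sup>2)))
      = (\<Sum>j. ennreal (x ^ j) * (if norm y \<le> 2 ^ j then 1 else 0) * c)"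
      by (intro suminf_cong) (simp add: c_def)
    also have "\<dots> = (\<Sum>j. ennreal (x ^ j) * (if norm y \<le> 2 ^ j then 1 else 0)) * c" by (rule ennreal_suminf_multc)
    also have "\<dots> \<le> ennreal (M / (1 - x)) * c" using geo by (intro mult_right_mono) auto
    also have "\<dots> = ennreal (1 / (1 - x)) * (ennreal (norm y powr (2 * \<delta>) * M) * ennreal ((cmod (g y))\<^sup>2))"
      unfolding c_def using x by (simp add: ennreal_mult[symmetric] M_def mult_ac)
    also have "\<dots> \<le> ennreal (1 / (1 - x)) * (ennreal ((1 + (norm y)\<^sup>2) powr s) * ennreal ((cmod (g y))\<^sup>2))"
      by (intro mult_left_mono mult_right_mono ennreal_leI key) auto
    finally show "(\<Sum>j. ennreal (x ^ j) * (ennreal (norm y powr (2 * \<delta>)) * ennreal ((cmod (if y \<in> {y. norm y \<le> 2 ^ j} then g y else 0))\<^sup>2)))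
      \<le> ennreal (1 / (1 - x)) * (ennreal ((1 + (norm y)\<^sup>2) powr s) * ennreal ((cmod (g y))\<^sup>2))" .
  qed
  also have "\<dots> = ennreal (1 / (1 - x)) * (\<integral>\<^sup>+(y::'a). ennreal ((1 + (norm y)\<^sup>2) powr s) * ennreal ((cmod (g y))\<^sup>2) \<partial>lborel)"
    by (rule nn_integral_cmult) measurable
  finally show ?thesis unfolding x_def .
qed

text \<open>Now y meets the indices with 2^j < |y|: an increasing geometric series, dominated by its
  last term, which is at most |y|^(2 s).\<close>

lemma sum_dyadic_high:
  fixes g :: "'a \<Rightarrow> complex"
  assumes [measurable]: "g \<in> borel_measurable borel" and s: "0 < s"
  shows "(\<Sum>j. ennreal ((2 powr (2 * s)) ^ j) * sqnorm (\<lambda>y. if y \<in> {y. norm y \<le> 2 ^ j} then 0 else g y))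
    \<le> ennreal (1 / (1 - 2 powr (- (2 * s)))) * (\<integral>\<^sup>+y. ennreal ((1 + (norm y)\<^sup>2) powr s) * ennreal ((cmod (g y))\<^sup>2) \<partial>lborel)"
proof -
  define x :: real where "x = 2 powr (- (2 * s))"
  have x: "0 < x" "x < 1" using s by (auto simp: x_def powr_less_one)
  have xi: "2 powr (2 * s) = 1 / x" by (simp add: x_def powr_minus_divide)
  have "(\<Sum>j. ennreal ((1 / x) ^ j) * sqnorm (\<lambda>y::'a. if y \<in> {y. norm y \<le> 2 ^ j} then 0 else g y))
    = (\<Sum>j. \<integral>\<^sup>+(y::'a). ennreal ((1 / x) ^ j) * ennreal ((cmod (if y \<in> {y. norm y \<le> 2 ^ j} then 0 else g y))\<^sup>2) \<partial>lborel)"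
    unfolding sqnorm_def by (intro suminf_cong nn_integral_cmult[symmetric]) measurable
  also have "\<dots> = (\<integral>\<^sup>+(y::'a). (\<Sum>j. ennreal ((1 / x) ^ j) * ennreal ((cmod (if y \<in> {y. norm y \<le> 2 ^ j} then 0 else g y))\<^sup>2)) \<partial>lborel)"
    by (rule nn_integral_suminf[symmetric]) measurable
  also have "\<dots> \<le> (\<integral>\<^sup>+(y::'a). ennreal (1 / (1 - x)) * (ennreal ((1 + (norm y)\<^sup>2) powr s) * ennreal ((cmod (g y))\<^sup>2)) \<partial>lborel)"
  proof (rule nn_integral_mono)
    fix y :: 'a
    define M where "M = (1 + (norm y)\<^sup>2) powr s"
    have geo: "(\<Sum>j. ennreal ((1 / x) ^ j) * (if \<not> norm y \<le> 2 ^ j then 1 else 0)) \<le> ennreal (M / (1 - x))"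
    proof (rule suminf_geometric_head[OF x])
      fix j :: nat assume j: "\<not> norm y \<le> 2 ^ j"
      have "(1 / x) ^ j = (2 powr real j) powr (2 * s)" unfolding xi[symmetric] by (simp add: powr_powr powr_power mult_ac)
      also have "\<dots> = (2 ^ j) powr (2 * s)" by (simp add: powr_realpow)
      also have "\<dots> = ((2 ^ j)\<^sup>2) powr s" by (simp add: square_powr)
      also have "\<dots> \<le> ((norm y)\<^sup>2) powr s" using j s by (intro powr_mono2 power_mono) auto
      also have "\<dots> \<le> M" unfolding M_def using s by (intro powr_mono2) auto
      finally show "(1 / x) ^ j \<le> M" .
    qed (simp add: M_def)
    define c where "c = ennreal ((cmod (g y))\<^sup>2)"
    have "(\<Sum>j. ennreal ((1 / x) ^ j) * ennreal ((cmod (if y \<in> {y. norm y \<le> 2 ^ j} then 0 else g y))\<^sup>2))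
      = (\<Sum>j. ennreal ((1 / x) ^ j) * (if \<not> norm y \<le> 2 ^ j then 1 else 0) * c)"
      by (intro suminf_cong) (simp add: c_def)
    also have "\<dots> = (\<Sum>j. ennreal ((1 / x) ^ j) * (if \<not> norm y \<le> 2 ^ j then 1 else 0)) * c" by (rule ennreal_suminf_multc)
    also have "\<dots> \<le> ennreal (M / (1 - x)) * c" using geo by (intro mult_right_mono) auto
    also have "\<dots> = ennreal (1 / (1 - x)) * (ennreal M * ennreal ((cmod (g y))\<^sup>2))"
      unfolding c_def using x by (simp add: ennreal_mult[symmetric] M_def mult_ac)
    finally show "(\<Sum>j. ennreal ((1 / x) ^ j) * ennreal ((cmod (if y \<in> {y. norm y \<le> 2 ^ j} then 0 else g y))\<^sup>2))
      \<le> ennreal (1 / (1 - x)) * (ennreal ((1 + (norm y)\<^sup>2) powr s) * ennreal ((cmod (g y))\<^sup>2))" unfolding M_def .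
  qed
  also have "\<dots> = ennreal (1 / (1 - x)) * (\<integral>\<^sup>+(y::'a). ennreal ((1 + (norm y)\<^sup>2) powr s) * ennreal ((cmod (g y))\<^sup>2) \<partial>lborel)"
    by (rule nn_integral_cmult) measurable
  finally show ?thesis unfolding xi x_def .
qed

lemma dyadic_cover: "1 < \<bar>t::real\<bar> \<Longrightarrow> \<exists>j::nat. (2 ^ j)\<^sup>2 < \<bar>t\<bar> \<and> \<bar>t\<bar> \<le> 4 * (2 ^ j)\<^sup>2"
proof -
  assume t: "1 < \<bar>t\<bar>"
  obtain n where n: "\<bar>t\<bar> < 4 ^ n" using real_arch_pow[of 4 "\<bar>t\<bar>"] by auto
  define k where "k = (LEAST n. \<bar>t\<bar> \<le> 4 ^ n)"
  have k: "\<bar>t\<bar> \<le> 4 ^ k" unfolding k_def by (rule LeastI[of _ n]) (use n in simp)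
  have "k \<noteq> 0" using k t by (intro notI) simp
  then obtain j where j: "k = Suc j" by (cases k) auto
  have "\<not> \<bar>t\<bar> \<le> 4 ^ j" using not_less_Least[of j "\<lambda>n. \<bar>t\<bar> \<le> 4 ^ n"] j unfolding k_def[symmetric] by simp
  moreover have "((2::real) ^ j)\<^sup>2 = 4 ^ j" by (simp add: power_mult[symmetric] mult.commute[of j] power_mult)
  ultimately show ?thesis using k j by (intro exI[of _ j]) auto
qed

end

context dispersive_operator
begin

text \<open>The tail inequality with S empty: the inverse transform of 0 is 0, and 8 <= 3^2.\<close>

lemma sqnorm_le_of_plancherel_pair:
  assumes fg: "plancherel_pair f (g :: 'a \<Rightarrow> complex)" and g: "sqnorm g \<le> ennreal (W\<^sup>2)"
  shows "sqnorm f \<le> ennreal ((3 * W)\<^sup>2)"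
proof -
  have z: "inFT (\<lambda>y::'a. 0) = (\<lambda>x. 0)" by (simp add: inFT_def nFT_def FT_def fun_eq_iff)
  have "sqnorm f \<le> 8 * sqnorm g" using inversion_tail[OF fg, of "{}"] by (simp add: z)
  also have "\<dots> \<le> 8 * ennreal (W\<^sup>2)" using g by (intro mult_left_mono) auto
  also have "\<dots> = ennreal 8 * ennreal (W\<^sup>2)" by simp
  also have "\<dots> = ennreal (8 * W\<^sup>2)" by (rule ennreal_mult[symmetric]) auto
  also have "\<dots> \<le> ennreal ((3 * W)\<^sup>2)" by (rule ennreal_leI) (simp add: power_mult_distrib)
  finally show ?thesis .
qed

lemma mixed_norm_estimate:
  assumes r: "2 < r" and \<delta>: "\<delta> = real DIM('a) * (1 / 2 - 1 / r)" and q: "2 \<le> q" "1 / q < \<delta>" "\<delta> < 2 / q"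
    and s: "s = 2 / q - \<delta>"
  obtains C where "0 < C" "\<And>f g W. plancherel_pair f g \<Longrightarrow> 0 < W \<Longrightarrow>
      (\<integral>\<^sup>+y. ennreal ((1 + (norm y)\<^sup>2) powr s) * ennreal ((cmod (g y))\<^sup>2) \<partial>lborel) \<le> ennreal (W\<^sup>2) \<Longrightarrow>
      (\<integral>\<^sup>+t. ennreal (Lr_power r f t powr (q / r)) \<partial>lborel) \<le> ennreal (C * W powr q)"
proof -
  \<comment> \<open>Turns s = 2 / q - \<delta> into \<delta> - 2 \<beta>, the form in which
    \<open>sum_dyadic_low\<close> uses it; 4 \<beta> is the rate of decay in R of the low
    part.\<close>
  define \<beta> where "\<beta> = \<delta> - 1 / q"
  have \<beta>: "0 < \<beta>" and s\<beta>: "s = \<delta> - 2 * \<beta>" and s0: "0 < s" using q s by (auto simp: \<beta>_def)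
  define x :: real where "x = 2 powr (- (4 * \<beta>))"
  define z :: real where "z = 2 powr (2 * s)"
  have x: "0 < x" "x < 1" using \<beta> by (auto simp: x_def powr_less_one)
  have z: "0 < z" by (simp add: z_def)
  define Ka where "Ka = 1 / (1 - x)"
  define Kb where "Kb = 1 / (1 - 2 powr (- (2 * s)))"
  have Ka: "0 < Ka" using x by (simp add: Ka_def)
  have Kb: "0 < Kb" using s0 by (simp add: Kb_def powr_less_one)
  obtain C1 where C1: "0 < C1" and piece: "\<And>f g R W1 W2. inversion_pair f g \<Longrightarrow> 0 < R \<Longrightarrow> 0 < W1 \<Longrightarrow> 0 < W2 \<Longrightarrow>
      (\<integral>\<^sup>+y. ennreal (norm y powr (2 * \<delta>)) * ennreal ((cmod (if y \<in> {y. norm y \<le> R} then g y else 0))\<^sup>2) \<partial>lborel) \<le> ennreal (W1\<^sup>2) \<Longrightarrow>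
      8 * sqnorm (\<lambda>y. if y \<in> {y. norm y \<le> R} then 0 else g y) \<le> ennreal (W2\<^sup>2) \<Longrightarrow>
      (\<integral>\<^sup>+t. ennreal (Lr_power r f t powr (q / r)) * indicator {t. R\<^sup>2 < \<bar>t\<bar> \<and> \<bar>t\<bar> \<le> 4 * R\<^sup>2} t \<partial>lborel)
        \<le> ennreal (C1 * ((R powr (- (4 * (\<delta> - 1 / q))) * W1\<^sup>2) powr (q / 2) + (R powr (2 * (2 / q - \<delta>)) * W2\<^sup>2) powr (q / 2)))"
    by (rule dyadic_time_estimate[OF r \<delta> q], rule that, assumption, assumption)
  \<comment> \<open>The constant for |t| <= 1; 3 and 9 come from the bound 3 W for the norm of
    f.\<close>
  define c0 where "c0 = (sup_const * 3) powr (r - 2) * (L2_const * 9)"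
  \<comment> \<open>The summand 2 here and in \<open>K2\<close> pays for the terms added in
    \<open>P\<close> and \<open>Q\<close> below; the 8 in \<open>K2\<close> is that of the tail
    inequality.\<close>
  define K1 where "K1 = Ka + 2"
  define K2 where "K2 = 8 * Kb + 2"
  have K: "0 < K1" "0 < K2" using Ka Kb by (auto simp: K1_def K2_def)
  define C where "C = 2 * c0 powr (q / r) + C1 * (K1 powr (q / 2) + K2 powr (q / 2))"
  have C0: "0 < C" unfolding C_def using C1 K by (intro add_nonneg_pos mult_pos_pos add_pos_pos) auto
  show ?thesis
  proof (rule that[OF C0])
    fix f g :: "'a \<Rightarrow> complex" and W :: real
    assume fg: "plancherel_pair f g" and W: "0 < W"
      and wt: "(\<integral>\<^sup>+y. ennreal ((1 + (norm y)\<^sup>2) powr s) * ennreal ((cmod (g y))\<^sup>2) \<partial>lborel) \<le> ennreal (W\<^sup>2)"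
    have [measurable]: "f \<in> borel_measurable borel" "g \<in> borel_measurable borel" using fg by (auto simp: plancherel_pair_def)
    have inv: "inversion_pair f g" by (rule inversion_pair_of_plancherel[OF fg])
    have "sqnorm g \<le> (\<integral>\<^sup>+y. ennreal ((1 + (norm y)\<^sup>2) powr s) * ennreal ((cmod (g y))\<^sup>2) \<partial>lborel)"
      unfolding sqnorm_def
    proof (rule nn_integral_mono)
      fix y :: 'a
      have "1 \<le> (1 + (norm y)\<^sup>2) powr s" using s0 by (intro ge_one_powr_ge_zero) auto
      then have "ennreal 1 * ennreal ((cmod (g y))\<^sup>2) \<le> ennreal ((1 + (norm y)\<^sup>2) powr s) * ennreal ((cmod (g y))\<^sup>2)"
        by (intro mult_right_mono ennreal_leI) auto
      then show "ennreal ((cmod (g y))\<^sup>2) \<le> ennreal ((1 + (norm y)\<^sup>2) powr s) * ennreal ((cmod (g y))\<^sup>2)" by simp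
    qed
    then have "sqnorm g \<le> ennreal (W\<^sup>2)" using wt by (rule order_trans)
    then have fW: "sqnorm f \<le> ennreal ((3 * W)\<^sup>2)" by (rule sqnorm_le_of_plancherel_pair[OF fg])
    then have ff: "sqnorm f < \<infinity>" by (rule le_less_trans) simp
    define A where "A j = (\<integral>\<^sup>+(y::'a). ennreal (norm y powr (2 * \<delta>)) * ennreal ((cmod (if y \<in> {y. norm y \<le> 2 ^ j} then g y else 0))\<^sup>2) \<partial>lborel)" for j :: nat
    define B where "B j = sqnorm (\<lambda>y::'a. if y \<in> {y. norm y \<le> 2 ^ j} then 0 else g y)" for j :: nat
    have SA: "(\<Sum>j. ennreal (x ^ j) * A j) \<le> ennreal Ka * ennreal (W\<^sup>2)"
      using order_trans[OF sum_dyadic_low[OF \<open>g \<in> borel_measurable borel\<close> \<beta> s\<beta> s0] mult_left_mono[OF wt]]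
      unfolding A_def x_def Ka_def by simp
    have SB: "(\<Sum>j. ennreal (z ^ j) * B j) \<le> ennreal Kb * ennreal (W\<^sup>2)"
      using order_trans[OF sum_dyadic_high[OF \<open>g \<in> borel_measurable borel\<close> s0] mult_left_mono[OF wt]]
      unfolding B_def z_def Kb_def by simp
    have term_le: "u j \<le> suminf u" for u :: "nat \<Rightarrow> ennreal" and j using sum_le_suminf[of u "{j}"] by auto
    have finite_of: "u j < \<infinity>" if S: "(\<Sum>j. ennreal (v ^ j) * u j) \<le> ennreal k * ennreal (W\<^sup>2)" and v: "0 < v" for u :: "nat \<Rightarrow> ennreal" and v k :: real and j
    proof -
      have "ennreal (v ^ j) * u j \<le> (\<Sum>j. ennreal (v ^ j) * u j)" by (rule term_le)
      also have "\<dots> \<le> ennreal k * ennreal (W\<^sup>2)" by (rule S)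
      also have "\<dots> < \<infinity>" by (simp add: ennreal_mult_less_top)
      finally have "ennreal (v ^ j) * u j < \<infinity>" .
      then show ?thesis using v by (auto simp: ennreal_mult_less_top)
    qed
    define av where "av j = enn2real (A j)" for j
    define bv where "bv j = enn2real (B j)" for j
    have av: "A j = ennreal (av j)" "0 \<le> av j" for j using finite_of[OF SA x(1), of j] by (auto simp: av_def ennreal_enn2real_if)
    have bv: "B j = ennreal (bv j)" "0 \<le> bv j" for j using finite_of[OF SB z, of j] by (auto simp: bv_def ennreal_enn2real_if)
    \<comment> \<open>The extra W^2 2^(-j) makes \<open>W1\<close> and \<open>W2\<close> below
      strictly positive, as \<open>dyadic_time_estimate\<close> requires, even when g has no mass in
      the range concerned; over all j it adds 2 W^2.\<close>
    define P where "P j = x ^ j * av j + W\<^sup>2 * (1 / 2) ^ j" for j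
    define Q where "Q j = z ^ j * (8 * bv j) + W\<^sup>2 * (1 / 2) ^ j" for j
    have PQ0: "0 \<le> P j" "0 \<le> Q j" for j using x z av bv by (auto simp: P_def Q_def)
    have half: "(\<Sum>j. ennreal (W\<^sup>2 * (1 / 2) ^ j)) = ennreal (2 * W\<^sup>2)"
    proof -
      have "(\<Sum>j. ennreal (W\<^sup>2 * (1 / 2) ^ j)) = ennreal (\<Sum>j. W\<^sup>2 * (1 / 2) ^ j)"
        by (rule suminf_ennreal2) (auto intro!: summable_mult summable_geometric)
      also have "(\<Sum>j. W\<^sup>2 * (1 / 2) ^ j) = W\<^sup>2 * 2" by (subst suminf_mult) (auto simp: suminf_geometric intro!: summable_geometric)
      finally show ?thesis by (simp add: mult.commute)
    qed
    have gen: "ennreal a * ennreal b + ennreal c = ennreal (a * b + c)" if "0 \<le> a" "0 \<le> b" "0 \<le> c" for a b c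
      using that by (simp add: ennreal_mult)
    have SP: "(\<Sum>j. ennreal (P j)) \<le> ennreal (K1 * W\<^sup>2)"
    proof -
      have "(\<Sum>j. ennreal (P j)) = (\<Sum>j. ennreal (x ^ j) * A j + ennreal (W\<^sup>2 * (1 / 2) ^ j))"
        unfolding P_def av(1) using x av(2) by (intro suminf_cong gen[symmetric]) auto
      also have "\<dots> = (\<Sum>j. ennreal (x ^ j) * A j) + (\<Sum>j. ennreal (W\<^sup>2 * (1 / 2) ^ j))" by (rule suminf_add[symmetric]) auto
      also have "\<dots> \<le> ennreal Ka * ennreal (W\<^sup>2) + ennreal (2 * W\<^sup>2)" unfolding half by (intro add_right_mono SA)
      also have "\<dots> = ennreal (Ka * W\<^sup>2 + 2 * W\<^sup>2)" by (rule gen) (use Ka in auto)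
      finally show ?thesis by (simp add: K1_def distrib_right)
    qed
    have SQ: "(\<Sum>j. ennreal (Q j)) \<le> ennreal (K2 * W\<^sup>2)"
    proof -
      have "(\<Sum>j. ennreal (Q j)) = (\<Sum>j. 8 * (ennreal (z ^ j) * B j) + ennreal (W\<^sup>2 * (1 / 2) ^ j))"
      proof (rule suminf_cong)
        fix j
        have "ennreal (Q j) = ennreal (8 * z ^ j) * ennreal (bv j) + ennreal (W\<^sup>2 * (1 / 2) ^ j)"
          unfolding Q_def using z bv(2)[of j] by (subst gen) (auto simp: mult_ac)
        also have "ennreal (8 * z ^ j) = 8 * ennreal (z ^ j)" using z by (subst ennreal_mult) auto
        finally show "ennreal (Q j) = 8 * (ennreal (z ^ j) * B j) + ennreal (W\<^sup>2 * (1 / 2) ^ j)" by (simp add: bv(1) mult.assoc)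
      qed
      also have "\<dots> = 8 * (\<Sum>j. ennreal (z ^ j) * B j) + (\<Sum>j. ennreal (W\<^sup>2 * (1 / 2) ^ j))" by (subst suminf_add[symmetric]) auto
      also have "\<dots> \<le> 8 * (ennreal Kb * ennreal (W\<^sup>2)) + ennreal (2 * W\<^sup>2)" unfolding half by (intro add_right_mono mult_left_mono SB) auto
      also have "8 * (ennreal Kb * ennreal (W\<^sup>2)) = ennreal (8 * Kb) * ennreal (W\<^sup>2)" using Kb by (subst ennreal_mult) (auto simp: mult.assoc)
      also have "ennreal (8 * Kb) * ennreal (W\<^sup>2) + ennreal (2 * W\<^sup>2) = ennreal (8 * Kb * W\<^sup>2 + 2 * W\<^sup>2)" by (rule gen) (use Kb in auto)
      finally show ?thesis by (simp add: K2_def distrib_right)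
    qed
    have Wq: "(k * W\<^sup>2) powr (q / 2) = k powr (q / 2) * W powr q" if "0 < k" for k using W that by (simp add: powr_mult square_powr)
    have p1: "1 \<le> q / 2" using q by simp
    have SP': "(\<Sum>j. ennreal (P j powr (q / 2))) \<le> ennreal (K1 powr (q / 2) * W powr q)"
      unfolding Wq[OF K(1), symmetric] by (rule suminf_powr_le[OF PQ0(1) p1 _ SP]) (use K W in auto)
    have SQ': "(\<Sum>j. ennreal (Q j powr (q / 2))) \<le> ennreal (K2 powr (q / 2) * W powr q)"
      unfolding Wq[OF K(2), symmetric] by (rule suminf_powr_le[OF PQ0(2) p1 _ SQ]) (use K W in auto)
    define J where "J j = {t::real. (2 ^ j)\<^sup>2 < \<bar>t\<bar> \<and> \<bar>t\<bar> \<le> 4 * (2 ^ j)\<^sup>2}" for j :: nat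
    have [measurable]: "J j \<in> sets borel" for j unfolding J_def by measurable
    have pc: "(\<integral>\<^sup>+t. ennreal (Lr_power r f t powr (q / r)) * indicator (J j) t \<partial>lborel) \<le> ennreal C1 * (ennreal (P j powr (q / 2)) + ennreal (Q j powr (q / 2)))" for j
    proof -
      \<comment> \<open>Chosen so that x^j W1^2 = \<open>P j\<close> and, with \<open>W2\<close>,
        z^j W2^2 = \<open>Q j\<close>, where x^j and z^j are the powers of R = 2^j in the dyadic
        estimate.\<close>
      define W1 where "W1 = sqrt (av j + W\<^sup>2 * (1 / 2) ^ j / x ^ j)"
      define W2 where "W2 = sqrt (8 * bv j + W\<^sup>2 * (1 / 2) ^ j / z ^ j)"
      have p1: "0 < W\<^sup>2 * (1 / 2) ^ j / x ^ j" "0 < W\<^sup>2 * (1 / 2) ^ j / z ^ j" using W x z by auto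
      have W12: "0 < W1" "0 < W2" unfolding W1_def W2_def using p1 av(2)[of j] bv(2)[of j] by (auto intro: add_nonneg_pos)
      have sq1: "W1\<^sup>2 = av j + W\<^sup>2 * (1 / 2) ^ j / x ^ j" unfolding W1_def using p1(1) av(2)[of j] by (intro real_sqrt_pow2 add_nonneg_nonneg) auto
      have sq2: "W2\<^sup>2 = 8 * bv j + W\<^sup>2 * (1 / 2) ^ j / z ^ j" unfolding W2_def using p1(2) bv(2)[of j] by (intro real_sqrt_pow2 add_nonneg_nonneg) auto
      have e1: "((2::real) ^ j) powr (- (4 * (\<delta> - 1 / q))) = x ^ j"
      proof -
        have "((2::real) ^ j) powr (- (4 * (\<delta> - 1 / q))) = (2 powr real j) powr (- (4 * \<beta>))" by (simp add: powr_realpow \<beta>_def)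
        then show ?thesis by (simp add: x_def powr_powr powr_power mult_ac)
      qed
      have e2: "((2::real) ^ j) powr (2 * (2 / q - \<delta>)) = z ^ j"
      proof -
        have "((2::real) ^ j) powr (2 * (2 / q - \<delta>)) = (2 powr real j) powr (2 * s)" by (simp add: powr_realpow s)
        then show ?thesis by (simp add: z_def powr_powr powr_power mult_ac)
      qed
      have P: "x ^ j * W1\<^sup>2 = P j" "z ^ j * W2\<^sup>2 = Q j" using x z by (auto simp: sq1 sq2 P_def Q_def distrib_left)
      have hA: "(\<integral>\<^sup>+(y::'a). ennreal (norm y powr (2 * \<delta>)) * ennreal ((cmod (if y \<in> {y. norm y \<le> 2 ^ j} then g y else 0))\<^sup>2) \<partial>lborel) \<le> ennreal (W1\<^sup>2)"
        unfolding A_def[symmetric] av(1) sq1 using p1(1) by (intro ennreal_leI) simp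
      have "8 * B j = ennreal (8 * bv j)" using bv(2)[of j] unfolding bv(1) by (subst ennreal_mult) auto
      also have "\<dots> \<le> ennreal (W2\<^sup>2)" unfolding sq2 using p1(2) by (intro ennreal_leI) simp
      finally have hB: "8 * sqnorm (\<lambda>y::'a. if y \<in> {y. norm y \<le> 2 ^ j} then 0 else g y) \<le> ennreal (W2\<^sup>2)" unfolding B_def .
      have "(\<integral>\<^sup>+t. ennreal (Lr_power r f t powr (q / r)) * indicator (J j) t \<partial>lborel) \<le> ennreal (C1 * (P j powr (q / 2) + Q j powr (q / 2)))"
        using piece[OF inv _ W12 hA hB] unfolding e1 e2 P J_def by simp
      also have "\<dots> = ennreal C1 * (ennreal (P j powr (q / 2)) + ennreal (Q j powr (q / 2)))"
        by (rule ennreal_mult_add[symmetric]) (use C1 in auto)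
      finally show ?thesis .
    qed
    have near: "(\<integral>\<^sup>+t. ennreal (Lr_power r f t powr (q / r)) * indicator {-1..1} t \<partial>lborel) \<le> ennreal (c0 powr (q / r) * W powr q) * 2"
    proof -
      have "Lr_power r f t powr (q / r) \<le> c0 powr (q / r) * W powr q" for t
      proof -
        have "ennreal (Lr_power r f t) \<le> ennreal ((sup_const * (3 * W)) powr (r - 2) * (L2_const * (3 * W)\<^sup>2))"
          unfolding nn_integral_T_powr[OF \<open>f \<in> borel_measurable borel\<close> ff r, symmetric] by (rule nn_integral_T_powr_le) (use fW W r in auto)
        then have "Lr_power r f t \<le> (sup_const * (3 * W)) powr (r - 2) * (L2_const * (3 * W)\<^sup>2)" using L2_const_pos by (subst (asm) ennreal_le_iff) auto
        also have "\<dots> = c0 * (W powr (r - 2) * W\<^sup>2)"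
        proof -
          have "(sup_const * (3 * W)) powr (r - 2) = (sup_const * 3) powr (r - 2) * W powr (r - 2)"
            unfolding mult.assoc[symmetric] by (rule powr_mult)
          then show ?thesis by (simp add: c0_def power_mult_distrib)
        qed
        also have "W powr (r - 2) * W\<^sup>2 = W powr r" using W by (simp add: powr_diff)
        finally have "Lr_power r f t powr (q / r) \<le> (c0 * W powr r) powr (q / r)" using q r by (intro powr_mono2) (auto simp: Lr_power_nonneg)
        also have "\<dots> = c0 powr (q / r) * W powr q" using r by (simp add: powr_mult powr_powr)
        finally show ?thesis .
      qed
      then have "(\<integral>\<^sup>+t. ennreal (Lr_power r f t powr (q / r)) * indicator {-1..1} t \<partial>lborel) \<le> (\<integral>\<^sup>+t. ennreal (c0 powr (q / r) * W powr q) * indicator {-1..1::real} t \<partial>lborel)"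
        by (intro nn_integral_mono mult_right_mono ennreal_leI) auto
      also have "\<dots> = ennreal (c0 powr (q / r) * W powr q) * 2" by (subst nn_integral_cmult_indicator) auto
      finally show ?thesis .
    qed
    \<comment> \<open>The sets \<open>J j\<close> cover |t| > 1, so the sum over j dominates there;
      on [-1, 1] the bound uniform in time suffices.\<close>
    have "(\<integral>\<^sup>+t. ennreal (Lr_power r f t powr (q / r)) \<partial>lborel)
      \<le> (\<integral>\<^sup>+t. ennreal (Lr_power r f t powr (q / r)) * indicator {-1..1} t + (\<Sum>j. ennreal (Lr_power r f t powr (q / r)) * indicator (J j) t) \<partial>lborel)"
    proof (rule nn_integral_mono)
      fix t :: real
      show "ennreal (Lr_power r f t powr (q / r)) \<le> ennreal (Lr_power r f t powr (q / r)) * indicator {-1..1} t + (\<Sum>j. ennreal (Lr_power r f t powr (q / r)) * indicator (J j) t)"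
      proof (cases "\<bar>t\<bar> \<le> 1")
        case True
        then show ?thesis by (simp add: indicator_def abs_le_iff)
      next
        case False
        then obtain j where "t \<in> J j" using dyadic_cover[of t] by (auto simp: J_def)
        then have "ennreal (Lr_power r f t powr (q / r)) = ennreal (Lr_power r f t powr (q / r)) * indicator (J j) t" by simp
        also have "\<dots> \<le> (\<Sum>j. ennreal (Lr_power r f t powr (q / r)) * indicator (J j) t)"
          by (rule term_le[of "\<lambda>j. ennreal (Lr_power r f t powr (q / r)) * indicator (J j) t" j])
        finally show ?thesis by (rule add_increasing[rotated]) simp
      qed
    qed
    also have "\<dots> = (\<integral>\<^sup>+t. ennreal (Lr_power r f t powr (q / r)) * indicator {-1..1} t \<partial>lborel) + (\<integral>\<^sup>+t. (\<Sum>j. ennreal (Lr_power r f t powr (q / r)) * indicator (J j) t) \<partial>lborel)"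
      by (rule nn_integral_add) measurable
    also have "(\<integral>\<^sup>+t. (\<Sum>j. ennreal (Lr_power r f t powr (q / r)) * indicator (J j) t) \<partial>lborel) = (\<Sum>j. \<integral>\<^sup>+t. ennreal (Lr_power r f t powr (q / r)) * indicator (J j) t \<partial>lborel)"
      by (rule nn_integral_suminf) measurable
    also have "(\<integral>\<^sup>+t. ennreal (Lr_power r f t powr (q / r)) * indicator {-1..1} t \<partial>lborel) + (\<Sum>j. \<integral>\<^sup>+t. ennreal (Lr_power r f t powr (q / r)) * indicator (J j) t \<partial>lborel)
      \<le> ennreal (c0 powr (q / r) * W powr q) * 2 + (\<Sum>j. ennreal C1 * (ennreal (P j powr (q / 2)) + ennreal (Q j powr (q / 2))))"
      by (intro add_mono near suminf_le pc allI) auto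
    also have "(\<Sum>j. ennreal C1 * (ennreal (P j powr (q / 2)) + ennreal (Q j powr (q / 2)))) = ennreal C1 * ((\<Sum>j. ennreal (P j powr (q / 2))) + (\<Sum>j. ennreal (Q j powr (q / 2))))"
      by (subst suminf_add) auto
    also have "ennreal (c0 powr (q / r) * W powr q) * 2 + ennreal C1 * ((\<Sum>j. ennreal (P j powr (q / 2))) + (\<Sum>j. ennreal (Q j powr (q / 2))))
      \<le> ennreal (c0 powr (q / r) * W powr q) * 2 + ennreal C1 * (ennreal (K1 powr (q / 2) * W powr q) + ennreal (K2 powr (q / 2) * W powr q))"
      by (intro add_left_mono mult_left_mono add_mono SP' SQ') auto
    also have "\<dots> = ennreal (c0 powr (q / r) * W powr q) * ennreal 2 + ennreal (C1 * (K1 powr (q / 2) * W powr q + K2 powr (q / 2) * W powr q))"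
      by (subst ennreal_mult_add) (use C1 in auto)
    also have "\<dots> = ennreal (c0 powr (q / r) * W powr q * 2 + C1 * (K1 powr (q / 2) * W powr q + K2 powr (q / 2) * W powr q))"
      by (rule gen) (use C1 in auto)
    also have "\<dots> = ennreal (C * W powr q)" by (simp add: C_def algebra_simps)
    finally show "(\<integral>\<^sup>+t. ennreal (Lr_power r f t powr (q / r)) \<partial>lborel) \<le> ennreal (C * W powr q)" .
  qed
qed

text \<open>The fixed time bound decays like |t|^(-1/q), so the level set lies in a bounded interval
  around 0, and the weak type bound is the length of that interval.\<close>

lemma weak_mixed_norm_estimate:
  assumes r: "2 < r" and \<delta>: "\<delta> = real DIM('a) * (1 / 2 - 1 / r)" "\<delta> = 1 / q" and q: "2 < q"
  obtains C where "0 < C" "\<And>f g W l. plancherel_pair f g \<Longrightarrow> 0 < W \<Longrightarrow>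
      (\<integral>\<^sup>+y. ennreal ((1 + (norm y)\<^sup>2) powr \<delta>) * ennreal ((cmod (g y))\<^sup>2) \<partial>lborel) \<le> ennreal (W\<^sup>2) \<Longrightarrow> 0 < l \<Longrightarrow>
      emeasure lborel {t. l < Lr_power r f t powr (1 / r)} \<le> ennreal ((C * W / l) powr q)"
proof -
  have d0: "0 < \<delta>" using \<delta>(2) q by simp
  have d2: "2 * \<delta> < real DIM('a)" unfolding \<delta>(1) using r by (simp add: field_simps)
  obtain C1 where C1: "0 < C1" and ft: "\<And>f g t W. inversion_pair f g \<Longrightarrow> t \<noteq> 0 \<Longrightarrow> 0 < W \<Longrightarrow>
    (\<integral>\<^sup>+y. ennreal (norm y powr (2 * \<delta>)) * ennreal ((cmod (g y))\<^sup>2) \<partial>lborel) \<le> ennreal (W\<^sup>2) \<Longrightarrow>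
    (\<integral>\<^sup>+x. ennreal (cmod (T t f x) powr r) \<partial>lborel) \<le> ennreal (C1 * (\<bar>t\<bar> powr (- \<delta>) * W) powr r)"
    by (rule fixed_time_estimate[OF d0 d2 r \<delta>(1)], rule that, assumption, assumption)
  \<comment> \<open>2^(1/q) accounts for the length 2 \<rho> of the symmetric interval
    below.\<close>
  define C where "C = 2 powr (1 / q) * C1 powr (1 / r)"
  have C0: "0 < C" using C1 by (simp add: C_def)
  show ?thesis
  proof (rule that[OF C0])
    fix f g :: "'a \<Rightarrow> complex" and W l :: real
    assume fg: "plancherel_pair f g" and W: "0 < W" and l: "0 < l"
      and wt: "(\<integral>\<^sup>+y. ennreal ((1 + (norm y)\<^sup>2) powr \<delta>) * ennreal ((cmod (g y))\<^sup>2) \<partial>lborel) \<le> ennreal (W\<^sup>2)"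
    have [measurable]: "f \<in> borel_measurable borel" using fg by (auto simp: plancherel_pair_def)
    have inv: "inversion_pair f g" by (rule inversion_pair_of_plancherel[OF fg])
    have ff: "sqnorm f < \<infinity>" using inv by (auto simp: inversion_pair_def)
    have "(\<integral>\<^sup>+y. ennreal (norm y powr (2 * \<delta>)) * ennreal ((cmod (g y))\<^sup>2) \<partial>lborel) \<le> (\<integral>\<^sup>+y. ennreal ((1 + (norm y)\<^sup>2) powr \<delta>) * ennreal ((cmod (g y))\<^sup>2) \<partial>lborel)"
    proof (intro nn_integral_mono mult_right_mono ennreal_leI)
      fix y :: 'a
      have "norm y powr (2 * \<delta>) = ((norm y)\<^sup>2) powr \<delta>" by (cases "y = 0") (auto simp: square_powr)
      also have "\<dots> \<le> (1 + (norm y)\<^sup>2) powr \<delta>" using d0 by (intro powr_mono2) auto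
      finally show "norm y powr (2 * \<delta>) \<le> (1 + (norm y)\<^sup>2) powr \<delta>" .
    qed auto
    then have wt': "(\<integral>\<^sup>+y. ennreal (norm y powr (2 * \<delta>)) * ennreal ((cmod (g y))\<^sup>2) \<partial>lborel) \<le> ennreal (W\<^sup>2)" using wt by (rule order_trans)
    \<comment> \<open>The time at which C1^(1/r) |t|^(-1/q) W equals l. It is nonnegative, so t = 0,
      where the decay bound is silent, also lies in the interval.\<close>
    define \<rho> where "\<rho> = (C1 powr (1 / r) * W / l) powr q"
    have sub: "{t. l < Lr_power r f t powr (1 / r)} \<subseteq> {-\<rho>..\<rho>}"
    proof
      fix t assume "t \<in> {t. l < Lr_power r f t powr (1 / r)}"
      then have t: "l < Lr_power r f t powr (1 / r)" by simp
      have "\<bar>t\<bar> \<le> \<rho>"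
      proof (cases "t = 0")
        case False
        have "ennreal (Lr_power r f t) \<le> ennreal (C1 * (\<bar>t\<bar> powr (- \<delta>) * W) powr r)"
          unfolding nn_integral_T_powr[OF \<open>f \<in> borel_measurable borel\<close> ff r, symmetric] by (rule ft[OF inv False W wt'])
        then have "Lr_power r f t \<le> C1 * (\<bar>t\<bar> powr (- \<delta>) * W) powr r" using C1 by (subst (asm) ennreal_le_iff) auto
        then have "Lr_power r f t powr (1 / r) \<le> (C1 * (\<bar>t\<bar> powr (- \<delta>) * W) powr r) powr (1 / r)" using r by (intro powr_mono2) (auto simp: Lr_power_nonneg)
        also have "\<dots> = C1 powr (1 / r) * (\<bar>t\<bar> powr (- \<delta>) * W)" using r W by (simp add: powr_mult powr_powr)
        finally have "l < C1 powr (1 / r) * (\<bar>t\<bar> powr (- \<delta>) * W)" using t by simp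
        then have "\<bar>t\<bar> powr \<delta> \<le> C1 powr (1 / r) * W / l" using l False by (simp add: powr_minus_divide field_simps)
        then have "(\<bar>t\<bar> powr \<delta>) powr q \<le> \<rho>" unfolding \<rho>_def using q by (intro powr_mono2) auto
        then show ?thesis using \<delta>(2) q False by (simp add: powr_powr)
      qed (simp add: \<rho>_def)
      then show "t \<in> {-\<rho>..\<rho>}" by auto
    qed
    have "emeasure lborel {t. l < Lr_power r f t powr (1 / r)} \<le> emeasure lborel {-\<rho>..\<rho>}" by (rule emeasure_mono[OF sub]) simp
    also have "\<dots> = ennreal (2 * \<rho>)" by (simp add: \<rho>_def)
    also have "2 * \<rho> = (C * W / l) powr q"
    proof -
      have e: "C * W / l = 2 powr (1 / q) * (C1 powr (1 / r) * W / l)" by (simp add: C_def)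
      show ?thesis unfolding \<rho>_def e powr_mult[of "2 powr (1 / q)"] using q by (simp add: powr_powr)
    qed
    finally show "emeasure lborel {t. l < Lr_power r f t powr (1 / r)} \<le> ennreal ((C * W / l) powr q)" .
  qed
qed

end

section \<open>Lebesgue measurable functions and Sobolev norms\<close>

lemma ennreal_powr_ennreal: "0 \<le> x \<Longrightarrow> ennreal_powr (ennreal x) p = ennreal (x powr p)"
  by (simp add: ennreal_powr_def)

lemma ennreal_powr_mono: "x \<le> y \<Longrightarrow> 0 < p \<Longrightarrow> ennreal_powr x p \<le> ennreal_powr y p"
  by (cases x; cases y) (auto simp: ennreal_powr_def top_unique intro!: ennreal_leI powr_mono2)

lemma ennreal_powr_half_sq: "(ennreal_powr x (1 / 2))\<^sup>2 = x"
proof (cases x)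
  case (real r)
  then have "(ennreal_powr x (1 / 2))\<^sup>2 = ennreal ((r powr (1 / 2))\<^sup>2)" by (simp add: ennreal_powr_ennreal ennreal_power)
  then show ?thesis using real by (simp add: powr_half_sqrt)
qed (simp add: ennreal_powr_def)

lemma lebesgue_ex_borel:
  fixes f :: "'a::euclidean_space \<Rightarrow> complex"
  assumes f: "f \<in> borel_measurable lebesgue"
  obtains f' where "f' \<in> borel_measurable borel" "AE x in lborel. f x = f' x"
proof -
  have "(\<lambda>x. Re (f x)) \<in> borel_measurable lebesgue" "(\<lambda>x. Im (f x)) \<in> borel_measurable lebesgue" using f by measurable
  from this[THEN completion_ex_borel_measurable_real] obtain u v where
    [measurable]: "u \<in> borel_measurable lborel" "v \<in> borel_measurable lborel" and
    uv: "AE x in lborel. Re (f x) = u x" "AE x in lborel. Im (f x) = v x" by blast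
  show ?thesis
  proof (rule that)
    have "(\<lambda>x. Complex (u x) (v x)) = (\<lambda>x. of_real (u x) + \<i> * of_real (v x))" by (simp add: fun_eq_iff complex_eq_iff)
    moreover have "(\<lambda>x. of_real (u x) + \<i> * of_real (v x) :: complex) \<in> borel_measurable lborel" by measurable
    ultimately show "(\<lambda>x. Complex (u x) (v x)) \<in> borel_measurable borel" by simp
    show "AE x in lborel. f x = Complex (u x) (v x)" using uv by eventually_elim (simp add: complex_eq_iff)
  qed
qed

lemma Lp_norm_AE:
  fixes F F' :: "'a::euclidean_space \<Rightarrow> complex"
  assumes "AE x in lborel. F x = F' x"
  shows "Lp_norm p F = ennreal_powr (\<integral>\<^sup>+x. ennreal (cmod (F' x) powr p) \<partial>lborel) (1 / p)"
  unfolding Lp_norm_def Lp_norm_ennreal_def nn_integral_completion ennreal_powr_ennreal[OF norm_ge_zero]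
  by (rule arg_cong[where f = "\<lambda>x. ennreal_powr x (1 / p)"], rule nn_integral_cong_AE) (use assms in auto)

lemma Lp_norm_2_AE:
  fixes F F' :: "'a::euclidean_space \<Rightarrow> complex"
  assumes "AE x in lborel. F x = F' x"
  shows "Lp_norm 2 F = ennreal_powr (sqnorm F') (1 / 2)"
proof -
  have "cmod z powr 2 = (cmod z)\<^sup>2" for z by simp
  then show ?thesis unfolding Lp_norm_AE[OF assms] sqnorm_def by (simp only:)
qed

text \<open>Connects the norms of the definitions with the squared norms used above; only
  convergence to 0 is at stake, and this survives both root and square.\<close>

lemma tendsto_ennreal_powr_half_iff:
  "((\<lambda>n. ennreal_powr (u n) (1 / 2)) \<longlonglongrightarrow> 0) \<longleftrightarrow> u \<longlonglongrightarrow> 0"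
proof
  assume "(\<lambda>n. ennreal_powr (u n) (1 / 2)) \<longlonglongrightarrow> 0"
  then have ev: "eventually (\<lambda>n. ennreal_powr (u n) (1 / 2) < ennreal (sqrt e)) sequentially" if "0 < e" for e
    using that by (intro order_tendstoD) auto
  show "u \<longlonglongrightarrow> 0"
  proof (rule tendsto_zero_ennreal)
    fix e :: real assume e: "0 < e"
    show "eventually (\<lambda>n. u n < ennreal e) sequentially" using ev[OF e]
    proof eventually_elim
      case (elim n)
      show ?case
      proof (cases "u n")
        case (real v)
        then have "v powr (1 / 2) < sqrt e" using elim by (simp add: ennreal_powr_ennreal ennreal_less_iff)
        then show ?thesis using real by (simp add: powr_half_sqrt ennreal_less_iff)
      qed (use elim in \<open>simp add: ennreal_powr_def\<close>)
    qed
  qed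
next
  assume "u \<longlonglongrightarrow> 0"
  then have ev: "eventually (\<lambda>n. u n < ennreal (e\<^sup>2)) sequentially" if "0 < e" for e
    using that by (intro order_tendstoD) auto
  show "(\<lambda>n. ennreal_powr (u n) (1 / 2)) \<longlonglongrightarrow> 0"
  proof (rule tendsto_zero_ennreal)
    fix e :: real assume e: "0 < e"
    show "eventually (\<lambda>n. ennreal_powr (u n) (1 / 2) < ennreal e) sequentially" using ev[OF e]
    proof eventually_elim
      case (elim n)
      show ?case
      proof (cases "u n")
        case (real v)
        then have "v < e\<^sup>2" using elim by (simp add: ennreal_less_iff)
        then have "sqrt v < e" using e by (intro real_less_lsqrt) auto
        then show ?thesis using real by (simp add: ennreal_powr_ennreal powr_half_sqrt ennreal_less_iff)
      qed (use elim in simp)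
    qed
  qed
qed

lemma integral_lebesgue_eq_lborel:
  fixes F F' :: "'a::euclidean_space \<Rightarrow> complex"
  assumes F: "F \<in> borel_measurable lebesgue" and F': "F' \<in> borel_measurable borel" and ae: "AE x in lborel. F x = F' x"
  shows "(LINT x|lebesgue. F x) = (LINT x|lborel. F' x)"
proof -
  have "(LINT x|lebesgue. F x) = (LINT x|lebesgue. F' x)"
    by (rule integral_cong_AE) (use F F' ae AE_completion[OF ae] in \<open>auto intro: measurable_completion\<close>)
  also have "\<dots> = (LINT x|lborel. F' x)" by (rule integral_completion) (use F' in simp)
  finally show ?thesis .
qed

lemma borel_imp_lebesgue: "F \<in> borel_measurable borel \<Longrightarrow> F \<in> borel_measurable lebesgue"
  by (rule measurable_completion) simp

lemma exp_i_eq_cis: "exp (\<i> * of_real x) = cis x" "exp (- \<i> * of_real x) = cis (- x)"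
  by (simp_all add: cis_conv_exp)

lemma fourier_L1_trunc:
  fixes f f' :: "real^'n::finite \<Rightarrow> complex"
  assumes f: "f \<in> borel_measurable lebesgue" and f'[measurable]: "f' \<in> borel_measurable borel" and ae: "AE x in lborel. f x = f' x"
  shows "fourier_L1 (\<lambda>x. if x \<in> ball 0 (real n) then f x else 0) y = nFT (trunc_ball n f') y"
proof -
  have [measurable]: "f \<in> borel_measurable lebesgue" by (rule f)
  have [measurable]: "ball (0::real^'n) (real n) \<in> sets lebesgue" by (intro lmeasurable_ball fmeasurableD)
  have [measurable]: "(\<lambda>x::real^'n. cis (- (x \<bullet> y))) \<in> borel_measurable lebesgue" by (rule borel_imp_lebesgue) measurable
  have "(LINT x|lebesgue. cis (- (x \<bullet> y)) * (if x \<in> ball 0 (real n) then f x else 0)) = (LINT x|lborel. cis (- (x \<bullet> y)) * trunc_ball n f' x)"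
  proof (rule integral_lebesgue_eq_lborel)
    show "(\<lambda>x. cis (- (x \<bullet> y)) * (if x \<in> ball 0 (real n) then f x else 0)) \<in> borel_measurable lebesgue" by measurable
    have [measurable]: "ball (0::real^'n) (real n) \<in> sets borel" by simp
    show "(\<lambda>x. cis (- (x \<bullet> y)) * trunc_ball n f' x) \<in> borel_measurable borel" unfolding trunc_ball_def by measurable
    show "AE x in lborel. cis (- (x \<bullet> y)) * (if x \<in> ball 0 (real n) then f x else 0) = cis (- (x \<bullet> y)) * trunc_ball n f' x"
      using ae by eventually_elim (simp add: trunc_ball_def)
  qed
  then show ?thesis unfolding fourier_L1_def nFT_def FT_def exp_i_eq_cis by simp
qed

text \<open>The truncated transforms of f and f' agree at every point and norms ignore null sets, so
  the two defining limits differ only by a square root.\<close>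

lemma is_fourier_L2_iff:
  fixes f f' :: "real^'n::finite \<Rightarrow> complex"
  assumes f: "f \<in> L2_space" and f': "f' \<in> borel_measurable borel" "AE x in lborel. f x = f' x"
    and g': "g' \<in> borel_measurable borel" "AE x in lborel. g x = g' x" and g: "g \<in> borel_measurable lebesgue"
  shows "is_fourier_L2 f g \<longleftrightarrow> plancherel_pair f' g'"
proof -
  have fm: "f \<in> borel_measurable lebesgue" using f by (simp add: L2_space_def)
  have fin: "ennreal_powr x (1 / 2) < top \<longleftrightarrow> x < top" for x by (simp add: ennreal_powr_def less_top)
  have f'f: "sqnorm f' < \<infinity>" using f by (simp add: L2_space_def Lp_norm_2_AE[OF f'(2)] fin)
  have L: "Lp_norm 2 (\<lambda>y. fourier_L1 (\<lambda>x. if x \<in> ball 0 (real n) then f x else 0) y - g y)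
      = ennreal_powr (sqnorm (\<lambda>y. nFT (trunc_ball n f') y - g' y)) (1 / 2)" for n
    unfolding fourier_L1_trunc[OF fm f'] by (rule Lp_norm_2_AE) (use g'(2) in auto)
  show ?thesis
    unfolding is_fourier_L2_def L tendsto_ennreal_powr_half_iff plancherel_pair_def L2_space_def
    using g g'(1) f'(1) f'f by (simp add: Lp_norm_2_AE[OF g'(2)] fin)
qed

lemma fourier_L2_plancherel_pair:
  fixes f f' :: "real^'n::finite \<Rightarrow> complex"
  assumes f: "f \<in> L2_space" and f': "f' \<in> borel_measurable borel" "AE x in lborel. f x = f' x"
  obtains g' where "plancherel_pair f' g'" "AE x in lborel. fourier_L2 f x = g' x"
proof -
  have "sqnorm f' < \<infinity>"
    using f by (simp add: L2_space_def Lp_norm_2_AE[OF f'(2)] ennreal_powr_def less_top split: if_splits)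
  then obtain g0 where g0: "plancherel_pair f' g0" using f'(1) plancherel_pair_exists by blast
  then have g0b: "g0 \<in> borel_measurable borel" by (simp add: plancherel_pair_def)
  have "is_fourier_L2 f g0" by (subst is_fourier_L2_iff[OF f f' g0b]) (use g0 g0b borel_imp_lebesgue in auto)
  \<comment> \<open>The witness \<open>g0\<close> justifies the choice in \<open>fourier_L2\<close>;
    from here on the chosen transform is used through a Borel representative.\<close>
  then have G: "is_fourier_L2 f (fourier_L2 f)" unfolding fourier_L2_def by (rule someI[of "is_fourier_L2 f"])
  then have Gm: "fourier_L2 f \<in> borel_measurable lebesgue" by (simp add: is_fourier_L2_def L2_space_def)
  obtain g' where g': "g' \<in> borel_measurable borel" "AE x in lborel. fourier_L2 f x = g' x" by (rule lebesgue_ex_borel[OF Gm])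
  show ?thesis by (rule that[OF _ g'(2)]) (use is_fourier_L2_iff[OF f f' g' Gm] G in simp)
qed

text \<open>Since 1 + |y|^2 >= 1, lowering the order from s to s' only decreases the weight; this
  extends the bound at s_c to all s >= s_c.\<close>

lemma sobolev_norm_weight:
  fixes f :: "real^'n::finite \<Rightarrow> complex"
  assumes ae: "AE x in lborel. fourier_L2 f x = g' x" and [measurable]: "g' \<in> borel_measurable borel"
    and W: "sobolev_norm s f \<le> ennreal W" and s: "s' \<le> s"
  shows "(\<integral>\<^sup>+y. ennreal ((1 + (norm y)\<^sup>2) powr s') * ennreal ((cmod (g' y))\<^sup>2) \<partial>lborel) \<le> ennreal (W\<^sup>2)"
proof -
  define h where "h y = of_real ((1 + (norm y)\<^sup>2) powr (s / 2)) * g' y" for y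
  have "(\<integral>\<^sup>+y. ennreal ((1 + (norm y)\<^sup>2) powr s') * ennreal ((cmod (g' y))\<^sup>2) \<partial>lborel) \<le> sqnorm h"
    unfolding sqnorm_def
  proof (rule nn_integral_mono)
    fix y :: "real^'n"
    have "(1 + (norm y)\<^sup>2) powr s' \<le> (1 + (norm y)\<^sup>2) powr s" using s by (intro powr_mono) auto
    also have "\<dots> = ((1 + (norm y)\<^sup>2) powr (s / 2))\<^sup>2" by (simp add: power2_eq_square powr_add[symmetric])
    finally have "(1 + (norm y)\<^sup>2) powr s' * (cmod (g' y))\<^sup>2 \<le> (cmod (h y))\<^sup>2"
      unfolding h_def norm_mult norm_of_real abs_of_nonneg[OF powr_ge_zero] power_mult_distrib by (intro mult_right_mono) auto
    then show "ennreal ((1 + (norm y)\<^sup>2) powr s') * ennreal ((cmod (g' y))\<^sup>2) \<le> ennreal ((cmod (h y))\<^sup>2)"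
      by (subst ennreal_mult[symmetric]) (auto intro: ennreal_leI)
  qed
  also have "sqnorm h = (sobolev_norm s f)\<^sup>2"
  proof -
    have "AE y in lborel. of_real ((1 + (norm y)\<^sup>2) powr (s / 2)) * fourier_L2 f y = h y"
      using ae by eventually_elim (simp add: h_def)
    then show ?thesis unfolding sobolev_norm_def by (simp add: Lp_norm_2_AE ennreal_powr_half_sq)
  qed
  \<comment> \<open>A negative W has \<open>ennreal W\<close> = 0; the absolute value covers both
    signs.\<close>
  also have "\<dots> \<le> (ennreal \<bar>W\<bar>)\<^sup>2" using W by (intro power_mono) (auto intro: order_trans ennreal_leI)
  also have "\<dots> = ennreal (W\<^sup>2)" by (simp add: ennreal_power)
  finally show ?thesis .
qed

text \<open>The estimates above ask for a strictly positive majorant W, so a vanishing norm cannot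
  be its own majorant; W = S + e / C with e tending to 0 covers this case too.\<close>

lemma ennreal_le_of_bounds:
  assumes S: "S < \<infinity>" and C: "0 < C" and bd: "\<And>W. 0 < W \<Longrightarrow> S \<le> ennreal W \<Longrightarrow> X \<le> ennreal (C * W)"
  shows "X \<le> ennreal C * S"
proof (rule ennreal_le_epsilon)
  fix e :: real assume e: "0 < e"
  obtain v where v: "S = ennreal v" "0 \<le> v" using S by (cases S) auto
  have "X \<le> ennreal (C * (v + e / C))" using v e C by (intro bd) (auto intro: add_nonneg_pos ennreal_leI)
  also have "C * (v + e / C) = C * v + e" using C by (simp add: distrib_left)
  also have "ennreal (C * v + e) = ennreal C * S + ennreal e" using v C e by (simp add: ennreal_mult)
  finally show "X \<le> ennreal C * S + ennreal e" .
qed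

lemma extension_op_eq_T:
  fixes \<phi> :: "real^'n::finite \<Rightarrow> real"
  assumes D: "dispersive_operator \<phi> a A D" and f: "f \<in> borel_measurable lebesgue"
    and f'[measurable]: "f' \<in> borel_measurable borel" and ae: "AE x in lborel. f x = f' x"
  shows "extension_op \<phi> a f x t = dispersive_operator.T \<phi> a t f' x"
proof -
  interpret dispersive_operator \<phi> a A D by (rule D)
  have [measurable]: "f \<in> borel_measurable lebesgue" by (rule f)
  have [measurable]: "(\<lambda>\<xi>. cis (x \<bullet> \<xi> + t * \<phi> \<xi>)) \<in> borel_measurable lebesgue" "a \<in> borel_measurable lebesgue"
    by (rule borel_imp_lebesgue, measurable)+
  have "(LINT \<xi>|lebesgue. cis (x \<bullet> \<xi> + t * \<phi> \<xi>) * a \<xi> * f \<xi>) = (LINT \<xi>|lborel. cis (x \<bullet> \<xi> + t * \<phi> \<xi>) * (a \<xi> * f' \<xi>))"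
  proof (rule integral_lebesgue_eq_lborel)
    show "(\<lambda>\<xi>. cis (x \<bullet> \<xi> + t * \<phi> \<xi>) * a \<xi> * f \<xi>) \<in> borel_measurable lebesgue" by measurable
    show "(\<lambda>\<xi>. cis (x \<bullet> \<xi> + t * \<phi> \<xi>) * (a \<xi> * f' \<xi>)) \<in> borel_measurable borel" by measurable
    show "AE \<xi> in lborel. cis (x \<bullet> \<xi> + t * \<phi> \<xi>) * a \<xi> * f \<xi> = cis (x \<bullet> \<xi> + t * \<phi> \<xi>) * (a \<xi> * f' \<xi>)"
      using ae by eventually_elim (simp add: mult.assoc)
  qed
  then show ?thesis unfolding extension_op_def T_def exp_i_eq_cis .
qed

context dispersive_operator
begin

lemma Lp_norm_T:
  assumes "f \<in> borel_measurable borel" "sqnorm f < \<infinity>" "2 < r"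
  shows "Lp_norm r (\<lambda>x. T t f x) = ennreal (Lr_power r f t powr (1 / r))"
  by (subst Lp_norm_AE[of _ "T t f"]) (use nn_integral_T_powr[OF assms] in \<open>auto simp: ennreal_powr_ennreal Lr_power_nonneg\<close>)

end

section \<open>The operator of a given phase and amplitude, and the conclusion\<close>

lemma dispersive_operator_exists:
  fixes \<phi> :: "real^'n::finite \<Rightarrow> real" and a :: "real^'n \<Rightarrow> complex"
  assumes phi: "smooth \<phi>" and a: "smooth a" and supp: "closed_support a \<subseteq> ball 0 1"
    and hess: "\<forall>\<xi>\<in>closed_support a. det (hessian \<phi> \<xi>) \<noteq> 0"
  obtains A D where "dispersive_operator \<phi> a A D"
proof -
  have ac: "continuous_on UNIV a" by (rule smooth_continuous_on[OF a])
  have a0: "a x = 0" if "x \<notin> closed_support a" for x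
    using that closure_subset[of "{x. a x \<noteq> 0}"] by (auto simp: closed_support_def)
  have K: "compact (closed_support a)"
    using bounded_subset[OF bounded_ball supp] by (simp add: closed_support_def compact_eq_bounded_closed)
  have "bounded (a ` cball 0 1)"
    by (intro compact_imp_bounded compact_continuous_image continuous_on_subset[OF ac]) auto
  then obtain A where A: "0 < A" "\<And>x. x \<in> cball 0 1 \<Longrightarrow> cmod (a x) \<le> A" by (auto simp: bounded_pos)
  have j1: "jet n {k. norm k \<le> 1} (ball 0 1) (\<lambda>k x. a (x + k))" for n
    using jet_shift[OF bounded_linear_ident a] by simp
  have j2: "jet n {k. norm k \<le> 1} (ball 0 1) (\<lambda>k x. cnj (a (x + k)))" for n
    by (rule jet_shift[OF bounded_linear_cnj a])
  have j3: "jet n {k. norm k \<le> 1} (ball 0 1) (\<lambda>k x. a (x + k) * cnj (a (x + k)))" for n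
    by (rule jet_mult[OF j1 j2])
  \<comment> \<open>The product of a with its conjugate is real, so its conjugates form the same
    family.\<close>
  have j4: "jet n {k. norm k \<le> 1} (ball 0 1) (\<lambda>k x. cnj (a (x + k) * cnj (a (x + k))))" for n
    using j3 by (simp add: mult.commute)
  obtain C1 where C1: "0 < C1" "\<And>t x. t \<noteq> 0 \<Longrightarrow> cmod (LINT \<xi>|lborel. cis (x \<bullet> \<xi> + t * \<phi> \<xi>) * a \<xi>) \<le> C1 * \<bar>t\<bar> powr (- real CARD('n) / 2)"
    by (rule dispersive_estimate[OF phi K supp hess ac a0 j1 j2], assumption, rule that, assumption, assumption)
  have ac2: "continuous_on UNIV (\<lambda>x. a x * cnj (a x))" by (intro continuous_intros ac)
  obtain C2 where C2: "0 < C2" "\<And>t x. t \<noteq> 0 \<Longrightarrow> cmod (LINT \<xi>|lborel. cis (x \<bullet> \<xi> + t * \<phi> \<xi>) * (a \<xi> * cnj (a \<xi>))) \<le> C2 * \<bar>t\<bar> powr (- real CARD('n) / 2)"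
    by (rule dispersive_estimate[OF phi K supp hess ac2 _ j3 j4], simp add: a0, rule that, assumption, assumption)
  show ?thesis
  proof (rule that[of A "max C1 C2"])
    show "dispersive_operator \<phi> a A (max C1 C2)"
    proof
      show "\<phi> \<in> borel_measurable borel" "a \<in> borel_measurable borel"
        by (intro borel_measurable_continuous_onI smooth_continuous_on phi a)+
      show "a \<xi> = 0" if "\<xi> \<notin> ball 0 1" for \<xi> using that supp by (intro a0) auto
      show "cmod (a \<xi>) \<le> A" for \<xi>
        using A(2)[of \<xi>] A(1) a0[of \<xi>] supp by (cases "\<xi> \<in> closed_support a") (auto simp: subset_iff)
      show "0 < A" "0 < max C1 C2" using A C1 by auto
      fix t :: real and x :: "real^'n" assume t: "t \<noteq> 0"
      show "cmod (LINT \<xi>|lborel. cis (x \<bullet> \<xi> + t * \<phi> \<xi>) * a \<xi>) \<le> max C1 C2 * \<bar>t\<bar> powr (- real DIM(real^'n) / 2)"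
        by (rule order_trans[OF C1(2)[OF t]]) (simp add: mult_right_mono)
      show "cmod (LINT \<xi>|lborel. cis (x \<bullet> \<xi> + t * \<phi> \<xi>) * (a \<xi> * cnj (a \<xi>))) \<le> max C1 C2 * \<bar>t\<bar> powr (- real DIM(real^'n) / 2)"
        by (rule order_trans[OF C2(2)[OF t]]) (simp add: mult_right_mono)
    qed
  qed
qed

theorem theorem1p2:
  fixes \<phi> :: "real^'n::finite \<Rightarrow> real"
    and a :: "real^'n \<Rightarrow> complex"
    and d q r s_c :: real
  assumes d: "d = real CARD('n)"
    and phi: "smooth \<phi>"
    and a: "smooth a"
    and supp: "closed_support a \<subseteq> ball 0 1"
    and hess: "\<forall>\<xi>\<in>closed_support a. det (hessian \<phi> \<xi>) \<noteq> 0"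
    and q: "2 \<le> q"
    and r: "2 \<le> r"
    and s_c: "s_c = d / r + 2 / q - d / 2"
  shows "(d / r + 2 / q > d / 2 \<and> d / r + 1 / q < d / 2 \<longrightarrow>
            (\<forall>s\<ge>s_c. \<exists>C::real. \<forall>f\<in>sobolev_space s.
               mixed_norm q r (extension_op \<phi> a f) \<le> ennreal C * sobolev_norm s f))
       \<and> (d / r + 1 / q = d / 2 \<and> q \<noteq> 2 \<longrightarrow>
            (\<exists>C::real. \<forall>f\<in>sobolev_space s_c.
               weak_mixed_norm q r (extension_op \<phi> a f) \<le> ennreal C * sobolev_norm s_c f))"
proof -
  obtain A D where opr: "dispersive_operator \<phi> a A D" by (rule dispersive_operator_exists[OF phi a supp hess])
  interpret dispersive_operator \<phi> a A D by (rule opr)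
  define \<delta> where "\<delta> = d * (1 / 2 - 1 / r)"
  have \<delta>: "\<delta> = real DIM(real^'n) * (1 / 2 - 1 / r)" by (simp add: \<delta>_def d)
  have \<delta>': "\<delta> = d / 2 - d / r" by (simp add: \<delta>_def right_diff_distrib)
  have sc: "s_c = 2 / q - \<delta>" by (simp add: s_c \<delta>')
  \<comment> \<open>Borel representatives of f and of its transform, obtained once for both parts.
    The weight inequality is kept for every order s' <= s; it is used with s' = s_c in part (i) and
    s' = \<delta> in part (ii).\<close>
  have rep: "\<exists>f' g'. plancherel_pair f' g' \<and> (\<forall>W s'. sobolev_norm s f \<le> ennreal W \<longrightarrow> s' \<le> s \<longrightarrow>
      (\<integral>\<^sup>+y. ennreal ((1 + (norm y)\<^sup>2) powr s') * ennreal ((cmod (g' y))\<^sup>2) \<partial>lborel) \<le> ennreal (W\<^sup>2))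
      \<and> (2 < r \<longrightarrow> (\<forall>t. Lp_norm r (\<lambda>x. extension_op \<phi> a f x t) = ennreal (Lr_power r f' t powr (1 / r))))"
    if f: "f \<in> sobolev_space s" for f :: "real^'n \<Rightarrow> complex" and s
  proof -
    have f2: "f \<in> L2_space" using f by (simp add: sobolev_space_def)
    then have fm: "f \<in> borel_measurable lebesgue" by (simp add: L2_space_def)
    obtain f' where f': "f' \<in> borel_measurable borel" "AE x in lborel. f x = f' x" by (rule lebesgue_ex_borel[OF fm])
    obtain g' where g': "plancherel_pair f' g'" "AE x in lborel. fourier_L2 f x = g' x" by (rule fourier_L2_plancherel_pair[OF f2 f'])
    then have "g' \<in> borel_measurable borel" "sqnorm f' < \<infinity>" by (auto simp: plancherel_pair_def)
    then show ?thesis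
      using g'(1) sobolev_norm_weight[OF g'(2)] Lp_norm_T[OF f'(1)]
      by (intro exI[of _ f'] exI[of _ g']) (simp add: extension_op_eq_T[OF opr fm f'])
  qed
  have strong: "\<exists>C::real. \<forall>f\<in>sobolev_space s. mixed_norm q r (extension_op \<phi> a f) \<le> ennreal C * sobolev_norm s f"
    if h: "d / r + 2 / q > d / 2" "d / r + 1 / q < d / 2" and s: "s_c \<le> s" for s
  proof -
    have q': "1 / q < \<delta>" "\<delta> < 2 / q" using h by (auto simp: \<delta>')
    have "0 < 1 / q" using q by simp
    \<comment> \<open>At r = 2 one has \<delta> = 0, contradicting 1 / q < \<delta>.\<close>
    then have "r \<noteq> 2" using q'(1) by (intro notI) (simp add: \<delta>_def)
    then have r2: "2 < r" using r by simp
    obtain C where C: "0 < C" and sm: "\<And>f g W. plancherel_pair f g \<Longrightarrow> 0 < W \<Longrightarrow>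
      (\<integral>\<^sup>+y. ennreal ((1 + (norm y)\<^sup>2) powr s_c) * ennreal ((cmod (g y))\<^sup>2) \<partial>lborel) \<le> ennreal (W\<^sup>2) \<Longrightarrow>
      (\<integral>\<^sup>+t. ennreal (Lr_power r f t powr (q / r)) \<partial>lborel) \<le> ennreal (C * W powr q)"
      by (rule mixed_norm_estimate[OF r2 \<delta> q q' sc], rule that, assumption, assumption)
    show ?thesis
    proof (intro exI ballI)
      fix f :: "real^'n \<Rightarrow> complex" assume f: "f \<in> sobolev_space s"
      obtain f' g' where fg: "plancherel_pair f' g'" and wt: "\<And>W s'. sobolev_norm s f \<le> ennreal W \<Longrightarrow> s' \<le> s \<Longrightarrow>
          (\<integral>\<^sup>+y. ennreal ((1 + (norm y)\<^sup>2) powr s') * ennreal ((cmod (g' y))\<^sup>2) \<partial>lborel) \<le> ennreal (W\<^sup>2)"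
        and Lp: "\<And>t. Lp_norm r (\<lambda>x. extension_op \<phi> a f x t) = ennreal (Lr_power r f' t powr (1 / r))"
        using rep[OF f] r2 by blast
      have mx: "mixed_norm q r (extension_op \<phi> a f) = ennreal_powr (\<integral>\<^sup>+t. ennreal (Lr_power r f' t powr (q / r)) \<partial>lborel) (1 / q)"
        unfolding mixed_norm_def Lp_norm_ennreal_def Lp nn_integral_completion by (simp add: ennreal_powr_ennreal powr_powr)
      show "mixed_norm q r (extension_op \<phi> a f) \<le> ennreal (C powr (1 / q)) * sobolev_norm s f"
      proof (rule ennreal_le_of_bounds)
        show "sobolev_norm s f < \<infinity>" using f by (simp add: sobolev_space_def)
        show "0 < C powr (1 / q)" using C by simp
        fix W :: real assume W: "0 < W" "sobolev_norm s f \<le> ennreal W"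
        have "mixed_norm q r (extension_op \<phi> a f) \<le> ennreal_powr (ennreal (C * W powr q)) (1 / q)"
          unfolding mx by (intro ennreal_powr_mono sm[OF fg W(1)] wt[OF W(2) s]) (use q in auto)
        also have "\<dots> = ennreal (C powr (1 / q) * W)" using C W q by (simp add: ennreal_powr_ennreal powr_mult powr_powr)
        finally show "mixed_norm q r (extension_op \<phi> a f) \<le> ennreal (C powr (1 / q) * W)" .
      qed
    qed
  qed
  have weak: "\<exists>C::real. \<forall>f\<in>sobolev_space s_c. weak_mixed_norm q r (extension_op \<phi> a f) \<le> ennreal C * sobolev_norm s_c f"
    if h: "d / r + 1 / q = d / 2" "q \<noteq> 2"
  proof -
    have q2: "2 < q" using q h by simp
    have \<delta>q: "\<delta> = 1 / q" using h by (simp add: \<delta>')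
    \<comment> \<open>In fact s_c = 2 / q - 1 / q = \<delta>, so the weight matches the Sobolev norm
      of part (ii) exactly.\<close>
    have s\<delta>: "\<delta> \<le> s_c" using \<delta>q by (simp add: sc)
    have "0 < 1 / q" using q by simp
    then have "r \<noteq> 2" using \<delta>q by (intro notI) (simp add: \<delta>_def)
    then have r2: "2 < r" using r by simp
    obtain C where C: "0 < C" and wm: "\<And>f g W l. plancherel_pair f g \<Longrightarrow> 0 < W \<Longrightarrow>
      (\<integral>\<^sup>+y. ennreal ((1 + (norm y)\<^sup>2) powr \<delta>) * ennreal ((cmod (g y))\<^sup>2) \<partial>lborel) \<le> ennreal (W\<^sup>2) \<Longrightarrow> 0 < l \<Longrightarrow>
      emeasure lborel {t. l < Lr_power r f t powr (1 / r)} \<le> ennreal ((C * W / l) powr q)"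
      by (rule weak_mixed_norm_estimate[OF r2 \<delta> \<delta>q q2], rule that, assumption, assumption)
    show ?thesis
    proof (intro exI ballI)
      fix f :: "real^'n \<Rightarrow> complex" assume f: "f \<in> sobolev_space s_c"
      obtain f' g' where fg: "plancherel_pair f' g'" and wt: "\<And>W s'. sobolev_norm s_c f \<le> ennreal W \<Longrightarrow> s' \<le> s_c \<Longrightarrow>
          (\<integral>\<^sup>+y. ennreal ((1 + (norm y)\<^sup>2) powr s') * ennreal ((cmod (g' y))\<^sup>2) \<partial>lborel) \<le> ennreal (W\<^sup>2)"
        and Lp: "\<And>t. Lp_norm r (\<lambda>x. extension_op \<phi> a f x t) = ennreal (Lr_power r f' t powr (1 / r))"
        using rep[OF f] r2 by blast
      have [measurable]: "f' \<in> borel_measurable borel" using fg by (simp add: plancherel_pair_def)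
      show "weak_mixed_norm q r (extension_op \<phi> a f) \<le> ennreal C * sobolev_norm s_c f"
      proof (rule ennreal_le_of_bounds[OF _ C])
        show "sobolev_norm s_c f < \<infinity>" using f by (simp add: sobolev_space_def)
        fix W :: real assume W: "0 < W" "sobolev_norm s_c f \<le> ennreal W"
        show "weak_mixed_norm q r (extension_op \<phi> a f) \<le> ennreal (C * W)"
          unfolding weak_mixed_norm_def weak_Lp_norm_ennreal_def Lp
        proof (rule SUP_least)
          fix l :: real assume "l \<in> {0<..}"
          then have l: "0 < l" by simp
          have "{t. ennreal (Lr_power r f' t powr (1 / r)) > ennreal l} = {t. l < Lr_power r f' t powr (1 / r)}" using l by (simp add: ennreal_less_iff)
          moreover have "{t. l < Lr_power r f' t powr (1 / r)} \<in> sets lborel" by measurable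
          ultimately have "emeasure lebesgue {t. ennreal (Lr_power r f' t powr (1 / r)) > ennreal l} = emeasure lborel {t. l < Lr_power r f' t powr (1 / r)}"
            by (simp add: emeasure_completion)
          also have "\<dots> \<le> ennreal ((C * W / l) powr q)" by (rule wm[OF fg W(1) wt[OF W(2) s\<delta>] l])
          finally have "ennreal_powr (emeasure lebesgue {t. ennreal (Lr_power r f' t powr (1 / r)) > ennreal l}) (1 / q) \<le> ennreal_powr (ennreal ((C * W / l) powr q)) (1 / q)"
            using q by (intro ennreal_powr_mono) auto
          also have "\<dots> = ennreal (C * W / l)" using C W l q by (simp add: ennreal_powr_ennreal powr_powr)
          finally have "ennreal l * ennreal_powr (emeasure lebesgue {t. ennreal (Lr_power r f' t powr (1 / r)) > ennreal l}) (1 / q) \<le> ennreal l * ennreal (C * W / l)"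
            by (intro mult_left_mono) auto
          also have "\<dots> = ennreal (C * W)" using l C W by (subst ennreal_mult[symmetric]) auto
          finally show "ennreal l * ennreal_powr (emeasure lebesgue {t. ennreal (Lr_power r f' t powr (1 / r)) > ennreal l}) (1 / q) \<le> ennreal (C * W)" .
        qed
      qed
    qed
  qed
  show ?thesis using strong weak by blast
qed

end
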